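(* Let $X$ be a Kähler manifold and let $\alpha=\sum_{k\ge 1}\hbar^k\omega_k$ be a closed formal differential form of type $(1,1)$ on $X$ (so $\alpha$ represents a class $[\alpha]\in\hbar H^2_{dR}(X)[[\hbar]]$ of type $(1,1)$). Then there exists a solution of the form $I_\alpha=I+J_\alpha\in\mathcal{A}_X^{0,1}(\mathcal{W}_{X,\mathbb{C}})$ of the Fedosov equation $$\nabla I_\alpha-\delta I_\alpha+\frac1\hbar I_\alpha\star I_\alpha+R_\nabla=\alpha ,$$ such that the corresponding connection $$D_{F,\alpha}=\nabla-\delta+\frac1\hbar[I_\alpha,-]_\star$$ is a Fedosov abelian connection on $\mathcal{W}_{X,\mathbb{C}}$ (i.e. $D_{F,\alpha}^2=0$) satisfying $D_{F,\alpha}|_{\mathcal{W}_X}=D_K$.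
   Context: **Kähler conventions.** Summation convention throughout. $\omega=\omega_{\alpha\bar\beta}dz^\alpha\wedge d\bar z^\beta=\sqrt{-1}g_{\alpha\bar\beta}dz^\alpha\wedge d\bar z^\beta$ is the Kähler form; $\omega^{\bar\gamma\alpha}\omega_{\alpha\bar\beta}=\delta^{\bar\gamma}_{\bar\beta}$ and $\omega^{\alpha\bar\beta}=-\omega^{\bar\beta\alpha}$ (equivalently $g^{\alpha\bar\beta}=-\sqrt{-1}\,\omega^{\alpha\bar\beta}$). **Weyl bundles.** $\mathcal{W}_X=\widehat{\mathrm{Sym}}(T^*X)[[\hbar]]$, $\overline{\mathcal{W}}_X=\widehat{\mathrm{Sym}}(\overline{T^*X})[[\hbar]]$, where $T^*X$, $\overline{T^*X}$ are the holomorphic and anti-holomorphic cotangent bundles, with local frames $y^i$, $\bar y^j$; $\mathcal{W}_{X,\mathbb{C}}=\mathcal{W}_X\otimes\overline{\mathcal{W}}_X$. Sections are formal power series in $\hbar,y^i,\bar y^j$ with smooth coefficients. $\mathcal{W}_{p,q}$ is the part of degree $p$ in the $y$'s and $q$ in the $\bar y$'s. On $\mathcal{A}_X^\bullet(\mathcal{W}_{X,\mathbb{C}})$: $\delta^{1,0}a=dz^i\wedge\frac{\partial a}{\partial y^i}$, $\delta^{0,1}a=d\bar z^j\wedge\frac{\partial a}{\partial\bar y^j}$, $\delta=\delta^{1,0}+\delta^{0,1}$, and $(\delta^{1,0})^{-1}a=\frac{1}{p_1+p_2}\,y^k\,\iota_{\partial_{z^k}}a$ for $a\in\mathcal{A}_X^{p_1,q_1}(\mathcal{W}_{p_2,q_2})$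 (zero if $p_1+p_2=0$). $\nabla=\nabla^{1,0}+\nabla^{0,1}$ is the Levi-Civita connection on all tensor and Weyl bundles. **Curvature.** $R_{i\bar jk}^m$ are defined by $\nabla^2(y^m)=R_{i\bar jk}^m\,dz^i\wedge d\bar z^j\otimes y^k$; $R_{i\bar jk\bar l}=R_{i\bar jk}^m g_{m\bar l}$; $R_\nabla=\sqrt{-1}R_{i\bar jk\bar l}\,dz^i\wedge d\bar z^j\otimes y^k\bar y^l$. **Kapranov's connection.** $R_2^*=\frac12R_{i\bar jk}^m\,d\bar z^j\otimes(y^iy^k\otimes\partial_{z^m})$ and $R_n^*=(\delta^{1,0})^{-1}\circ\nabla^{1,0}(R_{n-1}^* )\in\mathcal{A}_X^{0,1}(\mathrm{Sym}^n(T^*X)\otimes TX)$ for $n\ge3$. Each $R_n^*$ extends to an $\mathcal{A}_X^\bullet$-linear derivation $\tilde R_n^*$ of $\mathcal{W}_X$ (with $\partial_{z^m}$ acting as $\partial/\partial y^m$), and $D_K=\nabla-\delta^{1,0}+\sum_{n\ge2}\tilde R_n^*$ on $\mathcal{W}_X$. **Wick product.** $a\star b=\sum_{k\ge0}\frac{\hbar^k}{k!}\omega^{i_1\bar j_1}\cdots\omega^{i_k\bar j_k}\frac{\partial^ka}{\partial y^{i_1}\cdots\partial y^{i_k}}\frac{\partial^kb}{\partial\bar y^{j_1}\cdots\partial\bar y^{j_k}}$, extended to forms by wedge product of form parts; $[-,-]_\star$ is the graded commutator. **The section $I$.** Writing $R_n^*=R_{i_1\cdots i_n,\bar l}^j\,d\bar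 z^l\otimes(y^{i_1}\cdots y^{i_n}\otimes\partial_{z^j})$, put $I_n=R_{i_1\cdots i_n,\bar l}^j\,\omega_{j\bar k}\,d\bar z^l\otimes(y^{i_1}\cdots y^{i_n}\bar y^k)$ and $I=\sum_{n\ge2}I_n\in\mathcal{A}^{0,1}_X(\mathcal{W}_{X,\mathbb{C}})$. $J_\alpha$ denotes a section of $\mathcal{A}_X^{0,1}(\mathcal{W}_{X,\mathbb{C}})$ depending on $\alpha$, whose existence is part of the claim. A *Fedosov abelian connection* is a connection on $\mathcal{W}_{X,\mathbb{C}}$ of the form $\nabla-\delta+\frac1\hbar[I',-]_\star$ with $I'\in\mathcal{A}^1_X(\mathcal{W}_{X,\mathbb{C}})$, with square zero. *)

theory Defs
  imports "HOL-Analysis.Analysis" "HOL-Library.Countable" "HOL-Library.Function_Algebras"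
begin

text \<open>
  Everything is written in local holomorphic coordinates, and a global object on a complex manifold
  is a family of local expressions, one for each chart of an atlas, that agree on overlaps.
  Indices range over \<open>'n + 'n\<close>: \<open>Inl i\<close> stands for the holomorphic index \<open>i\<close> and \<open>Inr i\<close> for the
  anti-holomorphic index \<open>i\<close> conjugate to it, so that \<open>z\<close> and its conjugate, \<open>y\<close> and \<open>\<bar>y\<close>, and
  \<open>dz\<close> and \<open>d\<bar>z\<close> are treated uniformly.
\<close>

type_synonym 'n ix = "'n + 'n"

section \<open>Smooth functions and Wirtinger derivatives\<close>

fun ck_on :: "nat \<Rightarrow> 'b::real_normed_vector set \<Rightarrow> ('b \<Rightarrow> 'c::real_normed_vector) \<Rightarrow> bool" where
  "ck_on 0 S f \<longleftrightarrow> continuous_on S f"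
| "ck_on (Suc k) S f \<longleftrightarrow> (\<forall>x\<in>S. f differentiable (at x)) \<and>
     (\<forall>v. ck_on k S (\<lambda>x. frechet_derivative f (at x) v))"

definition smooth_on :: "'b::real_normed_vector set \<Rightarrow> ('b \<Rightarrow> 'c::real_normed_vector) \<Rightarrow> bool" where
  "smooth_on S f \<longleftrightarrow> (\<forall>k. ck_on k S f)"

fun pd :: "'n::finite ix \<Rightarrow> (complex^'n \<Rightarrow> complex) \<Rightarrow> complex^'n \<Rightarrow> complex" where
  "pd (Inl i) f x = (frechet_derivative f (at x) (axis i 1)
      - \<i> * frechet_derivative f (at x) (axis i \<i>)) / 2"
| "pd (Inr i) f x = (frechet_derivative f (at x) (axis i 1)
      + \<i> * frechet_derivative f (at x) (axis i \<i>)) / 2"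

definition holo_map_on :: "(complex^'n::finite) set \<Rightarrow> (complex^'n \<Rightarrow> complex^'n) \<Rightarrow> bool" where
  "holo_map_on S T \<longleftrightarrow> (\<forall>i. smooth_on S (\<lambda>w. T w $ i) \<and>
     (\<forall>x\<in>S. \<forall>j. pd (Inr j) (\<lambda>w. T w $ i) x = 0))"

section \<open>Complex manifolds\<close>

text \<open>A chart is a pair of its domain and its coordinate map.\<close>

type_synonym ('a, 'n) chart = "'a set \<times> ('a \<Rightarrow> complex^'n)"

definition cdom :: "('a, 'n::finite) chart \<Rightarrow> (complex^'n) set" where
  "cdom c = snd c ` fst c"

definition trans_map :: "('a, 'n::finite) chart \<Rightarrow> ('a, 'n) chart \<Rightarrow> complex^'n \<Rightarrow> complex^'n" where
  "trans_map c c' = snd c' \<circ> inv_into (fst c) (snd c)"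

definition complex_manifold :: "'a topology \<Rightarrow> ('a, 'n::finite) chart set \<Rightarrow> bool" where
  "complex_manifold X At \<longleftrightarrow>
     Hausdorff_space X \<and> second_countable X \<and> (\<Union>c\<in>At. fst c) = topspace X \<and>
     (\<forall>c\<in>At. openin X (fst c) \<and> open (cdom c) \<and>
        homeomorphic_map (subtopology X (fst c)) (top_of_set (cdom c)) (snd c)) \<and>
     (\<forall>c\<in>At. \<forall>c'\<in>At. holo_map_on (snd c ` (fst c \<inter> fst c')) (trans_map c c'))"

fun coord :: "'n::finite ix \<Rightarrow> complex^'n \<Rightarrow> complex" where
  "coord (Inl i) w = w $ i"
| "coord (Inr i) w = cnj (w $ i)"

text \<open>The change of charts acting on a complexified tangent vector at the point \<open>p\<close>, given by its
  components with respect to the coordinate frame of \<open>c\<close>.\<close>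

definition push :: "('a, 'n::finite) chart \<Rightarrow> ('a, 'n) chart \<Rightarrow> 'a \<Rightarrow> ('n ix \<Rightarrow> complex) \<Rightarrow> 'n ix \<Rightarrow> complex" where
  "push c c' p v A = (\<Sum>B\<in>UNIV. pd B (\<lambda>w. coord A (trans_map c c' w)) (snd c p) * v B)"

section \<open>The fibre: Weyl algebra tensored with the exterior algebra\<close>

text \<open>The value \<open>a k M S\<close> is the coefficient of \<open>\<hbar>^k y^M dx^S\<close>, where \<open>dx^S\<close> is the wedge product of
  the \<open>dx^A\<close>, \<open>A \<in> S\<close>, in increasing order for \<open>prec\<close>. That order on the indices is arbitrary except
  that the holomorphic ones come first, so that \<open>dz^i \<and> d\<bar>z^j\<close> is a basis element. Sums of fibre
  elements and of sections are pointwise.\<close>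

type_synonym 'n weyl = "nat \<Rightarrow> ('n ix \<Rightarrow> nat) \<Rightarrow> 'n ix set \<Rightarrow> complex"

fun prec :: "'n::finite ix \<Rightarrow> 'n ix \<Rightarrow> bool" where
  "prec (Inl i) (Inl j) \<longleftrightarrow> to_nat i < to_nat j"
| "prec (Inl i) (Inr j) \<longleftrightarrow> True"
| "prec (Inr i) (Inl j) \<longleftrightarrow> False"
| "prec (Inr i) (Inr j) \<longleftrightarrow> to_nat i < to_nat j"

definition wsign :: "'n::finite ix set \<Rightarrow> 'n ix set \<Rightarrow> complex" where
  "wsign S T = (-1) ^ card {(s, t). s \<in> S \<and> t \<in> T \<and> prec t s}"

definition wmul :: "'n::finite weyl \<Rightarrow> 'n weyl \<Rightarrow> 'n weyl" (infixl "\<odot>" 70) where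
  "a \<odot> b = (\<lambda>k M S. \<Sum>j\<le>k. \<Sum>N\<in>{N. N \<le> M}. \<Sum>T\<in>Pow S.
      wsign T (S - T) * a j N T * b (k - j) (\<lambda>A. M A - N A) (S - T))"

definition scl :: "complex \<Rightarrow> 'n weyl \<Rightarrow> 'n weyl" where
  "scl z a = (\<lambda>k M S. z * a k M S)"

definition single :: "'n ix \<Rightarrow> 'n ix \<Rightarrow> nat" where
  "single A = (\<lambda>B. if B = A then 1 else 0)"

definition ygen :: "'n::finite ix \<Rightarrow> 'n weyl" where
  "ygen A = (\<lambda>k M S. if k = 0 \<and> M = single A \<and> S = {} then 1 else 0)"

definition dxgen :: "'n::finite ix \<Rightarrow> 'n weyl" where
  "dxgen A = (\<lambda>k M S. if k = 0 \<and> M = 0 \<and> S = {A} then 1 else 0)"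

definition dy :: "'n::finite ix \<Rightarrow> 'n weyl \<Rightarrow> 'n weyl" where
  "dy A a = (\<lambda>k M S. of_nat (M A + 1) * a k (M(A := M A + 1)) S)"

text \<open>Contraction of the form part with the coordinate vector field of index \<open>A\<close>.\<close>

definition contr :: "'n::finite ix \<Rightarrow> 'n weyl \<Rightarrow> 'n weyl" where
  "contr A a = (\<lambda>k M S. if A \<in> S then 0 else wsign {A} S * a k M (insert A S))"

definition contr_vec :: "('n::finite ix \<Rightarrow> complex) \<Rightarrow> 'n weyl \<Rightarrow> 'n weyl" where
  "contr_vec u a = (\<Sum>A\<in>UNIV. scl (u A) (contr A a))"

text \<open>The coefficient of \<open>\<hbar>^k\<close> of \<open>a\<close>, in polynomial degree \<open>p\<close> and form degree \<open>length us\<close>, as a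
  multilinear object: the polynomial part is evaluated at the tangent vector \<open>v\<close> and the form part at
  the tangent vectors \<open>us\<close>.\<close>

definition tensor_eval ::
  "'n::finite weyl \<Rightarrow> nat \<Rightarrow> nat \<Rightarrow> ('n ix \<Rightarrow> complex) \<Rightarrow> ('n ix \<Rightarrow> complex) list \<Rightarrow> complex" where
  "tensor_eval a k p v us =
     (\<Sum>M | (\<Sum>A\<in>UNIV. M A) = p. (\<Prod>A\<in>UNIV. v A ^ M A) * fold contr_vec us a k M {})"

definition hmul :: "'n weyl \<Rightarrow> 'n weyl" where
  "hmul a = (\<lambda>k M S. case k of 0 \<Rightarrow> 0 | Suc j \<Rightarrow> a j M S)"

text \<open>Division by \<open>\<hbar>\<close>. It is only applied to elements without term of degree 0 in \<open>\<hbar>\<close>; see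
  \<open>hmul_hdiv_comm\<close> and \<open>hmul_hdiv_square\<close> below.\<close>

definition hdiv :: "'n weyl \<Rightarrow> 'n weyl" where
  "hdiv a = (\<lambda>k. a (Suc k))"

definition form_part :: "nat \<Rightarrow> 'n::finite weyl \<Rightarrow> 'n weyl" where
  "form_part p a = (\<lambda>k M S. if card S = p then a k M S else 0)"

definition delta10 :: "'n::finite weyl \<Rightarrow> 'n weyl" where
  "delta10 a = (\<Sum>i\<in>UNIV. dxgen (Inl i) \<odot> dy (Inl i) a)"

definition delta01 :: "'n::finite weyl \<Rightarrow> 'n weyl" where
  "delta01 a = (\<Sum>i\<in>UNIV. dxgen (Inr i) \<odot> dy (Inr i) a)"

definition delta :: "'n::finite weyl \<Rightarrow> 'n weyl" where
  "delta a = delta10 a + delta01 a"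

text \<open>Multiplication by \<open>y^k\<close> after contraction with the vector field of \<open>z^k\<close> preserves the total
  holomorphic degree \<open>p\<^sub>1 + p\<^sub>2\<close>, so that degree can be read off from the resulting monomial.\<close>

definition delta10_inv :: "'n::finite weyl \<Rightarrow> 'n weyl" where
  "delta10_inv a = (\<lambda>k M S.
     let d = card (S \<inter> range Inl) + (\<Sum>i\<in>UNIV. M (Inl i)) in
     if d = 0 then 0 else (\<Sum>i\<in>UNIV. ygen (Inl i) \<odot> contr (Inl i) a) k M S / of_nat d)"

text \<open>The Wick product and its graded commutator; \<open>w i j\<close> stands for \<open>\<omega>^{i \<bar>j}\<close>.\<close>

definition wick :: "('n \<Rightarrow> 'n \<Rightarrow> complex) \<Rightarrow> 'n::finite weyl \<Rightarrow> 'n weyl \<Rightarrow> 'n weyl" where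
  "wick w a b = (\<lambda>h M S. \<Sum>k\<le>h. \<Sum>is | length is = k. \<Sum>js | length js = k.
      (\<Prod>r<k. w (is ! r) (js ! r)) / fact k *
      (foldr dy (map Inl is) a \<odot> foldr dy (map Inr js) b) (h - k) M S)"

definition wick_comm :: "('n \<Rightarrow> 'n \<Rightarrow> complex) \<Rightarrow> 'n::finite weyl \<Rightarrow> 'n weyl \<Rightarrow> 'n weyl" where
  "wick_comm w a b = (\<Sum>p\<le>CARD('n ix). \<Sum>q\<le>CARD('n ix).
      wick w (form_part p a) (form_part q b)
      - scl ((-1) ^ (p * q)) (wick w (form_part q b) (form_part p a)))"

section \<open>Local differential geometry\<close>

text \<open>Local sections are functions of the coordinates. The argument \<open>G\<close> is the local expression of
  the metric: \<open>G x $ i $ j\<close> is \<open>g_{i \<bar>j}\<close> at \<open>x\<close>.\<close>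

definition pdw :: "'n::finite ix \<Rightarrow> (complex^'n \<Rightarrow> 'n weyl) \<Rightarrow> complex^'n \<Rightarrow> 'n weyl" where
  "pdw B a x = (\<lambda>k M S. pd B (\<lambda>w. a w k M S) x)"

definition ext_d :: "(complex^'n \<Rightarrow> 'n::finite weyl) \<Rightarrow> complex^'n \<Rightarrow> 'n weyl" where
  "ext_d a x = (\<Sum>B\<in>UNIV. dxgen B \<odot> pdw B a x)"

definition om_low :: "(complex^'n \<Rightarrow> complex^'n^'n) \<Rightarrow> complex^'n \<Rightarrow> 'n::finite \<Rightarrow> 'n \<Rightarrow> complex" where
  "om_low G x i j = \<i> * G x $ i $ j"

text \<open>The inverse matrix of \<open>\<omega>_{\<alpha> \<bar>\<beta>}\<close> is \<open>\<omega>^{\<bar>\<gamma> \<alpha>}\<close>, and \<open>\<omega>^{\<alpha> \<bar>\<beta>} = - \<omega>^{\<bar>\<beta> \<alpha>}\<close>.\<close>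

definition om_up :: "(complex^'n \<Rightarrow> complex^'n^'n) \<Rightarrow> complex^'n \<Rightarrow> 'n::finite \<Rightarrow> 'n \<Rightarrow> complex" where
  "om_up G x i j = - matrix_inv (\<chi> k l. om_low G x k l) $ j $ i"

definition kaehler_form :: "(complex^'n \<Rightarrow> complex^'n^'n) \<Rightarrow> complex^'n \<Rightarrow> 'n::finite weyl" where
  "kaehler_form G x =
     (\<Sum>i\<in>UNIV. \<Sum>j\<in>UNIV. scl (om_low G x i j) (dxgen (Inl i) \<odot> dxgen (Inr j)))"

text \<open>The complex bilinear extension of the Riemannian metric to the complexified tangent space (up to
  a constant factor, which does not affect the connection), and the Christoffel symbols of its
  Levi-Civita connection in the frame of the coordinates \<open>z\<close>, \<open>\<bar>z\<close>: \<open>christoffel G x A B C\<close> is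
  \<open>\<Gamma>^A_{B C}\<close>.\<close>

definition metricC :: "(complex^'n \<Rightarrow> complex^'n^'n) \<Rightarrow> complex^'n \<Rightarrow> complex^('n::finite ix)^('n ix)" where
  "metricC G x = (\<chi> A B. case (A, B) of
      (Inl i, Inr j) \<Rightarrow> G x $ i $ j | (Inr j, Inl i) \<Rightarrow> G x $ i $ j | _ \<Rightarrow> 0)"

definition christoffel ::
  "(complex^'n \<Rightarrow> complex^'n^'n) \<Rightarrow> complex^'n \<Rightarrow> 'n::finite ix \<Rightarrow> 'n ix \<Rightarrow> 'n ix \<Rightarrow> complex" where
  "christoffel G x A B C = (\<Sum>D\<in>UNIV. matrix_inv (metricC G x) $ A $ D *
      (pd B (\<lambda>w. metricC G w $ D $ C) x + pd C (\<lambda>w. metricC G w $ B $ D) x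
       - pd D (\<lambda>w. metricC G w $ B $ C) x)) / 2"

text \<open>The connection acts on the \<open>y^A\<close> as on the coordinate coframe; on form-valued sections it is
  extended to the exterior covariant derivative, whence only the \<open>y^A\<close> contribute below.\<close>

definition cov_deriv ::
  "(complex^'n \<Rightarrow> complex^'n^'n) \<Rightarrow> 'n::finite ix \<Rightarrow> (complex^'n \<Rightarrow> 'n weyl) \<Rightarrow> complex^'n \<Rightarrow> 'n weyl" where
  "cov_deriv G B a x = pdw B a x
     - (\<Sum>A\<in>UNIV. \<Sum>C\<in>UNIV. scl (christoffel G x A B C) (ygen C \<odot> dy A (a x)))"

definition nabla10 ::
  "(complex^'n \<Rightarrow> complex^'n^'n) \<Rightarrow> (complex^'n \<Rightarrow> 'n::finite weyl) \<Rightarrow> complex^'n \<Rightarrow> 'n weyl" where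
  "nabla10 G a x = (\<Sum>i\<in>UNIV. dxgen (Inl i) \<odot> cov_deriv G (Inl i) a x)"

definition nabla01 ::
  "(complex^'n \<Rightarrow> complex^'n^'n) \<Rightarrow> (complex^'n \<Rightarrow> 'n::finite weyl) \<Rightarrow> complex^'n \<Rightarrow> 'n weyl" where
  "nabla01 G a x = (\<Sum>i\<in>UNIV. dxgen (Inr i) \<odot> cov_deriv G (Inr i) a x)"

definition nabla ::
  "(complex^'n \<Rightarrow> complex^'n^'n) \<Rightarrow> (complex^'n \<Rightarrow> 'n::finite weyl) \<Rightarrow> complex^'n \<Rightarrow> 'n weyl" where
  "nabla G a x = nabla10 G a x + nabla01 G a x"

text \<open>\<open>curv G x m i j k\<close> is \<open>R_{i \<bar>j k}^m\<close>, read off from \<open>\<nabla>\<^sup>2 y^m\<close>.\<close>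

definition curv :: "(complex^'n \<Rightarrow> complex^'n^'n) \<Rightarrow> complex^'n \<Rightarrow> 'n::finite \<Rightarrow> 'n \<Rightarrow> 'n \<Rightarrow> 'n \<Rightarrow> complex" where
  "curv G x m i j k =
     nabla G (nabla G (\<lambda>_. ygen (Inl m))) x 0 (single (Inl k)) {Inl i, Inr j}"

definition R_nabla :: "(complex^'n \<Rightarrow> complex^'n^'n) \<Rightarrow> complex^'n \<Rightarrow> 'n::finite weyl" where
  "R_nabla G x = (\<Sum>i\<in>UNIV. \<Sum>j\<in>UNIV. \<Sum>k\<in>UNIV. \<Sum>l\<in>UNIV.
      scl (\<i> * (\<Sum>m\<in>UNIV. curv G x m i j k * G x $ m $ l))
        (dxgen (Inl i) \<odot> dxgen (Inr j) \<odot> ygen (Inl k) \<odot> ygen (Inr l)))"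

text \<open>A section with values in the holomorphic tangent bundle is given by its components with respect
  to the frame of the coordinate vector fields of the \<open>z^m\<close>.\<close>

definition nabla10_T ::
  "(complex^'n \<Rightarrow> complex^'n^'n) \<Rightarrow> ('n \<Rightarrow> complex^'n \<Rightarrow> 'n::finite weyl) \<Rightarrow> 'n \<Rightarrow> complex^'n \<Rightarrow> 'n weyl" where
  "nabla10_T G s m x = nabla10 G (s m) x
     + (\<Sum>i\<in>UNIV. \<Sum>k\<in>UNIV. scl (christoffel G x (Inl m) (Inl i) (Inl k)) (dxgen (Inl i) \<odot> s k x))"

fun R_star :: "(complex^'n \<Rightarrow> complex^'n^'n) \<Rightarrow> nat \<Rightarrow> 'n::finite \<Rightarrow> complex^'n \<Rightarrow> 'n weyl" where
  "R_star G 0 = (\<lambda>m x. 0)"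
| "R_star G (Suc 0) = (\<lambda>m x. 0)"
| "R_star G (Suc (Suc 0)) = (\<lambda>m x. \<Sum>i\<in>UNIV. \<Sum>j\<in>UNIV. \<Sum>k\<in>UNIV.
      scl (curv G x m i j k / 2) (dxgen (Inr j) \<odot> ygen (Inl i) \<odot> ygen (Inl k)))"
| "R_star G (Suc (Suc (Suc n))) = (\<lambda>m x. delta10_inv (nabla10_T G (R_star G (Suc (Suc n))) m x))"

definition R_tilde ::
  "(complex^'n \<Rightarrow> complex^'n^'n) \<Rightarrow> nat \<Rightarrow> (complex^'n \<Rightarrow> 'n::finite weyl) \<Rightarrow> complex^'n \<Rightarrow> 'n weyl" where
  "R_tilde G n a x = (\<Sum>m\<in>UNIV. R_star G n m x \<odot> dy (Inl m) (a x))"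

text \<open>The infinite sums over \<open>n \<ge> 2\<close> below are taken coefficientwise; each coefficient receives only
  finitely many non-zero contributions.\<close>

definition D_K ::
  "(complex^'n \<Rightarrow> complex^'n^'n) \<Rightarrow> (complex^'n \<Rightarrow> 'n::finite weyl) \<Rightarrow> complex^'n \<Rightarrow> 'n weyl" where
  "D_K G a x = nabla G a x - delta10 (a x) + (\<lambda>k M S. \<Sum>n. R_tilde G (n + 2) a x k M S)"

definition I_n :: "(complex^'n \<Rightarrow> complex^'n^'n) \<Rightarrow> nat \<Rightarrow> complex^'n \<Rightarrow> 'n::finite weyl" where
  "I_n G n x = (\<Sum>j\<in>UNIV. \<Sum>k\<in>UNIV. scl (om_low G x j k) (R_star G n j x \<odot> ygen (Inr k)))"

definition I_sum :: "(complex^'n \<Rightarrow> complex^'n^'n) \<Rightarrow> complex^'n \<Rightarrow> 'n::finite weyl" where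
  "I_sum G x = (\<lambda>k M S. \<Sum>n. I_n G (n + 2) x k M S)"

definition D_F :: "(complex^'n \<Rightarrow> complex^'n^'n) \<Rightarrow> (complex^'n \<Rightarrow> 'n::finite weyl) \<Rightarrow>
    (complex^'n \<Rightarrow> 'n weyl) \<Rightarrow> complex^'n \<Rightarrow> 'n weyl" where
  "D_F G I a x = nabla G a x - delta (a x) + hdiv (wick_comm (om_up G x) (I x) (a x))"

definition fedosov_lhs ::
  "(complex^'n \<Rightarrow> complex^'n^'n) \<Rightarrow> (complex^'n \<Rightarrow> 'n::finite weyl) \<Rightarrow> complex^'n \<Rightarrow> 'n weyl" where
  "fedosov_lhs G I x =
     nabla G I x - delta (I x) + hdiv (wick (om_up G x) (I x) (I x)) + R_nabla G x"

section \<open>Global sections\<close>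

type_synonym ('a, 'n) sect = "('a, 'n) chart \<Rightarrow> complex^'n \<Rightarrow> 'n weyl"
type_synonym ('a, 'n) metric = "('a, 'n) chart \<Rightarrow> complex^'n \<Rightarrow> complex^'n^'n"

text \<open>Values of sections are only meaningful over the coordinate domains of the charts.\<close>

definition sec_eq :: "('a, 'n::finite) chart set \<Rightarrow> ('a, 'n) sect \<Rightarrow> ('a, 'n) sect \<Rightarrow> bool" where
  "sec_eq At a b \<longleftrightarrow> (\<forall>c\<in>At. \<forall>x\<in>cdom c. a c x = b c x)"

text \<open>Differential forms of all degrees with values in the complexified Weyl bundle.\<close>

definition weyl_forms :: "('a, 'n::finite) chart set \<Rightarrow> ('a, 'n) sect set" where
  "weyl_forms At = {a.
     (\<forall>c\<in>At. \<forall>k M S. smooth_on (cdom c) (\<lambda>x. a c x k M S)) \<and>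
     (\<forall>c\<in>At. \<forall>c'\<in>At. \<forall>p \<in> fst c \<inter> fst c'. \<forall>k d v us.
        tensor_eval (a c (snd c p)) k d v us =
        tensor_eval (a c' (snd c' p)) k d (push c c' p v) (map (push c c' p) us))}"

definition weyl_forms_deg :: "('a, 'n::finite) chart set \<Rightarrow> nat \<Rightarrow> ('a, 'n) sect set" where
  "weyl_forms_deg At r = {a \<in> weyl_forms At.
     \<forall>c\<in>At. \<forall>x\<in>cdom c. \<forall>k M S. a c x k M S \<noteq> 0 \<longrightarrow> card S = r}"

definition weyl_forms_type :: "('a, 'n::finite) chart set \<Rightarrow> nat \<Rightarrow> nat \<Rightarrow> ('a, 'n) sect set" where
  "weyl_forms_type At p q = {a \<in> weyl_forms At.
     \<forall>c\<in>At. \<forall>x\<in>cdom c. \<forall>k M S. a c x k M S \<noteq> 0 \<longrightarrow>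
       card (S \<inter> range Inl) = p \<and> card (S \<inter> range Inr) = q}"

text \<open>Forms with values in the holomorphic Weyl bundle: no \<open>\<bar>y\<close> occurs.\<close>

definition holo_weyl_forms :: "('a, 'n::finite) chart set \<Rightarrow> ('a, 'n) sect set" where
  "holo_weyl_forms At = {a \<in> weyl_forms At.
     \<forall>c\<in>At. \<forall>x\<in>cdom c. \<forall>k M S. a c x k M S \<noteq> 0 \<longrightarrow> (\<forall>j. M (Inr j) = 0)}"

text \<open>The conditions on the metric: its Kaehler form is a smooth differential form on the manifold, it
  is Hermitian and positive definite, and its Kaehler form is closed.\<close>

definition kaehler_manifold ::
  "'a topology \<Rightarrow> ('a, 'n::finite) chart set \<Rightarrow> ('a, 'n) metric \<Rightarrow> bool" where
  "kaehler_manifold X At g \<longleftrightarrow> complex_manifold X At \<and>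
     (\<lambda>c. kaehler_form (g c)) \<in> weyl_forms At \<and>
     (\<forall>c\<in>At. \<forall>x\<in>cdom c.
        (\<forall>i j. g c x $ j $ i = cnj (g c x $ i $ j)) \<and>
        (\<forall>v. v \<noteq> 0 \<longrightarrow> 0 < Re (\<Sum>i\<in>UNIV. \<Sum>j\<in>UNIV. g c x $ i $ j * v $ i * cnj (v $ j))) \<and>
        ext_d (kaehler_form (g c)) x = 0)"

definition closed_formal_11 :: "('a, 'n::finite) chart set \<Rightarrow> ('a, 'n) sect \<Rightarrow> bool" where
  "closed_formal_11 At \<alpha> \<longleftrightarrow> \<alpha> \<in> weyl_forms_type At 1 1 \<and>
     (\<forall>c\<in>At. \<forall>x\<in>cdom c.
        (\<forall>k M S. \<alpha> c x k M S \<noteq> 0 \<longrightarrow> 1 \<le> k \<and> M = 0) \<and> ext_d (\<alpha> c) x = 0)"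

definition fedosov_abelian_connection :: "('a, 'n::finite) chart set \<Rightarrow> ('a, 'n) metric \<Rightarrow>
    (('a, 'n) sect \<Rightarrow> ('a, 'n) sect) \<Rightarrow> bool" where
  "fedosov_abelian_connection At g D \<longleftrightarrow>
     (\<exists>I'\<in>weyl_forms_deg At 1. D = (\<lambda>a c. D_F (g c) (I' c) (a c))) \<and>
     (\<forall>a\<in>weyl_forms At. sec_eq At (D (D a)) 0)"

section \<open>Divisibility by the formal parameter\<close>

lemma hmul_hdiv: "(\<And>M S. a 0 M S = 0) \<Longrightarrow> hmul (hdiv a) = a"
  by (auto simp: hmul_def hdiv_def fun_eq_iff split: nat.splits)

lemma prec_linear: "A \<noteq> B \<Longrightarrow> prec A B \<longleftrightarrow> \<not> prec B A"
  by (cases A; cases B) (auto simp: not_less le_less)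

lemma wsign_swap:
  fixes S T :: "'n::finite ix set"
  assumes "S \<inter> T = {}"
  shows "wsign S T = (-1) ^ (card S * card T) * wsign T S"
proof -
  let ?P = "{(s, t). s \<in> S \<and> t \<in> T \<and> prec t s}"
  let ?Q = "{(s, t). s \<in> S \<and> t \<in> T \<and> prec s t}"
  let ?R = "{(s, t). s \<in> T \<and> t \<in> S \<and> prec t s}"
  have *: "prec t s \<longleftrightarrow> \<not> prec s t" if "s \<in> S" "t \<in> T" for s t
    using assms that by (intro prec_linear) auto
  have "?P \<union> ?Q = S \<times> T" "?P \<inter> ?Q = {}"
    using * by blast+
  then have "card (S \<times> T) = card ?P + card ?Q"
    using card_Un_disjoint[of ?P ?Q] by simp
  moreover have "card ?Q = card ?R"
    by (rule bij_betw_same_card[of prod.swap]) (auto simp: bij_betw_def inj_on_def image_iff)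
  ultimately have e: "card S * card T = card ?P + card ?R"
    by (simp add: card_cartesian_product)
  show ?thesis
    unfolding wsign_def e
    by (simp add: power_add mult.assoc flip: power_mult_distrib)
qed

lemma wick_0: "wick w a b 0 M S = (a \<odot> b) 0 M S"
  by (simp add: wick_def)

lemma wmul_swap_0:
  fixes a b :: "'n::finite weyl"
  shows "(form_part p a \<odot> form_part q b) 0 M S =
    (-1) ^ (p * q) * (form_part q b \<odot> form_part p a) 0 M S"
proof -
  have "(\<Sum>T\<in>Pow S. wsign T (S - T) * form_part p a 0 N T * form_part q b 0 N' (S - T)) =
        (\<Sum>T\<in>Pow S. (-1) ^ (p * q) * (wsign T (S - T) * form_part q b 0 N' T * form_part p a 0 N (S - T)))"
    for N N'
  proof (rule sum.reindex_bij_witness[of _ "\<lambda>T. S - T" "\<lambda>T. S - T"])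
    fix T assume T: "T \<in> Pow S"
    then have "S - (S - T) = T" by auto
    moreover have "wsign T (S - T) = (-1) ^ (card T * card (S - T)) * wsign (S - T) T"
      by (rule wsign_swap) auto
    ultimately show "(-1) ^ (p * q) * (wsign (S - T) (S - (S - T)) * form_part q b 0 N' (S - T) *
        form_part p a 0 N (S - (S - T))) =
        wsign T (S - T) * form_part p a 0 N T * form_part q b 0 N' (S - T)"
      by (auto simp: form_part_def)
  qed auto
  then have "(form_part p a \<odot> form_part q b) 0 M S =
    (\<Sum>N\<in>{N. N \<le> M}. \<Sum>T\<in>Pow S. (-1) ^ (p * q) *
      (wsign T (S - T) * form_part q b 0 (\<lambda>A. M A - N A) T * form_part p a 0 N (S - T)))"
    by (simp add: wmul_def)
  also have "\<dots> = (\<Sum>N\<in>{N. N \<le> M}. \<Sum>T\<in>Pow S. (-1) ^ (p * q) *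
      (wsign T (S - T) * form_part q b 0 N T * form_part p a 0 (\<lambda>A. M A - N A) (S - T)))"
    by (rule sum.reindex_bij_witness[of _ "\<lambda>N A. M A - N A" "\<lambda>N A. M A - N A"])
      (auto simp: le_fun_def fun_eq_iff)
  also have "\<dots> = (-1) ^ (p * q) * (form_part q b \<odot> form_part p a) 0 M S"
    by (simp add: wmul_def sum_distrib_left)
  finally show ?thesis .
qed

lemma sum_fun_apply: "(\<Sum>i\<in>A. f i) x = (\<Sum>i\<in>A. f i x)"
  for f :: "'i \<Rightarrow> 'b \<Rightarrow> 'c::comm_monoid_add"
  by (induction A rule: infinite_finite_induct) auto

lemma hmul_hdiv_comm: "hmul (hdiv (wick_comm w a b)) = wick_comm w a b"
proof (rule hmul_hdiv)
  fix M S
  show "wick_comm w a b 0 M S = 0"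
    unfolding wick_comm_def sum_fun_apply
    by (auto simp: scl_def wick_0 intro!: sum.neutral wmul_swap_0)
qed

lemma hmul_hdiv_square:
  assumes "\<And>k M S. a k M S \<noteq> 0 \<Longrightarrow> card S = 1"
  shows "hmul (hdiv (wick w a a)) = wick w a a"
proof (rule hmul_hdiv)
  fix M S
  have "form_part 1 a = a"
    using assms by (fastforce simp: form_part_def fun_eq_iff)
  with wmul_swap_0[of 1 a 1 a M S] have "(a \<odot> a) 0 M S = 0" by simp
  then show "wick w a a 0 M S = 0"
    by (simp add: wick_0)
qed

end

theory Submission
  imports Defs
begin

text \<open>
  Split the Fedosov equation by form type. For \<open>A\<close> of type (0,1) with \<open>\<delta>\<^sup>0\<^sup>,\<^sup>1 A = 0\<close>, its (1,1)-part
  \<open>\<nabla>\<^sup>1\<^sup>,\<^sup>0 A - \<delta>\<^sup>1\<^sup>,\<^sup>0 A + R = \<alpha>\<close> is linear and is solved by iterating \<open>(\<delta>\<^sup>1\<^sup>,\<^sup>0)\<^sup>-\<^sup>1 \<nabla>\<^sup>1\<^sup>,\<^sup>0\<close>, starting from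
  \<open>(\<delta>\<^sup>1\<^sup>,\<^sup>0)\<^sup>-\<^sup>1\<close> of \<open>R\<close> and of \<open>-\<alpha>\<close>. The part coming from \<open>R\<close> is \<open>I\<close>, since the Kaehler form is
  parallel; the part \<open>J\<close> coming from \<open>\<alpha>\<close> contains no \<open>\<bar>y\<close>, so its Wick bracket with a section without \<open>\<bar>y\<close>
  vanishes and the connection restricts to Kapranov's. The (0,2)-part \<open>\<Omega>\<close> of the defect is then flat,
  \<open>\<nabla>\<^sup>1\<^sup>,\<^sup>0 \<Omega> = \<delta>\<^sup>1\<^sup>,\<^sup>0 \<Omega>\<close>, by the Bianchi identity, and every monomial of it contains some \<open>y\<close>;
  comparing degrees in \<open>y\<close> gives \<open>\<Omega> = 0\<close>. The square of the connection is the bracket with \<open>\<alpha>\<close>, which is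
  central. For the independence of charts, \<open>(\<delta>\<^sup>1\<^sup>,\<^sup>0)\<^sup>-\<^sup>1 \<nabla>\<^sup>1\<^sup>,\<^sup>0\<close> acts on evaluated sections as the
  holomorphic geodesic spray.
\<close>

section \<open>Smooth functions\<close>

text \<open>The ansatz asks for \<open>delta01\<close> to vanish because otherwise
  \<open>delta01\<close> would enter the (0,2)-part linearly and couple it to the (1,1)-part. The
  condition survives the iteration, as \<open>delta01\<close> anticommutes with
  \<open>nabla10\<close> and with the contraction \<open>iota\<close>. Convergence is free: each
  step raises the degree in y by one, so every coefficient of the infinite sum receives a single
  term. The Bianchi identity is not computed from Christoffel symbols. Since the inverse Kaehler
  form is parallel, \<open>dd\<close> = \<nabla> - \<delta> is a derivation of the Wick product; its
  square is the bracket with the curvature, and its cube, evaluated in two ways on the generators,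
  makes the derivative of the curvature central. A degree count then makes it zero. Gluing involves
  no choices, since the solution is given by a formula in each chart. Its transformation law would
  be unwieldy for coefficients of y-monomials, so sections are evaluated on tangent vectors, where
  the law becomes a chain rule. Division by \<hbar> just drops the lowest coefficient; the
  identities that depend on it are checked after multiplication by \<hbar>, the dropped coefficient
  being zero by graded commutativity.\<close>

lemma ck_on_SucD:
  assumes "ck_on (Suc k) S f" "x \<in> S"
  shows "(f has_derivative frechet_derivative f (at x)) (at x)"
  using assms by (auto simp: frechet_derivative_works)

lemma ck_on_cong:
  assumes "open S" "\<And>x. x \<in> S \<Longrightarrow> f x = g x" "ck_on k S f"
  shows "ck_on k S g"
  using assms(2,3)
proof (induction k arbitrary: f g)
  case 0
  then show ?case using continuous_on_cong by force
next
  case (Suc k)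
  have d: "g differentiable (at x)" "frechet_derivative g (at x) = frechet_derivative f (at x)" if "x \<in> S" for x
  proof -
    have f: "f differentiable (at x)" using Suc that by auto
    show "frechet_derivative g (at x) = frechet_derivative f (at x)"
      using frechet_derivative_transform_within_open[OF f assms(1) that] Suc.prems(1) by metis
    show "g differentiable (at x)"
      using f that assms(1) Suc.prems(1)
      by (meson differentiable_def has_derivative_transform_within_open)
  qed
  have "ck_on k S (\<lambda>x. frechet_derivative g (at x) v)" for v
    by (rule Suc.IH[of "\<lambda>x. frechet_derivative f (at x) v"]) (use d Suc.prems in auto)
  with d show ?case by auto
qed

text \<open>The closure properties below go through this rule: a derivative is exhibited by
  \<open>has_derivative\<close> calculus, and uniqueness of derivatives identifies it with the
  choice-based \<open>frechet_derivative\<close> of the definition.\<close>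

lemma ck_on_SucI:
  assumes "open S" "\<And>x. x \<in> S \<Longrightarrow> (f has_derivative f' x) (at x)" "\<And>v. ck_on k S (\<lambda>x. f' x v)"
  shows "ck_on (Suc k) S f"
proof -
  have *: "frechet_derivative f (at x) = f' x" if "x \<in> S" for x
    using assms(2)[OF that] frechet_derivative_at by metis
  have "ck_on k S (\<lambda>x. frechet_derivative f (at x) v)" for v
    by (rule ck_on_cong[OF assms(1) _ assms(3)[of v]]) (simp add: *)
  then show ?thesis using assms(2) by (auto simp: differentiable_def)
qed

lemma ck_on_Suc_imp: "ck_on (Suc k) S f \<Longrightarrow> ck_on k S f"
proof (induction k arbitrary: f)
  case 0
  then show ?case
    by (auto intro!: continuous_at_imp_continuous_on differentiable_imp_continuous_within)
next
  case (Suc k)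
  then show ?case by (metis ck_on.simps(2))
qed

lemma ck_on_subset: "ck_on k S f \<Longrightarrow> T \<subseteq> S \<Longrightarrow> ck_on k T f"
  by (induction k arbitrary: f) (auto intro: continuous_on_subset)

lemma ck_on_const: "ck_on k S (\<lambda>x. c)"
proof (induction k arbitrary: c)
  case (Suc k)
  then show ?case by simp
qed simp

lemma ck_on_add:
  assumes "open S" "ck_on k S f" "ck_on k S g"
  shows "ck_on k S (\<lambda>x. f x + g x)"
  using assms(2,3)
proof (induction k arbitrary: f g)
  case (Suc k)
  show ?case
  proof (rule ck_on_SucI[OF assms(1)])
    show "((\<lambda>x. f x + g x) has_derivative (\<lambda>v. frechet_derivative f (at x) v + frechet_derivative g (at x) v)) (at x)"
      if "x \<in> S" for x
      by (intro has_derivative_add ck_on_SucD[OF _ that]) (use Suc in auto)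
    show "ck_on k S (\<lambda>x. frechet_derivative f (at x) v + frechet_derivative g (at x) v)" for v
      by (rule Suc.IH) (use Suc.prems in auto)
  qed
qed (auto intro: continuous_intros)

lemma ck_on_bounded_linear:
  assumes "open S" "bounded_linear L" "ck_on k S f"
  shows "ck_on k S (\<lambda>x. L (f x))"
  using assms(3)
proof (induction k arbitrary: f)
  case 0
  then show ?case using assms(2) by (simp add: bounded_linear.continuous_on)
next
  case (Suc k)
  show ?case
  proof (rule ck_on_SucI[OF assms(1)])
    show "((\<lambda>x. L (f x)) has_derivative (\<lambda>v. L (frechet_derivative f (at x) v))) (at x)"
      if "x \<in> S" for x
      by (intro bounded_linear.has_derivative[OF assms(2)] ck_on_SucD[OF _ that]) (use Suc in auto)
    show "ck_on k S (\<lambda>x. L (frechet_derivative f (at x) v))" for v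
      by (rule Suc.IH) (use Suc.prems in auto)
  qed
qed

lemma ck_on_mult:
  fixes f g :: "'b::real_normed_vector \<Rightarrow> complex"
  assumes "open S" "ck_on k S f" "ck_on k S g"
  shows "ck_on k S (\<lambda>x. f x * g x)"
  using assms(2,3)
proof (induction k arbitrary: f g)
  case (Suc k)
  show ?case
  proof (rule ck_on_SucI[OF assms(1)])
    show "((\<lambda>x. f x * g x) has_derivative (\<lambda>v. f x * frechet_derivative g (at x) v + frechet_derivative f (at x) v * g x)) (at x)"
      if "x \<in> S" for x
      by (intro has_derivative_mult ck_on_SucD[OF _ that]) (use Suc in auto)
    show "ck_on k S (\<lambda>x. f x * frechet_derivative g (at x) v + frechet_derivative f (at x) v * g x)" for v
      using Suc.prems ck_on_Suc_imp[OF Suc.prems(1)] ck_on_Suc_imp[OF Suc.prems(2)]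
      by (intro ck_on_add[OF assms(1)] Suc.IH) auto
  qed
qed (auto intro: continuous_intros)

text \<open>The derivative of 1/f is built from 1/f and the derivative of f, so the induction stays
  with the same f. The derivative is written with a factor -1 so that the product rule applies to it
  as it stands.\<close>

lemma ck_on_inverse:
  fixes f :: "'b::real_normed_vector \<Rightarrow> complex"
  assumes "open S" "ck_on k S f" "\<And>x. x \<in> S \<Longrightarrow> f x \<noteq> 0"
  shows "ck_on k S (\<lambda>x. inverse (f x))"
  using assms(2)
proof (induction k)
  case 0
  then show ?case using assms(3) by (auto intro: continuous_intros)
next
  case (Suc k)
  note f = ck_on_Suc_imp[OF Suc.prems(1)]
  show ?case
  proof (rule ck_on_SucI[OF assms(1)])
    show "((\<lambda>x. inverse (f x)) has_derivative (\<lambda>v. (-1) * (inverse (f x) * frechet_derivative f (at x) v * inverse (f x)))) (at x)"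
      if "x \<in> S" for x
      using Deriv.has_derivative_inverse[OF assms(3)[OF that] ck_on_SucD[OF Suc.prems(1) that]] by simp
    show "ck_on k S (\<lambda>x. (-1) * (inverse (f x) * frechet_derivative f (at x) v * inverse (f x)))" for v
      using Suc.prems by (intro ck_on_mult[OF assms(1)] ck_on_const Suc.IH f) auto
  qed
qed

lemma smooth_on_cong: "open S \<Longrightarrow> (\<And>x. x \<in> S \<Longrightarrow> f x = g x) \<Longrightarrow> smooth_on S f \<Longrightarrow> smooth_on S g"
  unfolding smooth_on_def using ck_on_cong by blast

lemma smooth_on_subset: "smooth_on S f \<Longrightarrow> T \<subseteq> S \<Longrightarrow> smooth_on T f"
  unfolding smooth_on_def using ck_on_subset by blast

lemma smooth_on_const [simp]: "smooth_on S (\<lambda>x. c)"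
  unfolding smooth_on_def using ck_on_const by blast

lemma smooth_on_add: "open S \<Longrightarrow> smooth_on S f \<Longrightarrow> smooth_on S g \<Longrightarrow> smooth_on S (\<lambda>x. f x + g x)"
  unfolding smooth_on_def using ck_on_add by blast

lemma smooth_on_bounded_linear:
  "open S \<Longrightarrow> bounded_linear L \<Longrightarrow> smooth_on S f \<Longrightarrow> smooth_on S (\<lambda>x. L (f x))"
  unfolding smooth_on_def using ck_on_bounded_linear by blast

lemma smooth_on_mult:
  fixes f g :: "'b::real_normed_vector \<Rightarrow> complex"
  shows "open S \<Longrightarrow> smooth_on S f \<Longrightarrow> smooth_on S g \<Longrightarrow> smooth_on S (\<lambda>x. f x * g x)"
  unfolding smooth_on_def using ck_on_mult by blast

lemma smooth_on_inverse:
  fixes f :: "'b::real_normed_vector \<Rightarrow> complex"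
  shows "open S \<Longrightarrow> smooth_on S f \<Longrightarrow> (\<And>x. x \<in> S \<Longrightarrow> f x \<noteq> 0) \<Longrightarrow> smooth_on S (\<lambda>x. inverse (f x))"
  unfolding smooth_on_def using ck_on_inverse by blast

lemma smooth_on_cmul:
  fixes f :: "'b::real_normed_vector \<Rightarrow> complex"
  shows "open S \<Longrightarrow> smooth_on S f \<Longrightarrow> smooth_on S (\<lambda>x. c * f x)"
  by (rule smooth_on_mult) auto

lemma smooth_on_minus:
  fixes f :: "'b::real_normed_vector \<Rightarrow> complex"
  shows "open S \<Longrightarrow> smooth_on S f \<Longrightarrow> smooth_on S (\<lambda>x. - f x)"
  using smooth_on_cmul[of S f "-1"] by simp

lemma smooth_on_diff:
  fixes f :: "'b::real_normed_vector \<Rightarrow> complex"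
  shows "open S \<Longrightarrow> smooth_on S f \<Longrightarrow> smooth_on S g \<Longrightarrow> smooth_on S (\<lambda>x. f x - g x)"
  using smooth_on_add[OF _ _ smooth_on_minus] by fastforce

lemma smooth_on_sum:
  fixes f :: "'i \<Rightarrow> 'b::real_normed_vector \<Rightarrow> complex"
  shows "open S \<Longrightarrow> (\<And>i. i \<in> A \<Longrightarrow> smooth_on S (f i)) \<Longrightarrow> smooth_on S (\<lambda>x. \<Sum>i\<in>A. f i x)"
  by (induction A rule: infinite_finite_induct) (auto intro: smooth_on_add)

lemma smooth_on_prod:
  fixes f :: "'i \<Rightarrow> 'b::real_normed_vector \<Rightarrow> complex"
  shows "open S \<Longrightarrow> (\<And>i. i \<in> A \<Longrightarrow> smooth_on S (f i)) \<Longrightarrow> smooth_on S (\<lambda>x. \<Prod>i\<in>A. f i x)"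
  by (induction A rule: infinite_finite_induct) (auto intro: smooth_on_mult)

lemma smooth_on_differentiable: "smooth_on S f \<Longrightarrow> x \<in> S \<Longrightarrow> f differentiable (at x)"
  unfolding smooth_on_def using ck_on.simps(2) by metis

lemma smooth_on_has_derivative:
  "smooth_on S f \<Longrightarrow> x \<in> S \<Longrightarrow> (f has_derivative frechet_derivative f (at x)) (at x)"
  using smooth_on_differentiable frechet_derivative_works by blast

lemma smooth_on_frechet: "smooth_on S f \<Longrightarrow> smooth_on S (\<lambda>x. frechet_derivative f (at x) v)"
  unfolding smooth_on_def using ck_on.simps(2) by blast

lemma smooth_on_continuous: "smooth_on S f \<Longrightarrow> continuous_on S f"
  unfolding smooth_on_def using ck_on.simps(1) by blast

lemma smooth_on_det:
  fixes A :: "'b::real_normed_vector \<Rightarrow> complex^'n^'n"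
  assumes "open S" "\<And>i j. smooth_on S (\<lambda>x. A x $ i $ j)"
  shows "smooth_on S (\<lambda>x. det (A x))"
  unfolding det_def by (intro smooth_on_sum smooth_on_cmul smooth_on_prod assms)

section \<open>Inverse matrices with smooth entries\<close>

lemma matrix_inv_unique:
  fixes A B :: "'a::field^'n^'n"
  assumes "A ** B = mat 1"
  shows "matrix_inv A = B"
proof -
  have "B ** A = mat 1" using assms matrix_left_right_inverse by blast
  then have "invertible A" using assms invertible_def by blast
  then have "matrix_inv A ** A = mat 1"
    unfolding invertible_def matrix_inv_def by (metis (mono_tags, lifting) someI_ex)
  then show ?thesis
    by (metis assms matrix_mul_assoc matrix_mul_lid matrix_mul_rid)
qed

lemma matrix_inv_mult:
  fixes A :: "'a::field^'n^'n"
  assumes "invertible A"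
  shows "A ** matrix_inv A = mat 1" "matrix_inv A ** A = mat 1"
proof -
  obtain B where B: "A ** B = mat 1" "B ** A = mat 1" using assms invertible_def by blast
  with matrix_inv_unique[OF B(1)] show "A ** matrix_inv A = mat 1" "matrix_inv A ** A = mat 1" by auto
qed

text \<open>Cramer's rule for the columns of the inverse turns the entries into quotients of
  determinants, from which their smoothness is read off.\<close>

lemma matrix_inv_cramer:
  fixes A :: "'a::field^'n^'n"
  assumes "invertible A"
  shows "matrix_inv A $ i $ j = det (\<chi> p q. if q = i then axis j 1 $ p else A $ p $ q) / det A"
proof -
  have d: "det A \<noteq> 0" using assms invertible_det_nz by blast
  have "A *v column j (matrix_inv A) = axis j 1"
    using matrix_inv_mult(1)[OF assms]
    by (simp add: vec_eq_iff matrix_vector_mult_def column_def matrix_matrix_mult_def mat_def axis_def)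
  then have "column j (matrix_inv A) = (\<chi> k. det (\<chi> p q. if q = k then axis j 1 $ p else A $ p $ q) / det A)"
    using cramer[OF d] by blast
  then show ?thesis by (simp add: column_def vec_eq_iff)
qed

lemma smooth_on_matrix_inv:
  fixes A :: "'b::real_normed_vector \<Rightarrow> complex^'n^'n"
  assumes "open S" "\<And>i j. smooth_on S (\<lambda>x. A x $ i $ j)" "\<And>x. x \<in> S \<Longrightarrow> invertible (A x)"
  shows "smooth_on S (\<lambda>x. matrix_inv (A x) $ i $ j)"
proof (rule smooth_on_cong[OF assms(1)])
  show "smooth_on S (\<lambda>x. det (\<chi> p q. if q = i then axis j 1 $ p else A x $ p $ q) * inverse (det (A x)))"
  proof (intro smooth_on_mult smooth_on_inverse smooth_on_det assms)
    show "smooth_on S (\<lambda>x. (\<chi> p q. if q = i then axis j 1 $ p else A x $ p $ q) $ r $ s)" for r s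
      using assms(2) by (cases "s = i") auto
    show "det (A x) \<noteq> 0" if "x \<in> S" for x using assms(3)[OF that] invertible_det_nz by blast
  qed
qed (simp add: matrix_inv_cramer assms divide_inverse)

section \<open>Symmetry of second derivatives\<close>

text \<open>The mean value theorem is used twice, along u for the difference in the direction v and
  then along v for the derivative along u. The second difference is symmetric in u and v while the
  right-hand side is not, which is what yields symmetry of second derivatives.\<close>

lemma real_second_difference:
  fixes f :: "'b::real_normed_vector \<Rightarrow> real"
  assumes S: "\<And>s t. 0 \<le> s \<Longrightarrow> s \<le> h \<Longrightarrow> 0 \<le> t \<Longrightarrow> t \<le> h \<Longrightarrow> x + s *\<^sub>R u + t *\<^sub>R v \<in> S"
    and f: "\<And>y. y \<in> S \<Longrightarrow> f differentiable (at y)"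
    and g: "\<And>y. y \<in> S \<Longrightarrow> (\<lambda>y. frechet_derivative f (at y) u) differentiable (at y)"
    and h: "0 < h"
  shows "\<exists>s t. 0 \<le> s \<and> s \<le> h \<and> 0 \<le> t \<and> t \<le> h \<and>
    f (x + h *\<^sub>R u + h *\<^sub>R v) - f (x + h *\<^sub>R u) - f (x + h *\<^sub>R v) + f x =
    h * h * frechet_derivative (\<lambda>y. frechet_derivative f (at y) u) (at (x + s *\<^sub>R u + t *\<^sub>R v)) v"
proof -
  let ?D = "\<lambda>y. frechet_derivative f (at y) u"
  have "\<exists>s>0. s < h \<and> (f (x + h *\<^sub>R u + h *\<^sub>R v) - f (x + h *\<^sub>R u + 0 *\<^sub>R v))
      - (f (x + 0 *\<^sub>R u + h *\<^sub>R v) - f (x + 0 *\<^sub>R u + 0 *\<^sub>R v)) =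
      (h - 0) * (?D (x + s *\<^sub>R u + h *\<^sub>R v) - ?D (x + s *\<^sub>R u + 0 *\<^sub>R v))"
  proof (rule MVT2[OF h])
    fix s assume s: "0 \<le> s" "s \<le> h"
    have d: "((\<lambda>s. f (x + s *\<^sub>R u + t *\<^sub>R v)) has_real_derivative ?D (x + s *\<^sub>R u + t *\<^sub>R v)) (at s)"
      if "0 \<le> t" "t \<le> h" for t
    proof -
      have "(f has_derivative frechet_derivative f (at (x + s *\<^sub>R u + t *\<^sub>R v))) (at (x + s *\<^sub>R u + t *\<^sub>R v))"
        using f S[OF s that] frechet_derivative_works by blast
      then have "((\<lambda>s. f (x + s *\<^sub>R u + t *\<^sub>R v)) has_derivative
          (\<lambda>r. frechet_derivative f (at (x + s *\<^sub>R u + t *\<^sub>R v)) (r *\<^sub>R u))) (at s)"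
        by (rule has_derivative_compose[rotated]) (auto intro!: derivative_eq_intros)
      moreover have "linear (frechet_derivative f (at (x + s *\<^sub>R u + t *\<^sub>R v)))"
        using f S[OF s that] linear_frechet_derivative by blast
      ultimately show ?thesis
        unfolding has_field_derivative_def
        by (simp add: linear_cmul mult.commute[of _ "frechet_derivative f (at (x + s *\<^sub>R u + t *\<^sub>R v)) u"] cong: if_cong)
    qed
    show "((\<lambda>s. f (x + s *\<^sub>R u + h *\<^sub>R v) - f (x + s *\<^sub>R u + 0 *\<^sub>R v)) has_real_derivative
       (?D (x + s *\<^sub>R u + h *\<^sub>R v) - ?D (x + s *\<^sub>R u + 0 *\<^sub>R v))) (at s)"
      using h by (intro DERIV_diff d) auto
  qed
  then obtain s where s: "0 < s" "s < h" and e1: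
    "f (x + h *\<^sub>R u + h *\<^sub>R v) - f (x + h *\<^sub>R u) - f (x + h *\<^sub>R v) + f x =
      h * (?D (x + s *\<^sub>R u + h *\<^sub>R v) - ?D (x + s *\<^sub>R u + 0 *\<^sub>R v))"
    by (auto simp: algebra_simps)
  have "\<exists>t>0. t < h \<and> ?D (x + s *\<^sub>R u + h *\<^sub>R v) - ?D (x + s *\<^sub>R u + 0 *\<^sub>R v) =
      (h - 0) * frechet_derivative ?D (at (x + s *\<^sub>R u + t *\<^sub>R v)) v"
  proof (rule MVT2[OF h])
    fix t assume t: "0 \<le> t" "t \<le> h"
    let ?y = "x + s *\<^sub>R u + t *\<^sub>R v"
    have y: "?y \<in> S" using S s t by auto
    then have "(?D has_derivative frechet_derivative ?D (at ?y)) (at ?y)"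
      using g frechet_derivative_works by blast
    then have "((\<lambda>t. ?D (x + s *\<^sub>R u + t *\<^sub>R v)) has_derivative
        (\<lambda>r. frechet_derivative ?D (at ?y) (r *\<^sub>R v))) (at t)"
      by (rule has_derivative_compose[rotated]) (auto intro!: derivative_eq_intros)
    moreover have "linear (frechet_derivative ?D (at ?y))"
      using g y linear_frechet_derivative by blast
    ultimately show "((\<lambda>t. ?D (x + s *\<^sub>R u + t *\<^sub>R v)) has_real_derivative frechet_derivative ?D (at ?y) v) (at t)"
      unfolding has_field_derivative_def by (simp add: linear_cmul mult.commute[of _ "frechet_derivative ?D (at ?y) v"])
  qed
  then obtain t where t: "0 < t" "t < h" and
    "?D (x + s *\<^sub>R u + h *\<^sub>R v) - ?D (x + s *\<^sub>R u + 0 *\<^sub>R v) =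
      h * frechet_derivative ?D (at (x + s *\<^sub>R u + t *\<^sub>R v)) v" by auto
  with e1 s show ?thesis by (intro exI[of _ s] exI[of _ t]) auto
qed

text \<open>For small h the same second difference equals h squared times either mixed derivative at
  some point near x; continuity of both mixed derivatives at x then identifies their values
  there.\<close>

lemma frechet_derivative_commute_real:
  fixes f :: "'b::real_normed_vector \<Rightarrow> real"
  assumes S: "open S" "x \<in> S" and f: "smooth_on S f"
  shows "frechet_derivative (\<lambda>y. frechet_derivative f (at y) u) (at x) v =
    frechet_derivative (\<lambda>y. frechet_derivative f (at y) v) (at x) u"
proof -
  define A where "A u v y = frechet_derivative (\<lambda>y. frechet_derivative f (at y) u) (at y) v" for u v y
  have cont: "isCont (A u v) x" for u v
    unfolding A_def using smooth_on_continuous[OF smooth_on_frechet[OF smooth_on_frechet[OF f]]] S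
    by (metis continuous_on_eq_continuous_at)
  have "\<bar>A u v x - A v u x\<bar> < e" if e: "0 < e" for e
  proof -
    from cont[of u v] e obtain d1 where d1: "d1 > 0" "\<And>y. dist y x < d1 \<Longrightarrow> \<bar>A u v y - A u v x\<bar> < e / 2"
      unfolding continuous_at_eps_delta dist_real_def by (meson half_gt_zero)
    from cont[of v u] e obtain d2 where d2: "d2 > 0" "\<And>y. dist y x < d2 \<Longrightarrow> \<bar>A v u y - A v u x\<bar> < e / 2"
      unfolding continuous_at_eps_delta dist_real_def by (meson half_gt_zero)
    from S obtain d3 where d3: "d3 > 0" "\<And>y. dist y x < d3 \<Longrightarrow> y \<in> S"
      by (metis dist_commute mem_ball open_contains_ball subsetD)
    define d where "d = min d1 (min d2 d3)"
    \<comment> \<open>The parallelogram with sides h u and h v then stays within d / 2 of x; the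
      summand 1 keeps the denominator positive when u and v vanish.\<close>
    define h where "h = d / (2 * (norm u + norm v + 1))"
    have d: "d > 0" using d1 d2 d3 by (simp add: d_def)
    have np: "norm u + norm v + 1 > 0" by (simp add: add_nonneg_pos)
    then have h: "h > 0" using d by (simp add: h_def)
    have near: "dist (x + s *\<^sub>R u + t *\<^sub>R v) x < d" "dist (x + s *\<^sub>R v + t *\<^sub>R u) x < d"
      if st: "0 \<le> s" "s \<le> h" "0 \<le> t" "t \<le> h" for s t
    proof -
      have "s * norm u + t * norm v \<le> h * (norm u + norm v + 1)"
        "s * norm v + t * norm u \<le> h * (norm u + norm v + 1)"
        using st h mult_right_mono[of s h "norm u"] mult_right_mono[of t h "norm v"]
          mult_right_mono[of s h "norm v"] mult_right_mono[of t h "norm u"] by (auto simp: algebra_simps)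
      moreover have "h * (norm u + norm v + 1) = d / 2" unfolding h_def using np by (simp add: field_simps)
      moreover have "norm (s *\<^sub>R u + t *\<^sub>R v) \<le> s * norm u + t * norm v"
        "norm (s *\<^sub>R v + t *\<^sub>R u) \<le> s * norm v + t * norm u"
        using st by (metis norm_triangle_ineq norm_scaleR abs_of_nonneg)+
      ultimately show "dist (x + s *\<^sub>R u + t *\<^sub>R v) x < d" "dist (x + s *\<^sub>R v + t *\<^sub>R u) x < d"
        using d by (auto simp: dist_norm add.assoc)
    qed
    have fd: "f differentiable (at y)" if "y \<in> S" for y using f that smooth_on_differentiable by blast
    have gd: "(\<lambda>y. frechet_derivative f (at y) w) differentiable (at y)" if "y \<in> S" for y w
      using smooth_on_differentiable[OF smooth_on_frechet[OF f] that] .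
    obtain s t where st: "0 \<le> s" "s \<le> h" "0 \<le> t" "t \<le> h" and
      e1: "f (x + h *\<^sub>R u + h *\<^sub>R v) - f (x + h *\<^sub>R u) - f (x + h *\<^sub>R v) + f x = h * h * A u v (x + s *\<^sub>R u + t *\<^sub>R v)"
      using real_second_difference[of h x u v S f, OF _ fd gd h] near d3(2) unfolding A_def d_def by force
    obtain s' t' where st': "0 \<le> s'" "s' \<le> h" "0 \<le> t'" "t' \<le> h" and
      e2: "f (x + h *\<^sub>R v + h *\<^sub>R u) - f (x + h *\<^sub>R v) - f (x + h *\<^sub>R u) + f x = h * h * A v u (x + s' *\<^sub>R v + t' *\<^sub>R u)"
      using real_second_difference[of h x v u S f, OF _ fd gd h] near d3(2) unfolding A_def d_def by force
    have "h * h * A u v (x + s *\<^sub>R u + t *\<^sub>R v) = h * h * A v u (x + s' *\<^sub>R v + t' *\<^sub>R u)"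
      using e1 e2 by (simp add: algebra_simps)
    then have "A u v (x + s *\<^sub>R u + t *\<^sub>R v) = A v u (x + s' *\<^sub>R v + t' *\<^sub>R u)"
      using h by simp
    moreover have "\<bar>A u v (x + s *\<^sub>R u + t *\<^sub>R v) - A u v x\<bar> < e / 2"
      using d1(2) near(1)[OF st] by (auto simp: d_def)
    moreover have "\<bar>A v u (x + s' *\<^sub>R v + t' *\<^sub>R u) - A v u x\<bar> < e / 2"
      using d2(2) near(2)[OF st'] by (auto simp: d_def)
    ultimately show ?thesis by linarith
  qed
  then have "\<bar>A u v x - A v u x\<bar> \<le> 0" by (meson less_irrefl not_le)
  then show ?thesis by (simp add: A_def)
qed

lemma frechet_derivative_bounded_linear:
  assumes "bounded_linear L" "f differentiable (at x)"
  shows "frechet_derivative (\<lambda>y. L (f y)) (at x) v = L (frechet_derivative f (at x) v)"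
  using bounded_linear.has_derivative[OF assms(1)] assms(2) frechet_derivative_works frechet_derivative_at
  by metis

text \<open>The mean value theorem is available for real functions only, so real and imaginary parts
  are treated separately; both are bounded linear and commute with differentiation.\<close>

lemma frechet_derivative_commute:
  fixes f :: "'b::real_normed_vector \<Rightarrow> complex"
  assumes S: "open S" "x \<in> S" and f: "smooth_on S f"
  shows "frechet_derivative (\<lambda>y. frechet_derivative f (at y) u) (at x) v =
    frechet_derivative (\<lambda>y. frechet_derivative f (at y) v) (at x) u"
proof -
  have *: "L (frechet_derivative (\<lambda>y. frechet_derivative f (at y) u) (at x) v) =
    frechet_derivative (\<lambda>y. frechet_derivative (\<lambda>y. L (f y)) (at y) u) (at x) v"
    if L: "bounded_linear L" for L :: "complex \<Rightarrow> real" and u v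
  proof -
    have df: "(\<lambda>y. frechet_derivative f (at y) u) differentiable (at x)"
      using smooth_on_differentiable[OF smooth_on_frechet[OF f] S(2)] .
    have "frechet_derivative (\<lambda>y. frechet_derivative (\<lambda>y. L (f y)) (at y) u) (at x) =
        frechet_derivative (\<lambda>y. L (frechet_derivative f (at y) u)) (at x)"
      by (rule frechet_derivative_transform_within_open[OF _ S, symmetric])
        (auto intro!: frechet_derivative_bounded_linear[OF L, symmetric] smooth_on_differentiable[OF f]
          differentiableI[OF bounded_linear.has_derivative[OF L df[unfolded frechet_derivative_works]]])
    then show ?thesis using frechet_derivative_bounded_linear[OF L df] by simp
  qed
  have "L (frechet_derivative (\<lambda>y. frechet_derivative f (at y) u) (at x) v) =
    L (frechet_derivative (\<lambda>y. frechet_derivative f (at y) v) (at x) u)" if L: "bounded_linear L" for L :: "complex \<Rightarrow> real"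
    unfolding *[OF L]
    by (rule frechet_derivative_commute_real[OF S smooth_on_bounded_linear[OF S(1) L f]])
  from this[OF bounded_linear_Re] this[OF bounded_linear_Im] show ?thesis by (simp add: complex_eq_iff)
qed

section \<open>Wirtinger derivatives\<close>

text \<open>Separates the linear algebra of \<open>pd\<close> from differentiation: the rules for
  \<open>pd\<close> follow from those for real-linear maps and from \<open>has_derivative\<close>
  calculus.\<close>

fun wirt :: "'n::finite ix \<Rightarrow> (complex^'n \<Rightarrow> complex) \<Rightarrow> complex" where
  "wirt (Inl i) L = (L (axis i 1) - \<i> * L (axis i \<i>)) / 2"
| "wirt (Inr i) L = (L (axis i 1) + \<i> * L (axis i \<i>)) / 2"

lemma pd_wirt: "pd B f x = wirt B (frechet_derivative f (at x))"
  by (cases B) auto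

lemma pd_eq: "(f has_derivative f') (at x) \<Longrightarrow> pd B f x = wirt B f'"
  using frechet_derivative_at pd_wirt by metis

lemma pd_const [simp]: "pd B (\<lambda>w. c) x = 0"
  by (cases B) auto

lemma pd_cong:
  assumes "open S" "x \<in> S" "\<And>y. y \<in> S \<Longrightarrow> f y = g y"
  shows "pd B f x = pd B g x"
proof -
  have *: "(f has_derivative D) (at x) \<longleftrightarrow> (g has_derivative D) (at x)" for D
    using has_derivative_transform_within_open[OF _ assms(1,2)] assms(3) by metis
  show ?thesis unfolding pd_wirt frechet_derivative_def * ..
qed

text \<open>Conjugation of indices; conjugating a function exchanges its two kinds of Wirtinger
  derivative, see \<open>pd_cnj\<close>.\<close>

fun ixc :: "'n ix \<Rightarrow> 'n ix" where "ixc (Inl i) = Inr i" | "ixc (Inr i) = Inl i"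

lemma wirt_linear:
  "wirt B (\<lambda>h. L h + K h) = wirt B L + wirt B K"
  "wirt B (\<lambda>h. L h - K h) = wirt B L - wirt B K"
  "wirt B (\<lambda>h. c * L h) = c * wirt B L"
  "wirt B (\<lambda>h. L h * c) = wirt B L * c"
  by (cases B; simp add: algebra_simps add_divide_distrib diff_divide_distrib)+

lemma wirt_cnj: "wirt B (\<lambda>h. cnj (L h)) = cnj (wirt (ixc B) L)"
  by (cases B) auto

lemma pd_add:
  assumes "f differentiable (at x)" "g differentiable (at x)"
  shows "pd B (\<lambda>w. f w + g w) x = pd B f x + pd B g x"
  by (rule pd_eq[OF has_derivative_add[OF assms[unfolded frechet_derivative_works]], of B, unfolded wirt_linear(1), folded pd_wirt])

lemma pd_mult:
  assumes "f differentiable (at x)" "g differentiable (at x)"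
  shows "pd B (\<lambda>w. f w * g w) x = pd B f x * g x + f x * pd B g x"
  by (rule pd_eq[OF has_derivative_mult[OF assms[unfolded frechet_derivative_works]], of B, unfolded wirt_linear, folded pd_wirt, unfolded add.commute[of "f x * _"]])

lemma pd_cmul:
  assumes "f differentiable (at x)"
  shows "pd B (\<lambda>w. c * f w) x = c * pd B f x"
  using pd_mult[of "\<lambda>w. c" x f B] assms by simp

lemma pd_diff:
  assumes "f differentiable (at x)" "g differentiable (at x)"
  shows "pd B (\<lambda>w. f w - g w) x = pd B f x - pd B g x"
  by (rule pd_eq[OF has_derivative_diff[OF assms[unfolded frechet_derivative_works]], of B, unfolded wirt_linear(2), folded pd_wirt])

lemma pd_sum:
  assumes "\<And>i. i \<in> I \<Longrightarrow> f i differentiable (at x)"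
  shows "pd B (\<lambda>w. \<Sum>i\<in>I. f i w) x = (\<Sum>i\<in>I. pd B (f i) x)"
  using assms
proof (induction I rule: infinite_finite_induct)
  case (insert i I)
  then show ?case by (simp add: pd_add)
qed auto

lemma pd_cnj:
  assumes "f differentiable (at x)"
  shows "pd B (\<lambda>w. cnj (f w)) x = cnj (pd (ixc B) f x)"
  by (rule pd_eq[OF has_derivative_cnj[OF assms[unfolded frechet_derivative_works]], of B, unfolded wirt_cnj, folded pd_wirt])

lemma smooth_on_pd: "open S \<Longrightarrow> smooth_on S f \<Longrightarrow> smooth_on S (pd B f)"
proof (cases B)
  case (Inl i)
  assume S: "open S" "smooth_on S f"
  have "smooth_on S (\<lambda>x. (1/2) * (frechet_derivative f (at x) (axis i 1) - \<i> * frechet_derivative f (at x) (axis i \<i>)))"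
    by (intro smooth_on_cmul smooth_on_diff smooth_on_frechet S)
  then show ?thesis using Inl by (simp add: pd.simps[abs_def])
next
  case (Inr i)
  assume S: "open S" "smooth_on S f"
  have "smooth_on S (\<lambda>x. (1/2) * (frechet_derivative f (at x) (axis i 1) + \<i> * frechet_derivative f (at x) (axis i \<i>)))"
    by (intro smooth_on_cmul smooth_on_add smooth_on_frechet S)
  then show ?thesis using Inr by (simp add: pd.simps[abs_def])
qed

lemma pd_commute:
  assumes S: "open S" "x \<in> S" and f: "smooth_on S f"
  shows "pd A (pd B f) x = pd B (pd A f) x"
proof -
  define D where "D u v = frechet_derivative (\<lambda>y. frechet_derivative f (at y) u) (at x) v" for u v
  have D: "D u v = D v u" for u v
    unfolding D_def by (rule frechet_derivative_commute[OF S f])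
  \<comment> \<open>With the underlying direction \<open>e\<close> and the sign \<open>s\<close> in
    front of the derivative along the imaginary axis, one formula covers both kinds of index, and
    one computation all four cases.\<close>
  define s :: "'a ix \<Rightarrow> complex" where "s = (\<lambda>Inl _ \<Rightarrow> - \<i> | Inr _ \<Rightarrow> \<i>)"
  define e :: "'a ix \<Rightarrow> 'a" where "e = (\<lambda>Inl i \<Rightarrow> i | Inr i \<Rightarrow> i)"
  have p: "pd B f x = (1/2) * (frechet_derivative f (at x) (axis (e B) 1) + s B * frechet_derivative f (at x) (axis (e B) \<i>))"
    for f x and B :: "'a ix"
    by (cases B) (auto simp: s_def e_def)
  have d: "(\<lambda>y. frechet_derivative f (at y) u) differentiable (at x)" for u
    using smooth_on_differentiable[OF smooth_on_frechet[OF f] S(2)] .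
  have d': "((\<lambda>y. frechet_derivative f (at y) u) has_derivative D u) (at x)" for u
    using d[of u] unfolding D_def frechet_derivative_works .
  have "((\<lambda>x. (1/2) * (frechet_derivative f (at x) (axis (e B) 1) + s B * frechet_derivative f (at x) (axis (e B) \<i>)))
     has_derivative (\<lambda>v. (1/2) * (D (axis (e B) 1) v + s B * D (axis (e B) \<i>) v))) (at x)" for B
    by (rule has_derivative_mult_right[OF has_derivative_add[OF d' has_derivative_mult_right[OF d']]])
  then have fd: "frechet_derivative (pd B f) (at x) = (\<lambda>v. (1/2) * (D (axis (e B) 1) v + s B * D (axis (e B) \<i>) v))" for B
    unfolding p[abs_def] by (rule frechet_derivative_at[symmetric])
  have q: "pd A (pd B f) x = (1/2) * ((1/2) * (D (axis (e B) 1) (axis (e A) 1) + s B * D (axis (e B) \<i>) (axis (e A) 1))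
     + s A * ((1/2) * (D (axis (e B) 1) (axis (e A) \<i>) + s B * D (axis (e B) \<i>) (axis (e A) \<i>))))" for A B
    unfolding p[of _ "pd B f"] fd ..
  show ?thesis
    unfolding q D[of "axis (e A) 1" "axis (e B) 1"] D[of "axis (e A) 1" "axis (e B) \<i>"]
        D[of "axis (e A) \<i>" "axis (e B) 1"] D[of "axis (e A) \<i>" "axis (e B) \<i>"]
    by (simp add: algebra_simps)
qed

section \<open>The fibre algebra\<close>

lemma finite_le_fun [simp]: "finite {N::'n::finite \<Rightarrow> nat. N \<le> M}"
proof (rule finite_subset)
  show "{N. N \<le> M} \<subseteq> Pi\<^sub>E UNIV (\<lambda>A. {..M A})" by (auto simp: le_fun_def)
  show "finite (Pi\<^sub>E UNIV (\<lambda>A. {..M A}))" by (intro finite_PiE) auto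
qed

lemma wsign_empty [simp]: "wsign {} S = 1" "wsign S {} = 1"
  by (auto simp: wsign_def)

text \<open>Inversions against a disjoint union are counted part by part. Multiplicativity of
  \<open>wsign\<close> in both arguments is the cocycle property behind associativity of the wedge
  product.\<close>

lemma wsign_Un1:
  fixes S T U :: "'n::finite ix set"
  assumes "S \<inter> T = {}"
  shows "wsign (S \<union> T) U = wsign S U * wsign T U"
proof -
  have "{(s, t). s \<in> S \<union> T \<and> t \<in> U \<and> prec t s} =
      {(s, t). s \<in> S \<and> t \<in> U \<and> prec t s} \<union> {(s, t). s \<in> T \<and> t \<in> U \<and> prec t s}" by auto
  moreover have "{(s, t). s \<in> S \<and> t \<in> U \<and> prec t s} \<inter> {(s, t). s \<in> T \<and> t \<in> U \<and> prec t s} = {}"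
    using assms by auto
  ultimately show ?thesis by (simp add: wsign_def card_Un_disjoint power_add)
qed

lemma wsign_Un2:
  fixes S T U :: "'n::finite ix set"
  assumes "S \<inter> T = {}"
  shows "wsign U (S \<union> T) = wsign U S * wsign U T"
proof -
  have "{(s, t). s \<in> U \<and> t \<in> S \<union> T \<and> prec t s} =
      {(s, t). s \<in> U \<and> t \<in> S \<and> prec t s} \<union> {(s, t). s \<in> U \<and> t \<in> T \<and> prec t s}" by auto
  moreover have "{(s, t). s \<in> U \<and> t \<in> S \<and> prec t s} \<inter> {(s, t). s \<in> U \<and> t \<in> T \<and> prec t s} = {}"
    using assms by auto
  ultimately show ?thesis by (simp add: wsign_def card_Un_disjoint power_add)
qed

text \<open>The ways of splitting off a first piece of the index (k, M, S). As one finite set, it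
  turns the threefold convolution sum into a single sum that can be reindexed.\<close>

definition wdom :: "nat \<Rightarrow> ('n::finite ix \<Rightarrow> nat) \<Rightarrow> 'n ix set \<Rightarrow> (nat \<times> ('n ix \<Rightarrow> nat) \<times> 'n ix set) set" where
  "wdom k M S = {..k} \<times> {N. N \<le> M} \<times> Pow S"

lemma finite_wdom [simp]: "finite (wdom k M S)"
  by (simp add: wdom_def)

lemma wmul_wdom: "(a \<odot> b) k M S = (\<Sum>(j, N, T)\<in>wdom k M S.
    wsign T (S - T) * a j N T * b (k - j) (M - N) (S - T))"
  by (simp add: wmul_def wdom_def sum.cartesian_product fun_diff_def)

text \<open>Both sides run over the splittings of (k, M, S) into three pieces: the left records the
  first piece and the union of the first two, the right the first and the second piece. The
  reindexing translates between these records, and \<open>wsign_Un1\<close> and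
  \<open>wsign_Un2\<close> match the signs.\<close>

lemma wmul_assoc: "(a \<odot> b) \<odot> c = a \<odot> (b \<odot> c)"
proof (intro ext)
  fix k :: nat and M :: "'a ix \<Rightarrow> nat" and S :: "'a ix set"
  have "((a \<odot> b) \<odot> c) k M S = (\<Sum>(j, N, T)\<in>wdom k M S. \<Sum>(i, L, R)\<in>wdom j N T.
      wsign T (S - T) * wsign R (T - R) * a i L R * b (j - i) (N - L) (T - R) * c (k - j) (M - N) (S - T))"
    unfolding wmul_wdom[of "a \<odot> b"] unfolding wmul_wdom[of a b]
    by (simp add: sum_distrib_left sum_distrib_right case_prod_unfold mult.assoc)
  also have "\<dots> = (\<Sum>((j, N, T), (i, L, R))\<in>(SIGMA x:wdom k M S. case x of (j, N, T) \<Rightarrow> wdom j N T).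
      wsign T (S - T) * wsign R (T - R) * a i L R * b (j - i) (N - L) (T - R) * c (k - j) (M - N) (S - T))"
    by (subst sum.Sigma[symmetric]) (auto simp: case_prod_unfold)
  also have "\<dots> = (\<Sum>((i, L, R), (j, N, T))\<in>(SIGMA x:wdom k M S. case x of (i, L, R) \<Rightarrow> wdom (k - i) (M - L) (S - R)).
      wsign R (S - R) * a i L R * (wsign T (S - R - T) * b j N T * c (k - i - j) (M - L - N) (S - R - T)))"
  proof (rule sum.reindex_bij_witness[of _
        "\<lambda>((i, L, R), (j, N, T)). ((i + j, L + N, R \<union> T), (i, L, R))"
        "\<lambda>((j, N, T), (i, L, R)). ((i, L, R), (j - i, N - L, T - R))"], goal_cases)
    case (1 x)
    then show ?case by (auto simp: wdom_def le_fun_def fun_eq_iff)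
  next
    case (2 x)
    then show ?case
      by (fastforce simp: wdom_def le_fun_def fun_eq_iff intro: diff_le_mono order_trans)
  next
    case (3 x)
    then show ?case by (auto simp: wdom_def le_fun_def fun_eq_iff)
  next
    case (4 x)
    then show ?case
      by (auto simp: wdom_def le_fun_def fun_eq_iff Nat.le_diff_conv2 add.commute)
  next
    case (5 x)
    obtain j N T i L R where x: "x = ((j, N, T), (i, L, R))" by (metis prod.exhaust)
    with 5 have *: "i \<le> j" "j \<le> k" "L \<le> N" "N \<le> M" "R \<subseteq> T" "T \<subseteq> S"
      by (auto simp: wdom_def)
    have "wsign T (S - T) = wsign R (S - T) * wsign (T - R) (S - T)"
      using wsign_Un1[of R "T - R" "S - T"] * by (simp add: Un_absorb1)
    moreover have "wsign R (S - R) = wsign R (T - R) * wsign R (S - T)"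
    proof -
      have "S - R = (T - R) \<union> (S - T)" using * by auto
      then show ?thesis using wsign_Un2[of "T - R" "S - T" R] by auto
    qed
    moreover have "S - R - (T - R) = S - T" "M - L - (N - L) = M - N" "k - i - (j - i) = k - j"
      using * by (auto simp: fun_eq_iff le_fun_def)
    ultimately show ?case by (simp add: x)
  qed
  also have "\<dots> = (\<Sum>(i, L, R)\<in>wdom k M S. \<Sum>(j, N, T)\<in>wdom (k - i) (M - L) (S - R).
      wsign R (S - R) * a i L R * (wsign T (S - R - T) * b j N T * c (k - i - j) (M - L - N) (S - R - T)))"
    by (subst sum.Sigma[symmetric]) (auto simp: case_prod_unfold)
  also have "\<dots> = (a \<odot> (b \<odot> c)) k M S"
    unfolding wmul_wdom[of a "b \<odot> c"] unfolding wmul_wdom[of b c]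
    by (simp add: sum_distrib_left case_prod_unfold)
  finally show "((a \<odot> b) \<odot> c) k M S = (a \<odot> (b \<odot> c)) k M S" .
qed

lemma scl_apply [simp]: "scl z a k M S = z * a k M S"
  by (simp add: scl_def)

lemma weyl_sum_apply: "(\<Sum>i\<in>I. f i) k M S = (\<Sum>i\<in>I. f i k M S)"
  for f :: "'i \<Rightarrow> 'n weyl"
  by (simp add: sum_fun_apply)

lemma wmul_add_left: "(a + b) \<odot> c = a \<odot> c + b \<odot> c"
  by (simp add: wmul_def fun_eq_iff algebra_simps sum.distrib)

lemma wmul_add_right: "c \<odot> (a + b) = c \<odot> a + c \<odot> b"
  by (simp add: wmul_def fun_eq_iff algebra_simps sum.distrib)

lemma wmul_zero [simp]: "0 \<odot> a = 0" "a \<odot> 0 = 0"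
  by (simp_all add: wmul_def fun_eq_iff)

lemma wmul_scl_left: "scl z a \<odot> b = scl z (a \<odot> b)"
  by (simp add: wmul_def fun_eq_iff sum_distrib_left algebra_simps)

lemma wmul_scl_right: "a \<odot> scl z b = scl z (a \<odot> b)"
  by (simp add: wmul_def fun_eq_iff sum_distrib_left algebra_simps)

lemma scl_scl [simp]: "scl z (scl w a) = scl (z * w) a"
  by (simp add: fun_eq_iff)

lemma scl_one [simp]: "scl 1 a = a"
  by (simp add: fun_eq_iff)

lemma scl_zero [simp]: "scl 0 a = 0" "scl z 0 = 0"
  by (simp_all add: fun_eq_iff)

lemma scl_add: "scl z (a + b) = scl z a + scl z b" "scl (z + w) a = scl z a + scl w a"
  by (simp_all add: fun_eq_iff algebra_simps)

lemma scl_uminus: "scl (- z) a = - scl z a" "scl z (- a) = - scl z a"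
  by (simp_all add: fun_eq_iff)

lemma scl_sum: "scl z (\<Sum>i\<in>I. f i) = (\<Sum>i\<in>I. scl z (f i))" "scl (\<Sum>i\<in>I. c i) a = (\<Sum>i\<in>I. scl (c i) a)"
  by (simp_all add: fun_eq_iff weyl_sum_apply sum_distrib_left sum_distrib_right)

lemma wmul_uminus_left: "(- a) \<odot> b = - (a \<odot> b)"
  using wmul_scl_left[of "-1" a b] by (simp add: scl_uminus)

lemma wmul_uminus_right: "a \<odot> (- b) = - (a \<odot> b)"
  using wmul_scl_right[of a "-1" b] by (simp add: scl_uminus)

lemma wmul_diff_left: "(a - b) \<odot> c = a \<odot> c - b \<odot> c"
  using wmul_add_left[of a "- b" c] by (simp add: wmul_uminus_left)

lemma wmul_diff_right: "c \<odot> (a - b) = c \<odot> a - c \<odot> b"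
  using wmul_add_right[of c a "- b"] by (simp add: wmul_uminus_right)

lemma sum_hom:
  fixes h :: "'b::comm_monoid_add \<Rightarrow> 'c::comm_monoid_add"
  assumes "h 0 = 0" "\<And>a b. h (a + b) = h a + h b"
  shows "h (\<Sum>i\<in>I. f i) = (\<Sum>i\<in>I. h (f i))"
  by (induction I rule: infinite_finite_induct) (simp_all add: assms)

lemma wmul_sum_left: "(\<Sum>i\<in>I. f i) \<odot> a = (\<Sum>i\<in>I. f i \<odot> a)"
  by (rule sum_hom[of "\<lambda>x. x \<odot> a", OF wmul_zero(1) wmul_add_left])

lemma wmul_sum_right: "a \<odot> (\<Sum>i\<in>I. f i) = (\<Sum>i\<in>I. a \<odot> f i)"
  by (rule sum_hom[of "\<lambda>x. a \<odot> x", OF wmul_zero(2) wmul_add_right])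

section \<open>The parity operator and graded commutativity\<close>

definition sgm :: "'n::finite weyl \<Rightarrow> 'n weyl" where
  "sgm a = (\<lambda>k M S. (-1) ^ card S * a k M S)"

lemma sgm_add: "sgm (a + b) = sgm a + sgm b"
  by (simp add: sgm_def fun_eq_iff algebra_simps)

lemma sgm_diff: "sgm (a - b) = sgm a - sgm b"
  by (simp add: sgm_def fun_eq_iff algebra_simps)

lemma sgm_scl: "sgm (scl z a) = scl z (sgm a)"
  by (simp add: sgm_def fun_eq_iff algebra_simps)

lemma sgm_zero [simp]: "sgm 0 = 0"
  by (simp add: sgm_def fun_eq_iff)

lemma sgm_sum: "sgm (\<Sum>i\<in>I. f i) = (\<Sum>i\<in>I. sgm (f i))"
  by (rule sum_hom[of "sgm", OF sgm_zero sgm_add])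

lemma sgm_sgm [simp]: "sgm (sgm a) = a"
  by (simp add: sgm_def fun_eq_iff flip: mult.assoc power_add)

lemma sgm_wmul: "sgm (a \<odot> b) = sgm a \<odot> sgm b"
proof (intro ext)
  fix k M S
  have *: "card S = card T + card (S - T)" if "T \<subseteq> S" for T :: "'a ix set"
    using that by (simp add: card_Diff_subset card_mono finite_subset)
  show "sgm (a \<odot> b) k M S = (sgm a \<odot> sgm b) k M S"
    unfolding wmul_wdom sgm_def sum_distrib_left
    by (rule sum.cong) (auto simp: wdom_def *[of _] power_add)
qed

text \<open>The hypotheses express through signs that all form degrees in \<open>a\<close> have the
  parity of \<open>p\<close>. Exchanging the two pieces of a splitting costs the sign of
  \<open>wsign_swap\<close>, which then depends on \<open>a\<close> through \<open>p\<close> only;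
  the even and the odd case are p = 0 and p = 1.\<close>

lemma wmul_comm_aux:
  fixes a b :: "'n::finite weyl"
  assumes "\<And>k M S. a k M S \<noteq> 0 \<Longrightarrow> (-1 :: complex) ^ (card S * n) = (-1) ^ (p * n)"
    and "\<And>k M S. a k M S \<noteq> 0 \<Longrightarrow> (\<forall>n. (-1 :: complex) ^ (card S * n) = (-1) ^ (p * n))"
  shows "a \<odot> b = (\<lambda>k M S. (-1) ^ (p * card S) * b k M S) \<odot> a"
proof (intro ext)
  fix k M S
  show "(a \<odot> b) k M S = ((\<lambda>k M S. (-1) ^ (p * card S) * b k M S) \<odot> a) k M S"
    unfolding wmul_wdom
  proof (rule sum.reindex_bij_witness[of _ "\<lambda>(j, N, T). (k - j, M - N, S - T)" "\<lambda>(j, N, T). (k - j, M - N, S - T)"], goal_cases)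
    case (5 x)
    obtain j N T where x: "x = (j, N, T)" by (metis prod.exhaust)
    with 5 have *: "j \<le> k" "N \<le> M" "T \<subseteq> S" by (auto simp: wdom_def)
    then have e: "k - (k - j) = j" "M - (M - N) = N" "S - (S - T) = T"
      by (auto simp: fun_eq_iff le_fun_def)
    have "wsign T (S - T) = (-1) ^ (card T * card (S - T)) * wsign (S - T) T"
      by (rule wsign_swap) auto
    then show ?case using assms(2)[of j N T] by (cases "a j N T = 0") (auto simp: x e)
  qed (auto simp: wdom_def le_fun_def fun_eq_iff)
qed

lemma wmul_comm_even:
  assumes "\<And>k M S. a k M S \<noteq> 0 \<Longrightarrow> even (card S)"
  shows "a \<odot> b = b \<odot> a"
  using wmul_comm_aux[of a 0 0 b] assms by (auto simp: fun_eq_iff)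

lemma wmul_comm_odd:
  assumes "\<And>k M S. a k M S \<noteq> 0 \<Longrightarrow> odd (card S)"
  shows "a \<odot> b = sgm b \<odot> a"
proof -
  have "(-1 :: complex) ^ (card S * n) = (-1) ^ (1 * n)" if "a k M S \<noteq> 0" for k M S n
    using assms[OF that] by (simp add: power_mult)
  then show ?thesis using wmul_comm_aux[of a 0 1 b] by (simp add: sgm_def)
qed

definition wone :: "'n::finite weyl" where
  "wone = (\<lambda>k M S. if k = 0 \<and> M = 0 \<and> S = {} then 1 else 0)"

lemma wmul_one_left [simp]: "wone \<odot> a = a"
proof (intro ext)
  fix k M S
  have "(wone \<odot> a) k M S = (\<Sum>(j, N, T)\<in>{(0, 0, {})}.
    wsign T (S - T) * wone j N T * a (k - j) (M - N) (S - T))"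
    unfolding wmul_wdom
    by (rule sum.mono_neutral_right[OF finite_wdom]) (auto simp: wdom_def wone_def le_fun_def split: if_splits)
  then show "(wone \<odot> a) k M S = a k M S" by (simp add: wone_def)
qed

lemma wmul_one_right [simp]: "a \<odot> wone = a"
proof -
  have "wone \<odot> a = a \<odot> wone" by (rule wmul_comm_even) (auto simp: wone_def split: if_splits)
  then show ?thesis by simp
qed

lemma dxgen_wmul:
  "(dxgen A \<odot> a) k M S = (if A \<in> S then wsign {A} (S - {A}) * a k M (S - {A}) else 0)"
proof -
  have "(dxgen A \<odot> a) k M S = (\<Sum>(j, N, T)\<in>(if A \<in> S then {(0, 0, {A})} else {}).
    wsign T (S - T) * dxgen A j N T * a (k - j) (M - N) (S - T))"
    unfolding wmul_wdom
    by (rule sum.mono_neutral_right[OF finite_wdom]) (auto simp: wdom_def dxgen_def le_fun_def split: if_splits)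
  then show ?thesis by (simp add: dxgen_def)
qed

lemma ygen_wmul:
  "(ygen A \<odot> a) k M S = (if M A = 0 then 0 else a k (M(A := M A - 1)) S)"
proof -
  have s: "single A \<le> M \<longleftrightarrow> M A \<noteq> 0" "single A A = 1"
    by (auto simp: single_def le_fun_def)
  have "(ygen A \<odot> a) k M S = (\<Sum>(j, N, T)\<in>(if M A = 0 then {} else {(0, single A, {})}).
    wsign T (S - T) * ygen A j N T * a (k - j) (M - N) (S - T))"
    unfolding wmul_wdom
    by (rule sum.mono_neutral_right[OF finite_wdom]) (auto simp: wdom_def ygen_def s split: if_splits)
  moreover have "M - single A = M(A := M A - 1)"
    by (auto simp: single_def fun_eq_iff)
  ultimately show ?thesis by (simp add: ygen_def)
qed

lemma dxgen_comm: "dxgen A \<odot> a = sgm a \<odot> dxgen A"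
  by (rule wmul_comm_odd) (auto simp: dxgen_def split: if_splits)

lemma ygen_comm: "ygen A \<odot> a = a \<odot> ygen A"
  by (rule wmul_comm_even) (auto simp: ygen_def split: if_splits)

lemma sgm_dxgen: "sgm (dxgen A) = - dxgen A"
  by (auto simp: sgm_def dxgen_def fun_eq_iff)

lemma sgm_ygen: "sgm (ygen A) = ygen A"
  by (auto simp: sgm_def ygen_def fun_eq_iff)

lemma dxgen_anticomm: "dxgen A \<odot> (dxgen B \<odot> a) = - (dxgen B \<odot> (dxgen A \<odot> a))"
proof -
  have "dxgen A \<odot> dxgen B = - (dxgen B \<odot> dxgen A)"
    by (subst dxgen_comm) (simp add: sgm_dxgen wmul_uminus_left)
  then show ?thesis by (metis wmul_assoc wmul_uminus_left)
qed

lemma dxgen_past: "a \<odot> (dxgen A \<odot> b) = dxgen A \<odot> (sgm a \<odot> b)"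
  by (simp add: dxgen_comm[of A "sgm a"] flip: wmul_assoc)

lemma ygen_past: "a \<odot> (ygen A \<odot> b) = ygen A \<odot> (a \<odot> b)"
  by (simp add: ygen_comm[of A a] flip: wmul_assoc)

lemma weyl_eq_minus_self:
  fixes a :: "'n weyl"
  assumes "a = - a"
  shows "a = 0"
proof (intro ext)
  fix k M S
  have "a k M S = - a k M S"
    using fun_cong[OF fun_cong[OF fun_cong[OF assms]], of k M S] by simp
  then have "2 * a k M S = 0" by (simp add: eq_neg_iff_add_eq_0 flip: mult_2)
  then show "a k M S = 0 k M S" by simp
qed

text \<open>Exchanging the summation indices changes the sign, as one-forms anticommute, so the sum
  is its own negative. This makes \<open>delta\<close> and \<open>nabla10\<close> square to zero and
  removes the symmetric Christoffel terms.\<close>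

lemma dxgen_sum_symmetric:
  assumes "\<And>i j. i \<in> I \<Longrightarrow> j \<in> I \<Longrightarrow> X i j = X j i"
  shows "(\<Sum>i\<in>I. \<Sum>j\<in>I. dxgen (f i) \<odot> (dxgen (f j) \<odot> X i j)) = 0"
proof -
  let ?s = "\<Sum>i\<in>I. \<Sum>j\<in>I. dxgen (f i) \<odot> (dxgen (f j) \<odot> X i j)"
  have "?s = (\<Sum>i\<in>I. \<Sum>j\<in>I. dxgen (f j) \<odot> (dxgen (f i) \<odot> X j i))" by (rule sum.swap)
  also have "\<dots> = (\<Sum>i\<in>I. \<Sum>j\<in>I. - (dxgen (f i) \<odot> (dxgen (f j) \<odot> X i j)))"
  proof (intro sum.cong refl)
    fix i j assume "i \<in> I" "j \<in> I"
    then have "X j i = X i j" by (rule assms[rotated])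
    then show "dxgen (f j) \<odot> (dxgen (f i) \<odot> X j i) = - (dxgen (f i) \<odot> (dxgen (f j) \<odot> X i j))"
      using dxgen_anticomm[of "f j" "f i"] by simp
  qed
  also have "\<dots> = - ?s" by (simp add: sum_negf)
  finally show ?thesis by (rule weyl_eq_minus_self)
qed

section \<open>Fibre derivatives and contractions\<close>

lemma dy_add: "dy A (a + b) = dy A a + dy A b"
  by (simp add: dy_def fun_eq_iff algebra_simps)

lemma dy_diff: "dy A (a - b) = dy A a - dy A b"
  by (simp add: dy_def fun_eq_iff algebra_simps)

lemma dy_uminus: "dy A (- a) = - dy A a"
  by (simp add: dy_def fun_eq_iff algebra_simps)

lemma dy_zero [simp]: "dy A 0 = 0"
  by (simp add: dy_def fun_eq_iff)

lemma dy_scl: "dy A (scl z a) = scl z (dy A a)"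
  by (simp add: dy_def fun_eq_iff algebra_simps)

lemma dy_sum: "dy A (\<Sum>i\<in>I. f i) = (\<Sum>i\<in>I. dy A (f i))"
  by (rule sum_hom[of "dy A", OF dy_zero dy_add])

lemma dy_sgm: "dy A (sgm a) = sgm (dy A a)"
  by (simp add: dy_def sgm_def fun_eq_iff algebra_simps)

lemma dy_commute: "dy A (dy B a) = dy B (dy A a)"
  by (cases "A = B") (auto simp: dy_def fun_eq_iff fun_upd_twist algebra_simps)

lemma dy_ygen: "dy A (ygen B) = (if A = B then wone else 0)"
proof -
  have "M(A := Suc (M A)) = single B \<longleftrightarrow> A = B \<and> M = 0" for M :: "'a ix \<Rightarrow> nat"
    by (auto simp: fun_eq_iff single_def split: if_splits)
  then show ?thesis
    by (auto simp: dy_def ygen_def wone_def fun_eq_iff)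
qed

lemma dy_dxgen [simp]: "dy A (dxgen B) = 0"
proof -
  have "M(A := Suc (M A)) \<noteq> 0" for M :: "'a ix \<Rightarrow> nat"
    by (metis fun_upd_same nat.distinct(1) zero_fun_apply)
  then show ?thesis by (auto simp: dy_def dxgen_def fun_eq_iff)
qed

lemma dy_wmul: "dy A (a \<odot> b) = dy A a \<odot> b + a \<odot> dy A b"
proof (intro ext)
  fix k :: nat and M :: "'a ix \<Rightarrow> nat" and S :: "'a ix set"
  let ?M = "M(A := M A + 1)"
  let ?f = "\<lambda>j N T. wsign T (S - T) * a j N T * b (k - j) (?M - N) (S - T)"
  have up: "N \<le> ?M" if "N \<le> M" for N :: "'a ix \<Rightarrow> nat"
    using that by (auto simp: le_fun_def) (metis le_SucI)
  have down: "N(A := N A - 1) \<le> M" if "N \<le> ?M" for N :: "'a ix \<Rightarrow> nat"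
  proof (rule le_funI)
    fix B show "(N(A := N A - 1)) B \<le> M B" using that[THEN le_funD, of B] by (cases "B = A") auto
  qed
  have "dy A (a \<odot> b) k M S = (\<Sum>(j, N, T)\<in>wdom k ?M S. of_nat (M A + 1) * ?f j N T)"
    unfolding dy_def wmul_wdom by (simp add: sum_distrib_left case_prod_unfold)
  \<comment> \<open>The weight M A + 1 of the derivative is split into the exponent N A of the first
    factor and the exponent of the second; the first share differentiates \<open>a\<close>, the
    other differentiates \<open>b\<close>.\<close>
  also have "\<dots> = (\<Sum>(j, N, T)\<in>wdom k ?M S. of_nat (N A) * ?f j N T + of_nat (M A + 1 - N A) * ?f j N T)"
  proof (intro sum.cong refl, clarify)
    fix j N T assume "(j, N, T) \<in> wdom k ?M S"
    then have "N A \<le> M A + 1" by (auto simp: wdom_def le_fun_def split: if_splits)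
    then have "of_nat (M A + 1) = (of_nat (N A) + of_nat (M A + 1 - N A) :: complex)"
      by (metis le_add_diff_inverse of_nat_add)
    then show "of_nat (M A + 1) * ?f j N T = of_nat (N A) * ?f j N T + of_nat (M A + 1 - N A) * ?f j N T"
      by (simp add: algebra_simps)
  qed
  also have "\<dots> = (\<Sum>(j, N, T)\<in>wdom k ?M S. of_nat (N A) * ?f j N T) +
      (\<Sum>(j, N, T)\<in>wdom k ?M S. of_nat (M A + 1 - N A) * ?f j N T)"
    by (simp add: sum.distrib case_prod_unfold)
  also have "(\<Sum>(j, N, T)\<in>wdom k ?M S. of_nat (N A) * ?f j N T) =
      (\<Sum>(j, N, T)\<in>{x\<in>wdom k ?M S. fst (snd x) A \<noteq> 0}. of_nat (N A) * ?f j N T)"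
    by (rule sum.mono_neutral_right) auto
  also have "\<dots> = (\<Sum>(j, N, T)\<in>wdom k M S. wsign T (S - T) * dy A a j N T * b (k - j) (M - N) (S - T))"
  proof (rule sum.reindex_bij_witness[of _ "\<lambda>(j, N, T). (j, N(A := N A + 1), T)" "\<lambda>(j, N, T). (j, N(A := N A - 1), T)"], goal_cases)
    case (5 x)
    obtain j N T where x: "x = (j, N, T)" by (metis prod.exhaust)
    have "?M - N = M - N(A := N A - 1)" using 5 by (auto simp: x fun_eq_iff)
    then show ?case using 5 by (auto simp: x dy_def)
  next
    case (2 x)
    then show ?case using down by (auto simp: wdom_def)
  next
    case (4 x)
    then show ?case by (auto simp: wdom_def le_fun_def)
  qed auto
  also have "\<dots> = (dy A a \<odot> b) k M S" by (simp add: wmul_wdom)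
  also have "(\<Sum>(j, N, T)\<in>wdom k ?M S. of_nat (M A + 1 - N A) * ?f j N T) =
    (\<Sum>(j, N, T)\<in>wdom k M S. wsign T (S - T) * a j N T * dy A b (k - j) (M - N) (S - T))"
  proof (rule sum.mono_neutral_cong_right, goal_cases)
    case 2
    then show ?case using up by (auto simp: wdom_def)
  next
    case 3
    \<comment> \<open>A multi-index below \<open>?M\<close> but not below \<open>M\<close> takes all
      of y^A, so nothing is left for the second factor and the weight vanishes.\<close>
    have up': "N A = Suc (M A)" if N: "N \<le> ?M" "\<not> N \<le> M" for N :: "'a ix \<Rightarrow> nat"
    proof -
      obtain B where B: "\<not> N B \<le> M B" using N(2) by (auto simp: le_fun_def)
      then show ?thesis using N(1)[THEN le_funD, of B] by (cases "B = A") auto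
    qed
    have *: "of_nat (M A + 1 - N A) = (0::complex)" if "N \<le> ?M" "\<not> N \<le> M" for N :: "'a ix \<Rightarrow> nat"
      unfolding up'[OF that] by simp
    show ?case
    proof (intro ballI)
      fix x assume x: "x \<in> wdom k ?M S - wdom k M S"
      obtain j N T where e: "x = (j, N, T)" by (metis prod.exhaust)
      with x have N: "N \<le> ?M" "\<not> N \<le> M" by (auto simp: wdom_def)
      show "(case x of (j, N, T) \<Rightarrow> of_nat (M A + 1 - N A) * ?f j N T) = 0"
        unfolding e split *[OF N] by simp
    qed
  next
    case (4 x)
    obtain j N T where x: "x = (j, N, T)" by (metis prod.exhaust)
    have *: "N A \<le> M A" using 4 by (auto simp: x wdom_def le_fun_def)
    then have "?M - N = (M - N)(A := (M - N) A + 1)" by (auto simp: fun_eq_iff)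
    then show ?case using * by (simp add: x dy_def Suc_diff_le)
  qed auto
  also have "\<dots> = (a \<odot> dy A b) k M S" by (simp add: wmul_wdom)
  finally show "dy A (a \<odot> b) k M S = (dy A a \<odot> b + a \<odot> dy A b) k M S" by simp
qed

lemma dy_dxgen_wmul: "dy A (dxgen B \<odot> a) = dxgen B \<odot> dy A a"
  by (simp add: dy_wmul)

lemma dy_ygen_wmul: "dy A (ygen B \<odot> a) = (if A = B then a else 0) + ygen B \<odot> dy A a"
  by (simp add: dy_wmul dy_ygen)

lemma contr_add: "contr A (a + b) = contr A a + contr A b"
  by (simp add: contr_def fun_eq_iff algebra_simps)

lemma contr_scl: "contr A (scl z a) = scl z (contr A a)"
  by (simp add: contr_def fun_eq_iff algebra_simps)

lemma contr_zero [simp]: "contr A 0 = 0"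
  by (simp add: contr_def fun_eq_iff)

lemma contr_sum: "contr A (\<Sum>i\<in>I. f i) = (\<Sum>i\<in>I. contr A (f i))"
  by (rule sum_hom[of "contr A", OF contr_zero contr_add])

lemma contr_dy: "contr A (dy B a) = dy B (contr A a)"
  by (simp add: contr_def dy_def fun_eq_iff algebra_simps)

lemma contr_ygen: "contr A (ygen B \<odot> a) = ygen B \<odot> contr A a"
  by (auto simp: fun_eq_iff contr_def ygen_wmul)

lemma wsign_square: "wsign S T * wsign S T = 1"
  by (simp add: wsign_def flip: power_add mult_2)

text \<open>Contraction is an antiderivation. Off the diagonal the two signs differ by exchanging
  two singletons in \<open>wsign\<close>, which is where the minus sign comes from.\<close>

lemma contr_dxgen: "contr A (dxgen B \<odot> a) = (if A = B then a else 0) - dxgen B \<odot> contr A a"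
proof (intro ext)
  fix k M S
  show "contr A (dxgen B \<odot> a) k M S = ((if A = B then a else 0) - dxgen B \<odot> contr A a) k M S"
  proof (cases "A = B")
    case True
    then show ?thesis
      using wsign_square[of "{B}" S] wsign_square[of "{B}" "S - {B}"]
      by (auto simp: contr_def dxgen_wmul insert_absorb simp flip: mult.assoc)
  next
    case False
    show ?thesis
    proof (cases "A \<notin> S \<and> B \<in> S")
      case True
      have "wsign {A} S = wsign {A} (S - {B}) * wsign {A} {B}"
        using wsign_Un2[of "S - {B}" "{B}" "{A}"] True by (simp add: insert_absorb)
      moreover have "wsign {B} (insert A S - {B}) = wsign {B} (S - {B}) * wsign {B} {A}"
        using wsign_Un2[of "S - {B}" "{A}" "{B}"] True False by (simp add: insert_Diff_if)
      moreover have "wsign {A} {B} = - wsign {B} {A}"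
        using wsign_swap[of "{A}" "{B}"] False by simp
      moreover have "insert A (S - {B}) = insert A S - {B}" using False by auto
      ultimately show ?thesis using True False wsign_square[of "{B}" "{A}"]
        by (simp add: contr_def dxgen_wmul)
    qed (use False in \<open>auto simp: contr_def dxgen_wmul\<close>)
  qed
qed

lemma sgm_dxgen_wmul: "sgm (dxgen A \<odot> a) = - (dxgen A \<odot> sgm a)"
  by (simp add: sgm_wmul sgm_dxgen wmul_uminus_left)

section \<open>The Wick product\<close>

text \<open>The k-fold contraction without 1/k! and \<hbar>^k. Peeling off one contraction at a time
  replaces the lists of indices in \<open>wick\<close> by an induction on k, see
  \<open>wterm_lists\<close>.\<close>

fun wterm :: "('n \<Rightarrow> 'n \<Rightarrow> complex) \<Rightarrow> nat \<Rightarrow> 'n::finite weyl \<Rightarrow> 'n weyl \<Rightarrow> 'n weyl" where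
  "wterm w 0 a b = a \<odot> b"
| "wterm w (Suc k) a b = (\<Sum>i\<in>UNIV. \<Sum>j\<in>UNIV. scl (w i j) (wterm w k (dy (Inl i) a) (dy (Inr j) b)))"

lemma sum_lists_Suc:
  fixes f :: "'n::finite list \<Rightarrow> 'b::comm_monoid_add"
  shows "(\<Sum>xs | length xs = Suc k. f xs) = (\<Sum>x\<in>UNIV. \<Sum>xs | length xs = k. f (x # xs))"
proof -
  have "(\<Sum>x\<in>UNIV. \<Sum>xs | length xs = k. f (x # xs)) =
      (\<Sum>(x, xs)\<in>UNIV \<times> {xs. length xs = k}. f (x # xs))"
    by (simp add: sum.cartesian_product)
  also have "\<dots> = (\<Sum>xs | length xs = Suc k. f xs)"
    by (rule sum.reindex_bij_witness[of _ "\<lambda>xs. (hd xs, tl xs)" "\<lambda>(x, xs). x # xs"])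
      (auto simp: length_Suc_conv)
  finally show ?thesis ..
qed

lemma foldr_dy: "foldr dy As (dy A a) = dy A (foldr dy As a)"
  by (induction As) (simp_all add: dy_commute[of A])

lemma wterm_lists:
  "(\<Sum>is | length is = k. \<Sum>js | length js = k. (\<Prod>r<k. w (is ! r) (js ! r)) *
     (foldr dy (map Inl is) a \<odot> foldr dy (map Inr js) b) h M S) = wterm w k a b h M S"
proof (induction k arbitrary: a b)
  case (Suc k)
  have "wterm w (Suc k) a b h M S = (\<Sum>i\<in>UNIV. \<Sum>j\<in>UNIV. w i j * wterm w k (dy (Inl i) a) (dy (Inr j) b) h M S)"
    by (simp add: weyl_sum_apply)
  also have "\<dots> = (\<Sum>i\<in>UNIV. \<Sum>j\<in>UNIV. \<Sum>is | length is = k. \<Sum>js | length js = k.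
     (w i j * (\<Prod>r<k. w (is ! r) (js ! r))) *
     (dy (Inl i) (foldr dy (map Inl is) a) \<odot> dy (Inr j) (foldr dy (map Inr js) b)) h M S)"
    unfolding Suc.IH[symmetric] by (simp add: sum_distrib_left foldr_dy mult.assoc)
  also have "\<dots> = (\<Sum>i\<in>UNIV. \<Sum>is | length is = k. \<Sum>j\<in>UNIV. \<Sum>js | length js = k.
     (w i j * (\<Prod>r<k. w (is ! r) (js ! r))) *
     (dy (Inl i) (foldr dy (map Inl is) a) \<odot> dy (Inr j) (foldr dy (map Inr js) b)) h M S)"
    by (intro sum.cong refl) (rule sum.swap)
  finally show ?case
    by (simp add: sum_lists_Suc prod.lessThan_Suc_shift del: prod.lessThan_Suc wterm.simps)
qed simp

lemma wick_wterm: "wick w a b h M S = (\<Sum>k\<le>h. wterm w k a b (h - k) M S / fact k)"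
proof -
  have "wick w a b h M S = (\<Sum>k\<le>h. (1 / fact k) * (\<Sum>is | length is = k. \<Sum>js | length js = k.
      (\<Prod>r<k. w (is ! r) (js ! r)) * (foldr dy (map Inl is) a \<odot> foldr dy (map Inr js) b) (h - k) M S))"
    unfolding wick_def sum_distrib_left by (intro sum.cong refl) simp
  then show ?thesis unfolding wterm_lists by simp
qed

lemma wterm_add_left: "wterm w k (a + a') b = wterm w k a b + wterm w k a' b"
proof (induction k arbitrary: a a' b)
  case (Suc k)
  show ?case by (simp only: wterm.simps dy_add Suc.IH scl_add sum.distrib)
qed (simp add: wmul_add_left)

lemma wterm_add_right: "wterm w k a (b + b') = wterm w k a b + wterm w k a b'"
proof (induction k arbitrary: a b b')
  case (Suc k)
  show ?case by (simp only: wterm.simps dy_add Suc.IH scl_add sum.distrib)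
qed (simp add: wmul_add_right)

lemma wterm_scl_left: "wterm w k (scl z a) b = scl z (wterm w k a b)"
proof (induction k arbitrary: a b)
  case (Suc k)
  show ?case by (simp only: wterm.simps dy_scl Suc.IH scl_sum scl_scl mult.commute)
qed (simp add: wmul_scl_left)

lemma wterm_scl_right: "wterm w k a (scl z b) = scl z (wterm w k a b)"
proof (induction k arbitrary: a b)
  case (Suc k)
  show ?case by (simp only: wterm.simps dy_scl Suc.IH scl_sum scl_scl mult.commute)
qed (simp add: wmul_scl_right)

lemma wterm_zero [simp]: "wterm w k 0 b = 0" "wterm w k a 0 = 0"
  using wterm_scl_left[of w k 0 0 b] wterm_scl_right[of w k a 0 0] by simp_all

lemma wterm_sum_left: "wterm w k (\<Sum>i\<in>I. f i) b = (\<Sum>i\<in>I. wterm w k (f i) b)"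
  by (rule sum_hom[of "\<lambda>x. wterm w k x b", OF wterm_zero(1) wterm_add_left])

lemma wterm_sum_right: "wterm w k a (\<Sum>i\<in>I. f i) = (\<Sum>i\<in>I. wterm w k a (f i))"
  by (rule sum_hom[of "\<lambda>x. wterm w k a x", OF wterm_zero(2) wterm_add_right])

lemma dy_wterm: "dy A (wterm w k a b) = wterm w k (dy A a) b + wterm w k a (dy A b)"
proof (induction k arbitrary: a b)
  case (Suc k)
  show ?case
    by (simp only: wterm.simps dy_sum dy_scl Suc.IH scl_add sum.distrib dy_commute[of A])
qed (simp add: dy_wmul)

lemma wterm_dxgen_left: "wterm w k (dxgen B \<odot> a) b = dxgen B \<odot> wterm w k a b"
proof (induction k arbitrary: a b)
  case (Suc k)
  show ?case
    by (simp only: wterm.simps dy_dxgen_wmul Suc.IH wmul_sum_right wmul_scl_right)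
qed (simp add: wmul_assoc)

lemma wterm_dxgen_right: "wterm w k a (dxgen B \<odot> b) = dxgen B \<odot> wterm w k (sgm a) b"
proof (induction k arbitrary: a b)
  case (Suc k)
  show ?case
    by (simp only: wterm.simps dy_dxgen_wmul Suc.IH wmul_sum_right wmul_scl_right dy_sgm)
qed (simp add: dxgen_past)

lemma sgm_wterm: "sgm (wterm w k a b) = wterm w k (sgm a) (sgm b)"
proof (induction k arbitrary: a b)
  case (Suc k)
  show ?case by (simp only: wterm.simps sgm_sum sgm_scl Suc.IH dy_sgm)
qed (simp add: sgm_wmul)

section \<open>Powers of the formal parameter and truncation\<close>

lemma hmul_apply [simp]: "hmul a 0 M S = 0" "hmul a (Suc k) M S = a k M S"
  by (simp_all add: hmul_def)

lemma hmul_add: "hmul (a + b) = hmul a + hmul b"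
  by (auto simp: hmul_def fun_eq_iff split: nat.splits)

lemma hmul_zero [simp]: "hmul 0 = 0"
  by (auto simp: hmul_def fun_eq_iff split: nat.splits)

lemma hmul_scl: "hmul (scl z a) = scl z (hmul a)"
  by (auto simp: hmul_def fun_eq_iff split: nat.splits)

lemma hmul_sum: "hmul (\<Sum>i\<in>I. f i) = (\<Sum>i\<in>I. hmul (f i))"
  by (rule sum_hom[of hmul, OF hmul_zero hmul_add])

lemma dy_hmul: "dy A (hmul a) = hmul (dy A a)"
  by (auto simp: hmul_def dy_def fun_eq_iff split: nat.splits)

lemma hmul_wmul_left: "hmul a \<odot> b = hmul (a \<odot> b)"
proof (intro ext)
  fix k M S
  show "(hmul a \<odot> b) k M S = hmul (a \<odot> b) k M S"
    by (cases k) (simp_all add: wmul_def sum.atMost_Suc_shift del: sum.atMost_Suc)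
qed

lemma hmul_wmul_right: "a \<odot> hmul b = hmul (a \<odot> b)"
proof (intro ext)
  fix k M S
  show "(a \<odot> hmul b) k M S = hmul (a \<odot> b) k M S"
    by (cases k) (simp_all add: wmul_def Suc_diff_le)
qed

lemma wterm_hmul_left: "wterm w k (hmul a) b = hmul (wterm w k a b)"
proof (induction k arbitrary: a b)
  case (Suc k)
  show ?case by (simp only: wterm.simps dy_hmul Suc.IH hmul_sum hmul_scl)
qed (simp add: hmul_wmul_left)

lemma wterm_hmul_right: "wterm w k a (hmul b) = hmul (wterm w k a b)"
proof (induction k arbitrary: a b)
  case (Suc k)
  show ?case by (simp only: wterm.simps dy_hmul Suc.IH hmul_sum hmul_scl)
qed (simp add: hmul_wmul_right)

lemma hmul_pow: "(hmul ^^ l) a h M S = (if l \<le> h then a (h - l) M S else 0)"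
proof (induction l arbitrary: h)
  case (Suc l)
  then show ?case by (cases h) auto
qed simp

lemma wterm_hmul_pow_left: "wterm w k ((hmul ^^ l) a) b = (hmul ^^ l) (wterm w k a b)"
  by (induction l) (simp_all add: wterm_hmul_left)

lemma wterm_hmul_pow_right: "wterm w k a ((hmul ^^ l) b) = (hmul ^^ l) (wterm w k a b)"
  by (induction l) (simp_all add: wterm_hmul_right)

text \<open>Contractions and products never lower the power of \<hbar>, so a factor may be replaced
  by any other that agrees with it up to the order under consideration.\<close>

lemma wterm_h_cong:
  assumes "\<And>h M S. h \<le> H \<Longrightarrow> a h M S = a' h M S" "\<And>h M S. h \<le> H \<Longrightarrow> b h M S = b' h M S" "h \<le> H"
  shows "wterm w k a b h M S = wterm w k a' b' h M S"
  using assms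
proof (induction k arbitrary: a a' b b')
  case 0
  then show ?case by (simp add: wmul_def)
next
  case (Suc k)
  have "wterm w k (dy A a) (dy B b) h M S = wterm w k (dy A a') (dy B b') h M S" for A B
  proof (rule Suc.IH[OF _ _ Suc.prems(3)])
    show "dy A a h M S = dy A a' h M S" if "h \<le> H" for h M S
      unfolding dy_def Suc.prems(1)[OF that] ..
    show "dy B b h M S = dy B b' h M S" if "h \<le> H" for h M S
      unfolding dy_def Suc.prems(2)[OF that] ..
  qed
  then show ?case by (simp add: weyl_sum_apply)
qed

text \<open>Up to order H the Wick product is a finite sum of multiples of contraction terms by
  powers of \<hbar>. Together with \<open>wterm_h_cong\<close> this allows linearity to be used in
  place of any convergence argument.\<close>

lemma wick_trunc:
  assumes "h \<le> H"
  shows "wick w a b h M S = (\<Sum>l\<le>H. (hmul ^^ l) (scl (1 / fact l) (wterm w l a b))) h M S"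
proof -
  have "(\<Sum>l\<le>H. (hmul ^^ l) (scl (1 / fact l) (wterm w l a b))) h M S =
     (\<Sum>l\<le>H. if l \<le> h then wterm w l a b (h - l) M S / fact l else 0)"
    unfolding weyl_sum_apply hmul_pow by (intro sum.cong) auto
  also have "\<dots> = (\<Sum>l\<le>h. wterm w l a b (h - l) M S / fact l)"
    by (rule sum.mono_neutral_cong_right) (use assms in auto)
  finally show ?thesis by (simp add: wick_wterm)
qed

section \<open>Associativity of the Wick product\<close>

lemma wterm_wick_left:
  "wterm w k (wick w' a b) c h M S = (\<Sum>l\<le>h. wterm w k (wterm w' l a b) c (h - l) M S / fact l)"
proof -
  have "wterm w k (wick w' a b) c h M S =
      wterm w k (\<Sum>l\<le>h. (hmul ^^ l) (scl (1 / fact l) (wterm w' l a b))) c h M S"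
    by (rule wterm_h_cong[of h]) (auto intro: wick_trunc)
  also have "\<dots> = (\<Sum>l\<le>h. wterm w k (wterm w' l a b) c (h - l) M S / fact l)"
    unfolding wterm_sum_left wterm_hmul_pow_left wterm_scl_left weyl_sum_apply hmul_pow
    by (intro sum.cong) auto
  finally show ?thesis .
qed

lemma wterm_wick_right:
  "wterm w k a (wick w' b c) h M S = (\<Sum>l\<le>h. wterm w k a (wterm w' l b c) (h - l) M S / fact l)"
proof -
  have "wterm w k a (wick w' b c) h M S =
      wterm w k a (\<Sum>l\<le>h. (hmul ^^ l) (scl (1 / fact l) (wterm w' l b c))) h M S"
    by (rule wterm_h_cong[of h]) (auto intro: wick_trunc)
  also have "\<dots> = (\<Sum>l\<le>h. wterm w k a (wterm w' l b c) (h - l) M S / fact l)"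
    unfolding wterm_sum_right wterm_hmul_pow_right wterm_scl_right weyl_sum_apply hmul_pow
    by (intro sum.cong) auto
  finally show ?thesis .
qed

text \<open>The contribution to a triple product of \<open>p\<close> contractions between the first two factors, \<open>q\<close>
  between the outer ones and \<open>r\<close> between the last two.\<close>

fun wterm3 :: "('n \<Rightarrow> 'n \<Rightarrow> complex) \<Rightarrow> nat \<Rightarrow> nat \<Rightarrow> nat \<Rightarrow> 'n::finite weyl \<Rightarrow> 'n weyl \<Rightarrow> 'n weyl \<Rightarrow> 'n weyl" where
  "wterm3 w 0 0 0 a b c = a \<odot> b \<odot> c"
| "wterm3 w 0 0 (Suc r) a b c = (\<Sum>i\<in>UNIV. \<Sum>j\<in>UNIV. scl (w i j) (wterm3 w 0 0 r a (dy (Inl i) b) (dy (Inr j) c)))"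
| "wterm3 w 0 (Suc q) r a b c = (\<Sum>i\<in>UNIV. \<Sum>j\<in>UNIV. scl (w i j) (wterm3 w 0 q r (dy (Inl i) a) b (dy (Inr j) c)))"
| "wterm3 w (Suc p) q r a b c = (\<Sum>i\<in>UNIV. \<Sum>j\<in>UNIV. scl (w i j) (wterm3 w p q r (dy (Inl i) a) (dy (Inr j) b) c))"

lemma sum4_swap:
  fixes F :: "'i \<Rightarrow> 'j \<Rightarrow> 'k \<Rightarrow> 'l \<Rightarrow> 'b::comm_monoid_add"
  shows "(\<Sum>i\<in>I. \<Sum>j\<in>J. \<Sum>k\<in>K. \<Sum>l\<in>L. F i j k l) = (\<Sum>k\<in>K. \<Sum>l\<in>L. \<Sum>i\<in>I. \<Sum>j\<in>J. F i j k l)"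
proof -
  have "(\<Sum>i\<in>I. \<Sum>j\<in>J. \<Sum>k\<in>K. \<Sum>l\<in>L. F i j k l) = (\<Sum>i\<in>I. \<Sum>k\<in>K. \<Sum>j\<in>J. \<Sum>l\<in>L. F i j k l)"
    by (intro sum.cong refl sum.swap)
  also have "\<dots> = (\<Sum>k\<in>K. \<Sum>i\<in>I. \<Sum>j\<in>J. \<Sum>l\<in>L. F i j k l)"
    by (rule sum.swap)
  also have "\<dots> = (\<Sum>k\<in>K. \<Sum>i\<in>I. \<Sum>l\<in>L. \<Sum>j\<in>J. F i j k l)"
    by (intro sum.cong refl sum.swap)
  also have "\<dots> = (\<Sum>k\<in>K. \<Sum>l\<in>L. \<Sum>i\<in>I. \<Sum>j\<in>J. F i j k l)"
    by (intro sum.cong refl sum.swap)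
  finally show ?thesis .
qed

text \<open>The defining recursion peels contractions in a fixed order: first \<open>p\<close>, then
  \<open>q\<close>, then \<open>r\<close>. As fibre derivatives commute, one of any kind can be
  peeled first; this and the two following lemmas record it.\<close>

lemma wterm3_r0:
  "wterm3 w 0 q (Suc r) a b c = (\<Sum>i\<in>UNIV. \<Sum>j\<in>UNIV. scl (w i j) (wterm3 w 0 q r a (dy (Inl i) b) (dy (Inr j) c)))"
proof (induction q arbitrary: a b c)
  case (Suc q)
  have "wterm3 w 0 (Suc q) (Suc r) a b c =
    (\<Sum>i\<in>UNIV. \<Sum>j\<in>UNIV. \<Sum>k\<in>UNIV. \<Sum>l\<in>UNIV. scl (w i j * w k l)
      (wterm3 w 0 q r (dy (Inl i) a) (dy (Inl k) b) (dy (Inr l) (dy (Inr j) c))))"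
    by (simp only: wterm3.simps Suc.IH scl_sum scl_scl)
  also have "\<dots> = (\<Sum>k\<in>UNIV. \<Sum>l\<in>UNIV. \<Sum>i\<in>UNIV. \<Sum>j\<in>UNIV. scl (w k l * w i j)
      (wterm3 w 0 q r (dy (Inl i) a) (dy (Inl k) b) (dy (Inr j) (dy (Inr l) c))))"
    by (subst sum4_swap) (simp only: mult.commute dy_commute)
  finally show ?case by (simp only: wterm3.simps scl_sum scl_scl)
qed simp

lemma wterm3_r:
  "wterm3 w p q (Suc r) a b c = (\<Sum>i\<in>UNIV. \<Sum>j\<in>UNIV. scl (w i j) (wterm3 w p q r a (dy (Inl i) b) (dy (Inr j) c)))"
proof (induction p arbitrary: a b c)
  case (Suc p)
  have "wterm3 w (Suc p) q (Suc r) a b c =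
    (\<Sum>i\<in>UNIV. \<Sum>j\<in>UNIV. \<Sum>k\<in>UNIV. \<Sum>l\<in>UNIV. scl (w i j * w k l)
      (wterm3 w p q r (dy (Inl i) a) (dy (Inl k) (dy (Inr j) b)) (dy (Inr l) c)))"
    by (simp only: wterm3.simps Suc.IH scl_sum scl_scl)
  also have "\<dots> = (\<Sum>k\<in>UNIV. \<Sum>l\<in>UNIV. \<Sum>i\<in>UNIV. \<Sum>j\<in>UNIV. scl (w k l * w i j)
      (wterm3 w p q r (dy (Inl i) a) (dy (Inr j) (dy (Inl k) b)) (dy (Inr l) c)))"
    by (subst sum4_swap) (simp only: mult.commute dy_commute)
  finally show ?case by (simp only: wterm3.simps scl_sum scl_scl)
qed (simp only: wterm3_r0)

lemma wterm3_q:
  "wterm3 w p (Suc q) r a b c = (\<Sum>i\<in>UNIV. \<Sum>j\<in>UNIV. scl (w i j) (wterm3 w p q r (dy (Inl i) a) b (dy (Inr j) c)))"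
proof (induction p arbitrary: a b c)
  case (Suc p)
  have "wterm3 w (Suc p) (Suc q) r a b c =
    (\<Sum>i\<in>UNIV. \<Sum>j\<in>UNIV. \<Sum>k\<in>UNIV. \<Sum>l\<in>UNIV. scl (w i j * w k l)
      (wterm3 w p q r (dy (Inl k) (dy (Inl i) a)) (dy (Inr j) b) (dy (Inr l) c)))"
    by (simp only: wterm3.simps Suc.IH scl_sum scl_scl)
  also have "\<dots> = (\<Sum>k\<in>UNIV. \<Sum>l\<in>UNIV. \<Sum>i\<in>UNIV. \<Sum>j\<in>UNIV. scl (w k l * w i j)
      (wterm3 w p q r (dy (Inl i) (dy (Inl k) a)) (dy (Inr j) b) (dy (Inr l) c)))"
    by (subst sum4_swap) (simp only: mult.commute dy_commute)
  finally show ?case by (simp only: wterm3.simps scl_sum scl_scl)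
qed (simp only: wterm3.simps)

text \<open>Pascal's rule for the inductions below: one more contraction acts on either factor of a
  product and raises one of the two counters.\<close>

lemma sum_pascal:
  fixes f g :: "nat \<Rightarrow> complex"
  shows "(\<Sum>q\<le>k. of_nat (k choose q) * (F (Suc q) (k - q) + F q (Suc (k - q)))) =
    (\<Sum>q\<le>Suc k. of_nat (Suc k choose q) * (F q (Suc k - q) :: complex))"
proof -
  have "(\<Sum>q\<le>Suc k. of_nat (Suc k choose q) * F q (Suc k - q)) =
      F 0 (Suc k) + (\<Sum>q\<le>k. of_nat (k choose q) * F (Suc q) (k - q)) +
      (\<Sum>q\<le>k. of_nat (k choose Suc q) * F (Suc q) (k - q))"
    by (simp add: sum.atMost_Suc_shift algebra_simps sum.distrib del: sum.atMost_Suc)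
  also have "F 0 (Suc k) + (\<Sum>q\<le>k. of_nat (k choose q) * F (Suc q) (k - q)) +
      (\<Sum>q\<le>k. of_nat (k choose Suc q) * F (Suc q) (k - q)) =
      (\<Sum>q\<le>k. of_nat (k choose q) * F (Suc q) (k - q)) + (\<Sum>q\<le>Suc k. of_nat (k choose q) * F q (Suc k - q))"
    by (simp add: sum.atMost_Suc_shift del: sum.atMost_Suc)
  also have "(\<Sum>q\<le>Suc k. of_nat (k choose q) * F q (Suc k - q)) = (\<Sum>q\<le>k. of_nat (k choose q) * F q (Suc (k - q)))"
    by (auto simp: binomial_eq_0 Suc_diff_le intro!: sum.cong)
  finally show ?thesis by (simp add: algebra_simps sum.distrib)
qed

text \<open>By the Leibniz rule each of the k outer contractions puts its holomorphic derivative on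
  \<open>a\<close> or on \<open>b\<close>; q of them fall on \<open>a\<close> in k choose q
  ways.\<close>

lemma wterm_wterm_left:
  "wterm w k (wterm w l a b) c h M S = (\<Sum>q\<le>k. of_nat (k choose q) * wterm3 w l q (k - q) a b c h M S)"
proof (induction k arbitrary: a b c)
  case 0
  have "wterm w l a b \<odot> c = wterm3 w l 0 0 a b c"
    by (induction l arbitrary: a b c) (simp_all add: wmul_sum_left wmul_scl_left)
  then show ?case by simp
next
  case (Suc k)
  have "wterm w (Suc k) (wterm w l a b) c h M S = (\<Sum>i\<in>UNIV. \<Sum>j\<in>UNIV. w i j *
     (wterm w k (wterm w l (dy (Inl i) a) b) (dy (Inr j) c) h M S + wterm w k (wterm w l a (dy (Inl i) b)) (dy (Inr j) c) h M S))"
    by (simp add: weyl_sum_apply dy_wterm wterm_add_left)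
  also have "\<dots> = (\<Sum>i\<in>UNIV. \<Sum>j\<in>UNIV. \<Sum>q\<le>k. of_nat (k choose q) * (w i j *
     (wterm3 w l q (k - q) (dy (Inl i) a) b (dy (Inr j) c) h M S + wterm3 w l q (k - q) a (dy (Inl i) b) (dy (Inr j) c) h M S)))"
    unfolding Suc.IH by (simp add: sum_distrib_left sum.distrib algebra_simps)
  also have "\<dots> = (\<Sum>q\<le>k. \<Sum>i\<in>UNIV. \<Sum>j\<in>UNIV. of_nat (k choose q) * (w i j *
     (wterm3 w l q (k - q) (dy (Inl i) a) b (dy (Inr j) c) h M S + wterm3 w l q (k - q) a (dy (Inl i) b) (dy (Inr j) c) h M S)))"
    by (subst sum.swap[of _ "{..k}"]) (intro sum.cong refl sum.swap)
  also have "\<dots> = (\<Sum>q\<le>k. of_nat (k choose q) * (wterm3 w l (Suc q) (k - q) a b c h M S + wterm3 w l q (Suc (k - q)) a b c h M S))"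
    unfolding wterm3_q wterm3_r weyl_sum_apply
    by (simp add: sum_distrib_left sum.distrib algebra_simps)
  also have "\<dots> = (\<Sum>q\<le>Suc k. of_nat (Suc k choose q) * wterm3 w l q (Suc k - q) a b c h M S)"
    by (rule sum_pascal)
  finally show ?case .
qed

text \<open>The mirror image: here the anti-holomorphic derivatives of the outer contractions are
  shared between \<open>b\<close> and \<open>c\<close>.\<close>

lemma wterm_wterm_right:
  "wterm w k a (wterm w l b c) h M S = (\<Sum>p\<le>k. of_nat (k choose p) * wterm3 w p (k - p) l a b c h M S)"
proof (induction k arbitrary: a b c)
  case 0
  have "a \<odot> wterm w l b c = wterm3 w 0 0 l a b c"
    by (induction l arbitrary: a b c) (simp_all add: wmul_sum_right wmul_scl_right wmul_assoc)
  then show ?case by simp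
next
  case (Suc k)
  have "wterm w (Suc k) a (wterm w l b c) h M S = (\<Sum>i\<in>UNIV. \<Sum>j\<in>UNIV. w i j *
     (wterm w k (dy (Inl i) a) (wterm w l (dy (Inr j) b) c) h M S + wterm w k (dy (Inl i) a) (wterm w l b (dy (Inr j) c)) h M S))"
    by (simp add: weyl_sum_apply dy_wterm wterm_add_right)
  also have "\<dots> = (\<Sum>i\<in>UNIV. \<Sum>j\<in>UNIV. \<Sum>q\<le>k. of_nat (k choose q) * (w i j *
     (wterm3 w q (k - q) l (dy (Inl i) a) (dy (Inr j) b) c h M S + wterm3 w q (k - q) l (dy (Inl i) a) b (dy (Inr j) c) h M S)))"
    unfolding Suc.IH by (simp add: sum_distrib_left sum.distrib algebra_simps)
  also have "\<dots> = (\<Sum>q\<le>k. \<Sum>i\<in>UNIV. \<Sum>j\<in>UNIV. of_nat (k choose q) * (w i j *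
     (wterm3 w q (k - q) l (dy (Inl i) a) (dy (Inr j) b) c h M S + wterm3 w q (k - q) l (dy (Inl i) a) b (dy (Inr j) c) h M S)))"
    by (subst sum.swap[of _ "{..k}"]) (intro sum.cong refl sum.swap)
  also have "\<dots> = (\<Sum>q\<le>k. of_nat (k choose q) * (wterm3 w (Suc q) (k - q) l a b c h M S + wterm3 w q (Suc (k - q)) l a b c h M S))"
    unfolding wterm3_q wterm3.simps(4) weyl_sum_apply
    by (simp add: sum_distrib_left sum.distrib algebra_simps)
  also have "\<dots> = (\<Sum>q\<le>Suc k. of_nat (Suc k choose q) * wterm3 w q (Suc k - q) l a b c h M S)"
    by (rule sum_pascal)
  finally show ?case .
qed

lemma sum_triples:
  fixes F :: "nat \<Rightarrow> nat \<Rightarrow> nat \<Rightarrow> complex"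
  shows "(\<Sum>k\<le>h. \<Sum>l\<le>h - k. \<Sum>q\<le>k. F l q (k - q)) = (\<Sum>k\<le>h. \<Sum>l\<le>h - k. \<Sum>p\<le>k. F p (k - p) l)"
proof -
  have "(\<Sum>k\<le>h. \<Sum>l\<le>h - k. \<Sum>q\<le>k. F l q (k - q)) =
      (\<Sum>(k, l, q)\<in>(SIGMA k:{..h}. {..h - k} \<times> {..k}). F l q (k - q))"
    by (simp add: sum.cartesian_product sum.Sigma)
  also have "\<dots> = (\<Sum>(k, l, p)\<in>(SIGMA k:{..h}. {..h - k} \<times> {..k}). F p (k - p) l)"
    by (rule sum.reindex_bij_witness[of _ "\<lambda>(k, l, p). (l + k - p, p, k - p)" "\<lambda>(k, l, q). (l + q, k - q, l)"]) auto
  also have "\<dots> = (\<Sum>k\<le>h. \<Sum>l\<le>h - k. \<Sum>p\<le>k. F p (k - p) l)"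
    by (simp add: sum.cartesian_product sum.Sigma)
  finally show ?thesis .
qed

text \<open>Binomial coefficients from the Leibniz rule combine with 1/k! so that both bracketings
  become the sum over all contraction numbers (p, q, r) of \<open>wterm3\<close> with the symmetric
  weight 1/(p! q! r!).\<close>

lemma wick_assoc: "wick w (wick w a b) c = wick w a (wick w b c)"
proof (intro ext)
  fix h M S
  define F where "F p q r = wterm3 w p q r a b c (h - p - q - r) M S / (fact p * fact q * fact r)" for p q r
  have bin: "of_nat (k choose q) / fact k = 1 / (fact q * fact (k - q) :: complex)" if "q \<le> k" for k q
    using binomial_fact[OF that, where ?'a = complex] by simp
  have "wick w (wick w a b) c h M S =
     (\<Sum>k\<le>h. \<Sum>l\<le>h - k. \<Sum>q\<le>k. (of_nat (k choose q) / fact k) * wterm3 w l q (k - q) a b c (h - k - l) M S / fact l)"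
    unfolding wick_wterm[of w _ c] wterm_wick_left wterm_wterm_left
    by (simp add: sum_divide_distrib mult_ac)
  also have "\<dots> = (\<Sum>k\<le>h. \<Sum>l\<le>h - k. \<Sum>q\<le>k. F l q (k - q))"
    by (intro sum.cong refl) (simp add: bin F_def ac_simps)
  also have "\<dots> = (\<Sum>k\<le>h. \<Sum>l\<le>h - k. \<Sum>p\<le>k. F p (k - p) l)" by (rule sum_triples)
  also have "\<dots> = (\<Sum>k\<le>h. \<Sum>l\<le>h - k. \<Sum>p\<le>k. (of_nat (k choose p) / fact k) * wterm3 w p (k - p) l a b c (h - k - l) M S / fact l)"
    by (intro sum.cong refl) (simp add: bin F_def ac_simps)
  also have "\<dots> = wick w a (wick w b c) h M S"
    unfolding wick_wterm[of w a] wterm_wick_right wterm_wterm_right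
    by (simp add: sum_divide_distrib mult_ac)
  finally show "wick w (wick w a b) c h M S = wick w a (wick w b c) h M S" .
qed

section \<open>Linearity, Leibniz rule and signs for the Wick product\<close>

lemma wick_add_left: "wick w (a + a') b = wick w a b + wick w a' b"
  by (intro ext) (simp add: wick_wterm wterm_add_left sum.distrib add_divide_distrib)

lemma wick_add_right: "wick w a (b + b') = wick w a b + wick w a b'"
  by (intro ext) (simp add: wick_wterm wterm_add_right sum.distrib add_divide_distrib)

lemma wick_scl_left: "wick w (scl z a) b = scl z (wick w a b)"
  by (intro ext) (simp add: wick_wterm wterm_scl_left sum_distrib_left)

lemma wick_scl_right: "wick w a (scl z b) = scl z (wick w a b)"
  by (intro ext) (simp add: wick_wterm wterm_scl_right sum_distrib_left)

lemma wick_zero [simp]: "wick w 0 b = 0" "wick w a 0 = 0"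
  using wick_scl_left[of w 0 0 b] wick_scl_right[of w a 0 0] by simp_all

lemma wick_uminus: "wick w (- a) b = - wick w a b" "wick w a (- b) = - wick w a b"
  using wick_scl_left[of w "-1" a b] wick_scl_right[of w a "-1" b] by (simp_all add: scl_uminus)

lemma wick_diff_left: "wick w (a - a') b = wick w a b - wick w a' b"
  using wick_add_left[of w a "- a'" b] by (simp add: wick_uminus)

lemma wick_diff_right: "wick w a (b - b') = wick w a b - wick w a b'"
  using wick_add_right[of w a b "- b'"] by (simp add: wick_uminus)

lemma wick_sum_left: "wick w (\<Sum>i\<in>I. f i) b = (\<Sum>i\<in>I. wick w (f i) b)"
  by (rule sum_hom[of "\<lambda>x. wick w x b", OF wick_zero(1) wick_add_left])

lemma wick_sum_right: "wick w a (\<Sum>i\<in>I. f i) = (\<Sum>i\<in>I. wick w a (f i))"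
  by (rule sum_hom[of "\<lambda>x. wick w a x", OF wick_zero(2) wick_add_right])

lemma dy_wick: "dy A (wick w a b) = wick w (dy A a) b + wick w a (dy A b)"
proof (intro ext)
  fix h M S
  have "dy A (wick w a b) h M S = (\<Sum>k\<le>h. dy A (wterm w k a b) (h - k) M S / fact k)"
    by (simp add: dy_def wick_wterm sum_distrib_left)
  then show "dy A (wick w a b) h M S = (wick w (dy A a) b + wick w a (dy A b)) h M S"
    by (simp add: dy_wterm wick_wterm sum.distrib add_divide_distrib)
qed

lemma wick_dxgen_left: "wick w (dxgen B \<odot> a) b = dxgen B \<odot> wick w a b"
  by (intro ext) (simp add: wick_wterm wterm_dxgen_left dxgen_wmul sum_distrib_left)

lemma wick_dxgen_right: "wick w a (dxgen B \<odot> b) = dxgen B \<odot> wick w (sgm a) b"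
  by (intro ext) (simp add: wick_wterm wterm_dxgen_right dxgen_wmul sum_distrib_left)

lemma sgm_wick: "sgm (wick w a b) = wick w (sgm a) (sgm b)"
proof (intro ext)
  fix h M S
  have "sgm (wick w a b) h M S = (\<Sum>k\<le>h. sgm (wterm w k a b) (h - k) M S / fact k)"
    by (simp add: sgm_def wick_wterm sum_distrib_left)
  then show "sgm (wick w a b) h M S = wick w (sgm a) (sgm b) h M S"
    by (simp add: sgm_wterm wick_wterm)
qed

lemma wick_hmul_left: "wick w (hmul a) b = hmul (wick w a b)"
proof (intro ext)
  fix h M S
  show "wick w (hmul a) b h M S = hmul (wick w a b) h M S"
    by (cases h) (simp_all add: wick_wterm wterm_hmul_left Suc_diff_le)
qed

lemma wick_hmul_right: "wick w a (hmul b) = hmul (wick w a b)"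
proof (intro ext)
  fix h M S
  show "wick w a (hmul b) h M S = hmul (wick w a b) h M S"
    by (cases h) (simp_all add: wick_wterm wterm_hmul_right Suc_diff_le)
qed

lemma hdiv_hmul [simp]: "hdiv (hmul a) = a"
  by (simp add: hdiv_def fun_eq_iff)

lemma hdiv_add: "hdiv (a + b) = hdiv a + hdiv b"
  by (simp add: hdiv_def fun_eq_iff)

lemma hdiv_diff: "hdiv (a - b) = hdiv a - hdiv b"
  by (simp add: hdiv_def fun_eq_iff)

lemma hdiv_zero [simp]: "hdiv 0 = 0"
  by (simp add: hdiv_def fun_eq_iff)

lemma hdiv_uminus: "hdiv (- a) = - hdiv a"
  by (simp add: hdiv_def fun_eq_iff)

lemma hdiv_sum: "hdiv (\<Sum>i\<in>I. f i) = (\<Sum>i\<in>I. hdiv (f i))"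
  by (rule sum_hom[of hdiv, OF hdiv_zero hdiv_add])

lemma dy_hdiv: "dy A (hdiv a) = hdiv (dy A a)"
  by (simp add: hdiv_def dy_def fun_eq_iff)

lemma dxgen_hdiv: "dxgen B \<odot> hdiv a = hdiv (dxgen B \<odot> a)"
  by (simp add: hdiv_def fun_eq_iff dxgen_wmul)

text \<open>An exact expansion with at most one contraction. It applies when one factor is at most
  linear in the variables being contracted, as for generators, the curvature and elements free of
  y.\<close>

lemma wick_first_order:
  assumes "\<And>k. wterm w (Suc (Suc k)) a b = 0"
  shows "wick w a b = a \<odot> b + hmul (wterm w 1 a b)"
proof (intro ext)
  fix h M S
  show "wick w a b h M S = (a \<odot> b + hmul (wterm w 1 a b)) h M S"
  proof (cases h)
    case (Suc m)
    have "(\<Sum>k\<le>m. wterm w (Suc k) a b (m - k) M S / fact (Suc k)) =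
        (\<Sum>k\<in>{0}. wterm w (Suc k) a b (m - k) M S / fact (Suc k))"
    proof (rule sum.mono_neutral_right)
      show "\<forall>k\<in>{..m} - {0}. wterm w (Suc k) a b (m - k) M S / fact (Suc k) = 0"
      proof
        fix k assume "k \<in> {..m} - {0}"
        then obtain l where "k = Suc l" by (cases k) auto
        then show "wterm w (Suc k) a b (m - k) M S / fact (Suc k) = 0" using assms[of l] by simp
      qed
    qed auto
    then show ?thesis
      by (simp add: wick_wterm Suc sum.atMost_Suc_shift del: sum.atMost_Suc wterm.simps(2))
  qed (simp add: wick_wterm)
qed

section \<open>The graded commutator\<close>

lemma sum_form_part:
  fixes a :: "'n::finite weyl"
  shows "(\<Sum>p\<le>CARD('n ix). scl (c p) (form_part p a)) = (\<lambda>k M S. c (card S) * a k M S)"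
proof (intro ext)
  fix k M S
  have "card S \<le> CARD('n ix)" for S :: "'n ix set" by (rule card_mono) auto
  then have "(\<Sum>p\<le>CARD('n ix). if card S = p then c p * a k M S else 0) = c (card S) * a k M S"
    by (simp add: sum.delta)
  moreover have "(\<Sum>p\<le>CARD('n ix). scl (c p) (form_part p a)) k M S =
      (\<Sum>p\<le>CARD('n ix). if card S = p then c p * a k M S else 0)"
    unfolding weyl_sum_apply by (intro sum.cong) (auto simp: form_part_def)
  ultimately show "(\<Sum>p\<le>CARD('n ix). scl (c p) (form_part p a)) k M S = c (card S) * a k M S" by simp
qed

text \<open>For a first argument of pure form degree d only p = d survives in the double sum, and
  the sign of the graded commutator can be moved into the second argument. The bound on d puts it in
  the range of that sum.\<close>

lemma wick_comm_homogeneous: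
  fixes a b :: "'n::finite weyl"
  assumes "\<And>k M S. a k M S \<noteq> 0 \<Longrightarrow> card S = d" and d: "d \<le> CARD('n ix)"
  shows "wick_comm w a b = wick w a b - wick w (\<lambda>k M S. (-1) ^ (d * card S) * b k M S) a"
proof -
  have fa: "form_part p a = (if p = d then a else 0)" for p
    using assms(1) by (fastforce simp: form_part_def fun_eq_iff)
  have "wick_comm w a b = (\<Sum>p\<le>CARD('n ix). if p = d then
     (\<Sum>q\<le>CARD('n ix). wick w a (form_part q b) - scl ((-1) ^ (d * q)) (wick w (form_part q b) a)) else 0)"
    unfolding wick_comm_def by (intro sum.cong refl) (simp add: fa)
  also have "\<dots> = (\<Sum>q\<le>CARD('n ix). wick w a (form_part q b) - scl ((-1) ^ (d * q)) (wick w (form_part q b) a))"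
    using d by (simp add: sum.delta)
  also have "\<dots> = wick w a (\<Sum>q\<le>CARD('n ix). scl 1 (form_part q b)) - wick w (\<Sum>q\<le>CARD('n ix). scl ((-1) ^ (d * q)) (form_part q b)) a"
    by (simp add: sum_subtractf wick_sum_left wick_sum_right wick_scl_left)
  finally show ?thesis unfolding sum_form_part by simp
qed

lemma card_ix_ge_2: "2 \<le> CARD('n::finite ix)"
proof -
  have "0 < CARD('n)" by (simp add: card_gt_0_iff)
  then have "2 \<le> CARD('n) + CARD('n)" by linarith
  then show ?thesis by (simp add: card_UNIV_sum)
qed

lemma wick_comm_1:
  assumes "\<And>k M S. a k M S \<noteq> 0 \<Longrightarrow> card S = 1"
  shows "wick_comm w a b = wick w a b - wick w (sgm b) a"
  using wick_comm_homogeneous[of a 1, OF assms] card_ix_ge_2[where ?'n = 'a] by (simp add: sgm_def)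

declare pd.simps [simp del]

section \<open>Smooth local sections\<close>

definition ssec :: "(complex^'n::finite) set \<Rightarrow> (complex^'n \<Rightarrow> 'n weyl) \<Rightarrow> bool" where
  "ssec U a \<longleftrightarrow> (\<forall>k M S. smooth_on U (\<lambda>x. a x k M S))"

lemma ssecD: "ssec U a \<Longrightarrow> smooth_on U (\<lambda>x. a x k M S)"
  by (simp add: ssec_def)

lemma ssec_cong: "open U \<Longrightarrow> (\<And>x. x \<in> U \<Longrightarrow> a x = b x) \<Longrightarrow> ssec U a \<Longrightarrow> ssec U b"
  unfolding ssec_def by (metis (mono_tags, lifting) smooth_on_cong)

lemma ssec_const [simp]: "ssec U (\<lambda>x. c)"
  by (simp add: ssec_def)

lemma ssec_add: "open U \<Longrightarrow> ssec U a \<Longrightarrow> ssec U b \<Longrightarrow> ssec U (\<lambda>x. a x + b x)"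
  by (simp add: ssec_def smooth_on_add)

lemma ssec_diff: "open U \<Longrightarrow> ssec U a \<Longrightarrow> ssec U b \<Longrightarrow> ssec U (\<lambda>x. a x - b x)"
  by (simp add: ssec_def smooth_on_diff)

lemma ssec_uminus: "open U \<Longrightarrow> ssec U a \<Longrightarrow> ssec U (\<lambda>x. - a x)"
  by (simp add: ssec_def smooth_on_minus)

lemma ssec_scl: "open U \<Longrightarrow> smooth_on U f \<Longrightarrow> ssec U a \<Longrightarrow> ssec U (\<lambda>x. scl (f x) (a x))"
  by (simp add: ssec_def smooth_on_mult)

lemma ssec_sum: "open U \<Longrightarrow> (\<And>i. i \<in> I \<Longrightarrow> ssec U (a i)) \<Longrightarrow> ssec U (\<lambda>x. \<Sum>i\<in>I. a i x)"
  by (simp add: ssec_def weyl_sum_apply smooth_on_sum)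

lemma ssec_wmul: "open U \<Longrightarrow> ssec U a \<Longrightarrow> ssec U b \<Longrightarrow> ssec U (\<lambda>x. a x \<odot> b x)"
  unfolding ssec_def wmul_wdom case_prod_unfold
  by (auto intro!: smooth_on_sum smooth_on_mult)

lemma ssec_dy: "open U \<Longrightarrow> ssec U a \<Longrightarrow> ssec U (\<lambda>x. dy A (a x))"
  unfolding ssec_def dy_def by (auto intro!: smooth_on_mult)

lemma ssec_sgm: "open U \<Longrightarrow> ssec U a \<Longrightarrow> ssec U (\<lambda>x. sgm (a x))"
  unfolding ssec_def sgm_def by (auto intro!: smooth_on_mult)

lemma ssec_hdiv: "ssec U a \<Longrightarrow> ssec U (\<lambda>x. hdiv (a x))"
  unfolding ssec_def hdiv_def by auto

lemma ssec_contr: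
  assumes "open U" "ssec U a"
  shows "ssec U (\<lambda>x. contr A (a x))"
  unfolding ssec_def
proof (intro allI)
  fix k M S
  show "smooth_on U (\<lambda>x. contr A (a x) k M S)"
    using assms by (cases "A \<in> S") (auto simp: contr_def ssec_def intro: smooth_on_cmul)
qed

lemma ssec_pdw: "open U \<Longrightarrow> ssec U a \<Longrightarrow> ssec U (pdw B a)"
  unfolding ssec_def pdw_def by (auto intro!: smooth_on_pd)

lemma ssec_wterm:
  assumes U: "open U" and w: "\<And>i j. smooth_on U (\<lambda>x. w x i j)"
  shows "ssec U a \<Longrightarrow> ssec U b \<Longrightarrow> ssec U (\<lambda>x. wterm (w x) k (a x) (b x))"
  by (induction k arbitrary: a b) (auto intro!: ssec_wmul ssec_sum ssec_scl ssec_dy U w)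

lemma ssec_wick:
  assumes U: "open U" and w: "\<And>i j. smooth_on U (\<lambda>x. w x i j)" and "ssec U a" "ssec U b"
  shows "ssec U (\<lambda>x. wick (w x) (a x) (b x))"
  unfolding ssec_def wick_wterm divide_inverse
  by (intro allI smooth_on_sum smooth_on_mult U smooth_on_const ssecD[OF ssec_wterm] assms)

lemma pdw_cong:
  assumes "open U" "x \<in> U" "\<And>y. y \<in> U \<Longrightarrow> a y = b y"
  shows "pdw B a x = pdw B b x"
  unfolding pdw_def by (intro ext pd_cong[OF assms(1,2)]) (simp add: assms(3))

lemma pdw_const [simp]: "pdw B (\<lambda>_. c) x = 0"
  by (simp add: pdw_def fun_eq_iff)

context
  fixes U :: "(complex^'n::finite) set" and x
  assumes U: "open U" and x: "x \<in> U"
begin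

lemma pdw_add: "ssec U a \<Longrightarrow> ssec U b \<Longrightarrow> pdw B (\<lambda>x. a x + b x) x = pdw B a x + pdw B b x"
  unfolding pdw_def
  by (intro ext) (simp add: pd_add smooth_on_differentiable[OF ssecD x])

lemma pdw_diff: "ssec U a \<Longrightarrow> ssec U b \<Longrightarrow> pdw B (\<lambda>x. a x - b x) x = pdw B a x - pdw B b x"
  unfolding pdw_def
  by (intro ext) (simp add: pd_diff smooth_on_differentiable[OF ssecD x])

lemma pdw_scl: "smooth_on U f \<Longrightarrow> ssec U a \<Longrightarrow>
  pdw B (\<lambda>x. scl (f x) (a x)) x = scl (pd B f x) (a x) + scl (f x) (pdw B a x)"
  unfolding pdw_def
  by (intro ext) (simp add: pd_mult smooth_on_differentiable[OF ssecD x] smooth_on_differentiable[OF _ x])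

lemma pdw_sum: "(\<And>i. i \<in> I \<Longrightarrow> ssec U (a i)) \<Longrightarrow> pdw B (\<lambda>x. \<Sum>i\<in>I. a i x) x = (\<Sum>i\<in>I. pdw B (a i) x)"
  unfolding pdw_def
  by (intro ext) (simp add: weyl_sum_apply pd_sum smooth_on_differentiable[OF ssecD x])

lemma pdw_wmul:
  assumes "ssec U a" "ssec U b"
  shows "pdw B (\<lambda>x. a x \<odot> b x) x = pdw B a x \<odot> b x + a x \<odot> pdw B b x"
proof (intro ext)
  fix k M S
  have d: "(\<lambda>w. a w j N T) differentiable (at x)" "(\<lambda>w. b w j N T) differentiable (at x)" for j N T
    using assms by (auto intro: smooth_on_differentiable[OF ssecD x])
  have "pd B (\<lambda>w. (a w \<odot> b w) k M S) x = (\<Sum>(j, N, T)\<in>wdom k M S.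
      pd B (\<lambda>w. wsign T (S - T) * a w j N T * b w (k - j) (M - N) (S - T)) x)"
    unfolding wmul_wdom case_prod_unfold
    by (rule pd_sum) (intro differentiable_mult d differentiable_const)
  also have "\<dots> = (\<Sum>(j, N, T)\<in>wdom k M S.
      wsign T (S - T) * pdw B a x j N T * b x (k - j) (M - N) (S - T) +
      wsign T (S - T) * a x j N T * pdw B b x (k - j) (M - N) (S - T))"
    unfolding pdw_def case_prod_unfold
    by (simp add: pd_mult d differentiable_mult)
  also have "\<dots> = (pdw B a x \<odot> b x + a x \<odot> pdw B b x) k M S"
    by (simp add: wmul_wdom sum.distrib case_prod_unfold)
  finally show "pdw B (\<lambda>x. a x \<odot> b x) x k M S = (pdw B a x \<odot> b x + a x \<odot> pdw B b x) k M S"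
    by (simp add: pdw_def)
qed

lemma pdw_dy: "ssec U a \<Longrightarrow> pdw B (\<lambda>x. dy A (a x)) x = dy A (pdw B a x)"
  unfolding pdw_def dy_def
  by (intro ext pd_cmul) (simp add: smooth_on_differentiable[OF ssecD x])

lemma pdw_commute: "ssec U a \<Longrightarrow> pdw A (pdw B a) x = pdw B (pdw A a) x"
  unfolding pdw_def by (intro ext pd_commute[OF U x]) (rule ssecD)

end

lemma sum_ix: "(\<Sum>A\<in>UNIV. f A) = (\<Sum>i\<in>UNIV. f (Inl i)) + (\<Sum>i\<in>UNIV. f (Inr i))"
  for f :: "'n::finite ix \<Rightarrow> 'b::comm_monoid_add"
proof -
  have "(\<Sum>A\<in>UNIV. f A) = (\<Sum>A\<in>range Inl. f A) + (\<Sum>A\<in>range Inr. f A)"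
    by (subst sum.union_disjoint[symmetric]) (auto simp: UNIV_sum)
  then show ?thesis by (simp add: sum.reindex)
qed

section \<open>The Levi-Civita connection of a local Kaehler metric\<close>

text \<open>The Kaehler condition in coordinates: \<open>closed_l\<close> and
  \<open>closed_r\<close> are the two symmetries that closedness of the form imposes on the
  derivatives of the metric, and \<open>inv_G\<close> is what positive definiteness
  supplies.\<close>

locale kaehler_chart =
  fixes U :: "(complex^'n::finite) set" and G :: "complex^'n \<Rightarrow> complex^'n^'n"
  assumes U: "open U"
    and smooth_G: "\<And>i j. smooth_on U (\<lambda>x. G x $ i $ j)"
    and inv_G: "\<And>x. x \<in> U \<Longrightarrow> invertible (G x)"
    and closed_l: "\<And>x i j k. x \<in> U \<Longrightarrow> pd (Inl k) (\<lambda>w. G w $ i $ j) x = pd (Inl i) (\<lambda>w. G w $ k $ j) x"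
    and closed_r: "\<And>x i j k. x \<in> U \<Longrightarrow> pd (Inr k) (\<lambda>w. G w $ i $ j) x = pd (Inr j) (\<lambda>w. G w $ i $ k) x"
begin

abbreviation H :: "complex^'n \<Rightarrow> complex^'n^'n" where "H x \<equiv> matrix_inv (G x)"
abbreviation \<Gamma> where "\<Gamma> x A B C \<equiv> christoffel G x A B C"

lemma smooth_H: "smooth_on U (\<lambda>x. H x $ i $ j)"
  by (rule smooth_on_matrix_inv[OF U smooth_G inv_G])

lemma GH: "x \<in> U \<Longrightarrow> (\<Sum>j\<in>UNIV. G x $ i $ j * H x $ j $ k) = (if i = k then 1 else 0)"
  using matrix_inv_mult(1)[OF inv_G, of x]
  by (simp add: matrix_matrix_mult_def mat_def vec_eq_iff)

lemma HG: "x \<in> U \<Longrightarrow> (\<Sum>j\<in>UNIV. H x $ i $ j * G x $ j $ k) = (if i = k then 1 else 0)"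
  using matrix_inv_mult(2)[OF inv_G, of x]
  by (simp add: matrix_matrix_mult_def mat_def vec_eq_iff)

lemma metricC_simps [simp]:
  "metricC G x $ Inl i $ Inl j = 0" "metricC G x $ Inr i $ Inr j = 0"
  "metricC G x $ Inl i $ Inr j = G x $ i $ j" "metricC G x $ Inr j $ Inl i = G x $ i $ j"
  by (simp_all add: metricC_def)

text \<open>The complexified metric has zero diagonal blocks and the off-diagonal blocks G and its
  transpose; inverting transposes again, which explains the index order \<open>H x $ j $ i\<close>
  in both blocks.\<close>

lemma metricC_inv:
  assumes x: "x \<in> U"
  shows "matrix_inv (metricC G x) = (\<chi> A B. case (A, B) of
      (Inl i, Inr j) \<Rightarrow> H x $ j $ i | (Inr j, Inl i) \<Rightarrow> H x $ j $ i | _ \<Rightarrow> 0)" (is "_ = ?K")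
proof (rule matrix_inv_unique)
  have "(metricC G x ** ?K) $ A $ B = mat 1 $ A $ B" for A B
    by (cases A; cases B)
      (use GH[OF x] HG[OF x] in \<open>auto simp: matrix_matrix_mult_def sum_ix mat_def mult.commute\<close>)
  then show "metricC G x ** ?K = mat 1" by (simp add: vec_eq_iff)
qed

text \<open>Closedness cancels the differences of metric derivatives in all symbols of mixed type.
  Thus the Levi-Civita connection preserves types, and each remaining symbol keeps one of the two
  equal derivative terms.\<close>

lemma christoffel_simps:
  assumes x: "x \<in> U"
  shows "\<Gamma> x (Inl m) (Inl i) (Inl k) = (\<Sum>l\<in>UNIV. H x $ l $ m * pd (Inl i) (\<lambda>w. G w $ k $ l) x)"
    "\<Gamma> x (Inr m) (Inr i) (Inr k) = (\<Sum>l\<in>UNIV. H x $ m $ l * pd (Inr i) (\<lambda>w. G w $ l $ k) x)"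
    "\<Gamma> x (Inl m) (Inl i) (Inr k) = 0" "\<Gamma> x (Inl m) (Inr i) C = 0"
    "\<Gamma> x (Inr m) (Inr i) (Inl k) = 0" "\<Gamma> x (Inr m) (Inl i) C = 0"
proof -
  note [simp] = metricC_inv[OF x] sum_ix
  note cl = closed_l[OF x] note cr = closed_r[OF x]
  show "\<Gamma> x (Inl m) (Inl i) (Inl k) = (\<Sum>l\<in>UNIV. H x $ l $ m * pd (Inl i) (\<lambda>w. G w $ k $ l) x)"
    by (simp add: christoffel_def sum_divide_distrib cl[of k i] flip: mult_2)
  show "\<Gamma> x (Inr m) (Inr i) (Inr k) = (\<Sum>l\<in>UNIV. H x $ m $ l * pd (Inr i) (\<lambda>w. G w $ l $ k) x)"
    by (simp add: christoffel_def sum_divide_distrib cr[of k _ i] flip: mult_2)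
  show "\<Gamma> x (Inl m) (Inl i) (Inr k) = 0" "\<Gamma> x (Inr m) (Inr i) (Inl k) = 0"
    by (simp_all add: christoffel_def cr[of k i] cl[of k _ i])
  show "\<Gamma> x (Inl m) (Inr i) C = 0" "\<Gamma> x (Inr m) (Inl i) C = 0"
    by (cases C; simp add: christoffel_def cr[of _ _ i] cl[of i])+
qed

lemma christoffel_sym: "x \<in> U \<Longrightarrow> \<Gamma> x A B C = \<Gamma> x A C B"
proof -
  have s: "metricC G w $ A $ B = metricC G w $ B $ A" for w A B by (cases A; cases B) auto
  show "\<Gamma> x A B C = \<Gamma> x A C B"
    unfolding christoffel_def by (simp add: s add.commute)
qed

lemma smooth_christoffel: "smooth_on U (\<lambda>x. \<Gamma> x A B C)"
proof -
  have "smooth_on U (\<lambda>x. matrix_inv (metricC G x) $ A $ B)" for A B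
  proof (rule smooth_on_cong[OF U])
    show "smooth_on U (\<lambda>x. case (A, B) of
      (Inl i, Inr j) \<Rightarrow> H x $ j $ i | (Inr j, Inl i) \<Rightarrow> H x $ j $ i | _ \<Rightarrow> 0)"
      by (cases A; cases B) (auto intro: smooth_H)
  qed (simp add: metricC_inv)
  moreover have "smooth_on U (\<lambda>x. metricC G x $ A $ B)" for A B
    by (cases A; cases B) (auto intro: smooth_G)
  ultimately show ?thesis unfolding christoffel_def divide_inverse
    by (intro smooth_on_mult smooth_on_sum smooth_on_add smooth_on_diff smooth_on_pd U smooth_on_const)
qed

text \<open>Metric compatibility, solved for the derivative of the metric. In each direction only
  one of the two sums is non-zero; keeping both gives one formula for all directions.\<close>

lemma pd_G:
  assumes x: "x \<in> U"
  shows "pd B (\<lambda>w. G w $ m $ l) x = (\<Sum>p\<in>UNIV. G x $ p $ l * \<Gamma> x (Inl p) B (Inl m)) +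
    (\<Sum>q\<in>UNIV. G x $ m $ q * \<Gamma> x (Inr q) B (Inr l))"
proof (cases B)
  case (Inl b)
  have "(\<Sum>p\<in>UNIV. G x $ p $ l * \<Gamma> x (Inl p) B (Inl m)) =
     (\<Sum>p\<in>UNIV. \<Sum>q\<in>UNIV. (H x $ q $ p * G x $ p $ l) * pd (Inl b) (\<lambda>w. G w $ m $ q) x)"
    by (simp add: Inl christoffel_simps[OF x] sum_distrib_left mult_ac)
  also have "\<dots> = (\<Sum>q\<in>UNIV. (\<Sum>p\<in>UNIV. H x $ q $ p * G x $ p $ l) * pd (Inl b) (\<lambda>w. G w $ m $ q) x)"
    by (subst sum.swap) (simp add: sum_distrib_right)
  finally show ?thesis by (simp add: HG[OF x] Inl christoffel_simps[OF x] if_distrib[of "\<lambda>z. z * _"] sum.delta cong: if_cong)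
next
  case (Inr b)
  have "(\<Sum>q\<in>UNIV. G x $ m $ q * \<Gamma> x (Inr q) B (Inr l)) =
     (\<Sum>q\<in>UNIV. \<Sum>p\<in>UNIV. (G x $ m $ q * H x $ q $ p) * pd (Inr b) (\<lambda>w. G w $ p $ l) x)"
    by (simp add: Inr christoffel_simps[OF x] sum_distrib_left mult_ac)
  also have "\<dots> = (\<Sum>p\<in>UNIV. (\<Sum>q\<in>UNIV. G x $ m $ q * H x $ q $ p) * pd (Inr b) (\<lambda>w. G w $ p $ l) x)"
    by (subst sum.swap) (simp add: sum_distrib_right)
  finally show ?thesis by (simp add: GH[OF x] Inr christoffel_simps[OF x] if_distrib[of "\<lambda>z. z * _"] sum.delta cong: if_cong)
qed

text \<open>Differentiating H G = 1 and multiplying by H from the right reduces the inverse metric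
  to \<open>pd_G\<close>.\<close>

lemma pd_H:
  assumes x: "x \<in> U"
  shows "pd B (\<lambda>w. H w $ j $ i) x = - (\<Sum>m\<in>UNIV. H x $ j $ m * \<Gamma> x (Inl i) B (Inl m)) -
    (\<Sum>q\<in>UNIV. H x $ q $ i * \<Gamma> x (Inr j) B (Inr q))"
proof -
  note dG = smooth_on_differentiable[OF smooth_G x] note dH = smooth_on_differentiable[OF smooth_H x]
  have 0: "(\<Sum>m\<in>UNIV. pd B (\<lambda>w. H w $ j $ m) x * G x $ m $ q) = - (\<Sum>m\<in>UNIV. H x $ j $ m * pd B (\<lambda>w. G w $ m $ q) x)" for q
  proof -
    have "0 = pd B (\<lambda>w. \<Sum>m\<in>UNIV. H w $ j $ m * G w $ m $ q) x"
      using pd_cong[OF U x, of "\<lambda>w. \<Sum>m\<in>UNIV. H w $ j $ m * G w $ m $ q" "\<lambda>w. if j = q then 1 else 0"] HG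
      by simp
    also have "\<dots> = (\<Sum>m\<in>UNIV. pd B (\<lambda>w. H w $ j $ m) x * G x $ m $ q + H x $ j $ m * pd B (\<lambda>w. G w $ m $ q) x)"
      by (simp add: pd_sum pd_mult dG dH differentiable_mult)
    finally show ?thesis by (simp add: sum.distrib eq_neg_iff_add_eq_0)
  qed
  have "pd B (\<lambda>w. H w $ j $ i) x = (\<Sum>m\<in>UNIV. pd B (\<lambda>w. H w $ j $ m) x * (\<Sum>q\<in>UNIV. G x $ m $ q * H x $ q $ i))"
    by (simp add: GH[OF x] if_distrib[of "\<lambda>z. _ * z"] sum.delta cong: if_cong)
  also have "\<dots> = (\<Sum>q\<in>UNIV. (\<Sum>m\<in>UNIV. pd B (\<lambda>w. H w $ j $ m) x * G x $ m $ q) * H x $ q $ i)"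
    unfolding sum_distrib_left sum_distrib_right by (subst sum.swap) (simp add: mult_ac)
  also have "\<dots> = - (\<Sum>q\<in>UNIV. \<Sum>m\<in>UNIV. \<Sum>p\<in>UNIV. (H x $ j $ m * \<Gamma> x (Inl p) B (Inl m)) * (G x $ p $ q * H x $ q $ i))
      - (\<Sum>q\<in>UNIV. \<Sum>m\<in>UNIV. \<Sum>p\<in>UNIV. (H x $ j $ m * G x $ m $ p) * (\<Gamma> x (Inr p) B (Inr q) * H x $ q $ i))"
    unfolding 0 pd_G[OF x]
    by (simp add: sum_distrib_left sum_distrib_right sum.distrib sum_subtractf left_diff_distrib right_diff_distrib distrib_left distrib_right sum_negf mult_ac)
  also have "(\<Sum>q\<in>UNIV. \<Sum>m\<in>UNIV. \<Sum>p\<in>UNIV. (H x $ j $ m * \<Gamma> x (Inl p) B (Inl m)) * (G x $ p $ q * H x $ q $ i)) =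
      (\<Sum>m\<in>UNIV. \<Sum>p\<in>UNIV. (H x $ j $ m * \<Gamma> x (Inl p) B (Inl m)) * (\<Sum>q\<in>UNIV. G x $ p $ q * H x $ q $ i))"
    unfolding sum_distrib_left by (subst sum.swap) (intro sum.cong refl sum.swap)
  also have "\<dots> = (\<Sum>m\<in>UNIV. H x $ j $ m * \<Gamma> x (Inl i) B (Inl m))"
    by (simp add: GH[OF x] if_distrib[of "\<lambda>z. _ * z"] sum.delta cong: if_cong)
  also have "(\<Sum>q\<in>UNIV. \<Sum>m\<in>UNIV. \<Sum>p\<in>UNIV. (H x $ j $ m * G x $ m $ p) * (\<Gamma> x (Inr p) B (Inr q) * H x $ q $ i)) =
      (\<Sum>q\<in>UNIV. \<Sum>p\<in>UNIV. (\<Sum>m\<in>UNIV. H x $ j $ m * G x $ m $ p) * (\<Gamma> x (Inr p) B (Inr q) * H x $ q $ i))"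
    unfolding sum_distrib_right by (intro sum.cong refl sum.swap)
  also have "\<dots> = (\<Sum>q\<in>UNIV. H x $ q $ i * \<Gamma> x (Inr j) B (Inr q))"
    by (simp add: HG[OF x] if_distrib[of "\<lambda>z. z * _"] sum.delta cong: if_cong) (simp add: mult.commute)
  finally show ?thesis .
qed

lemma om_up_eq:
  assumes x: "x \<in> U"
  shows "om_up G x i j = \<i> * H x $ j $ i"
proof -
  have "matrix_inv (\<chi> k l. om_low G x k l) = (\<chi> k l. - \<i> * H x $ k $ l)"
  proof (rule matrix_inv_unique)
    show "(\<chi> k l. om_low G x k l) ** (\<chi> k l. - \<i> * H x $ k $ l) = mat 1"
      using GH[OF x] by (simp add: vec_eq_iff matrix_matrix_mult_def mat_def om_low_def mult_ac flip: sum_distrib_left)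
  qed
  then show ?thesis by (simp add: om_up_def)
qed

text \<open>The value -1 comes from the convention \<omega>^{\<alpha> \<beta>} = -\<omega>^{\<beta>
  \<alpha>}, with \<beta> the barred index; it is the source of the minus signs in all later
  cancellations of \<open>om_up\<close> against \<open>om_low\<close>.\<close>

lemma om_up_low:
  assumes x: "x \<in> U"
  shows "(\<Sum>i\<in>UNIV. om_up G x i j * om_low G x i l) = (if j = l then - 1 else 0)"
    "(\<Sum>j\<in>UNIV. om_up G x i j * om_low G x l j) = (if i = l then - 1 else 0)"
proof -
  have "(\<Sum>i\<in>UNIV. om_up G x i j * om_low G x i l) = - (\<Sum>i\<in>UNIV. H x $ j $ i * G x $ i $ l)"
    by (simp add: om_up_eq[OF x] om_low_def sum_negf[symmetric] mult_ac)
  then show "(\<Sum>i\<in>UNIV. om_up G x i j * om_low G x i l) = (if j = l then - 1 else 0)"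
    by (simp add: HG[OF x])
  have "(\<Sum>j\<in>UNIV. om_up G x i j * om_low G x l j) = - (\<Sum>j\<in>UNIV. G x $ l $ j * H x $ j $ i)"
    by (simp add: om_up_eq[OF x] om_low_def sum_negf[symmetric] mult_ac)
  then show "(\<Sum>j\<in>UNIV. om_up G x i j * om_low G x l j) = (if i = l then - 1 else 0)"
    by (auto simp: GH[OF x])
qed

lemma smooth_om_up: "smooth_on U (\<lambda>x. om_up G x i j)"
  by (rule smooth_on_cong[OF U, of "\<lambda>x. \<i> * H x $ j $ i"])
    (simp_all add: om_up_eq smooth_on_cmul[OF U smooth_H])

lemma smooth_om_low: "smooth_on U (\<lambda>x. om_low G x i j)"
  unfolding om_low_def by (rule smooth_on_cmul[OF U smooth_G])

lemma pd_om_up: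
  assumes x: "x \<in> U"
  shows "pd B (\<lambda>w. om_up G w i j) x = - (\<Sum>p\<in>UNIV. om_up G x p j * \<Gamma> x (Inl i) B (Inl p)) -
    (\<Sum>q\<in>UNIV. om_up G x i q * \<Gamma> x (Inr j) B (Inr q))"
proof -
  have "pd B (\<lambda>w. om_up G w i j) x = pd B (\<lambda>w. \<i> * H w $ j $ i) x"
    by (rule pd_cong[OF U x]) (simp add: om_up_eq)
  also have "\<dots> = \<i> * pd B (\<lambda>w. H w $ j $ i) x"
    by (rule pd_cmul[OF smooth_on_differentiable[OF smooth_H x]])
  finally show ?thesis
    by (simp add: pd_H[OF x] om_up_eq[OF x] algebra_simps sum_distrib_left)
qed

lemma pd_om_low:
  assumes x: "x \<in> U"
  shows "pd B (\<lambda>w. om_low G w m l) x = (\<Sum>p\<in>UNIV. om_low G x p l * \<Gamma> x (Inl p) B (Inl m)) +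
    (\<Sum>q\<in>UNIV. om_low G x m q * \<Gamma> x (Inr q) B (Inr l))"
proof -
  have "pd B (\<lambda>w. om_low G w m l) x = \<i> * pd B (\<lambda>w. G w $ m $ l) x"
    unfolding om_low_def by (rule pd_cmul[OF smooth_on_differentiable[OF smooth_G x]])
  then show ?thesis by (simp add: pd_G[OF x] om_low_def algebra_simps sum_distrib_left)
qed

text \<open>The covariant derivative of \<open>y\<^sup>A\<close> in the direction \<open>B\<close>.\<close>

definition cfm :: "'n ix \<Rightarrow> 'n ix \<Rightarrow> complex^'n \<Rightarrow> 'n weyl" where
  "cfm B A x = - (\<Sum>C\<in>UNIV. scl (\<Gamma> x A B C) (ygen C))"

lemma cov_cfm: "cov_deriv G B a x = pdw B a x + (\<Sum>A\<in>UNIV. cfm B A x \<odot> dy A (a x))"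
  unfolding cov_deriv_def cfm_def
  by (simp add: wmul_uminus_left wmul_sum_left wmul_scl_left sum_negf)

lemma ssec_cfm: "ssec U (cfm B A)"
  unfolding cfm_def[abs_def]
  by (intro ssec_uminus ssec_sum ssec_scl U smooth_christoffel ssec_const)

lemma cfm_past: "a \<odot> (cfm B A x \<odot> b) = cfm B A x \<odot> (a \<odot> b)"
  unfolding cfm_def
  by (simp add: wmul_uminus_left wmul_uminus_right wmul_sum_left wmul_sum_right wmul_scl_left wmul_scl_right ygen_past)

lemma ssec_cov: "ssec U a \<Longrightarrow> ssec U (cov_deriv G B a)"
  unfolding cov_cfm[abs_def] by (intro ssec_add ssec_pdw ssec_sum ssec_wmul ssec_dy ssec_cfm U)

lemma cov_cong:
  assumes x: "x \<in> U" and e: "\<And>y. y \<in> U \<Longrightarrow> a y = b y"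
  shows "cov_deriv G B a x = cov_deriv G B b x"
proof -
  have "pdw B a x = pdw B b x" by (rule pdw_cong[OF U x e])
  then show ?thesis by (simp add: cov_cfm e[OF x])
qed

lemma cov_add: "x \<in> U \<Longrightarrow> ssec U a \<Longrightarrow> ssec U b \<Longrightarrow>
    cov_deriv G B (\<lambda>x. a x + b x) x = cov_deriv G B a x + cov_deriv G B b x"
  by (simp add: cov_cfm pdw_add[OF U] dy_add wmul_add_right sum.distrib)

lemma cov_diff: "x \<in> U \<Longrightarrow> ssec U a \<Longrightarrow> ssec U b \<Longrightarrow>
    cov_deriv G B (\<lambda>x. a x - b x) x = cov_deriv G B a x - cov_deriv G B b x"
  by (simp add: cov_cfm pdw_diff[OF U] dy_diff wmul_diff_right sum_subtractf)

lemma cov_const0 [simp]: "cov_deriv G B (\<lambda>x. 0) x = 0"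
  by (simp add: cov_cfm)

lemma cov_scl: "x \<in> U \<Longrightarrow> smooth_on U f \<Longrightarrow> ssec U a \<Longrightarrow>
    cov_deriv G B (\<lambda>x. scl (f x) (a x)) x = scl (pd B f x) (a x) + scl (f x) (cov_deriv G B a x)"
  by (simp add: cov_cfm pdw_scl[OF U] dy_scl wmul_scl_right scl_add scl_sum add.assoc)

lemma cov_sum: "x \<in> U \<Longrightarrow> (\<And>i. i \<in> I \<Longrightarrow> ssec U (a i)) \<Longrightarrow>
    cov_deriv G B (\<lambda>x. \<Sum>i\<in>I. a i x) x = (\<Sum>i\<in>I. cov_deriv G B (a i) x)"
  unfolding cov_cfm by (simp add: pdw_sum[OF U] dy_sum wmul_sum_right sum.distrib sum.swap[of _ I])

lemma cov_wmul:
  assumes "x \<in> U" "ssec U a" "ssec U b"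
  shows "cov_deriv G B (\<lambda>x. a x \<odot> b x) x = cov_deriv G B a x \<odot> b x + a x \<odot> cov_deriv G B b x"
  unfolding cov_cfm
  by (simp add: pdw_wmul[OF U] assms dy_wmul wmul_add_right wmul_add_left wmul_sum_left wmul_sum_right
      cfm_past wmul_assoc sum.distrib algebra_simps)

lemma cov_const: "cov_deriv G B (\<lambda>_. c) x = (\<Sum>A\<in>UNIV. cfm B A x \<odot> dy A c)"
  by (simp add: cov_cfm)

lemma cov_ygen: "cov_deriv G B (\<lambda>_. ygen A) x = cfm B A x"
  by (simp add: cov_const dy_ygen if_distrib[of "\<lambda>z. _ \<odot> z"] sum.delta cong: if_cong)

lemma cov_dxgen: "x \<in> U \<Longrightarrow> ssec U a \<Longrightarrow> cov_deriv G B (\<lambda>x. dxgen A \<odot> a x) x = dxgen A \<odot> cov_deriv G B a x"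
  by (simp add: cov_wmul cov_const)

lemma dy_cfm: "dy E (cfm B A x) = scl (- \<Gamma> x A B E) wone"
  by (simp add: cfm_def dy_uminus dy_sum dy_scl dy_ygen if_distrib[of "\<lambda>z. scl _ z"] sum.delta' sum.delta scl_uminus cong: if_cong)

text \<open>\<open>dy E\<close> carries a lower index E, on which \<open>cov_deriv\<close> does not
  act; the sum on the right is the missing Christoffel term.\<close>

lemma cov_dy:
  assumes "x \<in> U" "ssec U a"
  shows "cov_deriv G B (\<lambda>x. dy E (a x)) x = dy E (cov_deriv G B a x) + (\<Sum>A\<in>UNIV. scl (\<Gamma> x A B E) (dy A (a x)))"
  unfolding cov_cfm
  by (simp add: pdw_dy[OF U] assms dy_add dy_sum dy_wmul dy_cfm wmul_scl_left wmul_uminus_left scl_uminus sum_subtractf sum.distrib sum_negf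
      dy_commute[of _ E])

lemma cov_hdiv: "cov_deriv G B (\<lambda>x. hdiv (a x)) x = hdiv (cov_deriv G B a x)"
proof -
  have e: "cfm B A x \<odot> hdiv c = hdiv (cfm B A x \<odot> c)" for A c
    by (auto simp: fun_eq_iff cfm_def wmul_uminus_left wmul_sum_left wmul_scl_left weyl_sum_apply ygen_wmul hdiv_def)
  have "pdw B (\<lambda>x. hdiv (a x)) x = hdiv (pdw B a x)" by (simp add: pdw_def hdiv_def)
  then show ?thesis by (simp add: cov_cfm hdiv_add hdiv_sum dy_hdiv e)
qed

section \<open>Curvature\<close>

text \<open>The commutator of two covariant derivatives applied to y^A, as \<open>cfm D A\<close> is
  the derivative of y^A in direction D. No Christoffel term acts on the direction indices B and
  D.\<close>

definition crv :: "'n ix \<Rightarrow> 'n ix \<Rightarrow> 'n ix \<Rightarrow> complex^'n \<Rightarrow> 'n weyl" where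
  "crv B D A x = cov_deriv G B (cfm D A) x - cov_deriv G D (cfm B A) x"

text \<open>A commutator of derivations is determined by its values on the generators y^A. In the
  expansion the second derivatives \<open>P\<close>, the mixed terms \<open>Q\<close> and the
  quadratic terms \<open>R\<close> are symmetric under exchange of B and D and cancel.\<close>

lemma cov_commutator:
  assumes x: "x \<in> U" and a: "ssec U a"
  shows "cov_deriv G B (cov_deriv G D a) x - cov_deriv G D (cov_deriv G B a) x =
    (\<Sum>A\<in>UNIV. crv B D A x \<odot> dy A (a x))"
proof -
  define P where "P B D = pdw B (pdw D a) x" for B D
  define Q where "Q B D = (\<Sum>A\<in>UNIV. cfm D A x \<odot> dy A (pdw B a x))" for B D
  define R where "R B D = (\<Sum>E\<in>UNIV. \<Sum>A\<in>UNIV. cfm B E x \<odot> (cfm D A x \<odot> dy E (dy A (a x))))" for B D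
  have *: "cov_deriv G B (cov_deriv G D a) x = P B D + (Q B D + Q D B) + R B D +
     (\<Sum>A\<in>UNIV. cov_deriv G B (cfm D A) x \<odot> dy A (a x))" for B D
  proof -
    have "pdw B (cov_deriv G D a) x = P B D + (\<Sum>A\<in>UNIV. pdw B (cfm D A) x \<odot> dy A (a x)) + Q B D"
      unfolding cov_cfm[abs_def] P_def Q_def
      by (simp add: pdw_add[OF U x] pdw_sum[OF U x] pdw_wmul[OF U x] pdw_dy[OF U x] ssec_pdw ssec_sum ssec_wmul ssec_dy
          ssec_cfm U a sum.distrib)
    moreover have "(\<Sum>E\<in>UNIV. cfm B E x \<odot> dy E (cov_deriv G D a x)) = Q D B +
      (\<Sum>A\<in>UNIV. (\<Sum>E\<in>UNIV. cfm B E x \<odot> dy E (cfm D A x)) \<odot> dy A (a x)) + R B D"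
    proof -
      have "(\<Sum>E\<in>UNIV. cfm B E x \<odot> dy E (cov_deriv G D a x)) = Q D B +
        (\<Sum>E\<in>UNIV. \<Sum>A\<in>UNIV. (cfm B E x \<odot> dy E (cfm D A x)) \<odot> dy A (a x)) + R B D"
        unfolding cov_cfm Q_def R_def
        by (simp add: dy_add dy_sum dy_wmul wmul_add_right wmul_sum_right sum.distrib wmul_assoc add.assoc)
      moreover have "(\<Sum>E\<in>UNIV. \<Sum>A\<in>UNIV. (cfm B E x \<odot> dy E (cfm D A x)) \<odot> dy A (a x)) =
        (\<Sum>A\<in>UNIV. (\<Sum>E\<in>UNIV. cfm B E x \<odot> dy E (cfm D A x)) \<odot> dy A (a x))"
        unfolding wmul_sum_left by (rule sum.swap)
      ultimately show ?thesis by simp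
    qed
    ultimately show ?thesis
      unfolding cov_cfm[of B "cov_deriv G D a"] unfolding cov_cfm[of B "cfm D _"]
      by (simp add: wmul_add_left sum.distrib)
  qed
  have P: "P B D = P D B" unfolding P_def by (rule pdw_commute[OF U x a])
  have R: "R B D = R D B"
    unfolding R_def
    by (subst sum.swap) (simp add: cfm_past[of "cfm B _ x"] dy_commute)
  show ?thesis
    unfolding *[of B D] *[of D B] crv_def P R by (simp add: wmul_diff_left sum_subtractf)
qed

end

context kaehler_chart
begin

section \<open>The connection and the Wick product\<close>

lemma cov_apply: "cov_deriv G B a x k M S = pd B (\<lambda>w. a w k M S) x -
   (\<Sum>A\<in>UNIV. \<Sum>C\<in>UNIV. \<Gamma> x A B C * (if M C = 0 then 0 else dy A (a x) k (M(C := M C - 1)) S))"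
  by (simp add: cov_deriv_def pdw_def weyl_sum_apply ygen_wmul)

text \<open>The connection neither mixes powers of \<hbar> nor acts on the form index S. Identities
  that hold at one fixed level can therefore be transported to operators such as \<open>sgm\<close>,
  \<open>hmul\<close> and truncations.\<close>

lemma cov_level:
  assumes x: "x \<in> U" and e: "\<And>y M. y \<in> U \<Longrightarrow> a y k M S = b y k' M S'"
  shows "cov_deriv G B a x k M S = cov_deriv G B b x k' M S'"
proof -
  have "pd B (\<lambda>w. a w k M S) x = pd B (\<lambda>w. b w k' M S') x"
    by (rule pd_cong[OF U x e])
  moreover have "dy A (a x) k N S = dy A (b x) k' N S'" for A N
    by (simp add: dy_def e[OF x])
  ultimately show ?thesis by (simp only: cov_apply)
qed

lemma cov_form_zero:
  assumes x: "x \<in> U" and e: "\<And>y M. y \<in> U \<Longrightarrow> a y k M S = 0"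
  shows "cov_deriv G B a x k M S = 0"
  using cov_level[OF x, of a k S "\<lambda>_. 0" k S] e by simp

lemma cov_hmul:
  assumes x: "x \<in> U"
  shows "cov_deriv G B (\<lambda>x. hmul (a x)) x = hmul (cov_deriv G B a x)"
proof (intro ext)
  fix k M S
  show "cov_deriv G B (\<lambda>x. hmul (a x)) x k M S = hmul (cov_deriv G B a x) k M S"
  proof (cases k)
    case 0
    then show ?thesis using cov_form_zero[OF x, of "\<lambda>x. hmul (a x)"] by simp
  next
    case (Suc n)
    then show ?thesis using cov_level[OF x, of "\<lambda>x. hmul (a x)" k S a n S] by simp
  qed
qed

lemma ssec_hmul: "ssec U a \<Longrightarrow> ssec U (\<lambda>x. hmul (a x))"
  unfolding ssec_def
proof (intro allI)
  fix k M S
  assume "\<forall>k M S. smooth_on U (\<lambda>x. a x k M S)"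
  then show "smooth_on U (\<lambda>x. hmul (a x) k M S)" by (cases k) simp_all
qed

lemma ssec_hmul_pow: "ssec U a \<Longrightarrow> ssec U (\<lambda>x. (hmul ^^ l) (a x))"
  by (induction l) (simp_all add: ssec_hmul)

lemma cov_hmul_pow:
  assumes x: "x \<in> U"
  shows "cov_deriv G B (\<lambda>x. (hmul ^^ l) (a x)) x = (hmul ^^ l) (cov_deriv G B a x)"
  by (induction l) (simp_all add: cov_hmul[OF x])

lemma cov_sgm:
  assumes x: "x \<in> U" and a: "ssec U a"
  shows "cov_deriv G B (\<lambda>x. sgm (a x)) x = sgm (cov_deriv G B a x)"
proof (intro ext)
  fix k M S
  have "cov_deriv G B (\<lambda>x. sgm (a x)) x k M S = cov_deriv G B (\<lambda>x. scl ((-1) ^ card S) (a x)) x k M S"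
    by (rule cov_level[OF x]) (simp add: sgm_def)
  also have "\<dots> = sgm (cov_deriv G B a x) k M S"
    by (simp add: cov_scl[OF x smooth_on_const a] sgm_def)
  finally show "cov_deriv G B (\<lambda>x. sgm (a x)) x k M S = sgm (cov_deriv G B a x) k M S" .
qed

lemma christoffel_mixed [simp]:
  assumes x: "x \<in> U"
  shows "\<Gamma> x (Inr m) B (Inl i) = 0" "\<Gamma> x (Inl m) B (Inr i) = 0"
  by (cases B; simp add: christoffel_simps[OF x])+

text \<open>Relabelling of indices: a connection matrix acting on coefficients is moved to its
  transpose acting on the basis elements.\<close>

lemma contract_swap:
  fixes u g :: "'n \<Rightarrow> 'n \<Rightarrow> complex" and X :: "'n \<Rightarrow> 'n \<Rightarrow> complex"
  shows "(\<Sum>i\<in>UNIV. \<Sum>j\<in>UNIV. (\<Sum>p\<in>UNIV. u p j * g i p) * X i j) = (\<Sum>i\<in>UNIV. \<Sum>j\<in>UNIV. u i j * (\<Sum>p\<in>UNIV. g p i * X p j))"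
    "(\<Sum>i\<in>UNIV. \<Sum>j\<in>UNIV. (\<Sum>q\<in>UNIV. u i q * g j q) * X i j) = (\<Sum>i\<in>UNIV. \<Sum>j\<in>UNIV. u i j * (\<Sum>q\<in>UNIV. g q j * X i q))"
proof -
  have "(\<Sum>i\<in>UNIV. \<Sum>j\<in>UNIV. \<Sum>p\<in>UNIV. u p j * g i p * X i j) = (\<Sum>j\<in>UNIV. \<Sum>i\<in>UNIV. \<Sum>p\<in>UNIV. u p j * g i p * X i j)"
    by (rule sum.swap)
  also have "\<dots> = (\<Sum>j\<in>UNIV. \<Sum>p\<in>UNIV. \<Sum>i\<in>UNIV. u p j * g i p * X i j)"
    by (intro sum.cong refl sum.swap)
  also have "\<dots> = (\<Sum>p\<in>UNIV. \<Sum>j\<in>UNIV. \<Sum>i\<in>UNIV. u p j * g i p * X i j)"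
    by (rule sum.swap)
  finally show "(\<Sum>i\<in>UNIV. \<Sum>j\<in>UNIV. (\<Sum>p\<in>UNIV. u p j * g i p) * X i j) = (\<Sum>i\<in>UNIV. \<Sum>j\<in>UNIV. u i j * (\<Sum>p\<in>UNIV. g p i * X p j))"
    by (simp add: sum_distrib_left sum_distrib_right mult.assoc)
  have "(\<Sum>i\<in>UNIV. \<Sum>j\<in>UNIV. \<Sum>q\<in>UNIV. u i q * g j q * X i j) = (\<Sum>i\<in>UNIV. \<Sum>q\<in>UNIV. \<Sum>j\<in>UNIV. u i q * g j q * X i j)"
    by (intro sum.cong refl sum.swap)
  then show "(\<Sum>i\<in>UNIV. \<Sum>j\<in>UNIV. (\<Sum>q\<in>UNIV. u i q * g j q) * X i j) = (\<Sum>i\<in>UNIV. \<Sum>j\<in>UNIV. u i j * (\<Sum>q\<in>UNIV. g q j * X i q))"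
    by (simp add: sum_distrib_left sum_distrib_right mult.assoc)
qed

text \<open>The inverse Kaehler form is parallel: differentiating it exactly offsets the Christoffel
  terms of \<open>cov_dy\<close> in both slots of a contraction.\<close>

lemma om_up_parallel:
  assumes x: "x \<in> U"
  shows "(\<Sum>i\<in>UNIV. \<Sum>j\<in>UNIV. scl (pd B (\<lambda>w. om_up G w i j) x) (X i j)
     + scl (om_up G x i j) ((\<Sum>p\<in>UNIV. scl (\<Gamma> x (Inl p) B (Inl i)) (X p j)) + (\<Sum>q\<in>UNIV. scl (\<Gamma> x (Inr q) B (Inr j)) (X i q)))) = 0"
proof (intro ext)
  fix k M S
  note c1 = contract_swap(1)[of "om_up G x" "\<lambda>i p. \<Gamma> x (Inl i) B (Inl p)" "\<lambda>i j. X i j k M S"]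
  note c2 = contract_swap(2)[of "om_up G x" "\<lambda>j q. \<Gamma> x (Inr j) B (Inr q)" "\<lambda>i j. X i j k M S"]
  show "(\<Sum>i\<in>UNIV. \<Sum>j\<in>UNIV. scl (pd B (\<lambda>w. om_up G w i j) x) (X i j)
     + scl (om_up G x i j) ((\<Sum>p\<in>UNIV. scl (\<Gamma> x (Inl p) B (Inl i)) (X p j)) + (\<Sum>q\<in>UNIV. scl (\<Gamma> x (Inr q) B (Inr j)) (X i q)))) k M S = 0 k M S"
    by (simp add: weyl_sum_apply pd_om_up[OF x] left_diff_distrib distrib_left sum.distrib sum_subtractf sum_negf c1 c2)
qed

text \<open>The Leibniz rule survives contraction because the two extra Christoffel sums and the
  derivative of \<open>om_up\<close> form the vanishing expression of
  \<open>om_up_parallel\<close>.\<close>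

lemma cov_wterm:
  assumes x: "x \<in> U"
  shows "ssec U a \<Longrightarrow> ssec U b \<Longrightarrow> cov_deriv G B (\<lambda>x. wterm (om_up G x) k (a x) (b x)) x =
    wterm (om_up G x) k (cov_deriv G B a x) (b x) + wterm (om_up G x) k (a x) (cov_deriv G B b x)"
proof (induction k arbitrary: a b)
  case 0
  then show ?case by (simp add: cov_wmul[OF x])
next
  case (Suc k)
  note a = Suc.prems(1) and b = Suc.prems(2)
  define X where "X i j = wterm (om_up G x) k (dy (Inl i) (a x)) (dy (Inr j) (b x))" for i j
  have sw: "ssec U (\<lambda>x. wterm (om_up G x) k (dy A (a x)) (dy B (b x)))" for A B
    by (intro ssec_wterm ssec_dy U a b smooth_om_up)
  have da: "cov_deriv G B (\<lambda>x. dy (Inl i) (a x)) x = dy (Inl i) (cov_deriv G B a x) + (\<Sum>p\<in>UNIV. scl (\<Gamma> x (Inl p) B (Inl i)) (dy (Inl p) (a x)))" for i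
    by (simp add: cov_dy[OF x a] sum_ix x)
  have db: "cov_deriv G B (\<lambda>x. dy (Inr i) (b x)) x = dy (Inr i) (cov_deriv G B b x) + (\<Sum>p\<in>UNIV. scl (\<Gamma> x (Inr p) B (Inr i)) (dy (Inr p) (b x)))" for i
    by (simp add: cov_dy[OF x b] sum_ix x)
  have "cov_deriv G B (\<lambda>x. wterm (om_up G x) (Suc k) (a x) (b x)) x =
    (\<Sum>i\<in>UNIV. \<Sum>j\<in>UNIV. scl (pd B (\<lambda>w. om_up G w i j) x) (X i j) + scl (om_up G x i j)
      (wterm (om_up G x) k (cov_deriv G B (\<lambda>x. dy (Inl i) (a x)) x) (dy (Inr j) (b x)) +
       wterm (om_up G x) k (dy (Inl i) (a x)) (cov_deriv G B (\<lambda>x. dy (Inr j) (b x)) x)))"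
    by (simp only: wterm.simps cov_sum[OF x] cov_scl[OF x] ssec_sum[OF U] ssec_scl[OF U] sw smooth_om_up X_def
        Suc.IH[OF ssec_dy[OF U a] ssec_dy[OF U b]])
  also have "\<dots> = (\<Sum>i\<in>UNIV. \<Sum>j\<in>UNIV. scl (pd B (\<lambda>w. om_up G w i j) x) (X i j)
     + scl (om_up G x i j) ((\<Sum>p\<in>UNIV. scl (\<Gamma> x (Inl p) B (Inl i)) (X p j)) + (\<Sum>q\<in>UNIV. scl (\<Gamma> x (Inr q) B (Inr j)) (X i q)))) +
     (wterm (om_up G x) (Suc k) (cov_deriv G B a x) (b x) + wterm (om_up G x) (Suc k) (a x) (cov_deriv G B b x))"
    unfolding da db X_def
    by (simp add: wterm_add_left wterm_add_right wterm_sum_left wterm_sum_right wterm_scl_left wterm_scl_right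
        scl_add sum.distrib algebra_simps)
  finally show ?case unfolding om_up_parallel[OF x] by simp
qed

lemma cov_wick:
  assumes x: "x \<in> U" and a: "ssec U a" and b: "ssec U b"
  shows "cov_deriv G B (\<lambda>x. wick (om_up G x) (a x) (b x)) x =
    wick (om_up G x) (cov_deriv G B a x) (b x) + wick (om_up G x) (a x) (cov_deriv G B b x)"
proof (intro ext)
  fix h M S
  let ?t = "\<lambda>l x. scl (1 / fact l) (wterm (om_up G x) l (a x) (b x))"
  have st: "ssec U (?t l)" for l
    by (intro ssec_scl ssec_wterm U a b smooth_om_up smooth_on_const)
  have t: "cov_deriv G B (?t l) x = scl (1 / fact l) (wterm (om_up G x) l (cov_deriv G B a x) (b x)) +
      scl (1 / fact l) (wterm (om_up G x) l (a x) (cov_deriv G B b x))" for l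
    by (subst cov_scl[OF x]) (simp_all add: ssec_wterm U a b smooth_om_up cov_wterm[OF x] scl_add)
  have pw: "(hmul ^^ l) (c + d) = (hmul ^^ l) c + (hmul ^^ l) d" for l and c d :: "'n weyl"
    by (induction l) (simp_all only: funpow.simps o_apply id_apply hmul_add)
  have "cov_deriv G B (\<lambda>x. wick (om_up G x) (a x) (b x)) x h M S =
      cov_deriv G B (\<lambda>x. \<Sum>l\<le>h. (hmul ^^ l) (?t l x)) x h M S"
    by (rule cov_level[OF x]) (simp add: wick_trunc)
  also have "cov_deriv G B (\<lambda>x. \<Sum>l\<le>h. (hmul ^^ l) (?t l x)) x = (\<Sum>l\<le>h. (hmul ^^ l) (cov_deriv G B (?t l) x))"
    by (simp add: cov_sum[OF x] ssec_hmul_pow st cov_hmul_pow[OF x])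
  finally show "cov_deriv G B (\<lambda>x. wick (om_up G x) (a x) (b x)) x h M S =
    (wick (om_up G x) (cov_deriv G B a x) (b x) + wick (om_up G x) (a x) (cov_deriv G B b x)) h M S"
    unfolding t pw sum.distrib by (simp add: wick_trunc[of h h])
qed

section \<open>Structure of the curvature\<close>

text \<open>The Kaehler form with its differentials replaced by y and y-bar. As a parallel quadratic
  section it turns the symmetries of the curvature tensor into a commutator identity.\<close>

definition varpi :: "complex^'n \<Rightarrow> 'n weyl" where
  "varpi x = (\<Sum>m\<in>UNIV. \<Sum>l\<in>UNIV. scl (om_low G x m l) (ygen (Inl m) \<odot> ygen (Inr l)))"

lemma ssec_varpi: "ssec U varpi"
  unfolding varpi_def[abs_def] by (intro ssec_sum ssec_scl U smooth_om_low ssec_const)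

lemma cfm_hol:
  assumes x: "x \<in> U"
  shows "cfm B (Inl m) x = - (\<Sum>p\<in>UNIV. scl (\<Gamma> x (Inl m) B (Inl p)) (ygen (Inl p)))"
    "cfm B (Inr m) x = - (\<Sum>p\<in>UNIV. scl (\<Gamma> x (Inr m) B (Inr p)) (ygen (Inr p)))"
  by (simp_all add: cfm_def sum_ix x)

lemma cfm_zero:
  assumes x: "x \<in> U"
  shows "cfm (Inr i) (Inl m) x = 0" "cfm (Inl i) (Inr m) x = 0"
  by (simp_all add: cfm_def christoffel_simps[OF x])

lemma cov_varpi:
  assumes x: "x \<in> U"
  shows "cov_deriv G B varpi x = 0"
proof (intro ext)
  fix k and M :: "'n ix \<Rightarrow> nat" and S :: "'n ix set"
  define Y where "Y m l = (ygen (Inl m) \<odot> ygen (Inr l)) k M S" for m l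
  have e: "cov_deriv G B varpi x = (\<Sum>m\<in>UNIV. \<Sum>l\<in>UNIV. scl (pd B (\<lambda>w. om_low G w m l) x) (ygen (Inl m) \<odot> ygen (Inr l)) +
     scl (om_low G x m l) (cfm B (Inl m) x \<odot> ygen (Inr l) + ygen (Inl m) \<odot> cfm B (Inr l) x))"
    unfolding varpi_def[abs_def]
    by (simp add: cov_sum[OF x] cov_scl[OF x] ssec_sum[OF U] ssec_scl[OF U] smooth_om_low cov_wmul[OF x] cov_ygen)
  have "cov_deriv G B varpi x k M S = (\<Sum>m\<in>UNIV. \<Sum>l\<in>UNIV. pd B (\<lambda>w. om_low G w m l) x * Y m l -
     om_low G x m l * (\<Sum>p\<in>UNIV. \<Gamma> x (Inl m) B (Inl p) * Y p l) - om_low G x m l * (\<Sum>q\<in>UNIV. \<Gamma> x (Inr l) B (Inr q) * Y m q))"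
    unfolding e cfm_hol[OF x] Y_def
    by (simp add: weyl_sum_apply wmul_uminus_left wmul_uminus_right wmul_sum_left wmul_sum_right wmul_scl_left wmul_scl_right algebra_simps)
  also have "\<dots> = (\<Sum>m\<in>UNIV. \<Sum>l\<in>UNIV. (\<Sum>p\<in>UNIV. om_low G x p l * \<Gamma> x (Inl p) B (Inl m)) * Y m l)
     + (\<Sum>m\<in>UNIV. \<Sum>l\<in>UNIV. (\<Sum>q\<in>UNIV. om_low G x m q * \<Gamma> x (Inr q) B (Inr l)) * Y m l)
     - (\<Sum>m\<in>UNIV. \<Sum>l\<in>UNIV. om_low G x m l * (\<Sum>p\<in>UNIV. \<Gamma> x (Inl m) B (Inl p) * Y p l))
     - (\<Sum>m\<in>UNIV. \<Sum>l\<in>UNIV. om_low G x m l * (\<Sum>q\<in>UNIV. \<Gamma> x (Inr l) B (Inr q) * Y m q))"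
    by (simp only: pd_om_low[OF x] distrib_right sum.distrib sum_subtractf)
  also have "\<dots> = 0"
    unfolding contract_swap(1)[of "om_low G x" "\<lambda>m p. \<Gamma> x (Inl p) B (Inl m)" Y]
        contract_swap(2)[of "om_low G x" "\<lambda>l q. \<Gamma> x (Inr q) B (Inr l)" Y]
    by (simp only: add_diff_cancel_left' diff_self)
  finally show "cov_deriv G B varpi x k M S = 0 k M S" by simp
qed

lemma dy_varpi:
  "dy (Inl m) (varpi x) = (\<Sum>l\<in>UNIV. scl (om_low G x m l) (ygen (Inr l)))"
  "dy (Inr l) (varpi x) = (\<Sum>m\<in>UNIV. scl (om_low G x m l) (ygen (Inl m)))"
proof -
  have y: "dy (Inl m) (ygen (Inl m') \<odot> ygen (Inr l')) = (if m' = m then ygen (Inr l') else 0)"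
    "dy (Inr l) (ygen (Inl m') \<odot> ygen (Inr l')) = (if l' = l then ygen (Inl m') else 0)" for m' l'
    by (simp_all add: dy_wmul dy_ygen)
  show "dy (Inl m) (varpi x) = (\<Sum>l\<in>UNIV. scl (om_low G x m l) (ygen (Inr l)))"
    unfolding varpi_def dy_sum dy_scl y
    by (subst sum.swap) (simp add: if_distrib[of "scl _"] sum.delta cong: if_cong)
  show "dy (Inr l) (varpi x) = (\<Sum>m\<in>UNIV. scl (om_low G x m l) (ygen (Inl m)))"
    unfolding varpi_def dy_sum dy_scl y
    by (simp add: if_distrib[of "scl _"] sum.delta cong: if_cong)
qed

text \<open>The curvature annihilates the parallel section \<open>varpi\<close>; expanding this over
  its two factors relates the curvature on y to the curvature on y-bar.\<close>

lemma crv_varpi: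
  assumes x: "x \<in> U"
  shows "(\<Sum>m\<in>UNIV. \<Sum>l\<in>UNIV. scl (om_low G x m l) (crv B D (Inl m) x \<odot> ygen (Inr l))) +
    (\<Sum>l\<in>UNIV. \<Sum>m\<in>UNIV. scl (om_low G x m l) (crv B D (Inr l) x \<odot> ygen (Inl m))) = 0"
proof -
  have "cov_deriv G B (cov_deriv G D varpi) x = 0" for B D
    using cov_cong[OF x, of "cov_deriv G D varpi" "\<lambda>_. 0" B] cov_varpi by simp
  then have "(\<Sum>A\<in>UNIV. crv B D A x \<odot> dy A (varpi x)) = 0"
    using cov_commutator[OF x ssec_varpi, of B D] by simp
  then show ?thesis
    by (simp add: sum_ix dy_varpi wmul_sum_right wmul_scl_right)
qed

lemma crv_zero:
  assumes x: "x \<in> U"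
  shows "crv (Inl i) (Inl j) (Inr l) x = 0" "crv (Inr i) (Inr j) (Inl l) x = 0"
  unfolding crv_def
  using cov_cong[OF x, of "cfm (Inl _) (Inr l)" "\<lambda>_. 0"] cov_cong[OF x, of "cfm (Inr _) (Inl l)" "\<lambda>_. 0"] cfm_zero
  by simp_all

lemma dy_crv:
  assumes x: "x \<in> U"
  shows "dy (Inr q) (crv B D (Inl m) x) = 0" "dy (Inl q) (crv B D (Inr m) x) = 0"
proof -
  have "dy (Inr q) (cov_deriv G B (cfm D (Inl m)) x) = 0" for B D
  proof -
    have "cov_deriv G B (\<lambda>x. dy (Inr q) (cfm D (Inl m) x)) x = 0"
      using cov_cong[OF x, of "\<lambda>x. dy (Inr q) (cfm D (Inl m) x)" "\<lambda>_. 0"] by (simp add: dy_cfm)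
    then show ?thesis using cov_dy[OF x ssec_cfm, of B "Inr q" D "Inl m"]
      by (simp add: sum_ix dy_cfm x)
  qed
  then show "dy (Inr q) (crv B D (Inl m) x) = 0" by (simp add: crv_def dy_diff)
  have "dy (Inl q) (cov_deriv G B (cfm D (Inr m)) x) = 0" for B D
  proof -
    have "cov_deriv G B (\<lambda>x. dy (Inl q) (cfm D (Inr m) x)) x = 0"
      using cov_cong[OF x, of "\<lambda>x. dy (Inl q) (cfm D (Inr m) x)" "\<lambda>_. 0"] by (simp add: dy_cfm)
    then show ?thesis using cov_dy[OF x ssec_cfm, of B "Inl q" D "Inr m"]
      by (simp add: sum_ix dy_cfm x)
  qed
  then show "dy (Inl q) (crv B D (Inr m) x) = 0" by (simp add: crv_def dy_diff)
qed

lemma crv_form: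
  assumes x: "x \<in> U" and S: "S \<noteq> {}"
  shows "crv B D A x k M S = 0"
proof -
  have "cfm B A y k M S = 0" for B A y M
    using S by (simp add: cfm_def weyl_sum_apply ygen_def)
  then show ?thesis by (simp add: crv_def cov_form_zero[OF x])
qed

lemma crv_comm:
  assumes x: "x \<in> U"
  shows "crv B D A x \<odot> a = a \<odot> crv B D A x"
proof (rule wmul_comm_even)
  fix k M S assume "crv B D A x k M S \<noteq> 0"
  then have "S = {}" using crv_form[OF x] by blast
  then show "even (card S)" by simp
qed

lemma om_cancel:
  fixes F :: "'n \<Rightarrow> 'n weyl"
  assumes x: "x \<in> U"
  shows "(\<Sum>q\<in>UNIV. scl (om_up G x p q) (\<Sum>m\<in>UNIV. scl (om_low G x m q) (F m))) = - F p"
    "(\<Sum>q\<in>UNIV. scl (om_up G x q p) (\<Sum>m\<in>UNIV. scl (om_low G x q m) (F m))) = - F p"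
proof -
  have "(\<Sum>q\<in>UNIV. scl (om_up G x p q) (\<Sum>m\<in>UNIV. scl (om_low G x m q) (F m))) =
     (\<Sum>m\<in>UNIV. scl (\<Sum>q\<in>UNIV. om_up G x p q * om_low G x m q) (F m))"
    unfolding scl_sum scl_scl by (rule sum.swap)
  then show "(\<Sum>q\<in>UNIV. scl (om_up G x p q) (\<Sum>m\<in>UNIV. scl (om_low G x m q) (F m))) = - F p"
    by (simp add: om_up_low[OF x] if_distrib[of "\<lambda>z. scl z _"] scl_uminus sum.delta cong: if_cong)
  have "(\<Sum>q\<in>UNIV. scl (om_up G x q p) (\<Sum>m\<in>UNIV. scl (om_low G x q m) (F m))) =
     (\<Sum>m\<in>UNIV. scl (\<Sum>q\<in>UNIV. om_up G x q p * om_low G x q m) (F m))"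
    unfolding scl_sum scl_scl by (rule sum.swap)
  then show "(\<Sum>q\<in>UNIV. scl (om_up G x q p) (\<Sum>m\<in>UNIV. scl (om_low G x q m) (F m))) = - F p"
    by (simp add: om_up_low[OF x] if_distrib[of "\<lambda>z. scl z _"] scl_uminus sum.delta cong: if_cong)
qed

text \<open>The curvature contracted with the Kaehler form; its second expression is the symmetry of the
  curvature tensor that comes from \<open>varpi\<close> being parallel.\<close>

definition rho :: "'n ix \<Rightarrow> 'n ix \<Rightarrow> complex^'n \<Rightarrow> 'n weyl" where
  "rho B D x = (\<Sum>m\<in>UNIV. \<Sum>l\<in>UNIV. scl (om_low G x m l) (crv B D (Inl m) x \<odot> ygen (Inr l)))"

lemma rho_alt:
  assumes x: "x \<in> U"
  shows "rho B D x = - (\<Sum>l\<in>UNIV. \<Sum>m\<in>UNIV. scl (om_low G x m l) (crv B D (Inr l) x \<odot> ygen (Inl m)))"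
  unfolding rho_def using crv_varpi[OF x] by (simp add: eq_neg_iff_add_eq_0)

lemma dy_rho:
  assumes x: "x \<in> U"
  shows "dy (Inr q) (rho B D x) = (\<Sum>m\<in>UNIV. scl (om_low G x m q) (crv B D (Inl m) x))"
    "dy (Inl p) (rho B D x) = - (\<Sum>l\<in>UNIV. scl (om_low G x p l) (crv B D (Inr l) x))"
proof -
  show "dy (Inr q) (rho B D x) = (\<Sum>m\<in>UNIV. scl (om_low G x m q) (crv B D (Inl m) x))"
    unfolding rho_def
    by (simp add: dy_sum dy_scl dy_wmul dy_crv[OF x] dy_ygen if_distrib[of "\<lambda>z. _ \<odot> z"] if_distrib[of "scl _"] sum.delta sum.delta' cong: if_cong)
  show "dy (Inl p) (rho B D x) = - (\<Sum>l\<in>UNIV. scl (om_low G x p l) (crv B D (Inr l) x))"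
    unfolding rho_alt[OF x]
    by (simp add: dy_uminus dy_sum dy_scl dy_wmul dy_crv[OF x] dy_ygen if_distrib[of "\<lambda>z. _ \<odot> z"] if_distrib[of "scl _"] sum.delta sum.delta' cong: if_cong)
qed

text \<open>The curvature is of type (1,1). In two holomorphic directions it kills y-bar already in
  the coordinate frame; by the symmetry of \<open>rho\<close> and nondegeneracy of the Kaehler form
  it then kills y as well. Conjugate directions are dual.\<close>

lemma crv_pure:
  assumes x: "x \<in> U"
  shows "crv (Inl i) (Inl j) A x = 0" "crv (Inr i) (Inr j) A x = 0"
proof -
  have "crv (Inl i) (Inl j) (Inl m) x = 0" for m
  proof -
    have "rho (Inl i) (Inl j) x = 0" by (simp add: rho_alt[OF x] crv_zero[OF x])
    then have "(\<Sum>m\<in>UNIV. scl (om_low G x m q) (crv (Inl i) (Inl j) (Inl m) x)) = 0" for q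
      by (simp flip: dy_rho(1)[OF x])
    then show ?thesis using om_cancel(1)[OF x, of m "\<lambda>m. crv (Inl i) (Inl j) (Inl m) x"] by simp
  qed
  then show "crv (Inl i) (Inl j) A x = 0" by (cases A) (simp_all add: crv_zero[OF x])
  have "crv (Inr i) (Inr j) (Inr m) x = 0" for m
  proof -
    have "rho (Inr i) (Inr j) x = 0" by (simp add: rho_def crv_zero[OF x])
    then have "(\<Sum>m\<in>UNIV. scl (om_low G x q m) (crv (Inr i) (Inr j) (Inr m) x)) = 0" for q
      using dy_rho(2)[OF x, of q "Inr i" "Inr j"] by simp
    then show ?thesis using om_cancel(2)[OF x, of m "\<lambda>m. crv (Inr i) (Inr j) (Inr m) x"] by simp
  qed
  then show "crv (Inr i) (Inr j) A x = 0" by (cases A) (simp_all add: crv_zero[OF x])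
qed

lemma cov_hol_commute:
  assumes x: "x \<in> U" and a: "ssec U a"
  shows "cov_deriv G (Inl i) (cov_deriv G (Inl j) a) x = cov_deriv G (Inl j) (cov_deriv G (Inl i) a) x"
    "cov_deriv G (Inr i) (cov_deriv G (Inr j) a) x = cov_deriv G (Inr j) (cov_deriv G (Inr i) a) x"
  using cov_commutator[OF x a, of "Inl i" "Inl j"] cov_commutator[OF x a, of "Inr i" "Inr j"] crv_pure[OF x]
  by simp_all

text \<open>In anti-holomorphic directions y is constant, so only the derivative of the Christoffel
  coefficient remains and no quadratic term appears.\<close>

lemma crv_mixed:
  assumes x: "x \<in> U"
  shows "crv (Inl i) (Inr j) (Inl m) x = (\<Sum>k\<in>UNIV. scl (pd (Inr j) (\<lambda>w. \<Gamma> w (Inl m) (Inl i) (Inl k)) x) (ygen (Inl k)))"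
proof -
  have "cov_deriv G (Inl i) (cfm (Inr j) (Inl m)) x = 0"
    using cov_cong[OF x, of "cfm (Inr j) (Inl m)" "\<lambda>_. 0"] cfm_zero by simp
  moreover have "cov_deriv G (Inr j) (cfm (Inl i) (Inl m)) x =
      cov_deriv G (Inr j) (\<lambda>x. \<Sum>k\<in>UNIV. scl (- \<Gamma> x (Inl m) (Inl i) (Inl k)) (ygen (Inl k))) x"
    by (rule cov_cong[OF x]) (simp add: cfm_hol sum_negf scl_uminus)
  moreover have "\<dots> = (\<Sum>k\<in>UNIV. scl (pd (Inr j) (\<lambda>w. - \<Gamma> w (Inl m) (Inl i) (Inl k)) x) (ygen (Inl k)))"
    by (simp add: cov_sum[OF x] cov_scl[OF x] ssec_scl[OF U] smooth_on_minus[OF U smooth_christoffel] cov_ygen cfm_zero[OF x])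
  moreover have "pd B (\<lambda>w. - \<Gamma> w (Inl m) (Inl i) (Inl k)) x = - pd B (\<lambda>w. \<Gamma> w (Inl m) (Inl i) (Inl k)) x" for B k
    using pd_cmul[OF smooth_on_differentiable[OF smooth_christoffel x], of B "-1"] by simp
  ultimately show ?thesis by (simp add: crv_def scl_uminus sum_negf)
qed

end

section \<open>Homogeneous elements\<close>

text \<open>One weight covers every grading in use: \<open>u\<close> weighs the polynomial part and
  \<open>v\<close> the form part, so degrees in y or y-bar, total degrees and form types differ only
  in the choice of \<open>u\<close> and \<open>v\<close>.\<close>

definition wt :: "('n ix \<Rightarrow> nat) \<Rightarrow> ('n ix \<Rightarrow> nat) \<Rightarrow> ('n::finite ix \<Rightarrow> nat) \<Rightarrow> 'n ix set \<Rightarrow> nat" where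
  "wt u v M S = (\<Sum>A\<in>UNIV. u A * M A) + (\<Sum>A\<in>S. v A)"

definition homog :: "('n ix \<Rightarrow> nat) \<Rightarrow> ('n ix \<Rightarrow> nat) \<Rightarrow> nat \<Rightarrow> 'n::finite weyl \<Rightarrow> bool" where
  "homog u v n a \<longleftrightarrow> (\<forall>k M S. a k M S \<noteq> 0 \<longrightarrow> wt u v M S = n)"

lemma homogD: "homog u v n a \<Longrightarrow> a k M S \<noteq> 0 \<Longrightarrow> wt u v M S = n"
  by (auto simp: homog_def)

lemma homog_zero [simp]: "homog u v n 0"
  by (simp add: homog_def)

lemma homog_add:
  assumes "homog u v n a" "homog u v n b"
  shows "homog u v n (a + b)"
  unfolding homog_def
proof (intro allI impI)
  fix k M S assume "(a + b) k M S \<noteq> 0"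
  then have "a k M S \<noteq> 0 \<or> b k M S \<noteq> 0" by auto
  then show "wt u v M S = n" using assms homogD by blast
qed

lemma homog_uminus: "homog u v n a \<Longrightarrow> homog u v n (- a)"
  by (simp add: homog_def)

lemma homog_diff: "homog u v n a \<Longrightarrow> homog u v n b \<Longrightarrow> homog u v n (a - b)"
  using homog_add[OF _ homog_uminus, of u v n a b] by simp

lemma homog_scl: "homog u v n a \<Longrightarrow> homog u v n (scl z a)"
  by (auto simp: homog_def)

lemma homog_hdiv: "homog u v n a \<Longrightarrow> homog u v n (hdiv a)"
  by (simp add: homog_def hdiv_def)

lemma homog_sum: "(\<And>i. i \<in> I \<Longrightarrow> homog u v n (f i)) \<Longrightarrow> homog u v n (\<Sum>i\<in>I. f i)"
  unfolding homog_def weyl_sum_apply by (meson sum.neutral)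

lemma wt_diff:
  assumes "N \<le> M" "T \<subseteq> S"
  shows "wt u v M S = wt u v N T + wt u v (M - N) (S - T)"
proof -
  have "u A * M A = u A * N A + u A * (M - N) A" for A
    using assms(1)[THEN le_funD, of A] by (simp flip: distrib_left)
  then have "(\<Sum>A\<in>UNIV. u A * M A) = (\<Sum>A\<in>UNIV. u A * N A) + (\<Sum>A\<in>UNIV. u A * (M - N) A)"
    by (simp flip: sum.distrib)
  moreover have "(\<Sum>A\<in>S. v A) = (\<Sum>A\<in>S - T. v A) + (\<Sum>A\<in>T. v A)"
    using assms(2) by (intro sum.subset_diff) auto
  ultimately show ?thesis by (simp add: wt_def)
qed

lemma homog_wmul:
  assumes a: "homog u v n a" and b: "homog u v m b"
  shows "homog u v (n + m) (a \<odot> b)"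
  unfolding homog_def
proof (intro allI impI)
  fix k M S assume "(a \<odot> b) k M S \<noteq> 0"
  then obtain z where "z \<in> wdom k M S" and
    "(case z of (j, N, T) \<Rightarrow> wsign T (S - T) * a j N T * b (k - j) (M - N) (S - T)) \<noteq> 0"
    unfolding wmul_wdom by (meson sum.not_neutral_contains_not_neutral)
  then obtain j N T where "N \<le> M" "T \<subseteq> S" "a j N T \<noteq> 0" "b (k - j) (M - N) (S - T) \<noteq> 0"
    by (auto simp: wdom_def)
  then show "wt u v M S = n + m"
    using wt_diff[of N M T S u v] homogD[OF a, of j N T] homogD[OF b, of "k - j" "M - N" "S - T"] by simp
qed

lemma homog_dxgen: "homog u v n a \<Longrightarrow> m = n + v A \<Longrightarrow> homog u v m (dxgen A \<odot> a)"
proof -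
  assume a: "homog u v n a" and m: "m = n + v A"
  have "homog u v (v A) (dxgen A)" by (auto simp: homog_def dxgen_def wt_def split: if_splits)
  from homog_wmul[OF this a] show ?thesis by (simp add: m add.commute)
qed

lemma homog_ygen: "homog u v n a \<Longrightarrow> m = n + u A \<Longrightarrow> homog u v m (ygen A \<odot> a)"
proof -
  assume a: "homog u v n a" and m: "m = n + u A"
  have "homog u v (u A) (ygen A)"
    by (auto simp: homog_def ygen_def wt_def single_def if_distrib[of "\<lambda>z. _ * z"] sum.delta split: if_splits cong: if_cong)
  from homog_wmul[OF this a] show ?thesis by (simp add: m add.commute)
qed

lemma wt_upd: "wt u v (M(A := M A + 1)) S = wt u v M S + u A"
proof -
  have "u B * (M(A := M A + 1)) B = u B * M B + (if B = A then u B else 0)" for B by simp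
  then have "(\<Sum>B\<in>UNIV. u B * (M(A := M A + 1)) B) = (\<Sum>B\<in>UNIV. u B * M B) + u A"
    by (simp only: sum.distrib) (simp add: sum.delta)
  then show ?thesis by (simp add: wt_def)
qed

lemma wt_dec: "M A \<noteq> 0 \<Longrightarrow> wt u v M S = wt u v (M(A := M A - 1)) S + u A"
  using wt_upd[of u v "M(A := M A - 1)" A S] by simp

lemma homog_dyD: "homog u v n a \<Longrightarrow> dy A a k M S \<noteq> 0 \<Longrightarrow> wt u v M S + u A = n"
  using homogD[of u v n a k "M(A := M A + 1)" S] by (simp add: dy_def wt_upd del: One_nat_def add_Suc_right)

lemma homog_dy: "homog u v n a \<Longrightarrow> n = m + u A \<Longrightarrow> homog u v m (dy A a)"
  using homog_dyD[of u v n a A] unfolding homog_def by (metis add_right_cancel)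

lemma homog_dy_zero: "homog u v n a \<Longrightarrow> n < u A \<Longrightarrow> dy A a = 0"
proof (intro ext)
  fix k M S assume "homog u v n a" "n < u A"
  then show "dy A a k M S = 0 k M S" using homog_dyD[of u v n a A k M S] by (cases "dy A a k M S = 0") auto
qed

lemma homog_contr: "homog u v n a \<Longrightarrow> n = m + v A \<Longrightarrow> homog u v m (contr A a)"
  unfolding homog_def
proof (intro allI impI)
  fix k M S assume a: "\<forall>k M S. a k M S \<noteq> 0 \<longrightarrow> wt u v M S = n" and n: "n = m + v A" and "contr A a k M S \<noteq> 0"
  then have "A \<notin> S" "a k M (insert A S) \<noteq> 0" by (auto simp: contr_def split: if_splits)
  with a n show "wt u v M S = m" by (force simp: wt_def)
qed

text \<open>Contractions lower the polynomial degrees but leave forms alone, hence additivity is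
  claimed for \<open>u\<close> = 0 only.\<close>

lemma homog_wterm:
  assumes "homog (\<lambda>_. 0) v n a" "homog (\<lambda>_. 0) v m b"
  shows "homog (\<lambda>_. 0) v (n + m) (wterm w k a b)"
  using assms
proof (induction k arbitrary: a b)
  case (Suc k)
  have "homog (\<lambda>_. 0) v (n + m) (wterm w k (dy A a) (dy B b))" for A B
    by (intro Suc.IH homog_dy[where n = n] homog_dy[where n = m] Suc.prems) simp_all
  then show ?case by (simp only: wterm.simps) (intro homog_sum homog_scl)
qed (simp add: homog_wmul)

lemma homog_wick:
  assumes "homog (\<lambda>_. 0) v n a" "homog (\<lambda>_. 0) v m b"
  shows "homog (\<lambda>_. 0) v (n + m) (wick w a b)"
  unfolding homog_def
proof (intro allI impI)
  fix h M S assume "wick w a b h M S \<noteq> 0"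
  then obtain k where "wterm w k a b (h - k) M S / fact k \<noteq> 0"
    unfolding wick_wterm by (meson sum.not_neutral_contains_not_neutral)
  then show "wt (\<lambda>_. 0) v M S = n + m" using homogD[OF homog_wterm[OF assms]] by fastforce
qed

definition hol :: "'n ix \<Rightarrow> nat" where "hol A = (case A of Inl i \<Rightarrow> 1 | Inr i \<Rightarrow> 0)"
definition anti :: "'n ix \<Rightarrow> nat" where "anti A = (case A of Inl i \<Rightarrow> 0 | Inr i \<Rightarrow> 1)"

lemma hol_anti_simps [simp]: "hol (Inl i) = 1" "hol (Inr i) = 0" "anti (Inl i) = 0" "anti (Inr i) = 1"
  by (simp_all add: hol_def anti_def)

lemma wt_hol: "wt hol (\<lambda>_. 0) M S = (\<Sum>i\<in>UNIV. M (Inl i))"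
  by (simp add: wt_def sum_ix)

lemma wt_form_hol: "wt (\<lambda>_. 0) hol M S = card (S \<inter> range Inl)"
proof -
  have "(\<Sum>A\<in>S. hol A) = (\<Sum>A\<in>S. if A \<in> range Inl then 1 else 0)"
    by (intro sum.cong) (auto simp: hol_def split: sum.splits)
  then show ?thesis by (simp add: wt_def sum.If_cases Int_def)
qed

lemma wt_form_anti: "wt (\<lambda>_. 0) anti M S = card (S \<inter> range Inr)"
proof -
  have "(\<Sum>A\<in>S. anti A) = (\<Sum>A\<in>S. if A \<in> range Inr then 1 else 0)"
    by (intro sum.cong) (auto simp: anti_def split: sum.splits)
  then show ?thesis by (simp add: wt_def sum.If_cases Int_def)
qed

lemma wt_form: "wt (\<lambda>_. 0) (\<lambda>_. 1) M S = card S" "wt (\<lambda>_. 0) (\<lambda>_. Suc 0) M S = card S"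
  by (simp_all add: wt_def)

lemma wt_form_split:
  fixes S :: "'n::finite ix set"
  shows "wt (\<lambda>_. 0) (\<lambda>_. 1) M S = wt (\<lambda>_. 0) hol M S + wt (\<lambda>_. 0) anti M S"
proof -
  have "hol A + anti A = 1" for A :: "'n ix" by (cases A) auto
  then have "(\<Sum>A\<in>S. hol A + anti A) = card S" by simp
  then show ?thesis by (simp add: wt_def sum.distrib)
qed

lemma homog_form: "homog (\<lambda>_. 0) hol p a \<Longrightarrow> homog (\<lambda>_. 0) anti q a \<Longrightarrow> homog (\<lambda>_. 0) (\<lambda>_. 1) (p + q) a"
  unfolding homog_def wt_form_split by auto

lemma sgm_homog: "homog (\<lambda>_. 0) (\<lambda>_. 1) p a \<Longrightarrow> sgm a = scl ((-1) ^ p) a"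
proof (intro ext)
  fix k M S assume "homog (\<lambda>_. 0) (\<lambda>_. 1) p a"
  then show "sgm a k M S = scl ((-1) ^ p) a k M S"
    using homogD[of "\<lambda>_. 0" "\<lambda>_. 1" p a k M S] by (cases "a k M S = 0") (auto simp: sgm_def wt_form)
qed

context kaehler_chart
begin

lemma christoffel_type:
  assumes x: "x \<in> U" and n: "\<Gamma> x A B C \<noteq> 0"
  shows "(\<exists>i j. A = Inl i \<and> C = Inl j) \<or> (\<exists>i j. A = Inr i \<and> C = Inr j)"
  using n christoffel_mixed[OF x] by (cases A; cases C) auto

text \<open>Christoffel symbols of mixed type vanish, so the connection preserves the degrees in y
  and in y-bar separately. The assumptions on \<open>u\<close> say that a weight depends on the type
  of an index only. This is what lets infinite sums be differentiated degree by degree.\<close>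

lemma cov_deg_local:
  assumes x: "x \<in> U" and u: "\<And>i j. u (Inl i) = u (Inl j)" "\<And>i j. u (Inr i) = u (Inr j)"
    and e: "\<And>y N. y \<in> U \<Longrightarrow> wt u v N S = wt u v M S \<Longrightarrow> a y k N S = b y k N S"
  shows "cov_deriv G B a x k M S = cov_deriv G B b x k M S"
proof -
  have "pd B (\<lambda>w. a w k M S) x = pd B (\<lambda>w. b w k M S) x"
    by (rule pd_cong[OF U x e]) auto
  moreover have "\<Gamma> x A B C * (if M C = 0 then 0 else dy A (a x) k (M(C := M C - 1)) S) =
    \<Gamma> x A B C * (if M C = 0 then 0 else dy A (b x) k (M(C := M C - 1)) S)" for A C
  proof (cases "\<Gamma> x A B C = 0 \<or> M C = 0")
    case False
    then have "u A = u C" using christoffel_type[OF x, of A B C] u by auto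
    moreover let ?M = "M(C := M C - 1)"
    have "wt u v (?M(A := ?M A + 1)) S = wt u v ?M S + u A" by (rule wt_upd)
    ultimately have "wt u v (?M(A := ?M A + 1)) S = wt u v M S"
      using wt_dec[of M C u v S] False by simp
    then have "dy A (a x) k ?M S = dy A (b x) k ?M S" unfolding dy_def by (simp only: e[OF x])
    then show ?thesis by simp
  qed auto
  ultimately show ?thesis by (simp only: cov_apply)
qed

lemma homog_cov:
  assumes x: "x \<in> U" and u: "\<And>i j. u (Inl i) = u (Inl j)" "\<And>i j. u (Inr i) = u (Inr j)"
    and a: "\<And>y. y \<in> U \<Longrightarrow> homog u v n (a y)"
  shows "homog u v n (cov_deriv G B a x)"
  unfolding homog_def
proof (intro allI impI, rule ccontr)
  fix k M S assume 1: "cov_deriv G B a x k M S \<noteq> 0" and 2: "wt u v M S \<noteq> n"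
  have "cov_deriv G B a x k M S = cov_deriv G B (\<lambda>_. 0) x k M S"
  proof (rule cov_deg_local[OF x u])
    fix y N assume "y \<in> U" "wt u v N S = wt u v M S"
    then show "a y k N S = 0 k N S" using homogD[OF a, of y k N S] 2 by auto
  qed
  with 1 show False by simp
qed

section \<open>The covariant exterior derivative\<close>

lemma nabla_cov: "nabla G a x = (\<Sum>B\<in>UNIV. dxgen B \<odot> cov_deriv G B a x)"
  by (simp add: nabla_def nabla10_def nabla01_def sum_ix)

lemma delta_dy: "delta a = (\<Sum>A\<in>UNIV. dxgen A \<odot> dy A a)"
  by (simp add: delta_def delta10_def delta01_def sum_ix)

text \<open>Splits \<nabla> - \<delta> into one even derivation per direction; the graded Leibniz
  rule for \<open>dd\<close> follows by putting the one-forms back.\<close>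

definition dcov :: "'n ix \<Rightarrow> (complex^'n \<Rightarrow> 'n weyl) \<Rightarrow> complex^'n \<Rightarrow> 'n weyl" where
  "dcov B a x = cov_deriv G B a x - dy B (a x)"

definition dd :: "(complex^'n \<Rightarrow> 'n weyl) \<Rightarrow> complex^'n \<Rightarrow> 'n weyl" where
  "dd a x = nabla G a x - delta (a x)"

lemma dd_dcov: "dd a x = (\<Sum>B\<in>UNIV. dxgen B \<odot> dcov B a x)"
  by (simp add: dd_def nabla_cov delta_dy dcov_def wmul_diff_right sum_subtractf)

lemma ssec_nabla10: "ssec U a \<Longrightarrow> ssec U (nabla10 G a)"
  unfolding nabla10_def[abs_def] by (intro ssec_sum ssec_wmul ssec_const ssec_cov U)

lemma ssec_nabla: "ssec U a \<Longrightarrow> ssec U (nabla G a)"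
  unfolding nabla_cov[abs_def] by (intro ssec_sum ssec_wmul ssec_const ssec_cov U)

lemma ssec_delta: "ssec U a \<Longrightarrow> ssec U (\<lambda>x. delta (a x))"
  unfolding delta_dy by (intro ssec_sum ssec_wmul ssec_const ssec_dy U)

lemma ssec_dd: "ssec U a \<Longrightarrow> ssec U (dd a)"
  unfolding dd_def[abs_def] by (intro ssec_diff ssec_nabla ssec_delta U)

lemma dd_cong: "x \<in> U \<Longrightarrow> (\<And>y. y \<in> U \<Longrightarrow> a y = b y) \<Longrightarrow> dd a x = dd b x"
  using cov_cong[of x a b] by (simp add: dd_dcov dcov_def)

lemma dd_add: "x \<in> U \<Longrightarrow> ssec U a \<Longrightarrow> ssec U b \<Longrightarrow> dd (\<lambda>x. a x + b x) x = dd a x + dd b x"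
  by (simp add: dd_dcov dcov_def cov_add dy_add wmul_add_right wmul_diff_right sum.distrib sum_subtractf)

lemma dd_diff: "x \<in> U \<Longrightarrow> ssec U a \<Longrightarrow> ssec U b \<Longrightarrow> dd (\<lambda>x. a x - b x) x = dd a x - dd b x"
  by (simp add: dd_dcov dcov_def cov_diff dy_diff wmul_diff_right sum.distrib sum_subtractf)

lemma dd_hdiv: "dd (\<lambda>x. hdiv (a x)) x = hdiv (dd a x)"
  by (simp add: dd_dcov dcov_def cov_hdiv dy_hdiv dxgen_hdiv hdiv_sum flip: hdiv_diff)

lemma dd_sgm: "x \<in> U \<Longrightarrow> ssec U a \<Longrightarrow> dd (\<lambda>x. sgm (a x)) x = - sgm (dd a x)"
  by (simp add: dd_dcov dcov_def cov_sgm dy_sgm sgm_sum sgm_dxgen_wmul sgm_diff sum_negf)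

lemma dd_wick:
  assumes x: "x \<in> U" and a: "ssec U a" and b: "ssec U b"
  shows "dd (\<lambda>x. wick (om_up G x) (a x) (b x)) x =
    wick (om_up G x) (dd a x) (b x) + wick (om_up G x) (sgm (a x)) (dd b x)"
proof -
  have "dcov B (\<lambda>x. wick (om_up G x) (a x) (b x)) x =
     wick (om_up G x) (dcov B a x) (b x) + wick (om_up G x) (a x) (dcov B b x)" for B
    by (simp add: dcov_def cov_wick[OF x a b] dy_wick wick_diff_left wick_diff_right)
  then show ?thesis
    by (simp add: dd_dcov wmul_add_right sum.distrib wick_sum_left wick_sum_right wick_dxgen_left wick_dxgen_right)
qed

text \<open>The square of the connection as a derivation of the fibre; only mixed directions occur,
  the curvature being of type (1,1).\<close>

definition curv_act :: "complex^'n \<Rightarrow> 'n weyl \<Rightarrow> 'n weyl" where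
  "curv_act x a = (\<Sum>i\<in>UNIV. \<Sum>j\<in>UNIV. dxgen (Inl i) \<odot> (dxgen (Inr j) \<odot>
     (\<Sum>A\<in>UNIV. crv (Inl i) (Inr j) A x \<odot> dy A a)))"

text \<open>Second derivatives in directions of equal type commute and are killed by anticommuting
  one-forms; the two mixed blocks combine into the commutator.\<close>

lemma nabla_square:
  assumes x: "x \<in> U" and a: "ssec U a"
  shows "nabla G (nabla G a) x = curv_act x (a x)"
proof -
  let ?Z = "\<lambda>B D. cov_deriv G B (cov_deriv G D a) x"
  have "nabla G (nabla G a) x = (\<Sum>B\<in>UNIV. \<Sum>D\<in>UNIV. dxgen B \<odot> (dxgen D \<odot> ?Z B D))"
    unfolding nabla_cov[abs_def]
    by (simp add: cov_sum[OF x] ssec_wmul[OF U] ssec_cov a cov_dxgen[OF x] wmul_sum_right)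
  also have "\<dots> = (\<Sum>i\<in>UNIV. \<Sum>j\<in>UNIV. dxgen (Inl i) \<odot> (dxgen (Inl j) \<odot> ?Z (Inl i) (Inl j))) +
     (\<Sum>i\<in>UNIV. \<Sum>j\<in>UNIV. dxgen (Inl i) \<odot> (dxgen (Inr j) \<odot> ?Z (Inl i) (Inr j))) +
     (\<Sum>j\<in>UNIV. \<Sum>i\<in>UNIV. dxgen (Inr j) \<odot> (dxgen (Inl i) \<odot> ?Z (Inr j) (Inl i))) +
     (\<Sum>i\<in>UNIV. \<Sum>j\<in>UNIV. dxgen (Inr i) \<odot> (dxgen (Inr j) \<odot> ?Z (Inr i) (Inr j)))"
    by (simp add: sum_ix sum.distrib add.assoc)
  also have "(\<Sum>i\<in>UNIV. \<Sum>j\<in>UNIV. dxgen (Inl i) \<odot> (dxgen (Inl j) \<odot> ?Z (Inl i) (Inl j))) = 0"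
    by (rule dxgen_sum_symmetric) (rule cov_hol_commute[OF x a])
  also have "(\<Sum>i\<in>UNIV. \<Sum>j\<in>UNIV. dxgen (Inr i) \<odot> (dxgen (Inr j) \<odot> ?Z (Inr i) (Inr j))) = 0"
    by (rule dxgen_sum_symmetric) (rule cov_hol_commute[OF x a])
  also have "(\<Sum>j\<in>UNIV. \<Sum>i\<in>UNIV. dxgen (Inr j) \<odot> (dxgen (Inl i) \<odot> ?Z (Inr j) (Inl i))) =
     (\<Sum>i\<in>UNIV. \<Sum>j\<in>UNIV. - (dxgen (Inl i) \<odot> (dxgen (Inr j) \<odot> ?Z (Inr j) (Inl i))))"
    by (subst sum.swap) (intro sum.cong refl dxgen_anticomm)
  also have "0 + (\<Sum>i\<in>UNIV. \<Sum>j\<in>UNIV. dxgen (Inl i) \<odot> (dxgen (Inr j) \<odot> ?Z (Inl i) (Inr j))) +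
     (\<Sum>i\<in>UNIV. \<Sum>j\<in>UNIV. - (dxgen (Inl i) \<odot> (dxgen (Inr j) \<odot> ?Z (Inr j) (Inl i)))) + 0 =
     (\<Sum>i\<in>UNIV. \<Sum>j\<in>UNIV. dxgen (Inl i) \<odot> (dxgen (Inr j) \<odot> (?Z (Inl i) (Inr j) - ?Z (Inr j) (Inl i))))"
    by (simp add: wmul_diff_right sum_subtractf sum_negf)
  finally show ?thesis unfolding curv_act_def cov_commutator[OF x a] .
qed

text \<open>Torsion-freeness: the only obstruction is the Christoffel term of \<open>cov_dy\<close>,
  symmetric in the two indices that are contracted with one-forms.\<close>

lemma nabla_delta_anticommute:
  assumes x: "x \<in> U" and a: "ssec U a"
  shows "nabla G (\<lambda>x. delta (a x)) x + delta (nabla G a x) = 0"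
proof -
  have "nabla G (\<lambda>x. delta (a x)) x = (\<Sum>B\<in>UNIV. \<Sum>A\<in>UNIV. dxgen B \<odot> (dxgen A \<odot> cov_deriv G B (\<lambda>x. dy A (a x)) x))"
    unfolding nabla_cov[abs_def] delta_dy
    by (simp add: cov_sum[OF x] ssec_wmul[OF U] ssec_dy[OF U] a cov_dxgen[OF x] wmul_sum_right)
  moreover have "delta (nabla G a x) = (\<Sum>B\<in>UNIV. \<Sum>A\<in>UNIV. - (dxgen B \<odot> (dxgen A \<odot> dy A (cov_deriv G B a x))))"
  proof -
    have "delta (nabla G a x) = (\<Sum>A\<in>UNIV. \<Sum>B\<in>UNIV. dxgen A \<odot> (dxgen B \<odot> dy A (cov_deriv G B a x)))"
      unfolding nabla_cov delta_dy by (simp add: dy_sum dy_dxgen_wmul wmul_sum_right)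
    also have "\<dots> = (\<Sum>B\<in>UNIV. \<Sum>A\<in>UNIV. dxgen A \<odot> (dxgen B \<odot> dy A (cov_deriv G B a x)))"
      by (rule sum.swap)
    also have "\<dots> = (\<Sum>B\<in>UNIV. \<Sum>A\<in>UNIV. - (dxgen B \<odot> (dxgen A \<odot> dy A (cov_deriv G B a x))))"
      by (intro sum.cong refl dxgen_anticomm)
    finally show ?thesis .
  qed
  ultimately have "nabla G (\<lambda>x. delta (a x)) x + delta (nabla G a x) =
     (\<Sum>B\<in>UNIV. \<Sum>A\<in>UNIV. dxgen B \<odot> (dxgen A \<odot> (\<Sum>E\<in>UNIV. scl (\<Gamma> x E B A) (dy E (a x)))))"
    by (simp add: cov_dy[OF x a] wmul_add_right sum.distrib sum_negf)
  also have "\<dots> = 0" by (rule dxgen_sum_symmetric) (simp add: christoffel_sym[OF x])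
  finally show ?thesis .
qed

lemma delta_delta: "delta (delta a) = 0"
proof -
  have "delta (delta a) = (\<Sum>B\<in>UNIV. \<Sum>A\<in>UNIV. dxgen B \<odot> (dxgen A \<odot> dy B (dy A a)))"
    by (simp add: delta_dy dy_sum dy_dxgen_wmul wmul_sum_right)
  also have "\<dots> = 0" by (rule dxgen_sum_symmetric) (rule dy_commute)
  finally show ?thesis .
qed

lemma delta_diff: "delta (a - b) = delta a - delta b"
  by (simp add: delta_dy dy_diff wmul_diff_right sum_subtractf)

lemma nabla_diff: "x \<in> U \<Longrightarrow> ssec U a \<Longrightarrow> ssec U b \<Longrightarrow> nabla G (\<lambda>x. a x - b x) x = nabla G a x - nabla G b x"
  by (simp add: nabla_cov cov_diff wmul_diff_right sum_subtractf)

lemma dd_square_curv_act: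
  assumes x: "x \<in> U" and a: "ssec U a"
  shows "dd (dd a) x = curv_act x (a x)"
proof -
  have "dd (dd a) x = nabla G (nabla G a) x - (nabla G (\<lambda>x. delta (a x)) x + delta (nabla G a x)) + delta (delta (a x))"
    unfolding dd_def[abs_def] by (simp add: nabla_diff[OF x] ssec_nabla ssec_delta a delta_diff)
  then show ?thesis by (simp add: nabla_delta_anticommute[OF x a] delta_delta nabla_square[OF x a])
qed

lemma curv_eq:
  assumes x: "x \<in> U"
  shows "curv G x m i j k = pd (Inr j) (\<lambda>w. \<Gamma> w (Inl m) (Inl i) (Inl k)) x"
proof -
  have w: "wsign {Inl i} {Inr j} = 1"
  proof -
    have "{(s, t). s \<in> {Inl i} \<and> t \<in> {Inr j} \<and> prec t s} = {}" by auto
    then show ?thesis unfolding wsign_def by (metis card.empty power_0)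
  qed
  have d: "{Inl i, Inr j} - {Inl i'} = (if i' = i then {Inr j} else {Inl i, Inr j})" for i' by auto
  have s: "single (Inl k) = single (Inl k') \<longleftrightarrow> k = k'" for k' by (auto simp: single_def fun_eq_iff split: if_splits)
  have "curv G x m i j k = (\<Sum>i'\<in>UNIV. \<Sum>j'\<in>UNIV. (dxgen (Inl i') \<odot> (dxgen (Inr j') \<odot> crv (Inl i') (Inr j') (Inl m) x)) 0 (single (Inl k)) {Inl i, Inr j})"
    unfolding curv_def nabla_square[OF x ssec_const] curv_act_def
    by (simp add: weyl_sum_apply dy_ygen if_distrib[of "\<lambda>z. _ \<odot> z"] sum.delta cong: if_cong)
  also have "\<dots> = (\<Sum>i'\<in>UNIV. \<Sum>j'\<in>UNIV. if i' = i \<and> j' = j then crv (Inl i') (Inr j') (Inl m) x 0 (single (Inl k)) {} else 0)"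
    by (intro sum.cong refl) (auto simp: dxgen_wmul d w)
  also have "\<dots> = crv (Inl i) (Inr j) (Inl m) x 0 (single (Inl k)) {}"
    by (subst sum.swap) (simp add: sum.delta if_if_eq_conj[symmetric] cong: if_cong)
  also have "\<dots> = pd (Inr j) (\<lambda>w. \<Gamma> w (Inl m) (Inl i) (Inl k)) x"
    unfolding crv_mixed[OF x]
    by (simp add: weyl_sum_apply ygen_def s if_distrib[of "\<lambda>z. _ * z"] sum.delta cong: if_cong)
  finally show ?thesis .
qed

lemma crv_mixed_curv:
  "x \<in> U \<Longrightarrow> crv (Inl i) (Inr j) (Inl m) x = (\<Sum>k\<in>UNIV. scl (curv G x m i j k) (ygen (Inl k)))"
  by (simp add: crv_mixed curv_eq)

lemma R_nabla_rho:
  assumes x: "x \<in> U"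
  shows "R_nabla G x = (\<Sum>i\<in>UNIV. \<Sum>j\<in>UNIV. dxgen (Inl i) \<odot> (dxgen (Inr j) \<odot> rho (Inl i) (Inr j) x))"
proof -
  have "rho (Inl i) (Inr j) x = (\<Sum>k\<in>UNIV. \<Sum>l\<in>UNIV. scl (\<i> * (\<Sum>m\<in>UNIV. curv G x m i j k * G x $ m $ l)) (ygen (Inl k) \<odot> ygen (Inr l)))" for i j
  proof -
    have "rho (Inl i) (Inr j) x = (\<Sum>m\<in>UNIV. \<Sum>l\<in>UNIV. \<Sum>k\<in>UNIV. scl (om_low G x m l * curv G x m i j k) (ygen (Inl k) \<odot> ygen (Inr l)))"
      by (simp add: rho_def crv_mixed_curv[OF x] wmul_sum_left wmul_scl_left scl_sum)
    also have "\<dots> = (\<Sum>k\<in>UNIV. \<Sum>l\<in>UNIV. \<Sum>m\<in>UNIV. scl (om_low G x m l * curv G x m i j k) (ygen (Inl k) \<odot> ygen (Inr l)))"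
    proof -
      have "(\<Sum>m\<in>UNIV. \<Sum>l\<in>UNIV. \<Sum>k\<in>UNIV. F m l k) = (\<Sum>k\<in>UNIV. \<Sum>l\<in>UNIV. \<Sum>m\<in>UNIV. F m l k)" for F :: "'n \<Rightarrow> 'n \<Rightarrow> 'n \<Rightarrow> 'n weyl"
      proof -
        have "(\<Sum>m\<in>UNIV. \<Sum>l\<in>UNIV. \<Sum>k\<in>UNIV. F m l k) = (\<Sum>m\<in>UNIV. \<Sum>k\<in>UNIV. \<Sum>l\<in>UNIV. F m l k)"
          by (intro sum.cong refl sum.swap)
        also have "\<dots> = (\<Sum>k\<in>UNIV. \<Sum>m\<in>UNIV. \<Sum>l\<in>UNIV. F m l k)" by (rule sum.swap)
        also have "\<dots> = (\<Sum>k\<in>UNIV. \<Sum>l\<in>UNIV. \<Sum>m\<in>UNIV. F m l k)" by (intro sum.cong refl sum.swap)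
        finally show ?thesis .
      qed
      then show ?thesis .
    qed
    also have "\<dots> = (\<Sum>k\<in>UNIV. \<Sum>l\<in>UNIV. scl (\<i> * (\<Sum>m\<in>UNIV. curv G x m i j k * G x $ m $ l)) (ygen (Inl k) \<odot> ygen (Inr l)))"
      by (intro sum.cong refl) (simp add: om_low_def sum_distrib_left mult_ac flip: scl_sum)
    finally show ?thesis .
  qed
  then show ?thesis
    by (simp add: R_nabla_def wmul_sum_right wmul_scl_right wmul_assoc)
qed

lemma ssec_crv: "ssec U (crv B D A)"
  unfolding crv_def[abs_def] by (intro ssec_diff ssec_cov ssec_cfm U)

lemma ssec_rho: "ssec U (rho B D)"
  unfolding rho_def[abs_def] by (intro ssec_sum ssec_scl ssec_wmul ssec_const ssec_crv smooth_om_low U)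

lemma ssec_R_nabla: "ssec U (R_nabla G)"
proof (rule ssec_cong[OF U])
  show "ssec U (\<lambda>x. \<Sum>i\<in>UNIV. \<Sum>j\<in>UNIV. dxgen (Inl i) \<odot> (dxgen (Inr j) \<odot> rho (Inl i) (Inr j) x))"
    by (intro ssec_sum ssec_wmul ssec_const ssec_rho U)
qed (simp add: R_nabla_rho)

lemma homog_wone: "homog u v 0 wone"
  by (auto simp: homog_def wone_def wt_def split: if_splits)

text \<open>\<open>undefined\<close> stands for an arbitrary index: the weights are assumed to
  depend on the type of an index only, so all terms have the same weight.\<close>

lemma homog_R_nabla:
  "n = u (Inl undefined) + u (Inr undefined) + v (Inl undefined) + v (Inr undefined) \<Longrightarrow>
   (\<And>i j. u (Inl i) = u (Inl j)) \<Longrightarrow> (\<And>i j. u (Inr i) = u (Inr j)) \<Longrightarrow>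
   (\<And>i j. v (Inl i) = v (Inl j)) \<Longrightarrow> (\<And>i j. v (Inr i) = v (Inr j)) \<Longrightarrow> homog u v n (R_nabla G x)"
proof -
  assume n: "n = u (Inl undefined) + u (Inr undefined) + v (Inl undefined) + v (Inr undefined)"
    and e: "\<And>i j. u (Inl i) = u (Inl j)" "\<And>i j. u (Inr i) = u (Inr j)"
      "\<And>i j. v (Inl i) = v (Inl j)" "\<And>i j. v (Inr i) = v (Inr j)"
  have n': "n = u (Inl k) + u (Inr l) + v (Inl i) + v (Inr j)" for i j k l
    unfolding n e(1)[of k undefined] e(2)[of l undefined] e(3)[of i undefined] e(4)[of j undefined] ..
  have "homog u v n (dxgen (Inl i) \<odot> (dxgen (Inr j) \<odot> (ygen (Inl k) \<odot> (ygen (Inr l) \<odot> wone))))" for i j k l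
    by (rule homog_dxgen[OF homog_dxgen[OF homog_ygen[OF homog_ygen[OF homog_wone refl] refl] refl]]) (simp add: n'[of k l i j])
  then show "homog u v n (R_nabla G x)"
    unfolding R_nabla_def wmul_assoc by (intro homog_sum homog_scl) simp
qed

lemma rho_quadratic:
  assumes x: "x \<in> U"
  shows "dy (Inl p) (dy (Inl q) (rho B D x)) = 0" "dy (Inr p) (dy (Inr q) (rho B D x)) = 0"
  by (simp_all add: dy_rho[OF x] dy_uminus dy_sum dy_scl dy_crv[OF x])

lemma rho_form: "x \<in> U \<Longrightarrow> S \<noteq> {} \<Longrightarrow> rho B D x k M S = 0"
  by (simp add: rho_def weyl_sum_apply crv_form ygen_wmul flip: ygen_comm cong: if_cong)

text \<open>\<open>rho\<close> lowers an index of the curvature with the Kaehler form and the Wick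
  contraction raises it again, so the bracket is the curvature derivation. On y-bar the minus signs
  of \<open>rho_alt\<close> and \<open>om_up_low\<close> cancel; on y the second minus sign is that
  of the commutator.\<close>

lemma rho_commutator:
  assumes x: "x \<in> U"
  shows "hdiv (wick (om_up G x) (rho B D x) a - wick (om_up G x) a (rho B D x)) = (\<Sum>A\<in>UNIV. crv B D A x \<odot> dy A a)"
proof -
  let ?r = "rho B D x" and ?w = "om_up G x"
  have e: "?r \<odot> a = a \<odot> ?r"
  proof (rule wmul_comm_even)
    fix k M S assume "?r k M S \<noteq> 0"
    then have "S = {}" using rho_form[OF x] by blast
    then show "even (card S)" by simp
  qed
  have "wick ?w ?r a = ?r \<odot> a + hmul (wterm ?w 1 ?r a)" "wick ?w a ?r = a \<odot> ?r + hmul (wterm ?w 1 a ?r)"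
    by (rule wick_first_order; simp add: rho_quadratic[OF x])+
  then have "hdiv (wick ?w ?r a - wick ?w a ?r) = wterm ?w 1 ?r a - wterm ?w 1 a ?r"
    by (simp add: e hdiv_diff hdiv_add)
  also have "wterm ?w 1 ?r a = (\<Sum>j\<in>UNIV. (\<Sum>i\<in>UNIV. scl (?w i j) (dy (Inl i) ?r)) \<odot> dy (Inr j) a)"
    by (simp add: wmul_sum_left wmul_scl_left) (rule sum.swap)
  also have "\<dots> = (\<Sum>j\<in>UNIV. crv B D (Inr j) x \<odot> dy (Inr j) a)"
    using om_cancel(2)[OF x, of _ "\<lambda>l. crv B D (Inr l) x"]
    by (simp add: dy_rho[OF x] scl_uminus sum_negf)
  also have "wterm ?w 1 a ?r = (\<Sum>i\<in>UNIV. dy (Inl i) a \<odot> (\<Sum>j\<in>UNIV. scl (?w i j) (dy (Inr j) ?r)))"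
    by (simp add: wmul_sum_right wmul_scl_right)
  also have "\<dots> = (\<Sum>i\<in>UNIV. - (crv B D (Inl i) x \<odot> dy (Inl i) a))"
    using om_cancel(1)[OF x, of _ "\<lambda>l. crv B D (Inl l) x"]
    by (simp add: dy_rho[OF x] wmul_uminus_right crv_comm[OF x])
  finally have "hdiv (wick ?w ?r a - wick ?w a ?r) =
     (\<Sum>j\<in>UNIV. crv B D (Inr j) x \<odot> dy (Inr j) a) - (\<Sum>i\<in>UNIV. - (crv B D (Inl i) x \<odot> dy (Inl i) a))" .
  also have "\<dots> = (\<Sum>A\<in>UNIV. crv B D A x \<odot> dy A a)"
    by (simp add: sum_ix sum_negf add.commute)
  finally show ?thesis .
qed

lemma R_nabla_commutator:
  assumes x: "x \<in> U"
  shows "hdiv (wick (om_up G x) (R_nabla G x) a - wick (om_up G x) a (R_nabla G x)) = curv_act x a"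
proof -
  have "wick (om_up G x) (R_nabla G x) a - wick (om_up G x) a (R_nabla G x) =
     (\<Sum>i\<in>UNIV. \<Sum>j\<in>UNIV. dxgen (Inl i) \<odot> (dxgen (Inr j) \<odot>
       (wick (om_up G x) (rho (Inl i) (Inr j) x) a - wick (om_up G x) a (rho (Inl i) (Inr j) x))))"
    unfolding R_nabla_rho[OF x]
    by (simp add: wick_sum_left wick_sum_right wick_dxgen_left wick_dxgen_right wmul_diff_right sum_subtractf)
  then show ?thesis
    by (simp only: hdiv_sum flip: dxgen_hdiv) (simp only: rho_commutator[OF x] curv_act_def)
qed

text \<open>The curvature of \<nabla> - \<delta> is an inner derivation. This turns the flatness
  question into an equation for a single section, the Fedosov equation.\<close>

lemma dd_square:
  assumes x: "x \<in> U" and a: "ssec U a"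
  shows "dd (dd a) x = hdiv (wick (om_up G x) (R_nabla G x) (a x) - wick (om_up G x) (a x) (R_nabla G x))"
  by (simp add: dd_square_curv_act[OF x a] R_nabla_commutator[OF x])

lemma sgm_R_nabla: "sgm (R_nabla G x) = R_nabla G x"
  using sgm_homog[OF homog_R_nabla, of 2 x] by simp

text \<open>The Bianchi identities follow from the two ways of evaluating the cube of the derivation: only
  elements without \<open>y\<close> and \<open>\<bar>y\<close> commute with all generators.\<close>

lemma wick_ygen_commutator:
  "wick w X (ygen (Inl m)) - wick w (ygen (Inl m)) X = - hmul (\<Sum>j\<in>UNIV. scl (w m j) (dy (Inr j) X))"
  "wick w X (ygen (Inr m)) - wick w (ygen (Inr m)) X = hmul (\<Sum>i\<in>UNIV. scl (w i m) (dy (Inl i) X))"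
proof -
  have 1: "wick w X (ygen (Inl m)) = X \<odot> ygen (Inl m)" "wick w (ygen (Inr m)) X = ygen (Inr m) \<odot> X"
    by (subst wick_first_order; simp add: dy_ygen)+
  have 2: "wick w (ygen (Inl m)) X = ygen (Inl m) \<odot> X + hmul (\<Sum>j\<in>UNIV. scl (w m j) (dy (Inr j) X))"
  proof -
    have d: "dy A wone = 0" for A using dy_wmul[of A wone wone] by simp
    have "wick w (ygen (Inl m)) X = ygen (Inl m) \<odot> X + hmul (wterm w 1 (ygen (Inl m)) X)"
      by (rule wick_first_order) (simp add: dy_ygen if_distrib[of "dy _"] d cong: if_cong)
    also have "wterm w 1 (ygen (Inl m)) X = (\<Sum>j\<in>UNIV. scl (w m j) (dy (Inr j) X))"
      by (subst One_nat_def, subst wterm.simps, subst sum.swap)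
        (simp add: dy_ygen if_distrib[of "\<lambda>z. z \<odot> _"] if_distrib[of "scl _"] sum.delta cong: if_cong)
    finally show ?thesis .
  qed
  have 3: "wick w X (ygen (Inr m)) = X \<odot> ygen (Inr m) + hmul (\<Sum>i\<in>UNIV. scl (w i m) (dy (Inl i) X))"
  proof -
    have d: "dy A wone = 0" for A using dy_wmul[of A wone wone] by simp
    have "wick w X (ygen (Inr m)) = X \<odot> ygen (Inr m) + hmul (wterm w 1 X (ygen (Inr m)))"
      by (rule wick_first_order) (simp add: dy_ygen if_distrib[of "dy _"] d cong: if_cong)
    also have "wterm w 1 X (ygen (Inr m)) = (\<Sum>i\<in>UNIV. scl (w i m) (dy (Inl i) X))"
      by (subst One_nat_def, subst wterm.simps)
        (simp add: dy_ygen if_distrib[of "\<lambda>z. _ \<odot> z"] if_distrib[of "scl _"] sum.delta cong: if_cong)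
    finally show ?thesis .
  qed
  show "wick w X (ygen (Inl m)) - wick w (ygen (Inl m)) X = - hmul (\<Sum>j\<in>UNIV. scl (w m j) (dy (Inr j) X))"
    unfolding 1 2 by (simp add: ygen_comm)
  show "wick w X (ygen (Inr m)) - wick w (ygen (Inr m)) X = hmul (\<Sum>i\<in>UNIV. scl (w i m) (dy (Inl i) X))"
    unfolding 1 3 by (simp add: ygen_comm)
qed

lemma om_cancel':
  fixes F :: "'n \<Rightarrow> 'n weyl"
  assumes x: "x \<in> U"
  shows "(\<Sum>m\<in>UNIV. scl (om_low G x m q) (\<Sum>j\<in>UNIV. scl (om_up G x m j) (F j))) = - F q"
    "(\<Sum>m\<in>UNIV. scl (om_low G x q m) (\<Sum>j\<in>UNIV. scl (om_up G x j m) (F j))) = - F q"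
proof -
  have "(\<Sum>m\<in>UNIV. scl (om_low G x m q) (\<Sum>j\<in>UNIV. scl (om_up G x m j) (F j))) =
     (\<Sum>j\<in>UNIV. scl (\<Sum>m\<in>UNIV. om_up G x m j * om_low G x m q) (F j))"
    unfolding scl_sum scl_scl by (subst sum.swap) (simp add: mult.commute)
  then show "(\<Sum>m\<in>UNIV. scl (om_low G x m q) (\<Sum>j\<in>UNIV. scl (om_up G x m j) (F j))) = - F q"
    by (simp add: om_up_low[OF x] if_distrib[of "\<lambda>z. scl z _"] scl_uminus sum.delta cong: if_cong)
  have "(\<Sum>m\<in>UNIV. scl (om_low G x q m) (\<Sum>j\<in>UNIV. scl (om_up G x j m) (F j))) =
     (\<Sum>j\<in>UNIV. scl (\<Sum>m\<in>UNIV. om_up G x j m * om_low G x q m) (F j))"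
    unfolding scl_sum scl_scl by (subst sum.swap) (simp add: mult.commute)
  then show "(\<Sum>m\<in>UNIV. scl (om_low G x q m) (\<Sum>j\<in>UNIV. scl (om_up G x j m) (F j))) = - F q"
    by (simp add: om_up_low[OF x] if_distrib[of "\<lambda>z. scl z _"] scl_uminus sum.delta cong: if_cong)
qed

lemma dd_R_nabla:
  assumes x: "x \<in> U"
  shows "dd (R_nabla G) x = 0"
proof -
  let ?X = "dd (R_nabla G) x" and ?w = "om_up G x"
  note R = ssec_R_nabla
  have c: "hdiv (wick ?w ?X (ygen A) - wick ?w (ygen A) ?X) = 0" for A
  proof -
    let ?a = "\<lambda>_ :: complex^'n. ygen A"
    have a: "ssec U ?a" by simp
    have sw: "ssec U (\<lambda>x. wick (om_up G x) (b x) (c x))" if "ssec U b" "ssec U c" for b c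
      by (rule ssec_wick[OF U smooth_om_up that])
    \<comment> \<open>Here the outer \<open>dd\<close> differentiates the square; at the end
      \<open>dd_square\<close> is applied to \<open>dd ?a\<close> instead. The two evaluations of
      the cube differ by the bracket of \<open>?X\<close> with \<open>ygen A\<close>.\<close>
    have "dd (dd (dd ?a)) x = dd (\<lambda>x. hdiv (wick (om_up G x) (R_nabla G x) (ygen A) - wick (om_up G x) (ygen A) (R_nabla G x))) x"
      by (rule dd_cong[OF x]) (rule dd_square[OF _ a])
    also have "\<dots> = hdiv (wick ?w ?X (ygen A) + wick ?w (R_nabla G x) (dd ?a x) - (wick ?w (dd ?a x) (R_nabla G x) + wick ?w (ygen A) ?X))"
      by (simp add: dd_hdiv dd_diff[OF x] sw R dd_wick[OF x] sgm_R_nabla sgm_ygen)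
    also have "\<dots> = hdiv (wick ?w (R_nabla G x) (dd ?a x) - wick ?w (dd ?a x) (R_nabla G x)) + hdiv (wick ?w ?X (ygen A) - wick ?w (ygen A) ?X)"
      by (simp add: hdiv_add hdiv_diff)
    finally show ?thesis using dd_square[OF x ssec_dd[OF a]] by simp
  qed
  have "dy (Inr q) ?X = 0" for q
  proof -
    have "(\<Sum>j\<in>UNIV. scl (?w m j) (dy (Inr j) ?X)) = 0" for m
      using c[of "Inl m"] by (simp add: wick_ygen_commutator hdiv_uminus)
    then show ?thesis using om_cancel'(1)[OF x, of q "\<lambda>j. dy (Inr j) ?X"] by simp
  qed
  moreover have "dy (Inl q) ?X = 0" for q
  proof -
    have "(\<Sum>j\<in>UNIV. scl (?w j m) (dy (Inl j) ?X)) = 0" for m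
      using c[of "Inr m"] by (simp add: wick_ygen_commutator)
    then show ?thesis using om_cancel'(2)[OF x, of q "\<lambda>j. dy (Inl j) ?X"] by simp
  qed
  ultimately have d: "dy A ?X = 0" for A by (cases A) auto
  show ?thesis
  proof (intro ext)
    fix k M S
    show "?X k M S = 0 k M S"
    proof (cases "M = 0")
      case False
      then obtain A where A: "M A \<noteq> 0" by (auto simp: fun_eq_iff)
      have "dy A ?X k (M(A := M A - 1)) S = of_nat (M A) * ?X k M S"
        using A by (simp add: dy_def flip: of_nat_Suc)
      with d A show ?thesis by simp
    next
      \<comment> \<open>Vanishing of all \<open>dy\<close> says nothing about M = 0, where degrees
        decide: \<nabla> keeps the degree 2 of the curvature and \<delta> lowers it to 1, so there
        is no constant term.\<close>
      case True
      have h: "homog (\<lambda>_. 1) (\<lambda>_. 0) 2 (R_nabla G y)" for y by (rule homog_R_nabla) auto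
      have z: "wt (\<lambda>_. 1) (\<lambda>_. 0) 0 S = 0" for S :: "'n ix set" by (simp add: wt_def)
      have "homog (\<lambda>_. 1) (\<lambda>_. 0) 2 (cov_deriv G B (R_nabla G) x)" for B
        by (rule homog_cov[OF x _ _ h]) auto
      then have "cov_deriv G B (R_nabla G) x k 0 S = 0" for B k S using homogD z by fastforce
      moreover have "dy B (R_nabla G x) k 0 S = 0" for B k S
        using homog_dyD[OF h, of B x k 0 S] z[of S] by fastforce
      ultimately show ?thesis
        by (simp add: dd_dcov weyl_sum_apply dxgen_wmul dcov_def True cong: if_cong)
    qed
  qed
qed

end

section \<open>Solving the (1,1)-part degree by degree\<close>

text \<open>\<open>delta10_inv\<close> without its degree-dependent factor, hence additive and easy
  to commute with other operators.\<close>

definition iota :: "'n::finite weyl \<Rightarrow> 'n weyl" where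
  "iota a = (\<Sum>i\<in>UNIV. ygen (Inl i) \<odot> contr (Inl i) a)"

lemma homog_iota:
  assumes "homog u v n a" "\<And>i. n = m i + v (Inl i)" "\<And>i. p = m i + u (Inl i)"
  shows "homog u v p (iota a)"
  unfolding iota_def
proof (rule homog_sum)
  fix i
  show "homog u v p (ygen (Inl i) \<odot> contr (Inl i) a)"
    by (rule homog_ygen[OF homog_contr[OF assms(1,2)] assms(3)])
qed

text \<open>With one holomorphic form index and degree n in y the result has none and degree n + 1;
  the normalisation, read off from the resulting monomial, is therefore constant.\<close>

lemma delta10_inv_iota:
  assumes f: "homog (\<lambda>_. 0) hol 1 a" and h: "homog hol (\<lambda>_. 0) n a"
  shows "delta10_inv a = scl (1 / of_nat (Suc n)) (iota a)"
proof (intro ext)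
  fix k M S
  show "delta10_inv a k M S = scl (1 / of_nat (Suc n)) (iota a) k M S"
  proof (cases "iota a k M S = 0")
    case True
    then show ?thesis by (simp add: delta10_inv_def iota_def Let_def)
  next
    case False
    have a0: "homog (\<lambda>_. 0) hol 0 (iota a)" by (rule homog_iota[OF f, of "\<lambda>_. 0"]) auto
    have a1: "homog hol (\<lambda>_. 0) (Suc n) (iota a)" by (rule homog_iota[OF h, of "\<lambda>_. n"]) auto
    have "wt (\<lambda>_. 0) hol M S + wt hol (\<lambda>_. 0) M S = Suc n"
      using homogD[OF a0 False] homogD[OF a1 False] by simp
    then have d: "card (S \<inter> range Inl) + (\<Sum>i\<in>UNIV. M (Inl i)) = Suc n"
      by (simp add: wt_hol wt_form_hol)
    show ?thesis unfolding delta10_inv_def iota_def Let_def d by simp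
  qed
qed

lemma ssec_delta10_inv:
  assumes "open U" "ssec U a"
  shows "ssec U (\<lambda>x. delta10_inv (a x))"
  unfolding ssec_def
proof (intro allI)
  fix k M S
  have "ssec U (\<lambda>x. \<Sum>i\<in>UNIV. ygen (Inl i) \<odot> contr (Inl i) (a x))"
    by (intro ssec_sum ssec_wmul ssec_const ssec_contr assms)
  then have "smooth_on U (\<lambda>x. (\<Sum>i\<in>UNIV. ygen (Inl i) \<odot> contr (Inl i) (a x)) k M S)" by (rule ssecD)
  then have s: "smooth_on U (\<lambda>x. (\<Sum>i\<in>UNIV. ygen (Inl i) \<odot> contr (Inl i) (a x)) k M S * inverse (of_nat d))" for d
    by (rule smooth_on_mult[OF assms(1) _ smooth_on_const])
  show "smooth_on U (\<lambda>x. delta10_inv (a x) k M S)"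
  proof (cases "card (S \<inter> range Inl) + (\<Sum>i\<in>UNIV. M (Inl i)) = 0")
    case True
    then show ?thesis unfolding delta10_inv_def Let_def by (simp only: simp_thms if_True smooth_on_const)
  next
    case False
    then show ?thesis unfolding delta10_inv_def Let_def divide_inverse by (simp only: if_False s)
  qed
qed

text \<open>Together with \<open>euler_hol\<close> this supplies the two counting operators whose
  sum is the anticommutator of \<open>delta10\<close> and \<open>iota\<close>.\<close>

lemma form_number:
  assumes "homog (\<lambda>_. 0) hol p c"
  shows "(\<Sum>j\<in>UNIV. dxgen (Inl j) \<odot> contr (Inl j) c) = scl (of_nat p) c"
proof (intro ext)
  fix k M S
  have "(\<Sum>j\<in>UNIV. dxgen (Inl j) \<odot> contr (Inl j) c) k M S = (\<Sum>j\<in>UNIV. if Inl j \<in> S then c k M S else 0)"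
    unfolding weyl_sum_apply
    by (intro sum.cong refl) (auto simp: dxgen_wmul contr_def insert_absorb wsign_square simp flip: mult.assoc)
  also have "\<dots> = of_nat (card {j. Inl j \<in> S}) * c k M S" by (simp add: sum.If_cases)
  also have "card {j. Inl j \<in> S} = card (S \<inter> range Inl)"
  proof (rule bij_betw_same_card)
    show "bij_betw Inl {j. Inl j \<in> S} (S \<inter> range Inl)" by (auto simp: bij_betw_def inj_on_def)
  qed
  finally show "(\<Sum>j\<in>UNIV. dxgen (Inl j) \<odot> contr (Inl j) c) k M S = scl (of_nat p) c k M S"
    using homogD[OF assms, of k M S] by (cases "c k M S = 0") (auto simp: wt_form_hol)
qed

lemma euler_hol:
  assumes "homog hol (\<lambda>_. 0) n c"
  shows "(\<Sum>i\<in>UNIV. ygen (Inl i) \<odot> dy (Inl i) c) = scl (of_nat n) c"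
proof (intro ext)
  fix k M S
  have "(\<Sum>i\<in>UNIV. ygen (Inl i) \<odot> dy (Inl i) c) k M S = (\<Sum>i\<in>UNIV. of_nat (M (Inl i)) * c k M S)"
    unfolding weyl_sum_apply
    by (intro sum.cong refl) (auto simp: ygen_wmul dy_def simp flip: of_nat_Suc)
  also have "\<dots> = of_nat (\<Sum>i\<in>UNIV. M (Inl i)) * c k M S" by (simp add: sum_distrib_right)
  finally show "(\<Sum>i\<in>UNIV. ygen (Inl i) \<odot> dy (Inl i) c) k M S = scl (of_nat n) c k M S"
    using homogD[OF assms, of k M S] by (cases "c k M S = 0") (auto simp: wt_hol)
qed

text \<open>The homotopy formula: \<open>delta10\<close> and \<open>iota\<close> anticommute to the
  total holomorphic degree n + 1, and on a \<open>delta10\<close>-closed element only one of the two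
  orders contributes. So \<open>delta10_inv\<close> inverts \<open>delta10\<close> there.\<close>

lemma delta10_iota:
  assumes "delta10 c = 0" "homog (\<lambda>_. 0) hol 1 c" "homog hol (\<lambda>_. 0) n c"
  shows "delta10 (iota c) = scl (of_nat (Suc n)) c"
proof -
  have e: "dxgen (Inl j) \<odot> (ygen (Inl i) \<odot> dy (Inl j) (contr (Inl i) c)) =
      ygen (Inl i) \<odot> ((if i = j then dy (Inl j) c else 0) - contr (Inl i) (dxgen (Inl j) \<odot> dy (Inl j) c))" for i j
    by (subst ygen_past) (simp add: contr_dxgen contr_dy)
  have "delta10 (iota c) = (\<Sum>j\<in>UNIV. dxgen (Inl j) \<odot> contr (Inl j) c) +
     (\<Sum>j\<in>UNIV. \<Sum>i\<in>UNIV. dxgen (Inl j) \<odot> (ygen (Inl i) \<odot> dy (Inl j) (contr (Inl i) c)))"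
    unfolding delta10_def iota_def
    by (simp add: dy_sum dy_ygen_wmul wmul_sum_right wmul_add_right sum.distrib cong: if_cong)
  also have "(\<Sum>j\<in>UNIV. dxgen (Inl j) \<odot> contr (Inl j) c) = c"
    using form_number[OF assms(2)] by simp
  also have "(\<Sum>j\<in>UNIV. \<Sum>i\<in>UNIV. dxgen (Inl j) \<odot> (ygen (Inl i) \<odot> dy (Inl j) (contr (Inl i) c))) =
     (\<Sum>i\<in>UNIV. \<Sum>j\<in>UNIV. ygen (Inl i) \<odot> ((if i = j then dy (Inl j) c else 0) - contr (Inl i) (dxgen (Inl j) \<odot> dy (Inl j) c)))"
    unfolding e by (rule sum.swap)
  also have "\<dots> = (\<Sum>i\<in>UNIV. ygen (Inl i) \<odot> (dy (Inl i) c - contr (Inl i) (delta10 c)))"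
    unfolding delta10_def
    by (simp add: wmul_diff_right sum_subtractf contr_sum wmul_sum_right if_distrib[of "\<lambda>z. _ \<odot> z"] sum.delta' cong: if_cong)
  also have "\<dots> = scl (of_nat n) c" by (simp add: assms(1) euler_hol[OF assms(3)])
  finally show ?thesis by (simp add: fun_eq_iff algebra_simps)
qed

text \<open>Ensures that the ansatz, annihilation by \<open>delta01\<close>, is passed on by the
  homotopy operator.\<close>

lemma delta01_iota: "delta01 (iota c) = - iota (delta01 c)"
proof -
  have e: "dxgen (Inr j) \<odot> (ygen (Inl i) \<odot> dy (Inr j) (contr (Inl i) c)) =
      - (ygen (Inl i) \<odot> contr (Inl i) (dxgen (Inr j) \<odot> dy (Inr j) c))" for i j
    by (subst ygen_past) (simp add: contr_dxgen contr_dy wmul_uminus_right)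
  have "delta01 (iota c) = (\<Sum>j\<in>UNIV. \<Sum>i\<in>UNIV. dxgen (Inr j) \<odot> (ygen (Inl i) \<odot> dy (Inr j) (contr (Inl i) c)))"
    unfolding delta01_def iota_def by (simp add: dy_sum dy_ygen_wmul wmul_sum_right)
  also have "\<dots> = (\<Sum>i\<in>UNIV. \<Sum>j\<in>UNIV. - (ygen (Inl i) \<odot> contr (Inl i) (dxgen (Inr j) \<odot> dy (Inr j) c)))"
    unfolding e by (rule sum.swap)
  also have "\<dots> = - iota (delta01 c)"
    by (simp add: iota_def delta01_def contr_sum wmul_sum_right sum_negf)
  finally show ?thesis .
qed

lemma delta10_scl: "delta10 (scl z a) = scl z (delta10 a)"
  by (simp add: delta10_def dy_scl wmul_scl_right scl_sum)

lemma delta01_scl: "delta01 (scl z a) = scl z (delta01 a)"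
  by (simp add: delta01_def dy_scl wmul_scl_right scl_sum)

lemma delta10_zero [simp]: "delta10 0 = 0"
  by (simp add: delta10_def)

lemma delta01_zero [simp]: "delta01 0 = 0"
  by (simp add: delta01_def)

lemma delta10_add: "delta10 (a + b) = delta10 a + delta10 b"
  by (simp add: delta10_def dy_add wmul_add_right sum.distrib)

lemma delta01_add: "delta01 (a + b) = delta01 a + delta01 b"
  by (simp add: delta01_def dy_add wmul_add_right sum.distrib)

lemma iota_zero [simp]: "iota 0 = 0"
  by (simp add: iota_def)

section \<open>The relations between nabla10, delta10 and delta01\<close>

context kaehler_chart
begin

lemma nabla10_cong: "x \<in> U \<Longrightarrow> (\<And>y. y \<in> U \<Longrightarrow> a y = b y) \<Longrightarrow> nabla10 G a x = nabla10 G b x"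
  using cov_cong[of x a b] by (simp add: nabla10_def)

lemma nabla10_const0 [simp]: "nabla10 G (\<lambda>_. 0) x = 0"
  by (simp add: nabla10_def)

lemma nabla10_add: "x \<in> U \<Longrightarrow> ssec U a \<Longrightarrow> ssec U b \<Longrightarrow>
    nabla10 G (\<lambda>x. a x + b x) x = nabla10 G a x + nabla10 G b x"
  by (simp add: nabla10_def cov_add wmul_add_right sum.distrib)

lemma nabla10_square:
  assumes x: "x \<in> U" and a: "ssec U a"
  shows "nabla10 G (nabla10 G a) x = 0"
proof -
  have "nabla10 G (nabla10 G a) x = (\<Sum>i\<in>UNIV. \<Sum>j\<in>UNIV. dxgen (Inl i) \<odot> (dxgen (Inl j) \<odot> cov_deriv G (Inl i) (cov_deriv G (Inl j) a) x))"
    unfolding nabla10_def[abs_def]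
    by (simp add: cov_sum[OF x] ssec_wmul[OF U] ssec_cov a cov_dxgen[OF x] wmul_sum_right)
  also have "\<dots> = 0" by (rule dxgen_sum_symmetric) (rule cov_hol_commute[OF x a])
  finally show ?thesis .
qed

text \<open>The map \<open>f\<close> is \<open>Inl\<close> or \<open>Inr\<close>, so
  \<open>delta10\<close> and \<open>delta01\<close> are treated together. The Christoffel remainder
  then vanishes for different reasons: symmetry in the first case, absence of mixed symbols in the
  second.\<close>

lemma nabla10_delta_aux:
  assumes x: "x \<in> U" and a: "ssec U a"
  shows "nabla10 G (\<lambda>x. \<Sum>j\<in>UNIV. dxgen (f j) \<odot> dy (f j) (a x)) x + (\<Sum>j\<in>UNIV. dxgen (f j) \<odot> dy (f j) (nabla10 G a x)) =
    (\<Sum>i\<in>UNIV. \<Sum>j\<in>(UNIV :: 'n set). dxgen (Inl i) \<odot> (dxgen (f j) \<odot> (\<Sum>E\<in>UNIV. scl (\<Gamma> x E (Inl i) (f j)) (dy E (a x)))))"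
proof -
  have "nabla10 G (\<lambda>x. \<Sum>j\<in>UNIV. dxgen (f j) \<odot> dy (f j) (a x)) x =
      (\<Sum>i\<in>UNIV. \<Sum>j\<in>UNIV. dxgen (Inl i) \<odot> (dxgen (f j) \<odot> cov_deriv G (Inl i) (\<lambda>x. dy (f j) (a x)) x))"
    unfolding nabla10_def
    by (simp add: cov_sum[OF x] ssec_wmul[OF U] ssec_dy[OF U] a cov_dxgen[OF x] wmul_sum_right)
  moreover have "(\<Sum>j\<in>UNIV. dxgen (f j) \<odot> dy (f j) (nabla10 G a x)) =
      (\<Sum>i\<in>UNIV. \<Sum>j\<in>UNIV. - (dxgen (Inl i) \<odot> (dxgen (f j) \<odot> dy (f j) (cov_deriv G (Inl i) a x))))"
  proof -
    have "(\<Sum>j\<in>UNIV. dxgen (f j) \<odot> dy (f j) (nabla10 G a x)) =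
      (\<Sum>j\<in>UNIV. \<Sum>i\<in>UNIV. dxgen (f j) \<odot> (dxgen (Inl i) \<odot> dy (f j) (cov_deriv G (Inl i) a x)))"
      unfolding nabla10_def by (simp add: dy_sum dy_dxgen_wmul wmul_sum_right)
    also have "\<dots> = (\<Sum>i\<in>UNIV. \<Sum>j\<in>UNIV. dxgen (f j) \<odot> (dxgen (Inl i) \<odot> dy (f j) (cov_deriv G (Inl i) a x)))"
      by (rule sum.swap)
    also have "\<dots> = (\<Sum>i\<in>UNIV. \<Sum>j\<in>UNIV. - (dxgen (Inl i) \<odot> (dxgen (f j) \<odot> dy (f j) (cov_deriv G (Inl i) a x))))"
      by (intro sum.cong refl dxgen_anticomm)
    finally show ?thesis .
  qed
  ultimately show ?thesis
    by (simp add: cov_dy[OF x a] wmul_add_right sum.distrib sum_negf)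
qed

lemma nabla10_delta10:
  assumes x: "x \<in> U" and a: "ssec U a"
  shows "delta10 (nabla10 G a x) = - nabla10 G (\<lambda>x. delta10 (a x)) x"
proof -
  have "nabla10 G (\<lambda>x. delta10 (a x)) x + delta10 (nabla10 G a x) = 0"
    unfolding delta10_def nabla10_delta_aux[OF x a]
    by (rule dxgen_sum_symmetric) (simp add: christoffel_sym[OF x])
  then show ?thesis by (simp add: add_eq_0_iff)
qed

lemma nabla10_delta01:
  assumes x: "x \<in> U" and a: "ssec U a"
  shows "delta01 (nabla10 G a x) = - nabla10 G (\<lambda>x. delta01 (a x)) x"
proof -
  have g: "\<Gamma> x E (Inl i) (Inr j) = 0" for E i j
    by (cases E) (simp_all add: christoffel_simps[OF x])
  have "nabla10 G (\<lambda>x. delta01 (a x)) x + delta01 (nabla10 G a x) = 0"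
    unfolding delta01_def nabla10_delta_aux[OF x a] by (simp add: g)
  then show ?thesis by (simp add: add_eq_0_iff)
qed

lemma homog_nabla10:
  assumes x: "x \<in> U" and u: "\<And>i j. u (Inl i) = u (Inl j)" "\<And>i j. u (Inr i) = u (Inr j)"
    and a: "\<And>y. y \<in> U \<Longrightarrow> homog u v n (a y)" and m: "\<And>i. m = n + v (Inl i)"
  shows "homog u v m (nabla10 G a x)"
  unfolding nabla10_def by (intro homog_sum homog_dxgen[OF homog_cov[OF x u a] m])

lemma homog_nabla01:
  assumes x: "x \<in> U" and u: "\<And>i j. u (Inl i) = u (Inl j)" "\<And>i j. u (Inr i) = u (Inr j)"
    and a: "\<And>y. y \<in> U \<Longrightarrow> homog u v n (a y)" and m: "\<And>i. m = n + v (Inr i)"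
  shows "homog u v m (nabla01 G a x)"
  unfolding nabla01_def by (intro homog_sum homog_dxgen[OF homog_cov[OF x u a] m])

lemma homog_delta10: "homog u v n a \<Longrightarrow> (\<And>i. n = p + u (Inl i)) \<Longrightarrow> (\<And>i. m = p + v (Inl i)) \<Longrightarrow> homog u v m (delta10 a)"
  unfolding delta10_def by (intro homog_sum) (rule homog_dxgen[OF homog_dy])

lemma homog_delta01: "homog u v n a \<Longrightarrow> (\<And>i. n = p + u (Inr i)) \<Longrightarrow> (\<And>i. m = p + v (Inr i)) \<Longrightarrow> homog u v m (delta01 a)"
  unfolding delta01_def by (intro homog_sum) (rule homog_dxgen[OF homog_dy])

lemma dd_split: "dd a x = (nabla10 G a x - delta10 (a x)) + (nabla01 G a x - delta01 (a x))"
  by (simp add: dd_def nabla_def delta_def)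

text \<open>A single equation is separated by two gradings: the (1,0)-operators raise the
  holomorphic form degree and the others do not, while \<nabla> preserves the polynomial degree and
  \<delta> lowers it. This extracts from the Bianchi identity what the iteration needs.\<close>

lemma dd_zero_components:
  assumes x: "x \<in> U" and f: "\<And>y. y \<in> U \<Longrightarrow> homog (\<lambda>_. 0) hol 1 (a y)"
    and h: "\<And>y. y \<in> U \<Longrightarrow> homog (\<lambda>_. 1) (\<lambda>_. 0) n (a y)" and d: "dd a x = 0"
  shows "nabla10 G a x = 0" "delta10 (a x) = 0" "delta01 (a x) = 0"
proof -
  define N10 D10 N01 D01 where defs: "N10 = nabla10 G a x" "D10 = delta10 (a x)" "N01 = nabla01 G a x" "D01 = delta01 (a x)"
  have sum0: "N10 k M S - D10 k M S + (N01 k M S - D01 k M S) = 0" for k M S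
    using fun_cong[OF fun_cong[OF fun_cong[OF d]], of k M S] unfolding dd_split defs by simp
  have f10: "homog (\<lambda>_. 0) hol 2 N10" "homog (\<lambda>_. 0) hol 2 D10"
    unfolding defs by (rule homog_nabla10[OF x _ _ f] homog_delta10[OF f[OF x], of 1]; simp)+
  have f01: "homog (\<lambda>_. 0) hol 1 N01" "homog (\<lambda>_. 0) hol 1 D01"
    unfolding defs by (rule homog_nabla01[OF x _ _ f] homog_delta01[OF f[OF x], of 1]; simp)+
  have hN: "homog (\<lambda>_. 1) (\<lambda>_. 0) n N10" "homog (\<lambda>_. 1) (\<lambda>_. 0) n N01"
    unfolding defs by (rule homog_nabla10[OF x _ _ h] homog_nabla01[OF x _ _ h]; simp)+
  have hD: "D k M S \<noteq> 0 \<Longrightarrow> wt (\<lambda>_. 1) (\<lambda>_. 0) M S \<noteq> n" if "D = D10 \<or> D = D01" for D k M S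
  proof (cases n)
    \<comment> \<open>There is no degree below 0 to be lowered to; instead the section is constant
      along the fibre and both \<delta> terms vanish.\<close>
    case 0
    then have "dy A (a x) = 0" for A using homog_dy_zero[OF h[OF x]] by simp
    then have "D10 = 0" "D01 = 0" by (simp_all add: defs delta10_def delta01_def)
    then show "D k M S \<noteq> 0 \<Longrightarrow> wt (\<lambda>_. 1) (\<lambda>_. 0) M S \<noteq> n" using that by auto
  next
    case (Suc m)
    have "homog (\<lambda>_. 1) (\<lambda>_. 0) m D10" "homog (\<lambda>_. 1) (\<lambda>_. 0) m D01"
      unfolding defs by (rule homog_delta10[OF h[OF x], of m] homog_delta01[OF h[OF x], of m]; simp add: Suc)+
    then show "D k M S \<noteq> 0 \<Longrightarrow> wt (\<lambda>_. 1) (\<lambda>_. 0) M S \<noteq> n" using that Suc homogD by fastforce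
  qed
  have z: "N10 k M S = 0 \<and> D10 k M S = 0 \<and> D01 k M S = 0" for k M S
  proof (cases "wt (\<lambda>_. 0) hol M S = 2")
    case True
    then have "N01 k M S = 0" "D01 k M S = 0" using homogD[OF f01(1), of k M S] homogD[OF f01(2), of k M S] by auto
    moreover have "N10 k M S = 0 \<or> D10 k M S = 0" using homogD[OF hN(1), of k M S] hD[of D10 k M S] by auto
    ultimately show ?thesis using sum0[of k M S] by auto
  next
    case False
    then have "N10 k M S = 0" "D10 k M S = 0" using homogD[OF f10(1), of k M S] homogD[OF f10(2), of k M S] by auto
    moreover have "N01 k M S = 0 \<or> D01 k M S = 0" using homogD[OF hN(2), of k M S] hD[of D01 k M S] by auto
    ultimately show ?thesis using sum0[of k M S] by auto
  qed
  show "nabla10 G a x = 0" "delta10 (a x) = 0" "delta01 (a x) = 0"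
    using z unfolding defs by (simp_all add: fun_eq_iff)
qed

end

text \<open>Successive approximation for \<delta> A = \<nabla> A + \<beta> in the (1,0)-direction:
  comparing degrees in y, the lowest term is a primitive of \<beta> and each later term a primitive
  of the derivative of its predecessor.\<close>

fun hs :: "(complex^'n \<Rightarrow> complex^'n^'n) \<Rightarrow> (complex^'n \<Rightarrow> 'n::finite weyl) \<Rightarrow> nat \<Rightarrow> complex^'n \<Rightarrow> 'n weyl" where
  "hs G \<beta> 0 = (\<lambda>x. delta10_inv (\<beta> x))"
| "hs G \<beta> (Suc n) = (\<lambda>x. delta10_inv (nabla10 G (hs G \<beta> n) x))"

text \<open>\<open>hs_tot\<close> is the sum of all \<open>hs G \<beta> n\<close> for \<open>\<beta>\<close> of degree \<open>n0\<close> in \<open>y\<close>; the \<open>n\<close>-th of them has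
  degree \<open>n0 + 1 + n\<close> in \<open>y\<close>.\<close>

definition hs_deg :: "(complex^'n \<Rightarrow> complex^'n^'n) \<Rightarrow> (complex^'n \<Rightarrow> 'n::finite weyl) \<Rightarrow> nat \<Rightarrow> nat \<Rightarrow> complex^'n \<Rightarrow> 'n weyl" where
  "hs_deg G \<beta> n0 n x = (if n \<le> n0 then 0 else hs G \<beta> (n - Suc n0) x)"

definition hs_tot :: "(complex^'n \<Rightarrow> complex^'n^'n) \<Rightarrow> (complex^'n \<Rightarrow> 'n::finite weyl) \<Rightarrow> nat \<Rightarrow> complex^'n \<Rightarrow> 'n weyl" where
  "hs_tot G \<beta> n0 x = (\<lambda>k M S. hs_deg G \<beta> n0 (\<Sum>i\<in>UNIV. M (Inl i)) x k M S)"

text \<open>A closed (1,1)-source of degree \<open>n0\<close> in y and \<open>r\<close> in y-bar.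
  Both uses are instances: the curvature has n0 = r = 1, and -\<alpha> has n0 = r = 0.\<close>

locale hol_source = kaehler_chart U G
  for U :: "(complex^'n::finite) set" and G +
  fixes \<beta> :: "complex^'n \<Rightarrow> 'n weyl" and n0 r :: nat
  assumes ssec_\<beta>: "ssec U \<beta>"
    and form_hol_\<beta>: "\<And>x. x \<in> U \<Longrightarrow> homog (\<lambda>_. 0) hol 1 (\<beta> x)"
    and form_anti_\<beta>: "\<And>x. x \<in> U \<Longrightarrow> homog (\<lambda>_. 0) anti 1 (\<beta> x)"
    and hol_\<beta>: "\<And>x. x \<in> U \<Longrightarrow> homog hol (\<lambda>_. 0) n0 (\<beta> x)"
    and anti_\<beta>: "\<And>x. x \<in> U \<Longrightarrow> homog anti (\<lambda>_. 0) r (\<beta> x)"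
    and dd_\<beta>: "\<And>x. x \<in> U \<Longrightarrow> dd \<beta> x = 0"
begin

lemma total_\<beta>: "x \<in> U \<Longrightarrow> homog (\<lambda>_. 1) (\<lambda>_. 0) (n0 + r) (\<beta> x)"
proof -
  assume x: "x \<in> U"
  have e: "hol A * m + anti A * m = m" for A :: "'n ix" and m by (cases A) auto
  then have "wt (\<lambda>_. 1) (\<lambda>_. 0) M S = wt hol (\<lambda>_. 0) M S + wt anti (\<lambda>_. 0) M S" for M and S :: "'n ix set"
    by (simp add: wt_def flip: sum.distrib)
  then show ?thesis using hol_\<beta>[OF x] anti_\<beta>[OF x] by (simp add: homog_def)
qed

lemma components_\<beta>:
  assumes "x \<in> U"
  shows "nabla10 G \<beta> x = 0" "delta10 (\<beta> x) = 0" "delta01 (\<beta> x) = 0"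
  using dd_zero_components[OF assms form_hol_\<beta> total_\<beta> dd_\<beta>[OF assms]] by auto

lemma hs_props:
  "ssec U (hs G \<beta> n)"
  "x \<in> U \<Longrightarrow> homog hol (\<lambda>_. 0) (Suc (n0 + n)) (hs G \<beta> n x)"
  "x \<in> U \<Longrightarrow> homog anti (\<lambda>_. 0) r (hs G \<beta> n x)"
  "x \<in> U \<Longrightarrow> homog (\<lambda>_. 0) hol 0 (hs G \<beta> n x)"
  "x \<in> U \<Longrightarrow> homog (\<lambda>_. 0) anti 1 (hs G \<beta> n x)"
proof -
  have step: "ssec U (\<lambda>x. delta10_inv (c x)) \<and> (\<forall>x\<in>U. homog hol (\<lambda>_. 0) (Suc m) (delta10_inv (c x)) \<and>
      homog anti (\<lambda>_. 0) r (delta10_inv (c x)) \<and>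
      homog (\<lambda>_. 0) hol 0 (delta10_inv (c x)) \<and> homog (\<lambda>_. 0) anti 1 (delta10_inv (c x)))"
    if c: "ssec U c" "\<And>x. x \<in> U \<Longrightarrow> homog (\<lambda>_. 0) hol 1 (c x)" "\<And>x. x \<in> U \<Longrightarrow> homog (\<lambda>_. 0) anti 1 (c x)"
      "\<And>x. x \<in> U \<Longrightarrow> homog hol (\<lambda>_. 0) m (c x)" "\<And>x. x \<in> U \<Longrightarrow> homog anti (\<lambda>_. 0) r (c x)" for c m
  proof (intro conjI ballI)
    show "ssec U (\<lambda>x. delta10_inv (c x))" by (rule ssec_delta10_inv[OF U c(1)])
    fix x assume x: "x \<in> U"
    show "homog hol (\<lambda>_. 0) (Suc m) (delta10_inv (c x))"
      unfolding delta10_inv_iota[OF c(2,4)[OF x]] by (intro homog_scl homog_iota[OF c(4)[OF x], of "\<lambda>_. m"]) auto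
    show "homog anti (\<lambda>_. 0) r (delta10_inv (c x))"
      unfolding delta10_inv_iota[OF c(2,4)[OF x]] by (intro homog_scl homog_iota[OF c(5)[OF x], of "\<lambda>_. r"]) auto
    show "homog (\<lambda>_. 0) hol 0 (delta10_inv (c x))"
      unfolding delta10_inv_iota[OF c(2,4)[OF x]] by (intro homog_scl homog_iota[OF c(2)[OF x], of "\<lambda>_. 0"]) auto
    show "homog (\<lambda>_. 0) anti 1 (delta10_inv (c x))"
      unfolding delta10_inv_iota[OF c(2,4)[OF x]] by (intro homog_scl homog_iota[OF c(3)[OF x], of "\<lambda>_. 1"]) auto
  qed
  have "ssec U (hs G \<beta> n) \<and> (\<forall>x\<in>U. homog hol (\<lambda>_. 0) (Suc (n0 + n)) (hs G \<beta> n x) \<and>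
      homog anti (\<lambda>_. 0) r (hs G \<beta> n x) \<and>
      homog (\<lambda>_. 0) hol 0 (hs G \<beta> n x) \<and> homog (\<lambda>_. 0) anti 1 (hs G \<beta> n x))"
  proof (induction n)
    case 0
    show ?case unfolding hs.simps add_0_right
      by (rule step) (use ssec_\<beta> form_hol_\<beta> form_anti_\<beta> hol_\<beta> anti_\<beta> in auto)
  next
    case (Suc n)
    show ?case unfolding hs.simps
    proof (rule step)
      show "ssec U (nabla10 G (hs G \<beta> n))" using Suc ssec_nabla10 by blast
      fix x assume x: "x \<in> U"
      show "homog (\<lambda>_. 0) hol 1 (nabla10 G (hs G \<beta> n) x)"
        by (rule homog_nabla10[OF x, where n = 0]) (use Suc in auto)
      show "homog (\<lambda>_. 0) anti 1 (nabla10 G (hs G \<beta> n) x)"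
        by (rule homog_nabla10[OF x, where n = 1]) (use Suc in auto)
      show "homog hol (\<lambda>_. 0) (n0 + Suc n) (nabla10 G (hs G \<beta> n) x)"
        by (rule homog_nabla10[OF x, where n = "Suc (n0 + n)"]) (use Suc in auto)
      show "homog anti (\<lambda>_. 0) r (nabla10 G (hs G \<beta> n) x)"
        by (rule homog_nabla10[OF x, where n = r]) (use Suc in auto)
    qed
  qed
  then show "ssec U (hs G \<beta> n)"
    "x \<in> U \<Longrightarrow> homog hol (\<lambda>_. 0) (Suc (n0 + n)) (hs G \<beta> n x)"
    "x \<in> U \<Longrightarrow> homog anti (\<lambda>_. 0) r (hs G \<beta> n x)"
    "x \<in> U \<Longrightarrow> homog (\<lambda>_. 0) hol 0 (hs G \<beta> n x)"
    "x \<in> U \<Longrightarrow> homog (\<lambda>_. 0) anti 1 (hs G \<beta> n x)" by auto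
qed

lemma nabla10_hs:
  assumes x: "x \<in> U"
  shows "homog (\<lambda>_. 0) hol 1 (nabla10 G (hs G \<beta> n) x)"
    "homog hol (\<lambda>_. 0) (Suc (n0 + n)) (nabla10 G (hs G \<beta> n) x)"
  by (rule homog_nabla10[OF x, where n = 0] homog_nabla10[OF x, where n = "Suc (n0 + n)"];
      simp add: hs_props)+

text \<open>The homotopy formula needs a closed argument: the derivative of each term is
  \<open>delta10\<close>-closed because \<open>nabla10\<close> anticommutes with
  \<open>delta10\<close> and squares to zero, or annihilates \<beta> at the start.\<close>

lemma delta10_hs:
  assumes x: "x \<in> U"
  shows "delta10 (hs G \<beta> 0 x) = \<beta> x" "delta10 (hs G \<beta> (Suc n) x) = nabla10 G (hs G \<beta> n) x"
proof -
  have s: "scl (1 / of_nat (Suc m)) (scl (of_nat (Suc m)) c) = c" for m and c :: "'n weyl"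
    by (simp del: of_nat_Suc)
  have 0: "delta10 (hs G \<beta> 0 x) = \<beta> x" if x: "x \<in> U" for x
    by (simp only: hs.simps delta10_inv_iota[OF form_hol_\<beta>[OF x] hol_\<beta>[OF x]] delta10_scl
        delta10_iota[OF components_\<beta>(2)[OF x] form_hol_\<beta>[OF x] hol_\<beta>[OF x]] s)
  then show "delta10 (hs G \<beta> 0 x) = \<beta> x" using x .
  show "delta10 (hs G \<beta> (Suc n) x) = nabla10 G (hs G \<beta> n) x"
    using x
  proof (induction n arbitrary: x)
    case 0
    have "nabla10 G (\<lambda>x. delta10 (hs G \<beta> 0 x)) x = nabla10 G \<beta> x"
      by (rule nabla10_cong[OF 0]) (rule \<open>\<And>x. x \<in> U \<Longrightarrow> delta10 (hs G \<beta> 0 x) = \<beta> x\<close>)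
    then have "delta10 (nabla10 G (hs G \<beta> 0) x) = 0"
      by (simp only: nabla10_delta10[OF 0 hs_props(1)] components_\<beta>(1)[OF 0] neg_equal_0_iff_equal)
    then show ?case
      by (simp only: hs.simps(2) delta10_inv_iota[OF nabla10_hs[OF 0]] delta10_scl delta10_iota[OF _ nabla10_hs[OF 0]] s)
  next
    case (Suc n)
    have "nabla10 G (\<lambda>x. delta10 (hs G \<beta> (Suc n) x)) x = nabla10 G (nabla10 G (hs G \<beta> n)) x"
      by (rule nabla10_cong[OF Suc.prems]) (rule Suc.IH)
    then have "delta10 (nabla10 G (hs G \<beta> (Suc n)) x) = 0"
      by (simp only: nabla10_delta10[OF Suc.prems hs_props(1)] nabla10_square[OF Suc.prems hs_props(1)] neg_equal_0_iff_equal)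
    then show ?case
      by (simp only: hs.simps(2)[of G \<beta> "Suc n"] delta10_inv_iota[OF nabla10_hs[OF Suc.prems]] delta10_scl delta10_iota[OF _ nabla10_hs[OF Suc.prems]] s)
  qed
qed

lemma delta01_hs: "x \<in> U \<Longrightarrow> delta01 (hs G \<beta> n x) = 0"
proof (induction n arbitrary: x)
  case 0
  then show ?case
    by (simp only: hs.simps(1) delta10_inv_iota[OF form_hol_\<beta>[OF 0] hol_\<beta>[OF 0]] delta01_scl delta01_iota
        components_\<beta>(3)[OF 0] iota_zero scl_zero minus_zero)
next
  case (Suc n)
  have "nabla10 G (\<lambda>x. delta01 (hs G \<beta> n x)) x = nabla10 G (\<lambda>_. 0) x"
    by (rule nabla10_cong[OF Suc.prems]) (rule Suc.IH)
  then have "delta01 (nabla10 G (hs G \<beta> n) x) = 0"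
    by (simp only: nabla10_delta01[OF Suc.prems hs_props(1)] nabla10_const0 neg_equal_0_iff_equal)
  then show ?case
    by (simp only: hs.simps(2) delta10_inv_iota[OF nabla10_hs[OF Suc.prems]] delta01_scl delta01_iota iota_zero scl_zero minus_zero)
qed

lemma hs_deg_props:
  "ssec U (hs_deg G \<beta> n0 n)"
  "x \<in> U \<Longrightarrow> homog hol (\<lambda>_. 0) n (hs_deg G \<beta> n0 n x)"
  "x \<in> U \<Longrightarrow> homog anti (\<lambda>_. 0) r (hs_deg G \<beta> n0 n x)"
  "x \<in> U \<Longrightarrow> homog (\<lambda>_. 0) hol 0 (hs_deg G \<beta> n0 n x)"
  "x \<in> U \<Longrightarrow> homog (\<lambda>_. 0) anti 1 (hs_deg G \<beta> n0 n x)"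
  "x \<in> U \<Longrightarrow> delta01 (hs_deg G \<beta> n0 n x) = 0"
  "x \<in> U \<Longrightarrow> delta10 (hs_deg G \<beta> n0 (Suc n) x) = nabla10 G (hs_deg G \<beta> n0 n) x + (if n = n0 then \<beta> x else 0)"
proof -
  show "ssec U (hs_deg G \<beta> n0 n)"
    unfolding hs_deg_def[abs_def] using hs_props(1) by (cases "n \<le> n0") simp_all
  have "Suc (n0 + (n - Suc n0)) = n" if "\<not> n \<le> n0" using that by simp
  then show "x \<in> U \<Longrightarrow> homog hol (\<lambda>_. 0) n (hs_deg G \<beta> n0 n x)"
    using hs_props(2)[of x "n - Suc n0"] by (cases "n \<le> n0") (simp_all add: hs_deg_def)
  show "x \<in> U \<Longrightarrow> homog anti (\<lambda>_. 0) r (hs_deg G \<beta> n0 n x)" "x \<in> U \<Longrightarrow> homog (\<lambda>_. 0) hol 0 (hs_deg G \<beta> n0 n x)"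
    "x \<in> U \<Longrightarrow> homog (\<lambda>_. 0) anti 1 (hs_deg G \<beta> n0 n x)" "x \<in> U \<Longrightarrow> delta01 (hs_deg G \<beta> n0 n x) = 0"
    using hs_props(3)[of x "n - Suc n0"] hs_props(4)[of x "n - Suc n0"] hs_props(5)[of x "n - Suc n0"] delta01_hs[of x "n - Suc n0"] by (simp_all add: hs_deg_def)
  assume x: "x \<in> U"
  consider "n < n0" | "n = n0" | m where "n = Suc (n0 + m)"
    by (metis less_imp_Suc_add linorder_neqE_nat)
  then show "delta10 (hs_deg G \<beta> n0 (Suc n) x) = nabla10 G (hs_deg G \<beta> n0 n) x + (if n = n0 then \<beta> x else 0)"
  proof cases
    case 3
    have "hs_deg G \<beta> n0 (Suc n) = hs G \<beta> (Suc m)" "hs_deg G \<beta> n0 n = hs G \<beta> m" "n \<noteq> n0"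
      using 3 by (simp_all add: hs_deg_def[abs_def] Suc_diff_le del: hs.simps)
    then show ?thesis using delta10_hs(2)[OF x, of m] by (simp del: hs.simps)
  qed (use delta10_hs(1)[OF x] in \<open>simp_all add: hs_deg_def[abs_def] del: hs.simps\<close>)
qed

lemma hs_tot_homog:
  assumes x: "x \<in> U"
  shows "homog anti (\<lambda>_. 0) r (hs_tot G \<beta> n0 x)" "homog (\<lambda>_. 0) hol 0 (hs_tot G \<beta> n0 x)" "homog (\<lambda>_. 0) anti 1 (hs_tot G \<beta> n0 x)"
  using hs_deg_props(3-5)[OF x] by (auto simp: homog_def hs_tot_def)

lemma ssec_hs_tot: "ssec U (hs_tot G \<beta> n0)"
  using hs_deg_props(1) by (auto simp: ssec_def hs_tot_def)

lemma hs_tot_pos: "hs_tot G \<beta> n0 x k M S \<noteq> 0 \<Longrightarrow> 1 \<le> (\<Sum>i\<in>UNIV. M (Inl i))"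
  by (auto simp: hs_tot_def hs_deg_def split: if_splits)

lemma delta01_hs_tot:
  assumes x: "x \<in> U"
  shows "delta01 (hs_tot G \<beta> n0 x) = 0"
proof (intro ext)
  fix k M S
  have "delta01 (hs_tot G \<beta> n0 x) k M S = delta01 (hs_deg G \<beta> n0 (\<Sum>i\<in>UNIV. M (Inl i)) x) k M S"
    by (simp add: delta01_def weyl_sum_apply dxgen_wmul dy_def hs_tot_def)
  then show "delta01 (hs_tot G \<beta> n0 x) k M S = 0 k M S" by (simp add: hs_deg_props(6)[OF x])
qed

text \<open>In degree n of y only the terms of degrees n and n + 1 enter, and they cancel by the
  recursion except in degree \<open>n0\<close>, where the source is left over. Note the sign: the
  total solves the equation with right-hand side -\<beta>.\<close>

lemma nabla10_hs_tot:
  assumes x: "x \<in> U"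
  shows "nabla10 G (hs_tot G \<beta> n0) x - delta10 (hs_tot G \<beta> n0 x) = - \<beta> x"
proof (intro ext)
  fix k and M :: "'n ix \<Rightarrow> nat" and S :: "'n ix set"
  let ?n = "\<Sum>i\<in>UNIV. M (Inl i)"
  have "cov_deriv G B (hs_tot G \<beta> n0) x k M S = cov_deriv G B (hs_deg G \<beta> n0 ?n) x k M S" for B S
    by (rule cov_deg_local[OF x, where u = hol and v = "\<lambda>_. 0"]) (simp_all add: wt_hol hs_tot_def)
  then have "nabla10 G (hs_tot G \<beta> n0) x k M S = nabla10 G (hs_deg G \<beta> n0 ?n) x k M S"
    by (simp add: nabla10_def weyl_sum_apply dxgen_wmul cong: if_cong)
  moreover have "delta10 (hs_tot G \<beta> n0 x) k M S = delta10 (hs_deg G \<beta> n0 (Suc ?n) x) k M S"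
  proof -
    have "(\<Sum>i\<in>UNIV. (M(Inl j := Suc (M (Inl j)))) (Inl i)) = Suc ?n" for j
      using wt_upd[of hol "\<lambda>_. 0" M "Inl j" "{}"] by (simp add: wt_hol)
    then show ?thesis by (simp add: delta10_def weyl_sum_apply dxgen_wmul dy_def hs_tot_def cong: if_cong)
  qed
  moreover have "\<beta> x k M S = 0" if "?n \<noteq> n0"
    using homogD[OF hol_\<beta>[OF x], of k M S] that by (auto simp: wt_hol)
  ultimately show "(nabla10 G (hs_tot G \<beta> n0) x - delta10 (hs_tot G \<beta> n0 x)) k M S = (- \<beta> x) k M S"
    by (simp add: hs_deg_props(7)[OF x])
qed

end

section \<open>The Fedosov equation and flatness\<close>

context kaehler_chart
begin

lemma fedosov_dd: "fedosov_lhs G I x = dd I x + hdiv (wick (om_up G x) (I x) (I x)) + R_nabla G x"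
  by (simp add: fedosov_lhs_def dd_def)

lemma D_F_dd:
  assumes "homog (\<lambda>_. 0) (\<lambda>_. 1) 1 (I x)"
  shows "D_F G I a x = dd a x + hdiv (wick (om_up G x) (I x) (a x) - wick (om_up G x) (sgm (a x)) (I x))"
proof -
  have "I x k M S \<noteq> 0 \<Longrightarrow> card S = 1" for k M S
    using homogD[OF assms, of k M S] by (simp add: wt_form)
  then show ?thesis by (simp add: D_F_def dd_def wick_comm_1)
qed

lemma hmul_inj: "hmul a = hmul b \<Longrightarrow> a = b"
  using hdiv_hmul by metis

text \<open>Membership in the ideal generated by the y^i, in the completed sense.\<close>

definition hpos :: "'n weyl \<Rightarrow> bool" where
  "hpos a \<longleftrightarrow> (\<forall>k M S. a k M S \<noteq> 0 \<longrightarrow> (\<exists>i. M (Inl i) \<noteq> 0))"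

lemma hpos_wmul:
  assumes b: "hpos b"
  shows "hpos (a \<odot> b)"
  unfolding hpos_def
proof (intro allI impI)
  fix k M S assume "(a \<odot> b) k M S \<noteq> 0"
  then obtain z where "z \<in> wdom k M S" and
    "(case z of (j, N, T) \<Rightarrow> wsign T (S - T) * a j N T * b (k - j) (M - N) (S - T)) \<noteq> 0"
    unfolding wmul_wdom by (meson sum.not_neutral_contains_not_neutral)
  then obtain j N T where "b (k - j) (M - N) (S - T) \<noteq> 0" by (auto simp: wdom_def)
  then obtain i where "(M - N) (Inl i) \<noteq> 0" using b hpos_def by blast
  then have "M (Inl i) \<noteq> 0" by simp
  then show "\<exists>i. M (Inl i) \<noteq> 0" ..
qed

text \<open>The Wick product differentiates its right factor in y-bar only, so no y of the right
  factor is consumed by a contraction.\<close>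

lemma hpos_wterm: "hpos b \<Longrightarrow> hpos (wterm w k a b)"
proof (induction k arbitrary: a b)
  case (Suc k)
  have "hpos (dy (Inr j) b)" for j
    using Suc.prems unfolding hpos_def dy_def by (metis Inl_Inr_False fun_upd_other mult_zero_right)
  then have h: "hpos (wterm w k (dy (Inl i) a) (dy (Inr j) b))" for i j by (rule Suc.IH)
  show ?case unfolding hpos_def
  proof (intro allI impI)
    fix h M S assume "wterm w (Suc k) a b h M S \<noteq> 0"
    moreover have "wterm w (Suc k) a b h M S = 0" if "\<nexists>i. M (Inl i) \<noteq> 0"
    proof -
      have "wterm w k (dy (Inl i) a) (dy (Inr j) b) h M S = 0" for i j
        using h[of i j] that unfolding hpos_def by blast
      then show ?thesis by (simp add: weyl_sum_apply)
    qed
    ultimately show "\<exists>i. M (Inl i) \<noteq> 0" by blast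
  qed
qed (simp add: hpos_wmul)

lemma hpos_wick: "hpos b \<Longrightarrow> hpos (wick w a b)"
  unfolding hpos_def[of "wick w a b"]
proof (intro allI impI)
  fix h M S assume b: "hpos b" and "wick w a b h M S \<noteq> 0"
  then obtain k where "wterm w k a b (h - k) M S / fact k \<noteq> 0"
    unfolding wick_wterm by (meson sum.not_neutral_contains_not_neutral)
  then show "\<exists>i. M (Inl i) \<noteq> 0" using hpos_wterm[OF b] unfolding hpos_def by fastforce
qed

text \<open>An element of \<open>\<A>\<^sup>0\<^sup>,\<^sup>2\<close> that is flat for the (1,0)-part of the connection is determined by its part
  without \<open>y\<close>: the equation expresses degree \<open>n + 1\<close> through the derivatives of degree \<open>n\<close>.\<close>

lemma flat_hol_zero:
  assumes f: "\<And>x. x \<in> U \<Longrightarrow> homog (\<lambda>_. 0) hol 0 (\<Omega> x)"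
    and p: "\<And>x. x \<in> U \<Longrightarrow> hpos (\<Omega> x)"
    and flat: "\<And>x. x \<in> U \<Longrightarrow> nabla10 G \<Omega> x = delta10 (\<Omega> x)"
    and x: "x \<in> U"
  shows "\<Omega> x = 0"
proof -
  have c: "cov_deriv G (Inl i) \<Omega> x = dy (Inl i) (\<Omega> x)" if x: "x \<in> U" for x i
  proof -
    define X where "X i = cov_deriv G (Inl i) \<Omega> x - dy (Inl i) (\<Omega> x)" for i
    have "homog (\<lambda>_. 0) hol 0 (X i)" for i
      unfolding X_def by (intro homog_diff homog_cov[OF x _ _ f] homog_dy[OF f[OF x]]) auto
    then have X: "contr (Inl i) (X j) = 0" for i j
    proof (intro ext)
      fix k M S assume h: "\<And>i. homog (\<lambda>_. 0) hol 0 (X i)"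
      have "X j k M (insert (Inl i) S) = 0"
        using homogD[OF h, of j k M "insert (Inl i) S"] by (force simp: wt_form_hol)
      then show "contr (Inl i) (X j) k M S = 0 k M S" by (simp add: contr_def)
    qed
    have "(\<Sum>j\<in>UNIV. dxgen (Inl j) \<odot> X j) = 0"
      using flat[OF x] by (simp add: X_def nabla10_def delta10_def wmul_diff_right sum_subtractf)
    then have "contr (Inl i) (\<Sum>j\<in>UNIV. dxgen (Inl j) \<odot> X j) = 0" by simp
    then have "X i = 0"
      by (simp add: contr_sum contr_dxgen X sum.delta' cong: if_cong)
    then show ?thesis by (simp add: X_def)
  qed
  have "\<Omega> x k M S = 0" if "(\<Sum>i\<in>UNIV. M (Inl i)) = n" "x \<in> U" for n x k M S
    using that
  proof (induction n arbitrary: x k M S)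
    case 0
    then have "\<nexists>i. M (Inl i) \<noteq> 0" by simp
    then show ?case using p[OF 0(2)] unfolding hpos_def by blast
  next
    case (Suc n)
    then have "\<exists>i. M (Inl i) \<noteq> 0" by (metis nat.distinct(1) sum.neutral)
    then obtain i where i: "M (Inl i) \<noteq> 0" ..
    let ?M = "M(Inl i := M (Inl i) - 1)"
    have w: "(\<Sum>i\<in>UNIV. ?M (Inl i)) = n"
      using wt_dec[of M "Inl i" hol "\<lambda>_. 0" "{}"] i Suc.prems(1) unfolding wt_hol by simp
    \<comment> \<open>The induction hypothesis makes the degree n part vanish at every point of
      \<open>U\<close>, so its covariant derivative vanishes too and the flatness equation kills
      degree n + 1.\<close>
    have "cov_deriv G (Inl i) \<Omega> x k ?M S = cov_deriv G (Inl i) (\<lambda>_. 0) x k ?M S"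
    proof (rule cov_deg_local[OF Suc.prems(2), where u = hol and v = "\<lambda>_. 0"])
      fix y N assume "y \<in> U" "wt hol (\<lambda>_. 0) N S = wt hol (\<lambda>_. 0) ?M S"
      then show "\<Omega> y k N S = 0 k N S" using Suc.IH[of N y k S] w by (simp add: wt_hol)
    qed auto
    then have "dy (Inl i) (\<Omega> x) k ?M S = 0" unfolding c[OF Suc.prems(2)] by simp
    then show ?case using i by (simp add: dy_def flip: of_nat_Suc)
  qed
  then show ?thesis using x by (simp add: fun_eq_iff)
qed

end

text \<open>The section \<open>I\<close> is only required to solve the (1,1)-part
  \<open>I_10\<close> within the ansatz; the (0,2)-part of the Fedosov equation is a conclusion, for
  which \<open>I_pos\<close> supplies the initial condition.\<close>

locale fedosov_data = kaehler_chart U G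
  for U :: "(complex^'n::finite) set" and G +
  fixes I \<alpha> :: "complex^'n \<Rightarrow> 'n weyl"
  assumes ssec_I: "ssec U I" and ssec_\<alpha>: "ssec U \<alpha>"
    and I_hol: "\<And>x. x \<in> U \<Longrightarrow> homog (\<lambda>_. 0) hol 0 (I x)"
    and I_anti: "\<And>x. x \<in> U \<Longrightarrow> homog (\<lambda>_. 0) anti 1 (I x)"
    and I_pos: "\<And>x. x \<in> U \<Longrightarrow> hpos (I x)"
    and I_delta01: "\<And>x. x \<in> U \<Longrightarrow> delta01 (I x) = 0"
    and I_10: "\<And>x. x \<in> U \<Longrightarrow> nabla10 G I x - delta10 (I x) + R_nabla G x = \<alpha> x"
    and \<alpha>_form: "\<And>x. x \<in> U \<Longrightarrow> homog (\<lambda>_. 0) (\<lambda>_. 1) 2 (\<alpha> x)"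
    and \<alpha>_const: "\<And>x A. x \<in> U \<Longrightarrow> dy A (\<alpha> x) = 0"
    and dd_\<alpha>: "\<And>x. x \<in> U \<Longrightarrow> dd \<alpha> x = 0"
begin

abbreviation "w \<equiv> om_up G"

lemma I_form: "x \<in> U \<Longrightarrow> homog (\<lambda>_. 0) (\<lambda>_. 1) 1 (I x)"
  using homog_form[OF I_hol I_anti] by simp

lemma sgm_I: "x \<in> U \<Longrightarrow> sgm (I x) = - I x"
  using sgm_homog[OF I_form] by (simp add: scl_uminus)

definition II :: "complex^'n \<Rightarrow> 'n weyl" where "II x = hdiv (wick (w x) (I x) (I x))"

lemma hmul_II:
  assumes x: "x \<in> U"
  shows "hmul (II x) = wick (w x) (I x) (I x)"
  unfolding II_def
proof (rule hmul_hdiv_square)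
  show "I x k M S \<noteq> 0 \<Longrightarrow> card S = 1" for k M S
    using homogD[OF I_form[OF x], of k M S] by (simp add: wt_form)
qed

lemma \<alpha>_central: "x \<in> U \<Longrightarrow> wick (w x) (\<alpha> x) a = wick (w x) a (\<alpha> x)"
proof -
  assume x: "x \<in> U"
  have "wick (w x) (\<alpha> x) a = \<alpha> x \<odot> a" "wick (w x) a (\<alpha> x) = a \<odot> \<alpha> x"
    by (subst wick_first_order; simp add: \<alpha>_const[OF x])+
  moreover have "\<alpha> x \<odot> a = a \<odot> \<alpha> x"
  proof (rule wmul_comm_even)
    fix k M S assume "\<alpha> x k M S \<noteq> 0"
    then show "even (card S)" using homogD[OF \<alpha>_form[OF x], of k M S] by (simp add: wt_form)
  qed
  ultimately show ?thesis by simp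
qed

lemma ssec_wick': "ssec U a \<Longrightarrow> ssec U b \<Longrightarrow> ssec U (\<lambda>x. wick (w x) (a x) (b x))"
  by (rule ssec_wick[OF U smooth_om_up])

lemma ssec_II: "ssec U II"
  unfolding II_def[abs_def] by (intro ssec_hdiv ssec_wick' ssec_I)

lemma dd_II:
  assumes x: "x \<in> U"
  shows "dd II x = hdiv (wick (w x) (dd I x) (I x) - wick (w x) (I x) (dd I x))"
  unfolding II_def[abs_def]
  by (simp add: dd_hdiv dd_wick[OF x ssec_I ssec_I] sgm_I[OF x] wick_uminus)

text \<open>By associativity an element commutes with its own square. The comparison is made after
  multiplication by \<hbar>, where \<open>II\<close> becomes an honest Wick square.\<close>

lemma II_commutes:
  assumes x: "x \<in> U"
  shows "wick (w x) (I x) (II x) = wick (w x) (II x) (I x)"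
proof (rule hmul_inj)
  show "hmul (wick (w x) (I x) (II x)) = hmul (wick (w x) (II x) (I x))"
    unfolding wick_hmul_left[symmetric, of _ "II x"] wick_hmul_right[symmetric, of _ _ "II x"] hmul_II[OF x] wick_assoc ..
qed

theorem fedosov_equation:
  assumes x: "x \<in> U"
  shows "fedosov_lhs G I x = \<alpha> x"
proof -
  define \<Omega> where "\<Omega> x = dd I x + II x + R_nabla G x - \<alpha> x" for x
  \<comment> \<open>\<open>I_10\<close> removes the (1,1)-part of the defect and
    \<open>I_delta01\<close> the only linear \<delta> term of type (0,2).\<close>
  have \<Omega>01: "\<Omega> x = nabla01 G I x + II x" if x: "x \<in> U" for x
  proof -
    have "\<Omega> x = (nabla10 G I x - delta10 (I x) + R_nabla G x) - \<alpha> x + nabla01 G I x - delta01 (I x) + II x"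
      unfolding \<Omega>_def dd_split by (simp add: algebra_simps)
    then show ?thesis unfolding I_10[OF x] I_delta01[OF x] by simp
  qed
  have \<Omega>_hol: "homog (\<lambda>_. 0) hol 0 (\<Omega> x)" if x: "x \<in> U" for x
    unfolding \<Omega>01[OF x] II_def
    using homog_wick[OF I_hol[OF x] I_hol[OF x]]
    by (intro homog_add homog_hdiv homog_nabla01[OF x _ _ I_hol]) simp_all
  have \<Omega>_anti: "homog (\<lambda>_. 0) anti 2 (\<Omega> x)" if x: "x \<in> U" for x
    unfolding \<Omega>01[OF x] II_def
    using homog_wick[OF I_anti[OF x] I_anti[OF x]]
    by (intro homog_add homog_hdiv homog_nabla01[OF x _ _ I_anti]) (simp_all add: numeral_2_eq_2)
  have \<Omega>_pos: "hpos (\<Omega> x)" if x: "x \<in> U" for x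
    unfolding hpos_def
  proof (intro allI impI, rule ccontr)
    fix k M S assume 1: "\<Omega> x k M S \<noteq> 0" and 2: "\<nexists>i. M (Inl i) \<noteq> 0"
    \<comment> \<open>\<open>I\<close> has no part of degree 0 in y, and the connection preserves
      that degree, so no derivative of \<open>I\<close> can produce such a part.\<close>
    have "cov_deriv G B I x k M T = cov_deriv G B (\<lambda>_. 0) x k M T" for B T
    proof (rule cov_deg_local[OF x, where u = hol and v = "\<lambda>_. 0"])
      fix y N assume "y \<in> U" "wt hol (\<lambda>_. 0) N T = wt hol (\<lambda>_. 0) M T"
      then have "I y k N T = 0" using I_pos[of y] 2 unfolding hpos_def wt_hol by (metis sum.neutral sum_eq_0_iff finite UNIV_I)
      then show "I y k N T = 0 k N T" by simp
    qed auto
    then have "nabla01 G I x k M S = 0" by (simp add: nabla01_def weyl_sum_apply dxgen_wmul cong: if_cong)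
    moreover have "II x k M S = 0"
    proof -
      have "wick (w x) (I x) (I x) (Suc k) M S = 0"
        using hpos_wick[OF I_pos[OF x], of "w x" "I x"] 2 unfolding hpos_def by blast
      then show ?thesis by (simp add: II_def hdiv_def)
    qed
    ultimately show False using 1 by (simp add: \<Omega>01[OF x])
  qed
  \<comment> \<open>The Bianchi identity of the connection with potential \<open>I\<close>: the
    terms in the curvature and in \<open>dd I\<close> cancel against the bracket, \<open>II\<close>
    commutes with \<open>I\<close>, and \<alpha> is closed and central.\<close>
  have \<Omega>_bianchi: "dd \<Omega> x + hdiv (wick (w x) (I x) (\<Omega> x) - wick (w x) (\<Omega> x) (I x)) = 0" if x: "x \<in> U" for x
  proof -
    have "dd \<Omega> x = dd (dd I) x + dd II x + dd (R_nabla G) x - dd \<alpha> x"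
      unfolding \<Omega>_def[abs_def]
      by (simp add: dd_diff[OF x] dd_add[OF x] ssec_add[OF U] ssec_dd ssec_I ssec_II ssec_R_nabla ssec_\<alpha>)
    also have "\<dots> = hdiv (wick (w x) (R_nabla G x) (I x) - wick (w x) (I x) (R_nabla G x)) +
        hdiv (wick (w x) (dd I x) (I x) - wick (w x) (I x) (dd I x))"
      by (simp add: dd_square[OF x ssec_I] dd_II[OF x] dd_R_nabla[OF x] dd_\<alpha>[OF x])
    finally show ?thesis
      unfolding \<Omega>_def
      by (simp add: wick_add_left wick_add_right wick_diff_left wick_diff_right hdiv_add hdiv_diff hdiv_uminus
          II_commutes[OF x] \<alpha>_central[OF x])
  qed
  have flat: "nabla10 G \<Omega> x = delta10 (\<Omega> x)" if x: "x \<in> U" for x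
  proof -
    \<comment> \<open>All terms without dz are collected in \<open>Y\<close>. The remaining ones
      contain exactly one dz, so the two groups vanish separately and the unknown bracket disappears
      from the flatness equation.\<close>
    define Y where "Y = nabla01 G \<Omega> x - delta01 (\<Omega> x) + hdiv (wick (w x) (I x) (\<Omega> x) - wick (w x) (\<Omega> x) (I x))"
    have Y: "homog (\<lambda>_. 0) hol 0 Y"
      unfolding Y_def
      using homog_wick[OF I_hol[OF x] \<Omega>_hol[OF x]] homog_wick[OF \<Omega>_hol[OF x] I_hol[OF x]]
      by (intro homog_add homog_diff homog_hdiv homog_nabla01[OF x _ _ \<Omega>_hol] homog_delta01[OF \<Omega>_hol[OF x], of 0]) simp_all
    have X: "homog (\<lambda>_. 0) hol 1 (nabla10 G \<Omega> x - delta10 (\<Omega> x))"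
      by (intro homog_diff homog_nabla10[OF x _ _ \<Omega>_hol] homog_delta10[OF \<Omega>_hol[OF x], of 0]) simp_all
    have s: "nabla10 G \<Omega> x - delta10 (\<Omega> x) + Y = 0"
      using \<Omega>_bianchi[OF x] unfolding dd_split Y_def by (simp only: add.assoc)
    show ?thesis
    proof (intro ext)
      fix k M S
      have "(nabla10 G \<Omega> x - delta10 (\<Omega> x)) k M S + Y k M S = 0"
        using fun_cong[OF fun_cong[OF fun_cong[OF s]], of k M S] by simp
      moreover have "(nabla10 G \<Omega> x - delta10 (\<Omega> x)) k M S = 0 \<or> Y k M S = 0"
        using homogD[OF X, of k M S] homogD[OF Y, of k M S] by force
      ultimately show "nabla10 G \<Omega> x k M S = delta10 (\<Omega> x) k M S" by auto
    qed
  qed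
  have "\<Omega> x = 0" by (rule flat_hol_zero[OF \<Omega>_hol \<Omega>_pos flat x])
  then show ?thesis by (simp add: \<Omega>_def fedosov_dd II_def)
qed

theorem D_F_square:
  assumes x: "x \<in> U" and a: "ssec U a"
  shows "D_F G I (D_F G I a) x = 0"
proof -
  define L where "L x = wick (w x) (I x) (a x) - wick (w x) (sgm (a x)) (I x)" for x
  have sL: "ssec U L"
    unfolding L_def[abs_def] by (intro ssec_diff ssec_wick' ssec_sgm ssec_I a U)
  have DF: "D_F G I a y = dd a y + hdiv (L y)" if "y \<in> U" for y
    unfolding L_def by (rule D_F_dd[of I y a, OF I_form[OF that]])
  have hL: "hmul (hdiv (L x)) = L x"
  proof -
    have "I x k M S \<noteq> 0 \<Longrightarrow> card S = 1" for k M S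
      using homogD[OF I_form[OF x], of k M S] by (simp add: wt_form)
    then have "L x = wick_comm (w x) (I x) (a x)" by (simp add: L_def wick_comm_1)
    then show ?thesis by (simp add: hmul_hdiv_comm)
  qed
  have ddL: "dd L x = wick (w x) (dd I x) (a x) - wick (w x) (I x) (dd a x) + wick (w x) (sgm (dd a x)) (I x) - wick (w x) (a x) (dd I x)"
    unfolding L_def[abs_def]
    by (simp add: dd_diff[OF x] ssec_wick' ssec_I a ssec_sgm[OF U] dd_wick[OF x] sgm_I[OF x] wick_uminus dd_sgm[OF x])
  \<comment> \<open>The graded Jacobi identity for the odd element \<open>I\<close>: its double
    bracket is the bracket with its square. Associativity gives it after one multiplication by
    \<hbar>, and \<open>hmul_inj\<close> removes that factor.\<close>
  have LL: "wick (w x) (I x) (hdiv (L x)) - wick (w x) (sgm (hdiv (L x))) (I x) =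
      wick (w x) (II x) (a x) - wick (w x) (a x) (II x)"
  proof -
    have sL: "sgm (L x) = - wick (w x) (I x) (sgm (a x)) + wick (w x) (a x) (I x)"
      by (simp add: L_def sgm_diff sgm_wick sgm_I[OF x] wick_uminus)
    have hm: "hmul (c - d) = hmul c - hmul d" for c d :: "'n weyl"
      by (auto simp: fun_eq_iff hmul_def split: nat.splits)
    have hs: "hmul (sgm c) = sgm (hmul c)" for c :: "'n weyl"
      by (auto simp: fun_eq_iff hmul_def sgm_def split: nat.splits)
    have "hmul (wick (w x) (I x) (hdiv (L x)) - wick (w x) (sgm (hdiv (L x))) (I x)) =
        wick (w x) (I x) (L x) - wick (w x) (sgm (L x)) (I x)"
      unfolding hm wick_hmul_left[symmetric, of _ "sgm (hdiv (L x))"] wick_hmul_right[symmetric, of _ _ "hdiv (L x)"] hs hL ..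
    also have "\<dots> = wick (w x) (wick (w x) (I x) (I x)) (a x) - wick (w x) (a x) (wick (w x) (I x) (I x))"
      unfolding sL unfolding L_def by (simp add: wick_diff_right wick_diff_left wick_add_left wick_uminus wick_assoc)
    also have "\<dots> = hmul (wick (w x) (II x) (a x) - wick (w x) (a x) (II x))"
      unfolding hm wick_hmul_left[symmetric, of _ "II x"] wick_hmul_right[symmetric, of _ _ "II x"] hmul_II[OF x] ..
    finally show ?thesis by (rule hmul_inj)
  qed
  have "D_F G I (D_F G I a) x = dd (D_F G I a) x + hdiv (wick (w x) (I x) (D_F G I a x) - wick (w x) (sgm (D_F G I a x)) (I x))"
    by (rule D_F_dd[of I x "D_F G I a", OF I_form[OF x]])
  also have "dd (D_F G I a) x = dd (\<lambda>y. dd a y + hdiv (L y)) x"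
    by (rule dd_cong[OF x]) (rule DF)
  also have "\<dots> = dd (dd a) x + hdiv (dd L x)"
    by (simp add: dd_add[OF x] ssec_dd a ssec_hdiv sL dd_hdiv)
  \<comment> \<open>The brackets of \<open>I\<close> with \<open>dd a\<close> occur once from
    differentiating \<open>L\<close> and once from the outer connection, with opposite
    signs.\<close>
  also have "\<dots> + hdiv (wick (w x) (I x) (D_F G I a x) - wick (w x) (sgm (D_F G I a x)) (I x)) =
    hdiv (wick (w x) (R_nabla G x) (a x) - wick (w x) (a x) (R_nabla G x)) +
    hdiv (wick (w x) (dd I x) (a x) - wick (w x) (a x) (dd I x)) +
    hdiv (wick (w x) (I x) (hdiv (L x)) - wick (w x) (sgm (hdiv (L x))) (I x))"
    unfolding DF[OF x] dd_square[OF x a] ddL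
    by (simp add: sgm_add wick_add_left wick_add_right hdiv_add hdiv_diff)
  also have "\<dots> = hdiv (wick (w x) (dd I x + II x + R_nabla G x) (a x) - wick (w x) (a x) (dd I x + II x + R_nabla G x))"
    unfolding LL by (simp add: wick_add_left wick_add_right hdiv_add hdiv_diff)
  also have "dd I x + II x + R_nabla G x = \<alpha> x"
    using fedosov_equation[OF x] by (simp add: fedosov_dd II_def)
  also have "hdiv (wick (w x) (\<alpha> x) (a x) - wick (w x) (a x) (\<alpha> x)) = 0"
    by (simp only: \<alpha>_central[OF x] diff_self hdiv_zero)
  finally show ?thesis .
qed

end

section \<open>Comparison with Kapranov's connection\<close>

lemma iota_scl: "iota (scl z a) = scl z (iota a)"
  by (simp add: iota_def contr_scl wmul_scl_right scl_sum)

lemma iota_add: "iota (a + b) = iota a + iota b"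
  by (simp add: iota_def contr_add wmul_add_right sum.distrib)

lemma iota_sum: "iota (\<Sum>i\<in>I. f i) = (\<Sum>i\<in>I. iota (f i))"
  by (rule sum_hom[of iota, OF iota_zero iota_add])

lemma iota_ygen: "iota (a \<odot> ygen A) = iota a \<odot> ygen A"
proof -
  have "contr (Inl i) (a \<odot> ygen A) = contr (Inl i) a \<odot> ygen A" for i
    by (simp add: ygen_comm[symmetric] contr_ygen)
  then show ?thesis by (simp add: iota_def wmul_sum_left wmul_assoc)
qed

lemma wt_hol_mono:
  fixes N M :: "'n::finite ix \<Rightarrow> nat"
  shows "N \<le> M \<Longrightarrow> (\<Sum>i\<in>UNIV. N (Inl i)) \<le> (\<Sum>i\<in>UNIV. M (Inl i))"
  by (intro sum_mono) (erule le_funD)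

lemma nat_cases2: obtains "n = 0" | "n = Suc 0" | p where "n = Suc (Suc p)"
  by (metis not0_implies_Suc)

context kaehler_chart
begin

sublocale R: hol_source U G "R_nabla G" 1 1
proof
  show "ssec U (R_nabla G)" by (rule ssec_R_nabla)
  fix x assume x: "x \<in> U"
  show "homog (\<lambda>_. 0) hol 1 (R_nabla G x)" "homog (\<lambda>_. 0) anti 1 (R_nabla G x)"
    "homog hol (\<lambda>_. 0) 1 (R_nabla G x)" "homog anti (\<lambda>_. 0) 1 (R_nabla G x)"
    by (rule homog_R_nabla; simp)+
  show "dd (R_nabla G) x = 0" by (rule dd_R_nabla[OF x])
qed

lemma smooth_curv: "smooth_on U (\<lambda>x. curv G x m i j k)"
  by (rule smooth_on_cong[OF U _ smooth_on_pd[OF U smooth_christoffel]]) (simp add: curv_eq)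

lemma R_star_2:
  assumes x: "x \<in> U"
  shows "R_star G 2 m x = scl (1 / 2) (\<Sum>a\<in>UNIV. \<Sum>j\<in>UNIV. ygen (Inl a) \<odot> (dxgen (Inr j) \<odot> crv (Inl a) (Inr j) (Inl m) x))"
proof -
  have e: "ygen (Inl a) \<odot> (dxgen (Inr j) \<odot> ygen (Inl k)) = dxgen (Inr j) \<odot> ygen (Inl a) \<odot> ygen (Inl k)" for a j k
    by (simp add: wmul_assoc ygen_past[of "dxgen (Inr j)"])
  show ?thesis
    by (simp add: numeral_2_eq_2 crv_mixed_curv[OF x] wmul_sum_right wmul_scl_right scl_sum e)
qed

lemma nabla10_T_props:
  assumes x: "x \<in> U" and u: "\<And>i j. u (Inl i) = u (Inl j)" "\<And>i j. u (Inr i) = u (Inr j)"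
    and a: "\<And>m y. y \<in> U \<Longrightarrow> homog u v n (s m y)" and m: "\<And>i. p = n + v (Inl i)"
  shows "homog u v p (nabla10_T G s m x)"
  unfolding nabla10_T_def
  by (intro homog_add homog_nabla10[OF x u a m] homog_sum homog_scl homog_dxgen[OF a[OF x] m])

lemma R_star_props:
  "ssec U (R_star G (Suc (Suc n)) m)"
  "x \<in> U \<Longrightarrow> homog hol (\<lambda>_. 0) (Suc (Suc n)) (R_star G (Suc (Suc n)) m x)"
  "x \<in> U \<Longrightarrow> homog anti (\<lambda>_. 0) 0 (R_star G (Suc (Suc n)) m x)"
  "x \<in> U \<Longrightarrow> homog (\<lambda>_. 0) hol 0 (R_star G (Suc (Suc n)) m x)"
  "x \<in> U \<Longrightarrow> homog (\<lambda>_. 0) anti 1 (R_star G (Suc (Suc n)) m x)"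
proof -
  have "\<forall>m. ssec U (R_star G (Suc (Suc n)) m) \<and> (\<forall>x\<in>U. homog hol (\<lambda>_. 0) (Suc (Suc n)) (R_star G (Suc (Suc n)) m x) \<and>
    homog anti (\<lambda>_. 0) 0 (R_star G (Suc (Suc n)) m x) \<and> homog (\<lambda>_. 0) hol 0 (R_star G (Suc (Suc n)) m x) \<and>
    homog (\<lambda>_. 0) anti 1 (R_star G (Suc (Suc n)) m x))"
  proof (induction n)
    case 0
    have h: "homog u v p (dxgen (Inr j) \<odot> ygen (Inl i) \<odot> ygen (Inl k))"
      if "p = u (Inl k) + u (Inl i) + v (Inr j)" for u v p i j k
    proof -
      have "homog u v p (dxgen (Inr j) \<odot> (ygen (Inl i) \<odot> (ygen (Inl k) \<odot> wone)))"
        by (rule homog_dxgen[OF homog_ygen[OF homog_ygen[OF homog_wone refl] refl]]) (simp add: that)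
      then show ?thesis by (simp add: wmul_assoc)
    qed
    have "smooth_on U (\<lambda>x. curv G x m i j k / 2)" for m i j k
      unfolding divide_inverse by (intro smooth_on_mult smooth_curv smooth_on_const U)
    then have "ssec U (R_star G (Suc (Suc 0)) m)" for m
      unfolding R_star.simps by (intro ssec_sum ssec_scl ssec_const U)
    moreover have "homog u v p (R_star G (Suc (Suc 0)) m x)"
      if "\<And>i j k. p = u (Inl k) + u (Inl i) + v (Inr j)" for u v p m x
      unfolding R_star.simps by (intro homog_sum homog_scl h that)
    ultimately show ?case by simp
  next
    case (Suc n)
    let ?T = "nabla10_T G (R_star G (Suc (Suc n)))"
    have sT: "ssec U (?T m)" for m
      unfolding nabla10_T_def[abs_def]
      using Suc by (intro ssec_add ssec_nabla10 ssec_sum ssec_scl ssec_wmul ssec_const smooth_christoffel U) auto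
    have T: "homog (\<lambda>_. 0) hol 1 (?T m x)" "homog hol (\<lambda>_. 0) (Suc (Suc n)) (?T m x)"
      "homog anti (\<lambda>_. 0) 0 (?T m x)" "homog (\<lambda>_. 0) anti 1 (?T m x)" if x: "x \<in> U" for m x
      by (rule nabla10_T_props[OF x, where n = 0] nabla10_T_props[OF x, where n = "Suc (Suc n)"]
          nabla10_T_props[OF x, where n = 1]; use Suc in simp)+
    show ?case
    proof (intro allI conjI ballI)
      fix m show "ssec U (R_star G (Suc (Suc (Suc n))) m)"
        unfolding R_star.simps by (rule ssec_delta10_inv[OF U sT])
      fix x assume x: "x \<in> U"
      have e: "R_star G (Suc (Suc (Suc n))) m x = scl (1 / of_nat (Suc (Suc (Suc n)))) (iota (?T m x))"
        unfolding R_star.simps by (rule delta10_inv_iota[OF T(1,2)[OF x]])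
      show "homog hol (\<lambda>_. 0) (Suc (Suc (Suc n))) (R_star G (Suc (Suc (Suc n))) m x)"
        unfolding e by (intro homog_scl homog_iota[OF T(2)[OF x], of "\<lambda>_. Suc (Suc n)"]) auto
      show "homog anti (\<lambda>_. 0) 0 (R_star G (Suc (Suc (Suc n))) m x)"
        unfolding e by (intro homog_scl homog_iota[OF T(3)[OF x], of "\<lambda>_. 0"]) auto
      show "homog (\<lambda>_. 0) hol 0 (R_star G (Suc (Suc (Suc n))) m x)"
        unfolding e by (intro homog_scl homog_iota[OF T(1)[OF x], of "\<lambda>_. 0"]) auto
      show "homog (\<lambda>_. 0) anti 1 (R_star G (Suc (Suc (Suc n))) m x)"
        unfolding e by (intro homog_scl homog_iota[OF T(4)[OF x], of "\<lambda>_. 1"]) auto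
    qed
  qed
  then show "ssec U (R_star G (Suc (Suc n)) m)"
  "x \<in> U \<Longrightarrow> homog hol (\<lambda>_. 0) (Suc (Suc n)) (R_star G (Suc (Suc n)) m x)"
  "x \<in> U \<Longrightarrow> homog anti (\<lambda>_. 0) 0 (R_star G (Suc (Suc n)) m x)"
  "x \<in> U \<Longrightarrow> homog (\<lambda>_. 0) hol 0 (R_star G (Suc (Suc n)) m x)"
  "x \<in> U \<Longrightarrow> homog (\<lambda>_. 0) anti 1 (R_star G (Suc (Suc n)) m x)" by auto
qed

lemma nabla10_T_homog:
  assumes x: "x \<in> U"
  shows "homog (\<lambda>_. 0) hol 1 (nabla10_T G (R_star G (Suc (Suc n))) m x)"
    "homog hol (\<lambda>_. 0) (Suc (Suc n)) (nabla10_T G (R_star G (Suc (Suc n))) m x)"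
  by (rule nabla10_T_props[OF x, where n = 0] nabla10_T_props[OF x, where n = "Suc (Suc n)"];
      simp add: R_star_props del: R_star.simps)+

lemma contract_swap_weyl:
  fixes X :: "'n \<Rightarrow> 'n \<Rightarrow> 'n weyl" and u g :: "'n \<Rightarrow> 'n \<Rightarrow> complex"
  shows "(\<Sum>i\<in>UNIV. \<Sum>j\<in>UNIV. scl (\<Sum>p\<in>UNIV. u p j * g i p) (X i j)) = (\<Sum>i\<in>UNIV. \<Sum>j\<in>UNIV. scl (u i j) (\<Sum>p\<in>UNIV. scl (g p i) (X p j)))"
proof (intro ext)
  fix k M S
  show "(\<Sum>i\<in>UNIV. \<Sum>j\<in>UNIV. scl (\<Sum>p\<in>UNIV. u p j * g i p) (X i j)) k M S = (\<Sum>i\<in>UNIV. \<Sum>j\<in>UNIV. scl (u i j) (\<Sum>p\<in>UNIV. scl (g p i) (X p j))) k M S"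
    using contract_swap(1)[of u g "\<lambda>i j. X i j k M S"] by (simp add: weyl_sum_apply)
qed

text \<open>Lowering the tangent index with the parallel Kaehler form commutes with
  \<open>nabla10\<close>: the Christoffel term from differentiating \<open>om_low\<close> becomes
  the one acting on the tangent index in \<open>nabla10_T\<close>, and y-bar is constant in
  holomorphic directions.\<close>

lemma nabla10_lower:
  assumes x: "x \<in> U" and s: "\<And>m. ssec U (s m)"
  shows "nabla10 G (\<lambda>x. \<Sum>j\<in>UNIV. \<Sum>k\<in>UNIV. scl (om_low G x j k) (s j x \<odot> ygen (Inr k))) x =
    (\<Sum>j\<in>UNIV. \<Sum>k\<in>UNIV. scl (om_low G x j k) (nabla10_T G s j x \<odot> ygen (Inr k)))"
proof -
  have c: "cov_deriv G (Inl i) (\<lambda>x. s j x \<odot> ygen (Inr k)) x = cov_deriv G (Inl i) (s j) x \<odot> ygen (Inr k)" for i j k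
    by (simp add: cov_wmul[OF x s ssec_const] cov_ygen cfm_zero[OF x])
  have p: "pd (Inl i) (\<lambda>w. om_low G w j k) x = (\<Sum>p\<in>UNIV. om_low G x p k * \<Gamma> x (Inl p) (Inl i) (Inl j))" for i j k
    by (simp add: pd_om_low[OF x] christoffel_simps[OF x])
  have "cov_deriv G (Inl i) (\<lambda>x. \<Sum>j\<in>UNIV. \<Sum>k\<in>UNIV. scl (om_low G x j k) (s j x \<odot> ygen (Inr k))) x =
    (\<Sum>j\<in>UNIV. \<Sum>k\<in>UNIV. scl (\<Sum>p\<in>UNIV. om_low G x p k * \<Gamma> x (Inl p) (Inl i) (Inl j)) (s j x \<odot> ygen (Inr k))) +
    (\<Sum>j\<in>UNIV. \<Sum>k\<in>UNIV. scl (om_low G x j k) (cov_deriv G (Inl i) (s j) x \<odot> ygen (Inr k)))" for i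
    by (simp add: cov_sum[OF x] cov_scl[OF x] ssec_sum[OF U] ssec_scl[OF U] smooth_om_low ssec_wmul[OF U s ssec_const] c p sum.distrib)
  also have "(\<Sum>j\<in>UNIV. \<Sum>k\<in>UNIV. scl (\<Sum>p\<in>UNIV. om_low G x p k * \<Gamma> x (Inl p) (Inl i) (Inl j)) (s j x \<odot> ygen (Inr k))) +
    (\<Sum>j\<in>UNIV. \<Sum>k\<in>UNIV. scl (om_low G x j k) (cov_deriv G (Inl i) (s j) x \<odot> ygen (Inr k))) =
    (\<Sum>j\<in>UNIV. \<Sum>k\<in>UNIV. scl (om_low G x j k) ((cov_deriv G (Inl i) (s j) x + (\<Sum>p\<in>UNIV. scl (\<Gamma> x (Inl j) (Inl i) (Inl p)) (s p x))) \<odot> ygen (Inr k)))" for i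
    unfolding contract_swap_weyl
    by (simp add: wmul_add_left scl_add sum.distrib wmul_sum_left wmul_scl_left add.commute)
  finally have d: "cov_deriv G (Inl i) (\<lambda>x. \<Sum>j\<in>UNIV. \<Sum>k\<in>UNIV. scl (om_low G x j k) (s j x \<odot> ygen (Inr k))) x =
    (\<Sum>j\<in>UNIV. \<Sum>k\<in>UNIV. scl (om_low G x j k) ((cov_deriv G (Inl i) (s j) x + (\<Sum>p\<in>UNIV. scl (\<Gamma> x (Inl j) (Inl i) (Inl p)) (s p x))) \<odot> ygen (Inr k)))" for i .
  have T: "nabla10_T G s j x = (\<Sum>i\<in>UNIV. dxgen (Inl i) \<odot> (cov_deriv G (Inl i) (s j) x + (\<Sum>p\<in>UNIV. scl (\<Gamma> x (Inl j) (Inl i) (Inl p)) (s p x))))" for j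
    by (simp add: nabla10_T_def nabla10_def wmul_add_right wmul_sum_right wmul_scl_right sum.distrib)
  let ?Y = "\<lambda>i j. cov_deriv G (Inl i) (s j) x + (\<Sum>p\<in>UNIV. scl (\<Gamma> x (Inl j) (Inl i) (Inl p)) (s p x))"
  have "nabla10 G (\<lambda>x. \<Sum>j\<in>UNIV. \<Sum>k\<in>UNIV. scl (om_low G x j k) (s j x \<odot> ygen (Inr k))) x =
    (\<Sum>i\<in>UNIV. \<Sum>j\<in>UNIV. \<Sum>k\<in>UNIV. scl (om_low G x j k) (dxgen (Inl i) \<odot> ?Y i j \<odot> ygen (Inr k)))"
    unfolding nabla10_def d by (simp only: wmul_sum_right wmul_scl_right wmul_assoc)
  also have "\<dots> = (\<Sum>j\<in>UNIV. \<Sum>i\<in>UNIV. \<Sum>k\<in>UNIV. scl (om_low G x j k) (dxgen (Inl i) \<odot> ?Y i j \<odot> ygen (Inr k)))"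
    by (rule sum.swap)
  also have "\<dots> = (\<Sum>j\<in>UNIV. \<Sum>k\<in>UNIV. \<Sum>i\<in>UNIV. scl (om_low G x j k) (dxgen (Inl i) \<odot> ?Y i j \<odot> ygen (Inr k)))"
    by (intro sum.cong refl sum.swap)
  also have "\<dots> = (\<Sum>j\<in>UNIV. \<Sum>k\<in>UNIV. scl (om_low G x j k) (nabla10_T G s j x \<odot> ygen (Inr k)))"
    unfolding T by (simp only: wmul_sum_left scl_sum)
  finally show ?thesis .
qed

text \<open>Kapranov's recursion and the iteration for the curvature are intertwined by lowering the
  tangent index. The factor y-bar that this adds does not count in the holomorphic degree, so the
  normalisations agree.\<close>

lemma I_n_hs: "x \<in> U \<Longrightarrow> I_n G (Suc (Suc n)) x = hs G (R_nabla G) n x"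
proof (induction n arbitrary: x)
  case 0
  note x = 0
  have c0: "contr A (rho (Inl i) (Inr j) x) = 0" for A i j
    using rho_form[OF x] by (auto simp: contr_def fun_eq_iff)
  have "iota (R_nabla G x) = (\<Sum>i\<in>UNIV. \<Sum>j\<in>UNIV. ygen (Inl i) \<odot> (dxgen (Inr j) \<odot> rho (Inl i) (Inr j) x))"
  proof -
    have "contr (Inl a) (R_nabla G x) = (\<Sum>j\<in>UNIV. dxgen (Inr j) \<odot> rho (Inl a) (Inr j) x)" for a
    proof -
      have "contr (Inl a) (R_nabla G x) = (\<Sum>i\<in>UNIV. \<Sum>j\<in>UNIV. if a = i then dxgen (Inr j) \<odot> rho (Inl i) (Inr j) x else 0)"
        unfolding R_nabla_rho[OF x] contr_sum
        by (intro sum.cong refl) (simp add: contr_dxgen c0)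
      also have "\<dots> = (\<Sum>j\<in>UNIV. dxgen (Inr j) \<odot> rho (Inl a) (Inr j) x)"
        by (subst sum.swap) (simp add: sum.delta')
      finally show ?thesis .
    qed
    then show ?thesis by (simp add: iota_def wmul_sum_right)
  qed
  also have "\<dots> = (\<Sum>i\<in>UNIV. \<Sum>j\<in>UNIV. \<Sum>m\<in>UNIV. \<Sum>l\<in>UNIV. scl (om_low G x m l)
      (ygen (Inl i) \<odot> (dxgen (Inr j) \<odot> crv (Inl i) (Inr j) (Inl m) x) \<odot> ygen (Inr l)))"
    by (simp add: rho_def wmul_sum_right wmul_scl_right wmul_assoc)
  also have "\<dots> = (\<Sum>m\<in>UNIV. \<Sum>l\<in>UNIV. \<Sum>i\<in>UNIV. \<Sum>j\<in>UNIV. scl (om_low G x m l)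
      (ygen (Inl i) \<odot> (dxgen (Inr j) \<odot> crv (Inl i) (Inr j) (Inl m) x) \<odot> ygen (Inr l)))"
    by (rule sum4_swap)
  finally have i: "iota (R_nabla G x) = (\<Sum>m\<in>UNIV. \<Sum>l\<in>UNIV. \<Sum>i\<in>UNIV. \<Sum>j\<in>UNIV. scl (om_low G x m l)
      (ygen (Inl i) \<odot> (dxgen (Inr j) \<odot> crv (Inl i) (Inr j) (Inl m) x) \<odot> ygen (Inr l)))" .
  \<comment> \<open>The factor 1/2 in the first Kapranov term is the normalisation of
    \<open>delta10_inv\<close> on the curvature: one dz plus one y.\<close>
  have h: "hs G (R_nabla G) 0 x = scl (1 / 2) (iota (R_nabla G x))"
    using delta10_inv_iota[OF R.form_hol_\<beta>[OF x] R.hol_\<beta>[OF x]] by simp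
  have "I_n G 2 x = scl (1 / 2) (iota (R_nabla G x))"
    unfolding I_n_def R_star_2[OF x] i
    by (simp add: wmul_scl_left wmul_sum_left scl_sum mult.commute)
  then show ?case unfolding h by (simp add: numeral_2_eq_2)
next
  case (Suc n)
  note x = Suc.prems
  let ?T = "nabla10_T G (R_star G (Suc (Suc n)))"
  have T: "R_star G (Suc (Suc (Suc n))) j x = scl (1 / of_nat (Suc (Suc (Suc n)))) (iota (?T j x))" for j
    unfolding R_star.simps by (rule delta10_inv_iota[OF nabla10_T_homog[OF x]])
  have "hs G (R_nabla G) (Suc n) x = scl (1 / of_nat (Suc (Suc (1 + n)))) (iota (nabla10 G (hs G (R_nabla G) n) x))"
    unfolding hs.simps by (rule delta10_inv_iota[OF R.nabla10_hs[OF x]])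
  also have "nabla10 G (hs G (R_nabla G) n) x = nabla10 G (I_n G (Suc (Suc n))) x"
    by (rule nabla10_cong[OF x]) (simp only: Suc.IH)
  also have "\<dots> = (\<Sum>j\<in>UNIV. \<Sum>k\<in>UNIV. scl (om_low G x j k) (?T j x \<odot> ygen (Inr k)))"
    unfolding I_n_def[abs_def] by (rule nabla10_lower[OF x R_star_props(1)])
  finally have hS: "hs G (R_nabla G) (Suc n) x = (\<Sum>j\<in>UNIV. \<Sum>k\<in>UNIV. scl (om_low G x j k)
     (scl (1 / of_nat (Suc (Suc (Suc n)))) (iota (?T j x)) \<odot> ygen (Inr k)))"
    by (simp add: iota_sum iota_scl iota_ygen scl_sum wmul_scl_left mult.commute)
  have "I_n G (Suc (Suc (Suc n))) x = (\<Sum>j\<in>UNIV. \<Sum>k\<in>UNIV. scl (om_low G x j k)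
     (scl (1 / of_nat (Suc (Suc (Suc n)))) (iota (?T j x)) \<odot> ygen (Inr k)))"
    unfolding I_n_def T by (rule refl)
  then show ?case by (rule trans[OF _ hS[symmetric]])
qed

lemma I_sum_hs_tot:
  assumes x: "x \<in> U"
  shows "I_sum G x = hs_tot G (R_nabla G) 1 x"
proof (intro ext)
  fix k and M :: "'n ix \<Rightarrow> nat" and S
  define N where "N = (\<Sum>i\<in>UNIV. M (Inl i))"
  have z: "hs G (R_nabla G) n x k M S = 0" if "N \<noteq> Suc (Suc n)" for n
    using homogD[OF R.hs_props(2)[OF x], of n k M S] that by (auto simp: wt_hol N_def)
  have "I_sum G x k M S = (\<Sum>n. hs G (R_nabla G) n x k M S)"
    unfolding I_sum_def by (simp add: I_n_hs[OF x])
  \<comment> \<open>Only the iterate of degree N contributes to a coefficient of degree N in y.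
    Iterates start in degree 2, which fixes the index and leaves degrees 0 and 1 empty.\<close>
  also have "\<dots> = (\<Sum>n\<in>(if N \<le> 1 then {} else {N - Suc 1}). hs G (R_nabla G) n x k M S)"
    by (rule suminf_finite) (auto intro!: z split: if_splits)
  finally show "I_sum G x k M S = hs_tot G (R_nabla G) 1 x k M S"
    by (simp add: hs_tot_def hs_deg_def flip: N_def)
qed

text \<open>The sum of all Kapranov terms: the n-th one is homogeneous of degree n in y, so the
  degree of the monomial selects the summand.\<close>

definition R_tot :: "'n \<Rightarrow> complex^'n \<Rightarrow> 'n weyl" where
  "R_tot m x = (\<lambda>k M S. R_star G (\<Sum>i\<in>UNIV. M (Inl i)) m x k M S)"

lemma R_star_hol:
  assumes x: "x \<in> U" and n: "R_star G n m x k M S \<noteq> 0"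
  shows "(\<Sum>i\<in>UNIV. M (Inl i)) = n"
proof -
  from n obtain p where p: "n = Suc (Suc p)" by (cases n rule: nat_cases2) auto
  show ?thesis using homogD[OF R_star_props(2)[OF x]] n unfolding p by (simp add: wt_hol del: R_star.simps)
qed

lemma R_tot_odd: "x \<in> U \<Longrightarrow> R_tot m x \<odot> b = sgm b \<odot> R_tot m x"
proof (rule wmul_comm_odd)
  fix k M S assume x: "x \<in> U" and n: "R_tot m x k M S \<noteq> 0"
  then obtain p where p: "(\<Sum>i\<in>UNIV. M (Inl i)) = Suc (Suc p)"
    unfolding R_tot_def by (cases "\<Sum>i\<in>UNIV. M (Inl i)" rule: nat_cases2) auto
  have "homog (\<lambda>_. 0) (\<lambda>_. 1) 1 (R_star G (Suc (Suc p)) m x)"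
    using homog_form[OF R_star_props(4,5)[OF x]] by (simp del: R_star.simps)
  then show "odd (card S)"
    using n homogD unfolding R_tot_def p by (fastforce simp: wt_form simp del: R_star.simps)
qed

lemma dy_R_tot: "x \<in> U \<Longrightarrow> dy (Inr q) (R_tot m x) = 0"
proof (intro ext)
  fix k and M :: "'n ix \<Rightarrow> nat" and S assume x: "x \<in> U"
  have "dy (Inr q) (R_star G n m x) = 0" for n
    by (cases n rule: nat_cases2)
      (use homog_dy_zero[OF R_star_props(3)[OF x], of "Inr q"] in \<open>auto simp del: R_star.simps(3-)\<close>)
  then have "dy (Inr q) (R_star G (\<Sum>i\<in>UNIV. M (Inl i)) m x) k M S = 0" by simp
  then show "dy (Inr q) (R_tot m x) k M S = 0 k M S" by (simp add: dy_def R_tot_def)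
qed

lemma dy_I_sum:
  assumes x: "x \<in> U"
  shows "dy (Inr q) (I_sum G x) = (\<Sum>m\<in>UNIV. scl (om_low G x m q) (R_tot m x))"
proof (intro ext)
  fix k and M :: "'n ix \<Rightarrow> nat" and S
  define N where "N = (\<Sum>i\<in>UNIV. M (Inl i))"
  have I: "dy (Inr q) (I_n G (Suc (Suc n)) x) = (\<Sum>m\<in>UNIV. scl (om_low G x m q) (R_star G (Suc (Suc n)) m x))" for n
  proof -
    have "dy (Inr q) (R_star G (Suc (Suc n)) m x) = 0" for m
      by (rule homog_dy_zero[OF R_star_props(3)[OF x]]) simp
    then show ?thesis
      unfolding I_n_def
      by (simp add: dy_sum dy_scl dy_wmul dy_ygen if_distrib[of "\<lambda>z. _ \<odot> z"] if_distrib[of "scl _"] sum.delta sum.delta'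
          cong: if_cong del: R_star.simps)
  qed
  have "dy (Inr q) (I_sum G x) k M S = dy (Inr q) (hs_deg G (R_nabla G) 1 N x) k M S"
    unfolding I_sum_hs_tot[OF x] by (simp add: dy_def hs_tot_def N_def)
  also have "\<dots> = (\<Sum>m\<in>UNIV. scl (om_low G x m q) (R_star G N m x)) k M S"
  proof (cases "N \<le> 1")
    case True
    then have "N = 0 \<or> N = Suc 0" by auto
    then show ?thesis by (auto simp: hs_deg_def weyl_sum_apply)
  next
    case False
    then obtain p where p: "N = Suc (Suc p)" by (metis One_nat_def le_SucI le_zero_eq not0_implies_Suc order_refl)
    then have "hs_deg G (R_nabla G) 1 N x = I_n G (Suc (Suc p)) x" by (simp add: hs_deg_def I_n_hs[OF x])
    then show ?thesis using I by (simp add: p del: R_star.simps)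
  qed
  finally show "dy (Inr q) (I_sum G x) k M S = (\<Sum>m\<in>UNIV. scl (om_low G x m q) (R_tot m x)) k M S"
    by (simp add: weyl_sum_apply R_tot_def N_def)
qed

lemma D_K_R_tot:
  assumes x: "x \<in> U"
  shows "D_K G a x = nabla G a x - delta10 (a x) + (\<Sum>m\<in>UNIV. R_tot m x \<odot> dy (Inl m) (a x))"
proof -
  have "(\<lambda>k M S. \<Sum>n. R_tilde G (n + 2) a x k M S) = (\<Sum>m\<in>UNIV. R_tot m x \<odot> dy (Inl m) (a x))"
  proof (intro ext)
    fix k and M :: "'n ix \<Rightarrow> nat" and S
    \<comment> \<open>Multiplication cannot lower the degree in y, so a term of degree above that of
      \<open>M\<close> contributes nothing to the coefficient at \<open>M\<close>; this truncates
      the infinite sum.\<close>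
    define H where "H = (\<Sum>i\<in>UNIV. M (Inl i))"
    have le: "(\<Sum>i\<in>UNIV. N (Inl i)) \<le> H" if "N \<le> M" for N :: "'n ix \<Rightarrow> nat"
      unfolding H_def by (rule wt_hol_mono[OF that])
    have z: "(R_star G n m x \<odot> b) k M S = 0" if "H < n" for n m b
      unfolding wmul_wdom
    proof (rule sum.neutral, clarify)
      fix j N T assume "(j, N, T) \<in> wdom k M S"
      then have "N \<le> M" by (simp add: wdom_def)
      then have "R_star G n m x j N T = 0" using R_star_hol[OF x, of n m j N T] le[of N] that by fastforce
      then show "wsign T (S - T) * R_star G n m x j N T * b (k - j) (M - N) (S - T) = 0" by simp
    qed
    have "(\<Sum>n. R_tilde G (n + 2) a x k M S) = (\<Sum>n\<in>{..H}. R_tilde G (n + 2) a x k M S)"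
    proof (rule suminf_finite)
      fix n assume "n \<notin> {..H}"
      then show "R_tilde G (n + 2) a x k M S = 0"
        unfolding R_tilde_def weyl_sum_apply by (intro sum.neutral ballI z) simp
    qed simp
    also have "\<dots> = (\<Sum>m\<in>UNIV. ((\<Sum>n\<in>{..H}. R_star G (n + 2) m x) \<odot> dy (Inl m) (a x)) k M S)"
      unfolding R_tilde_def weyl_sum_apply wmul_sum_left by (rule sum.swap)
    also have "\<dots> = (\<Sum>m\<in>UNIV. (R_tot m x \<odot> dy (Inl m) (a x)) k M S)"
    proof (intro sum.cong refl)
      fix m
      have "(\<Sum>n\<in>{..H}. R_star G (n + 2) m x) j N T = R_tot m x j N T" if "N \<le> M" for j N T
      proof -
        let ?h = "\<Sum>i\<in>UNIV. N (Inl i)"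
        have "(\<Sum>n\<in>{..H}. R_star G (n + 2) m x j N T) = (\<Sum>n\<in>{..H}. if n + 2 = ?h then R_star G ?h m x j N T else 0)"
        proof (intro sum.cong refl)
          fix n
          show "R_star G (n + 2) m x j N T = (if n + 2 = ?h then R_star G ?h m x j N T else 0)"
            using R_star_hol[OF x, of "n + 2" m j N T] by (cases "n + 2 = ?h") auto
        qed
        also have "\<dots> = R_star G ?h m x j N T"
        proof (cases "?h < 2")
          case True
          then have "?h = 0 \<or> ?h = Suc 0" by linarith
          then have "R_star G ?h m x j N T = 0" by auto
          moreover have "(\<Sum>n\<in>{..H}. if n + 2 = ?h then R_star G ?h m x j N T else 0) = 0"
            by (intro sum.neutral ballI) (use True in simp)
          ultimately show ?thesis by simp
        next
          case False
          have "(\<Sum>n\<in>{..H}. if n + 2 = ?h then R_star G ?h m x j N T else 0) =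
             (\<Sum>n\<in>{..H}. if n = ?h - 2 then R_star G ?h m x j N T else 0)"
            by (intro sum.cong refl if_cong) (use False in auto)
          also have "\<dots> = R_star G ?h m x j N T" using le[OF that] by (simp add: sum.delta)
          finally show ?thesis .
        qed
        finally show ?thesis by (simp add: weyl_sum_apply R_tot_def)
      qed
      then show "((\<Sum>n\<in>{..H}. R_star G (n + 2) m x) \<odot> dy (Inl m) (a x)) k M S = (R_tot m x \<odot> dy (Inl m) (a x)) k M S"
        unfolding wmul_wdom by (intro sum.cong refl) (auto simp: wdom_def)
    qed
    finally show "(\<Sum>n. R_tilde G (n + 2) a x k M S) = (\<Sum>m\<in>UNIV. R_tot m x \<odot> dy (Inl m) (a x)) k M S"
      by (simp add: weyl_sum_apply)
  qed
  then show ?thesis unfolding D_K_def by simp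
qed

text \<open>When \<open>a\<close> contains no y-bar, contractions occur only in the order with
  \<open>I\<close> on the right, and only once because \<open>I\<close> is linear in y-bar. That
  contraction raises the index lowered in \<open>I_sum\<close>; its sign and that of the commutator
  cancel. \<open>J\<close> has no y-bar to contract.\<close>

lemma D_F_eq_D_K:
  assumes x: "x \<in> U" and I: "homog (\<lambda>_. 0) (\<lambda>_. 1) 1 (I x)" and IJ: "I x = I_sum G x + J x"
    and J: "\<And>j. dy (Inr j) (J x) = 0" and a: "\<And>j. dy (Inr j) (a x) = 0"
  shows "D_F G I a x = D_K G a x"
proof -
  let ?w = "om_up G x"
  have dI: "dy (Inr q) (I x) = (\<Sum>m\<in>UNIV. scl (om_low G x m q) (R_tot m x))" for q
    by (simp add: IJ dy_add J dy_I_sum[OF x])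
  have ddI: "dy (Inr p) (dy (Inr q) (I x)) = 0" for p q
    by (simp add: dI dy_sum dy_scl dy_R_tot[OF x])
  have 1: "wick ?w (I x) (a x) = I x \<odot> a x"
    by (subst wick_first_order) (simp_all add: a)
  have 2: "wick ?w (sgm (a x)) (I x) = sgm (a x) \<odot> I x + hmul (wterm ?w 1 (sgm (a x)) (I x))"
    by (rule wick_first_order) (simp add: ddI)
  have 3: "I x \<odot> a x = sgm (a x) \<odot> I x"
  proof (rule wmul_comm_odd)
    fix k M S assume "I x k M S \<noteq> 0"
    then show "odd (card S)" using homogD[OF I, of k M S] by (simp add: wt_form)
  qed
  have "wterm ?w 1 (sgm (a x)) (I x) = (\<Sum>i\<in>UNIV. sgm (dy (Inl i) (a x)) \<odot> (\<Sum>j\<in>UNIV. scl (?w i j) (\<Sum>m\<in>UNIV. scl (om_low G x m j) (R_tot m x))))"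
    by (simp add: dI dy_sgm wmul_sum_right wmul_scl_right)
  also have "\<dots> = - (\<Sum>i\<in>UNIV. R_tot i x \<odot> dy (Inl i) (a x))"
    by (simp only: om_cancel(1)[OF x] wmul_uminus_right R_tot_odd[OF x] sum_negf)
  finally have 4: "wterm ?w 1 (sgm (a x)) (I x) = - (\<Sum>i\<in>UNIV. R_tot i x \<odot> dy (Inl i) (a x))" .
  have "hdiv (wick ?w (I x) (a x) - wick ?w (sgm (a x)) (I x)) = (\<Sum>i\<in>UNIV. R_tot i x \<odot> dy (Inl i) (a x))"
    unfolding 1 2 3 hdiv_diff hdiv_add hdiv_hmul 4 by simp
  then have "D_F G I a x = dd a x + (\<Sum>i\<in>UNIV. R_tot i x \<odot> dy (Inl i) (a x))"
    unfolding D_F_dd[of I x a, OF I] by simp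
  moreover have "delta01 (a x) = 0" by (simp add: delta01_def a)
  ultimately show ?thesis unfolding D_K_R_tot[OF x] dd_def delta_def by simp
qed

end

section \<open>The local solution\<close>

locale kaehler_chart_form = kaehler_chart U G
  for U :: "(complex^'n::finite) set" and G +
  fixes \<alpha> :: "complex^'n \<Rightarrow> 'n weyl"
  assumes ssec_\<alpha>: "ssec U \<alpha>"
    and \<alpha>_hol: "\<And>x. x \<in> U \<Longrightarrow> homog (\<lambda>_. 0) hol 1 (\<alpha> x)"
    and \<alpha>_anti: "\<And>x. x \<in> U \<Longrightarrow> homog (\<lambda>_. 0) anti 1 (\<alpha> x)"
    and \<alpha>_y: "\<And>x k M S. x \<in> U \<Longrightarrow> \<alpha> x k M S \<noteq> 0 \<Longrightarrow> M = 0"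
    and d_\<alpha>: "\<And>x. x \<in> U \<Longrightarrow> ext_d \<alpha> x = 0"
begin

abbreviation J where "J \<equiv> hs_tot G (\<lambda>x. - \<alpha> x) 0"

lemma dy_\<alpha>: "x \<in> U \<Longrightarrow> dy A (\<alpha> x) = 0"
proof (intro ext)
  fix k and M :: "'n ix \<Rightarrow> nat" and S assume x: "x \<in> U"
  have "M(A := M A + 1) \<noteq> 0"
  proof
    assume "M(A := M A + 1) = 0"
    then have "(M(A := M A + 1)) A = 0 A" by (rule fun_cong)
    then show False by simp
  qed
  then have "\<alpha> x k (M(A := M A + 1)) S = 0" using \<alpha>_y[OF x] by blast
  then show "dy A (\<alpha> x) k M S = 0 k M S" by (simp add: dy_def)
qed

lemma dd_\<alpha>: "x \<in> U \<Longrightarrow> dd \<alpha> x = 0"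
  using d_\<alpha>[of x] by (simp add: dd_def nabla_cov cov_cfm dy_\<alpha> delta_dy ext_d_def)

lemma \<alpha>_deg: "x \<in> U \<Longrightarrow> homog u (\<lambda>_. 0) 0 (\<alpha> x)"
  using \<alpha>_y unfolding homog_def wt_def by fastforce

text \<open>The iteration produces minus its source, hence the source -\<alpha> for the right-hand
  side \<alpha>; the curvature, which stands on the left of the equation, keeps its sign.\<close>

sublocale J: hol_source U G "\<lambda>x. - \<alpha> x" 0 0
proof
  show "ssec U (\<lambda>x. - \<alpha> x)" by (rule ssec_uminus[OF U ssec_\<alpha>])
  fix x assume x: "x \<in> U"
  show "homog (\<lambda>_. 0) hol 1 (- \<alpha> x)" "homog (\<lambda>_. 0) anti 1 (- \<alpha> x)"
    "homog hol (\<lambda>_. 0) 0 (- \<alpha> x)" "homog anti (\<lambda>_. 0) 0 (- \<alpha> x)"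
    by (intro homog_uminus \<alpha>_hol \<alpha>_anti \<alpha>_deg x)+
  show "dd (\<lambda>x. - \<alpha> x) x = 0"
    using dd_diff[OF x ssec_const ssec_\<alpha>, of 0] dd_\<alpha>[OF x] by (simp add: dd_dcov dcov_def)
qed

lemma ssec_I_sum: "ssec U (I_sum G)"
  by (rule ssec_cong[OF U _ R.ssec_hs_tot]) (simp add: I_sum_hs_tot)

text \<open>The (1,1)-equation is linear within the ansatz, so the solutions for the curvature and
  for -\<alpha> are superposed. The nonlinear square of the sum is left to the (0,2)-part.\<close>

sublocale F: fedosov_data U G "\<lambda>x. I_sum G x + J x" \<alpha>
proof
  show "ssec U (\<lambda>x. I_sum G x + J x)" by (intro ssec_add U ssec_I_sum J.ssec_hs_tot)
  show "ssec U \<alpha>" by (rule ssec_\<alpha>)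
  fix x assume x: "x \<in> U"
  note I = I_sum_hs_tot[OF x]
  show "homog (\<lambda>_. 0) hol 0 (I_sum G x + J x)" "homog (\<lambda>_. 0) anti 1 (I_sum G x + J x)"
    unfolding I by (intro homog_add R.hs_tot_homog J.hs_tot_homog x)+
  show "hpos (I_sum G x + J x)"
    unfolding I hpos_def
  proof (intro allI impI)
    fix k M S assume "(hs_tot G (R_nabla G) 1 x + J x) k M S \<noteq> 0"
    then have "1 \<le> (\<Sum>i\<in>UNIV. M (Inl i))" using R.hs_tot_pos[of x k M S] J.hs_tot_pos[of x k M S] by force
    then show "\<exists>i. M (Inl i) \<noteq> 0" by (rule contrapos_pp) simp
  qed
  show "delta01 (I_sum G x + J x) = 0"
    unfolding I delta01_add R.delta01_hs_tot[OF x] J.delta01_hs_tot[OF x] by simp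
  have "nabla10 G (I_sum G) x = nabla10 G (hs_tot G (R_nabla G) 1) x"
    by (rule nabla10_cong[OF x I_sum_hs_tot])
  then have "nabla10 G (\<lambda>x. I_sum G x + J x) x - delta10 (I_sum G x + J x) =
     (nabla10 G (hs_tot G (R_nabla G) 1) x - delta10 (hs_tot G (R_nabla G) 1 x)) + (nabla10 G J x - delta10 (J x))"
    unfolding nabla10_add[OF x ssec_I_sum J.ssec_hs_tot] delta10_add I by simp
  then show "nabla10 G (\<lambda>x. I_sum G x + J x) x - delta10 (I_sum G x + J x) + R_nabla G x = \<alpha> x"
    unfolding R.nabla10_hs_tot[OF x] J.nabla10_hs_tot[OF x] by simp
  show "homog (\<lambda>_. 0) (\<lambda>_. 1) 2 (\<alpha> x)" using homog_form[OF \<alpha>_hol[OF x] \<alpha>_anti[OF x]] by (simp add: numeral_2_eq_2)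
  show "dy A (\<alpha> x) = 0" for A by (rule dy_\<alpha>[OF x])
  show "dd \<alpha> x = 0" by (rule dd_\<alpha>[OF x])
qed

lemma D_F_holo:
  assumes x: "x \<in> U" and a: "\<And>j. dy (Inr j) (a x) = 0"
  shows "D_F G (\<lambda>x. I_sum G x + J x) a x = D_K G a x"
proof (rule D_F_eq_D_K[OF x])
  show "homog (\<lambda>_. 0) (\<lambda>_. 1) 1 (I_sum G x + J x)" by (rule F.I_form[OF x])
  show "dy (Inr j) (J x) = 0" for j by (rule homog_dy_zero[OF J.hs_tot_homog(1)[OF x]]) simp
  show "dy (Inr j) (a x) = 0" for j by (rule a)
qed (rule refl)

end

section \<open>The chain rule for Wirtinger derivatives\<close>

lemma wirt_zero: "wirt B (\<lambda>h. 0) = 0"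
  by (cases B) auto

lemma wirt_sum: "wirt B (\<lambda>h. \<Sum>i\<in>I. L i h) = (\<Sum>i\<in>I. wirt B (L i))"
proof (induction I rule: infinite_finite_induct)
  case (insert i I)
  then show ?case by (simp add: wirt_linear del: wirt.simps)
qed (simp_all add: wirt_zero del: wirt.simps)

text \<open>A real-linear functional splits into a complex-linear and an antilinear part, with the
  Wirtinger coefficients; this is what makes the chain rule take its complex form.\<close>

lemma linear_wirt:
  fixes D :: "complex^'n::finite \<Rightarrow> complex"
  assumes "linear D"
  shows "D u = (\<Sum>i\<in>UNIV. wirt (Inl i) D * u $ i + wirt (Inr i) D * cnj (u $ i))"
proof -
  have a: "axis i z = Re z *\<^sub>R axis i 1 + Im z *\<^sub>R axis i \<i>" for i :: 'n and z :: complex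
    by (simp add: vec_eq_iff axis_def complex_eq_iff)
  have d: "D (axis i z) = wirt (Inl i) D * z + wirt (Inr i) D * cnj z" for i z
  proof -
    have "D (axis i z) = D (Re z *\<^sub>R axis i 1 + Im z *\<^sub>R axis i \<i>)" by (rule arg_cong[OF a])
    also have "\<dots> = Re z *\<^sub>R D (axis i 1) + Im z *\<^sub>R D (axis i \<i>)"
      by (simp only: linear_add[OF assms] linear_cmul[OF assms])
    also have "\<dots> = wirt (Inl i) D * z + wirt (Inr i) D * cnj z"
      by (simp add: complex_eq_iff field_simps)
    finally show ?thesis .
  qed
  have "u = (\<Sum>i\<in>UNIV. axis i (u $ i))"
    by (simp add: vec_eq_iff axis_def if_distrib sum.delta cong: if_cong)
  then have "D u = (\<Sum>i\<in>UNIV. D (axis i (u $ i)))"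
    using linear_sum[OF assms] by metis
  then show ?thesis by (simp only: d)
qed

lemma has_derivative_vec_componentwise:
  fixes T :: "'b::euclidean_space \<Rightarrow> complex^'n::finite"
  assumes "\<And>i. ((\<lambda>w. T w $ i) has_derivative (\<lambda>h. L h $ i)) (at x)"
  shows "(T has_derivative L) (at x)"
proof -
  have "((\<lambda>w. T w \<bullet> b) has_derivative (\<lambda>h. L h \<bullet> b)) (at x)" if "b \<in> Basis" for b
  proof -
    from that obtain i z where b: "b = axis i z" by (auto simp: Basis_vec_def)
    show ?thesis unfolding b inner_axis by (rule has_derivative_inner_left[OF assms])
  qed
  then show ?thesis using has_derivative_componentwise_within[of T L x UNIV] by simp
qed

lemma pd_chain:
  fixes T :: "complex^'n::finite \<Rightarrow> complex^'n"
  assumes T: "\<And>i. (\<lambda>w. T w $ i) differentiable (at x)" and h: "h differentiable (at (T x))"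
  shows "pd B (\<lambda>w. h (T w)) x = (\<Sum>A\<in>UNIV. pd A h (T x) * pd B (\<lambda>w. coord A (T w)) x)"
proof -
  define L where "L v = (\<chi> i. frechet_derivative (\<lambda>w. T w $ i) (at x) v)" for v
  define D where "D = frechet_derivative h (at (T x))"
  have Li: "((\<lambda>w. T w $ i) has_derivative (\<lambda>v. L v $ i)) (at x)" for i
    using T[of i] unfolding frechet_derivative_works L_def by simp
  have L: "(T has_derivative L) (at x)" by (rule has_derivative_vec_componentwise[OF Li])
  have D: "(h has_derivative D) (at (T x))" using h unfolding frechet_derivative_works D_def .
  have lin: "linear D" using D has_derivative_linear by blast
  have "((\<lambda>w. h (T w)) has_derivative (\<lambda>v. D (L v))) (at x)"
    by (rule has_derivative_compose[OF L D])
  then have "pd B (\<lambda>w. h (T w)) x = wirt B (\<lambda>v. D (L v))" by (rule pd_eq)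
  also have "(\<lambda>v. D (L v)) = (\<lambda>v. \<Sum>i\<in>UNIV. wirt (Inl i) D * L v $ i + wirt (Inr i) D * cnj (L v $ i))"
    by (rule ext) (rule linear_wirt[OF lin])
  also have "wirt B \<dots> = (\<Sum>i\<in>UNIV. wirt (Inl i) D * wirt B (\<lambda>v. L v $ i) + wirt (Inr i) D * wirt B (\<lambda>v. cnj (L v $ i)))"
    by (simp only: wirt_sum wirt_linear)
  also have "\<dots> = (\<Sum>i\<in>UNIV. pd (Inl i) h (T x) * pd B (\<lambda>w. T w $ i) x + pd (Inr i) h (T x) * pd B (\<lambda>w. cnj (T w $ i)) x)"
    unfolding D_def pd_wirt[symmetric]
    by (simp only: pd_eq[OF Li, symmetric] pd_eq[OF has_derivative_cnj[OF Li], symmetric])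
  finally show ?thesis by (simp add: sum_ix sum.distrib)
qed

lemma smooth_on_component:
  assumes "open S"
  shows "smooth_on S (\<lambda>w :: complex^'n::finite. w $ i)"
  unfolding smooth_on_def
proof
  fix k show "ck_on k S (\<lambda>w :: complex^'n. w $ i)"
  proof (cases k)
    case 0
    then show ?thesis by (auto intro: continuous_intros)
  next
    case (Suc m)
    show ?thesis unfolding Suc
    proof (rule ck_on_SucI[OF assms])
      show "((\<lambda>w :: complex^'n. w $ i) has_derivative (\<lambda>h. h $ i)) (at x)" for x
        by (rule bounded_linear_imp_has_derivative[OF bounded_linear_vec_nth])
    qed (rule ck_on_const)
  qed
qed

lemma smooth_on_power:
  fixes f :: "'b::real_normed_vector \<Rightarrow> complex"
  shows "open S \<Longrightarrow> smooth_on S f \<Longrightarrow> smooth_on S (\<lambda>x. f x ^ n)"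
  by (induction n) (auto intro: smooth_on_mult)

lemma pd_prod:
  assumes "open V" "x \<in> V" "finite F" "\<And>i. i \<in> F \<Longrightarrow> smooth_on V (f i)"
  shows "pd B (\<lambda>w. \<Prod>i\<in>F. f i w) x = (\<Sum>i\<in>F. pd B (f i) x * (\<Prod>j\<in>F - {i}. f j x))"
  using assms(3,4)
proof (induction F)
  case (insert i F)
  have s: "smooth_on V (f i)" "smooth_on V (\<lambda>w. \<Prod>i\<in>F. f i w)"
    using insert.prems by (auto intro!: smooth_on_prod assms(1))
  have e: "(\<Prod>j\<in>insert i F - {k}. f j x) = f i x * (\<Prod>j\<in>F - {k}. f j x)" if "k \<in> F" for k
  proof -
    have "insert i F - {k} = insert i (F - {k})" "i \<notin> F - {k}" using that insert.hyps by auto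
    then show ?thesis using insert.hyps by simp
  qed
  have "pd B (\<lambda>w. \<Prod>i\<in>insert i F. f i w) x = pd B (\<lambda>w. f i w * (\<Prod>i\<in>F. f i w)) x"
    using insert.hyps by simp
  also have "\<dots> = pd B (f i) x * (\<Prod>i\<in>F. f i x) + f i x * (\<Sum>k\<in>F. pd B (f k) x * (\<Prod>j\<in>F - {k}. f j x))"
    using insert.IH insert.prems by (simp add: pd_mult[OF s[THEN smooth_on_differentiable, OF assms(2)]])
  also have "\<dots> = (\<Sum>k\<in>insert i F. pd B (f k) x * (\<Prod>j\<in>insert i F - {k}. f j x))"
    using insert.hyps by (simp add: e sum_distrib_left algebra_simps)
  finally show ?case .
qed simp

lemma pd_power:
  assumes "open V" "x \<in> V" "smooth_on V f"
  shows "pd B (\<lambda>w. f w ^ n) x = of_nat n * f x ^ (n - 1) * pd B f x"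
proof (induction n)
  case (Suc n)
  have "pd B (\<lambda>w. f w ^ Suc n) x = pd B f x * f x ^ n + f x * pd B (\<lambda>w. f w ^ n) x"
    using smooth_on_power[OF assms(1,3), THEN smooth_on_differentiable, OF assms(2)]
      smooth_on_differentiable[OF assms(3,2)] by (simp add: pd_mult)
  then show ?case unfolding Suc.IH by (cases n) (simp_all add: algebra_simps)
qed simp

section \<open>Evaluation of one-forms with polynomial coefficients\<close>

definition mset_deg :: "nat \<Rightarrow> ('n::finite ix \<Rightarrow> nat) set" where
  "mset_deg p = {M. (\<Sum>A\<in>UNIV. M A) = p}"

definition mon :: "('n::finite ix \<Rightarrow> complex) \<Rightarrow> ('n ix \<Rightarrow> nat) \<Rightarrow> complex" where
  "mon v M = (\<Prod>A\<in>UNIV. v A ^ M A)"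

text \<open>The explicit form of \<open>tensor_eval\<close> on one-forms: polynomial in
  \<open>v\<close> and linear in \<open>u\<close>, so that it can be differentiated in both.\<close>

definition ev :: "'n::finite weyl \<Rightarrow> nat \<Rightarrow> nat \<Rightarrow> ('n ix \<Rightarrow> complex) \<Rightarrow> ('n ix \<Rightarrow> complex) \<Rightarrow> complex" where
  "ev a k p v u = (\<Sum>M\<in>mset_deg p. mon v M * (\<Sum>A\<in>UNIV. u A * a k M {A}))"

text \<open>\<open>evd a A\<close> is the derivative of \<open>ev a\<close> with respect to the component \<open>v A\<close>.\<close>

definition evd :: "'n::finite weyl \<Rightarrow> 'n ix \<Rightarrow> nat \<Rightarrow> nat \<Rightarrow> ('n ix \<Rightarrow> complex) \<Rightarrow> ('n ix \<Rightarrow> complex) \<Rightarrow> complex" where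
  "evd a A k p v u = (case p of 0 \<Rightarrow> 0 | Suc q \<Rightarrow> ev (dy A a) k q v u)"

lemma mset_deg_upd: "M(A := Suc (M A)) \<in> mset_deg (Suc p) \<longleftrightarrow> M \<in> mset_deg p"
  using wt_upd[of "\<lambda>_. 1" "\<lambda>_. 0" M A "{}"] by (simp add: wt_def mset_deg_def)

lemma mset_deg_0: "M \<in> mset_deg 0 \<longleftrightarrow> M = 0"
  by (simp add: mset_deg_def fun_eq_iff)

lemma mon_upd: "mon v (M(A := Suc (M A))) = v A * mon v M"
proof -
  have "v B ^ (M(A := Suc (M A))) B = (if B = A then v A else 1) * v B ^ M B" for B by simp
  then have "mon v (M(A := Suc (M A))) = (\<Prod>B\<in>UNIV. if B = A then v A else 1) * mon v M"
    by (simp only: mon_def prod.distrib)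
  then show ?thesis by (simp add: prod.delta)
qed

lemma sum_mset_deg_Suc:
  fixes F :: "('n::finite ix \<Rightarrow> nat) \<Rightarrow> complex"
  assumes "\<And>M. M A = 0 \<Longrightarrow> F M = 0"
  shows "(\<Sum>M\<in>mset_deg (Suc p). F M) = (\<Sum>M\<in>mset_deg p. F (M(A := Suc (M A))))"
proof -
  have fin: "finite (mset_deg q :: ('n ix \<Rightarrow> nat) set)" for q
  proof (rule finite_subset)
    show "mset_deg q \<subseteq> {N :: 'n ix \<Rightarrow> nat. N \<le> (\<lambda>_. q)}"
      by (auto simp: mset_deg_def le_fun_def intro: member_le_sum)
  qed simp
  have "(\<Sum>M\<in>mset_deg (Suc p). F M) = (\<Sum>M\<in>{M\<in>mset_deg (Suc p). M A \<noteq> 0}. F M)"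
    by (rule sum.mono_neutral_right[OF fin]) (use assms in auto)
  also have "\<dots> = (\<Sum>M\<in>mset_deg p. F (M(A := Suc (M A))))"
  proof (rule sum.reindex_bij_witness[of _ "\<lambda>M. M(A := Suc (M A))" "\<lambda>M. M(A := M A - 1)"], goal_cases)
    case (2 M)
    then show ?case using mset_deg_upd[of "M(A := M A - 1)" A p] by auto
  next
    case (4 M)
    then show ?case using mset_deg_upd[of M A p] by auto
  qed auto
  finally show ?thesis .
qed

lemma ev_zero [simp]: "ev 0 k p v u = 0"
  by (simp add: ev_def)

lemma ev_add: "ev (a + b) k p v u = ev a k p v u + ev b k p v u"
  by (simp add: ev_def algebra_simps sum.distrib)

lemma ev_diff: "ev (a - b) k p v u = ev a k p v u - ev b k p v u"
  by (simp add: ev_def algebra_simps sum_subtractf)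

lemma ev_scl: "ev (scl z a) k p v u = z * ev a k p v u"
  by (simp add: ev_def sum_distrib_left mult_ac)

lemma ev_sum: "ev (\<Sum>i\<in>I. f i) k p v u = (\<Sum>i\<in>I. ev (f i) k p v u)"
  by (rule sum_hom[of "\<lambda>a. ev a k p v u", OF ev_zero ev_add])

lemma ev_ygen: "ev (ygen B \<odot> a) k p v u = (case p of 0 \<Rightarrow> 0 | Suc q \<Rightarrow> v B * ev a k q v u)"
proof (cases p)
  case 0
  then show ?thesis by (simp add: ev_def mset_deg_0 ygen_wmul)
next
  case (Suc q)
  have "ev (ygen B \<odot> a) k p v u = (\<Sum>M\<in>mset_deg (Suc q). mon v M * (\<Sum>A\<in>UNIV. u A * (ygen B \<odot> a) k M {A}))"
    by (simp add: ev_def Suc)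
  also have "\<dots> = (\<Sum>M\<in>mset_deg q. mon v (M(B := Suc (M B))) * (\<Sum>A\<in>UNIV. u A * (ygen B \<odot> a) k (M(B := Suc (M B))) {A}))"
    by (rule sum_mset_deg_Suc) (simp add: ygen_wmul)
  also have "\<dots> = v B * ev a k q v u"
    by (simp add: mon_upd ygen_wmul ev_def sum_distrib_left mult.assoc)
  finally show ?thesis by (simp add: Suc)
qed

lemma ev_ygen_dy: "ev (ygen C \<odot> dy A a) k p v u = v C * evd a A k p v u"
  by (simp add: ev_ygen evd_def split: nat.split)

lemma ev_dxgen:
  fixes D :: "'n::finite ix"
  shows "ev (dxgen D) k p v u = (if k = 0 \<and> p = 0 then u D else 0)"
proof -
  have "u A * dxgen D k M {A} = (if A = D then (if k = 0 \<and> M = 0 then u D else 0) else 0)" for A M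
    by (auto simp: dxgen_def)
  then have "ev (dxgen D) k p v u = (\<Sum>M\<in>mset_deg p. mon v M * (if k = 0 \<and> M = 0 then u D else 0))"
    unfolding ev_def by (simp only:) (simp add: sum.delta)
  also have "\<dots> = (\<Sum>M\<in>(mset_deg p :: ('n ix \<Rightarrow> nat) set). if M = 0 then (if k = 0 then u D else 0) else 0)"
    by (intro sum.cong refl) (simp add: mon_def)
  also have "\<dots> = (if k = 0 \<and> p = 0 then u D else 0)"
  proof (cases "p = 0")
    case True
    then have "mset_deg p = {0 :: 'n ix \<Rightarrow> nat}" using mset_deg_0 by auto
    then show ?thesis using True by simp
  next
    case False
    then have "(0 :: 'n ix \<Rightarrow> nat) \<notin> mset_deg p" by (simp add: mset_deg_def)
    then show ?thesis using False by (intro sum.neutral[THEN trans]) auto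
  qed
  finally show ?thesis .
qed

lemma evd_eq: "(\<Sum>M\<in>mset_deg p. of_nat (M A) * mon v (M(A := M A - 1)) * (\<Sum>C\<in>UNIV. u C * a k M {C})) = evd a A k p v u"
proof (cases p)
  case 0
  then show ?thesis by (simp add: evd_def mset_deg_0)
next
  case (Suc q)
  have "(\<Sum>M\<in>mset_deg (Suc q). of_nat (M A) * mon v (M(A := M A - 1)) * (\<Sum>C\<in>UNIV. u C * a k M {C})) =
    (\<Sum>M\<in>mset_deg q. of_nat ((M(A := Suc (M A))) A) * mon v ((M(A := Suc (M A)))(A := (M(A := Suc (M A))) A - 1)) * (\<Sum>C\<in>UNIV. u C * a k (M(A := Suc (M A))) {C}))"
    by (rule sum_mset_deg_Suc) simp
  also have "\<dots> = ev (dy A a) k q v u"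
    unfolding ev_def by (intro sum.cong refl) (simp add: dy_def sum_distrib_left mult_ac)
  finally show ?thesis by (simp add: Suc evd_def)
qed

text \<open>The vectors are allowed to vary with the point, because the push-forward of a fixed
  vector under a change of charts does.\<close>

lemma pd_ev:
  assumes V: "open V" "x \<in> V" and a: "ssec V a" and v: "\<And>A. smooth_on V (\<lambda>x. v x A)" and u: "\<And>A. smooth_on V (\<lambda>x. u x A)"
  shows "pd B (\<lambda>x. ev (a x) k p (v x) (u x)) x = ev (pdw B a x) k p (v x) (u x) +
     ev (a x) k p (v x) (\<lambda>A. pd B (\<lambda>x. u x A) x) + (\<Sum>A\<in>UNIV. pd B (\<lambda>x. v x A) x * evd (a x) A k p (v x) (u x))"
proof -
  note d = smooth_on_differentiable[OF _ V(2)]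
  have sm: "smooth_on V (\<lambda>x. mon (v x) M)" for M
    unfolding mon_def by (intro smooth_on_prod smooth_on_power v V)
  have sc: "smooth_on V (\<lambda>x. \<Sum>C\<in>UNIV. u x C * a x k M {C})" for M
    by (intro smooth_on_sum smooth_on_mult u ssecD[OF a] V)
  have pm: "pd B (\<lambda>x. mon (v x) M) x = (\<Sum>A\<in>UNIV. pd B (\<lambda>x. v x A) x * (of_nat (M A) * mon (v x) (M(A := M A - 1))))" for M
  proof -
    have pm0: "(\<Prod>C\<in>UNIV - {A}. v x C ^ M C) * v x A ^ (M A - 1) = mon (v x) (M(A := M A - 1))" for A
    proof -
      have "mon (v x) (M(A := M A - 1)) = v x A ^ (M A - 1) * (\<Prod>C\<in>UNIV - {A}. v x C ^ (M(A := M A - 1)) C)"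
        by (simp add: mon_def prod.remove[of UNIV A])
      also have "(\<Prod>C\<in>UNIV - {A}. v x C ^ (M(A := M A - 1)) C) = (\<Prod>C\<in>UNIV - {A}. v x C ^ M C)"
        by (intro prod.cong) auto
      finally have h: "mon (v x) (M(A := M A - 1)) = v x A ^ (M A - 1) * (\<Prod>C\<in>UNIV - {A}. v x C ^ M C)" .
      show ?thesis unfolding h by (rule mult.commute)
    qed
    have e: "of_nat (M A) * v x A ^ (M A - 1) * b * (\<Prod>C\<in>UNIV - {A}. v x C ^ M C) = b * (of_nat (M A) * mon (v x) (M(A := M A - 1)))" for A b
      unfolding pm0[symmetric] by (simp only: mult_ac)
    have "pd B (\<lambda>x. mon (v x) M) x = (\<Sum>A\<in>UNIV. pd B (\<lambda>w. v w A ^ M A) x * (\<Prod>C\<in>UNIV - {A}. v x C ^ M C))"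
      unfolding mon_def by (rule pd_prod[OF V]) (auto intro: smooth_on_power v V)
    then show ?thesis by (simp only: pd_power[OF V v] e)
  qed
  have pc: "pd B (\<lambda>x. \<Sum>C\<in>UNIV. u x C * a x k M {C}) x =
     (\<Sum>C\<in>UNIV. pd B (\<lambda>x. u x C) x * a x k M {C}) + (\<Sum>C\<in>UNIV. u x C * pdw B a x k M {C})" for M
    by (simp add: pd_sum pd_mult d u ssecD[OF a] smooth_on_mult[OF V(1)] sum.distrib pdw_def)
  have "pd B (\<lambda>x. ev (a x) k p (v x) (u x)) x =
    (\<Sum>M\<in>mset_deg p. pd B (\<lambda>x. mon (v x) M) x * (\<Sum>C\<in>UNIV. u x C * a x k M {C}) +
      mon (v x) M * pd B (\<lambda>x. \<Sum>C\<in>UNIV. u x C * a x k M {C}) x)"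
    unfolding ev_def by (subst pd_sum) (auto intro!: d smooth_on_mult sm sc V simp: pd_mult[OF d[OF sm] d[OF sc]])
  also have "\<dots> = (\<Sum>M\<in>mset_deg p. \<Sum>A\<in>UNIV. pd B (\<lambda>x. v x A) x * (of_nat (M A) * mon (v x) (M(A := M A - 1)) * (\<Sum>C\<in>UNIV. u x C * a x k M {C}))) +
     ev (a x) k p (v x) (\<lambda>A. pd B (\<lambda>x. u x A) x) + ev (pdw B a x) k p (v x) (u x)"
    unfolding pm pc ev_def by (simp add: sum.distrib distrib_left sum_distrib_right mult.assoc)
  also have "(\<Sum>M\<in>mset_deg p. \<Sum>A\<in>UNIV. pd B (\<lambda>x. v x A) x * (of_nat (M A) * mon (v x) (M(A := M A - 1)) * (\<Sum>C\<in>UNIV. u x C * a x k M {C}))) =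
     (\<Sum>A\<in>UNIV. pd B (\<lambda>x. v x A) x * evd (a x) A k p (v x) (u x))"
    unfolding evd_eq[symmetric] sum_distrib_left by (rule sum.swap)
  finally show ?thesis by simp
qed

lemma ev_form_hol_zero:
  assumes "homog (\<lambda>_. 0) hol 0 a" "\<And>l. u (Inr l) = 0"
  shows "ev a k p v u = 0"
proof -
  have "u A * a k M {A} = 0" for A M
    using homogD[OF assms(1), of k M "{A}"] assms(2) by (cases A) (auto simp: wt_def)
  then show ?thesis unfolding ev_def by (simp only: sum.neutral_const mult_zero_right)
qed

section \<open>Change of charts\<close>

locale chart_change = c1: kaehler_chart U G + c2: kaehler_chart U' G'
  for U :: "(complex^'n::finite) set" and G and U' :: "(complex^'n) set" and G' +
  fixes V :: "(complex^'n) set" and T :: "complex^'n \<Rightarrow> complex^'n"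
  assumes V: "open V" and VU: "V \<subseteq> U" and TV: "\<And>x. x \<in> V \<Longrightarrow> T x \<in> U'"
    and smooth_T: "\<And>i. smooth_on V (\<lambda>w. T w $ i)"
    and holo_T: "\<And>x i j. x \<in> V \<Longrightarrow> pd (Inr j) (\<lambda>w. T w $ i) x = 0"
    and metric_T: "\<And>x i j. x \<in> V \<Longrightarrow> G x $ i $ j =
      (\<Sum>a\<in>UNIV. \<Sum>b\<in>UNIV. pd (Inl i) (\<lambda>w. T w $ a) x * cnj (pd (Inl j) (\<lambda>w. T w $ b) x) * G' (T x) $ a $ b)"
begin

abbreviation P where "P x a i \<equiv> pd (Inl i) (\<lambda>w. T w $ a) x"

text \<open>The local form of \<open>push\<close>: the complexified differential of \<open>T\<close>
  applied to a tangent vector.\<close>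

definition Dp :: "complex^'n \<Rightarrow> ('n ix \<Rightarrow> complex) \<Rightarrow> 'n ix \<Rightarrow> complex" where
  "Dp x v A = (\<Sum>B\<in>UNIV. pd B (\<lambda>w. coord A (T w)) x * v B)"

lemma d_T: "x \<in> V \<Longrightarrow> (\<lambda>w. T w $ i) differentiable (at x)"
  by (rule smooth_on_differentiable[OF smooth_T])

lemma Dp_simps:
  assumes x: "x \<in> V"
  shows "Dp x v (Inl a) = (\<Sum>i\<in>UNIV. P x a i * v (Inl i))" "Dp x v (Inr a) = (\<Sum>i\<in>UNIV. cnj (P x a i) * v (Inr i))"
  by (simp_all add: Dp_def sum_ix holo_T[OF x] pd_cnj[OF d_T[OF x]])

lemma smooth_P: "smooth_on V (\<lambda>x. P x a i)"
  using smooth_on_pd[OF V smooth_T] by simp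

lemma smooth_cP: "smooth_on V (\<lambda>x. cnj (P x a i))"
  by (rule smooth_on_bounded_linear[OF V bounded_linear_cnj smooth_P])

lemma smooth_Dp: "smooth_on V (\<lambda>x. Dp x v A)"
proof (rule smooth_on_cong[OF V])
  show "smooth_on V (\<lambda>x. case A of Inl a \<Rightarrow> (\<Sum>i\<in>UNIV. P x a i * v (Inl i)) | Inr a \<Rightarrow> (\<Sum>i\<in>UNIV. cnj (P x a i) * v (Inr i)))"
    by (cases A) (auto intro!: smooth_on_sum smooth_on_mult smooth_P smooth_cP V)
qed (cases A; simp add: Dp_simps)

lemma pd_T_chain:
  assumes x: "x \<in> V" and h: "smooth_on U' h"
  shows "pd (Inl i) (\<lambda>w. h (T w)) x = (\<Sum>a\<in>UNIV. pd (Inl a) h (T x) * P x a i)"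
    "pd (Inr i) (\<lambda>w. h (T w)) x = (\<Sum>a\<in>UNIV. pd (Inr a) h (T x) * cnj (P x a i))"
proof -
  have c: "pd B (\<lambda>w. h (T w)) x = (\<Sum>A\<in>UNIV. pd A h (T x) * pd B (\<lambda>w. coord A (T w)) x)" for B
    by (rule pd_chain[OF d_T[OF x] smooth_on_differentiable[OF h TV[OF x]]])
  show "pd (Inl i) (\<lambda>w. h (T w)) x = (\<Sum>a\<in>UNIV. pd (Inl a) h (T x) * P x a i)"
    "pd (Inr i) (\<lambda>w. h (T w)) x = (\<Sum>a\<in>UNIV. pd (Inr a) h (T x) * cnj (P x a i))"
    by (simp_all add: c sum_ix holo_T[OF x] pd_cnj[OF d_T[OF x]])
qed

lemma pd_P:
  assumes x: "x \<in> V"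
  shows "pd (Inr l) (\<lambda>w. P w a i) x = 0" "pd (Inl l) (\<lambda>w. cnj (P w a i)) x = 0"
    "pd (Inr l) (\<lambda>w. pd (Inl j) (\<lambda>w. P w a i) w) x = 0"
proof -
  have c: "pd (Inr l) (pd (Inl i) h) x = 0" if "smooth_on V h" "\<And>y. y \<in> V \<Longrightarrow> pd (Inr l) h y = 0" "x \<in> V" for h i l x
  proof -
    have "pd (Inr l) (pd (Inl i) h) x = pd (Inl i) (pd (Inr l) h) x" by (rule pd_commute[OF V that(3,1)])
    also have "\<dots> = pd (Inl i) (\<lambda>_. 0) x" by (rule pd_cong[OF V that(3,2)])
    finally show ?thesis by simp
  qed
  have 1: "pd (Inr l) (\<lambda>w. P w a i) x = 0" if "x \<in> V" for x l a i
    using c[OF smooth_T holo_T that] by simp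
  then show "pd (Inr l) (\<lambda>w. P w a i) x = 0" using x .
  show "pd (Inl l) (\<lambda>w. cnj (P w a i)) x = 0"
    using 1[OF x] by (simp add: pd_cnj[OF smooth_on_differentiable[OF smooth_P x]])
  show "pd (Inr l) (\<lambda>w. pd (Inl j) (\<lambda>w. P w a i) w) x = 0"
    using c[OF smooth_P 1 x] by simp
qed

text \<open>Nondegeneracy of the metric in the first chart makes the Jacobian and the second metric
  invertible without any appeal to the inverse transition map.\<close>

lemma metric_cancel:
  assumes x: "x \<in> V" and z: "\<And>l. (\<Sum>b\<in>UNIV. \<Sum>e\<in>UNIV. cnj (P x b l) * G' (T x) $ e $ b * z e) = 0"
  shows "z e = 0"
proof -
  have xU: "x \<in> U" using x VU by auto
  define Q :: "complex^'n^'n" where "Q = (\<chi> f l. \<Sum>b\<in>UNIV. cnj (P x b l) * G' (T x) $ f $ b)"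
  define PT :: "complex^'n^'n" where "PT = (\<chi> k e. P x e k)"
  have "G x = PT ** Q"
    unfolding PT_def Q_def
    by (simp add: vec_eq_iff matrix_matrix_mult_def metric_T[OF x] sum_distrib_left mult.assoc)
  then have "PT ** (Q ** c1.H x) = mat 1"
    using matrix_inv_mult(1)[OF c1.inv_G[OF xU]] by (simp add: matrix_mul_assoc)
  then have 1: "(Q ** c1.H x) ** PT = mat 1" using matrix_left_right_inverse by blast
  define zr :: "complex^'n" where "zr = (\<chi> f. z f)"
  have "zr v* Q = 0"
    using z by (simp add: vec_eq_iff vector_matrix_mult_def Q_def zr_def sum_distrib_right sum_distrib_left mult_ac)
      (subst sum.swap, simp add: mult_ac)
  then have "zr v* ((Q ** c1.H x) ** PT) = 0"
    by (simp add: vector_matrix_mul_assoc[symmetric] flip: vector_matrix_mul_assoc)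
  then have "zr = 0" by (simp add: 1)
  then show ?thesis by (simp add: zr_def vec_eq_iff)
qed

end

lemma sum3_rev:
  fixes F :: "'i \<Rightarrow> 'j \<Rightarrow> 'k \<Rightarrow> 'b::comm_monoid_add"
  shows "(\<Sum>i\<in>I. \<Sum>j\<in>J. \<Sum>k\<in>K. F i j k) = (\<Sum>k\<in>K. \<Sum>j\<in>J. \<Sum>i\<in>I. F i j k)"
proof -
  have "(\<Sum>i\<in>I. \<Sum>j\<in>J. \<Sum>k\<in>K. F i j k) = (\<Sum>i\<in>I. \<Sum>k\<in>K. \<Sum>j\<in>J. F i j k)"
    by (intro sum.cong refl sum.swap)
  also have "\<dots> = (\<Sum>k\<in>K. \<Sum>i\<in>I. \<Sum>j\<in>J. F i j k)" by (rule sum.swap)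
  also have "\<dots> = (\<Sum>k\<in>K. \<Sum>j\<in>J. \<Sum>i\<in>I. F i j k)" by (intro sum.cong refl sum.swap)
  finally show ?thesis .
qed

text \<open>The derivative of the composite is polynomial in the derivatives of \<open>T\<close>,
  their conjugates and the Wirtinger derivatives of \<open>h\<close> along \<open>T\<close>. The
  latter are composites of the same kind, which is why \<open>h\<close> is generalised in the
  induction.\<close>

lemma smooth_on_comp:
  fixes T :: "complex^'n::finite \<Rightarrow> complex^'n" and h :: "complex^'n \<Rightarrow> complex"
  assumes V: "open V" and U': "open U'" and T: "\<And>i. smooth_on V (\<lambda>w. T w $ i)" and TV: "\<And>x. x \<in> V \<Longrightarrow> T x \<in> U'"
    and h: "smooth_on U' h"
  shows "smooth_on V (\<lambda>w. h (T w))"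
proof -
  define L where "L x v = (\<chi> i. frechet_derivative (\<lambda>w. T w $ i) (at x) v)" for x v
  have Td: "(T has_derivative L x) (at x)" if "x \<in> V" for x
  proof (rule has_derivative_vec_componentwise)
    show "((\<lambda>w. T w $ i) has_derivative (\<lambda>v. L x v $ i)) (at x)" for i
      using smooth_on_has_derivative[OF T that] by (simp add: L_def)
  qed
  have hd: "((\<lambda>w. h (T w)) has_derivative (\<lambda>v. \<Sum>i\<in>UNIV. pd (Inl i) h (T x) * L x v $ i + pd (Inr i) h (T x) * cnj (L x v $ i))) (at x)"
    if x: "x \<in> V" and h: "smooth_on U' h" for x h
  proof -
    let ?D = "frechet_derivative h (at (T x))"
    have D: "(h has_derivative ?D) (at (T x))" by (rule smooth_on_has_derivative[OF h TV[OF x]])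
    have "((\<lambda>w. h (T w)) has_derivative (\<lambda>v. ?D (L x v))) (at x)"
      by (rule has_derivative_compose[OF Td[OF x] D])
    also have "(\<lambda>v. ?D (L x v)) = (\<lambda>v. \<Sum>i\<in>UNIV. pd (Inl i) h (T x) * L x v $ i + pd (Inr i) h (T x) * cnj (L x v $ i))"
      unfolding pd_wirt by (rule ext) (rule linear_wirt[OF has_derivative_linear[OF D]])
    finally show ?thesis .
  qed
  have "ck_on k V (\<lambda>w. h (T w))" for k
    using h
  proof (induction k arbitrary: h)
    case 0
    then show ?case
      using hd[OF _ 0] by (auto intro!: continuous_at_imp_continuous_on has_derivative_continuous)
  next
    case (Suc k)
    show ?case
    proof (rule ck_on_SucI[OF V hd[OF _ Suc.prems]])
      fix v
      have L: "ck_on k V (\<lambda>x. L x v $ i)" for i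
        using smooth_on_frechet[OF T, of i v] by (simp add: L_def smooth_on_def)
      have p: "ck_on k V (\<lambda>x. pd A h (T x))" for A
        by (rule Suc.IH[OF smooth_on_pd[OF U' Suc.prems]])
      have s: "ck_on k V (\<lambda>x. \<Sum>i\<in>I. F i x)" if "\<And>i. ck_on k V (F i)" for F :: "'n \<Rightarrow> complex^'n \<Rightarrow> complex" and I
        by (induction I rule: infinite_finite_induct) (auto intro: ck_on_const ck_on_add[OF V] that)
      show "ck_on k V (\<lambda>x. \<Sum>i\<in>UNIV. pd (Inl i) h (T x) * L x v $ i + pd (Inr i) h (T x) * cnj (L x v $ i))"
        by (intro s ck_on_add[OF V] ck_on_mult[OF V] p L ck_on_bounded_linear[OF V bounded_linear_cnj])
    qed
  qed
  then show ?thesis by (simp add: smooth_on_def)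
qed

lemma pd_component: "pd (Inl m) (\<lambda>w :: complex^'n::finite. c * w $ m) x = c"
proof -
  have "((\<lambda>w :: complex^'n. w $ m) has_derivative (\<lambda>h. h $ m)) (at x)"
    by (rule bounded_linear_imp_has_derivative[OF bounded_linear_vec_nth])
  then have "((\<lambda>w :: complex^'n. c * w $ m) has_derivative (\<lambda>h. c * h $ m)) (at x)"
    by (rule has_derivative_mult_right)
  then show ?thesis by (subst pd_eq) (auto simp: axis_def field_simps)
qed

section \<open>Holomorphic derivatives of evaluated sections\<close>

context kaehler_chart
begin

text \<open>On a section without dz the contraction simply replaces each dz^i produced by
  \<open>nabla10\<close> by y^i.\<close>

lemma iota_nabla10:
  assumes x: "x \<in> U" and a: "\<And>y. y \<in> U \<Longrightarrow> homog (\<lambda>_. 0) hol 0 (a y)"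
  shows "iota (nabla10 G a x) = (\<Sum>i\<in>UNIV. ygen (Inl i) \<odot> cov_deriv G (Inl i) a x)"
proof -
  have z: "contr (Inl i) (cov_deriv G B a x) = 0" for i B
  proof (intro ext)
    fix k M S
    have "homog (\<lambda>_. 0) hol 0 (cov_deriv G B a x)" by (rule homog_cov[OF x _ _ a]) auto
    then have "cov_deriv G B a x k M (insert (Inl i) S) = 0"
      using homogD[of "\<lambda>_. 0" hol 0 "cov_deriv G B a x" k M "insert (Inl i) S"] by (force simp: wt_form_hol)
    then show "contr (Inl i) (cov_deriv G B a x) k M S = 0 k M S" by (simp add: contr_def)
  qed
  have "contr (Inl i) (nabla10 G a x) = cov_deriv G (Inl i) a x" for i
    by (simp add: nabla10_def contr_sum contr_dxgen z sum.delta' cong: if_cong)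
  then show ?thesis by (simp add: iota_def)
qed

lemma ev_cov_hol:
  assumes x: "x \<in> U"
  shows "ev (cov_deriv G (Inl i) a x) k p v u = ev (pdw (Inl i) a x) k p v u -
     (\<Sum>m\<in>UNIV. \<Sum>j\<in>UNIV. \<Gamma> x (Inl m) (Inl i) (Inl j) * v (Inl j) * evd (a x) (Inl m) k p v u)"
  unfolding cov_deriv_def
  by (simp add: sum_ix christoffel_simps(3-)[OF x] ev_diff ev_sum ev_scl ev_ygen_dy mult.assoc)

end

context chart_change
begin

lemma U_V: "x \<in> V \<Longrightarrow> x \<in> U"
  using VU by auto

text \<open>The transformation law of the connection, obtained by differentiating
  \<open>metric_T\<close> in a holomorphic direction; conjugated Jacobians are constant there. It
  appears paired with the metric, and \<open>metric_cancel\<close> removes the pairing.\<close>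

lemma christoffel_T:
  assumes x: "x \<in> V"
  shows "(\<Sum>k\<in>UNIV. P x a k * christoffel G x (Inl k) (Inl i) (Inl j)) = pd (Inl i) (\<lambda>w. P w a j) x +
    (\<Sum>c\<in>UNIV. \<Sum>e\<in>UNIV. christoffel G' (T x) (Inl a) (Inl c) (Inl e) * P x c i * P x e j)"
proof -
  let ?\<Gamma> = "\<lambda>k. christoffel G x (Inl k) (Inl i) (Inl j)"
  let ?\<Gamma>' = "\<lambda>e c a. christoffel G' (T x) (Inl e) (Inl c) (Inl a)"
  let ?G' = "\<lambda>a b. G' (T x) $ a $ b"
  \<comment> \<open>The difference of the two sides; \<open>w1\<close> and \<open>w2\<close> compute
    the same metric derivative in the first chart and through the second one.\<close>
  define z where "z e = (\<Sum>k\<in>UNIV. P x e k * ?\<Gamma> k) - (pd (Inl i) (\<lambda>w. P w e j) x +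
    (\<Sum>c\<in>UNIV. \<Sum>a\<in>UNIV. ?\<Gamma>' e c a * P x c i * P x a j))" for e
  have "(\<Sum>b\<in>UNIV. \<Sum>e\<in>UNIV. cnj (P x b l) * ?G' e b * z e) = 0" for l
  proof -
    have w1: "pd (Inl i) (\<lambda>w. G w $ j $ l) x = (\<Sum>k\<in>UNIV. \<Sum>e\<in>UNIV. \<Sum>b\<in>UNIV. cnj (P x b l) * ?G' e b * (P x e k * ?\<Gamma> k))"
      by (simp only: c1.pd_G[OF U_V[OF x]] c1.christoffel_simps(3-)[OF U_V[OF x]] metric_T[OF x] mult_zero_right sum.neutral_const add_0_right sum_distrib_right)
        (simp add: mult_ac)
    have sG: "smooth_on V (\<lambda>w. G' (T w) $ a $ b)" for a b
      by (rule smooth_on_comp[OF V c2.U smooth_T TV c2.smooth_G])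
    note d = smooth_on_differentiable[OF _ x]
    have pG: "pd (Inl i) (\<lambda>w. G' (T w) $ a $ b) x = (\<Sum>c\<in>UNIV. \<Sum>e\<in>UNIV. ?G' e b * ?\<Gamma>' e c a * P x c i)" for a b
      by (simp add: pd_T_chain(1)[OF x c2.smooth_G] c2.pd_G[OF TV[OF x]] c2.christoffel_simps(3-)[OF TV[OF x]] sum_distrib_right)
    have "pd (Inl i) (\<lambda>w. G w $ j $ l) x = pd (Inl i) (\<lambda>w. \<Sum>a\<in>UNIV. \<Sum>b\<in>UNIV. P w a j * cnj (P w b l) * G' (T w) $ a $ b) x"
      by (rule pd_cong[OF V x metric_T])
    also have "\<dots> = (\<Sum>a\<in>UNIV. \<Sum>b\<in>UNIV. pd (Inl i) (\<lambda>w. P w a j) x * cnj (P x b l) * ?G' a b +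
        P x a j * cnj (P x b l) * (\<Sum>c\<in>UNIV. \<Sum>e\<in>UNIV. ?G' e b * ?\<Gamma>' e c a * P x c i))"
      by (simp add: pd_sum pd_mult d smooth_P smooth_cP sG smooth_on_mult[OF V] smooth_on_sum[OF V] pd_P[OF x] pG)
    also have "\<dots> = (\<Sum>a\<in>UNIV. \<Sum>b\<in>UNIV. cnj (P x b l) * ?G' a b * pd (Inl i) (\<lambda>w. P w a j) x) +
        (\<Sum>a\<in>UNIV. \<Sum>b\<in>UNIV. \<Sum>c\<in>UNIV. \<Sum>e\<in>UNIV. cnj (P x b l) * ?G' e b * (?\<Gamma>' e c a * P x c i * P x a j))"
      by (simp add: sum.distrib sum_distrib_left mult_ac)
    also have "(\<Sum>a\<in>UNIV. \<Sum>b\<in>UNIV. \<Sum>c\<in>UNIV. \<Sum>e\<in>UNIV. cnj (P x b l) * ?G' e b * (?\<Gamma>' e c a * P x c i * P x a j)) =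
        (\<Sum>b\<in>UNIV. \<Sum>a\<in>UNIV. \<Sum>c\<in>UNIV. \<Sum>e\<in>UNIV. cnj (P x b l) * ?G' e b * (?\<Gamma>' e c a * P x c i * P x a j))"
      by (rule sum.swap)
    also have "\<dots> = (\<Sum>b\<in>UNIV. \<Sum>e\<in>UNIV. \<Sum>c\<in>UNIV. \<Sum>a\<in>UNIV. cnj (P x b l) * ?G' e b * (?\<Gamma>' e c a * P x c i * P x a j))"
      by (intro sum.cong refl sum3_rev)
    also have "(\<Sum>a\<in>UNIV. \<Sum>b\<in>UNIV. cnj (P x b l) * ?G' a b * pd (Inl i) (\<lambda>w. P w a j) x) =
        (\<Sum>b\<in>UNIV. \<Sum>a\<in>UNIV. cnj (P x b l) * ?G' a b * pd (Inl i) (\<lambda>w. P w a j) x)"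
      by (rule sum.swap)
    finally have w2: "pd (Inl i) (\<lambda>w. G w $ j $ l) x = (\<Sum>b\<in>UNIV. \<Sum>a\<in>UNIV. cnj (P x b l) * ?G' a b * pd (Inl i) (\<lambda>w. P w a j) x) +
        (\<Sum>b\<in>UNIV. \<Sum>e\<in>UNIV. \<Sum>c\<in>UNIV. \<Sum>a\<in>UNIV. cnj (P x b l) * ?G' e b * (?\<Gamma>' e c a * P x c i * P x a j))" .
    have "(\<Sum>b\<in>UNIV. \<Sum>e\<in>UNIV. cnj (P x b l) * ?G' e b * z e) =
       (\<Sum>b\<in>UNIV. \<Sum>e\<in>UNIV. \<Sum>k\<in>UNIV. cnj (P x b l) * ?G' e b * (P x e k * ?\<Gamma> k)) -
       ((\<Sum>b\<in>UNIV. \<Sum>a\<in>UNIV. cnj (P x b l) * ?G' a b * pd (Inl i) (\<lambda>w. P w a j) x) +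
        (\<Sum>b\<in>UNIV. \<Sum>e\<in>UNIV. \<Sum>c\<in>UNIV. \<Sum>a\<in>UNIV. cnj (P x b l) * ?G' e b * (?\<Gamma>' e c a * P x c i * P x a j)))"
      unfolding z_def right_diff_distrib distrib_left sum_distrib_left sum_subtractf sum.distrib ..
    also have "\<dots> = 0"
      unfolding w2[symmetric] w1 by (subst sum3_rev) simp
    finally show ?thesis .
  qed
  then have "z a = 0" by (rule metric_cancel[OF x])
  then show ?thesis by (simp add: z_def)
qed

text \<open>Differentiating \<open>christoffel_T\<close> anti-holomorphically removes the
  inhomogeneous term, a second derivative of a holomorphic map, and leaves a tensor law.\<close>

lemma curv_T:
  assumes x: "x \<in> V"
  shows "(\<Sum>k\<in>UNIV. P x a k * curv G x k i l j) =
    (\<Sum>c\<in>UNIV. \<Sum>e\<in>UNIV. \<Sum>d\<in>UNIV. curv G' (T x) a c d e * cnj (P x d l) * P x c i * P x e j)"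
proof -
  note d = smooth_on_differentiable[OF _ x]
  have s1: "smooth_on V (\<lambda>w. christoffel G w A B C)" for A B C
    by (rule smooth_on_subset[OF c1.smooth_christoffel VU])
  have s2: "smooth_on V (\<lambda>w. christoffel G' (T w) A B C)" for A B C
    by (rule smooth_on_comp[OF V c2.U smooth_T TV c2.smooth_christoffel])
  have "pd (Inr l) (\<lambda>w. \<Sum>k\<in>UNIV. P w a k * christoffel G w (Inl k) (Inl i) (Inl j)) x =
    pd (Inr l) (\<lambda>w. pd (Inl i) (\<lambda>w. P w a j) w +
      (\<Sum>c\<in>UNIV. \<Sum>e\<in>UNIV. christoffel G' (T w) (Inl a) (Inl c) (Inl e) * P w c i * P w e j)) x"
    by (rule pd_cong[OF V x christoffel_T])
  also have "\<dots> = (\<Sum>c\<in>UNIV. \<Sum>e\<in>UNIV. pd (Inr l) (\<lambda>w. christoffel G' (T w) (Inl a) (Inl c) (Inl e)) x * P x c i * P x e j)"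
    using smooth_on_pd[OF V smooth_P]
    by (simp add: pd_add pd_sum pd_mult d smooth_P s2 smooth_on_mult[OF V] smooth_on_sum[OF V] pd_P[OF x])
  also have "\<dots> = (\<Sum>c\<in>UNIV. \<Sum>e\<in>UNIV. \<Sum>d\<in>UNIV. curv G' (T x) a c d e * cnj (P x d l) * P x c i * P x e j)"
    by (simp add: pd_T_chain(2)[OF x c2.smooth_christoffel] c2.curv_eq[OF TV[OF x]] sum_distrib_right)
  also have "pd (Inr l) (\<lambda>w. \<Sum>k\<in>UNIV. P w a k * christoffel G w (Inl k) (Inl i) (Inl j)) x =
      (\<Sum>k\<in>UNIV. P x a k * curv G x k i l j)"
    by (simp add: pd_sum pd_mult d smooth_P s1 smooth_on_mult[OF V] pd_P[OF x] c1.curv_eq[OF U_V[OF x]])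
  finally show ?thesis .
qed

text \<open>The transformation law stated through values on tangent vectors, so that no formula for
  the coefficients of transformed y-monomials is needed.\<close>

definition related :: "(complex^'n \<Rightarrow> 'n weyl) \<Rightarrow> (complex^'n \<Rightarrow> 'n weyl) \<Rightarrow> bool" where
  "related a a' \<longleftrightarrow> (\<forall>x\<in>V. \<forall>k p v u. ev (a x) k p v u = ev (a' (T x)) k p (Dp x v) (Dp x u))"

text \<open>The relation holds for all \<open>v\<close>, so it may be differentiated in the
  component \<open>Inl m\<close>. For this \<open>vw\<close> perturbs that component alone by a
  holomorphic parameter and the derivative is taken at 0.\<close>

lemma evd_related:
  assumes r: "related a a'" and x: "x \<in> V"
  shows "evd (a x) (Inl m) k p v u = (\<Sum>A\<in>UNIV. P x A m * evd (a' (T x)) (Inl A) k p (Dp x v) (Dp x u))"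
proof -
  define vw where "vw w B = v B + (if B = Inl m then 1 else 0) * w $ m" for w :: "complex^'n" and B
  have vw0: "vw 0 = v" by (rule ext) (simp add: vw_def)
  have D: "Dp x (vw w) A = Dp x v A + pd (Inl m) (\<lambda>w. coord A (T w)) x * w $ m" for w A
    by (simp add: Dp_def vw_def distrib_left sum.distrib if_distrib[of "\<lambda>z. z * _"] if_distrib[of "\<lambda>z. _ * z"] sum.delta cong: if_cong)
  have lin: "smooth_on UNIV (\<lambda>w :: complex^'n. c + b * w $ m)" "pd (Inl m) (\<lambda>w :: complex^'n. c + b * w $ m) 0 = b" for b c
  proof -
    have s: "smooth_on UNIV (\<lambda>w :: complex^'n. b * w $ m)"
      by (rule smooth_on_cmul[OF open_UNIV smooth_on_component[OF open_UNIV]])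
    then show "smooth_on UNIV (\<lambda>w :: complex^'n. c + b * w $ m)"
      by (intro smooth_on_add open_UNIV smooth_on_const)
    show "pd (Inl m) (\<lambda>w :: complex^'n. c + b * w $ m) 0 = b"
      using pd_add[of "\<lambda>_. c" "0 :: complex^'n" "\<lambda>w. b * w $ m" "Inl m"] smooth_on_differentiable[OF s]
      by (simp add: pd_component)
  qed
  have sv: "smooth_on UNIV (\<lambda>w. vw w A)" and pv: "pd (Inl m) (\<lambda>w. vw w A) 0 = (if A = Inl m then 1 else 0)" for A
    unfolding vw_def by (rule lin)+
  have "pd (Inl m) (\<lambda>w. ev (a x) k p (vw w) u) 0 = evd (a x) (Inl m) k p v u"
  proof -
    have "pd (Inl m) (\<lambda>w. ev (a x) k p (vw w) u) 0 =
      (\<Sum>A\<in>UNIV. pd (Inl m) (\<lambda>w. vw w A) 0 * evd (a x) A k p (vw 0) u)"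
      using pd_ev[of UNIV "0 :: complex^'n" "\<lambda>_. a x" vw "\<lambda>_. u" "Inl m" k p]
      by (simp add: sv) (simp add: ev_def)
    then show ?thesis by (simp add: pv vw0 if_distrib[of "\<lambda>z. z * _"] sum.delta cong: if_cong)
  qed
  moreover have "pd (Inl m) (\<lambda>w. ev (a x) k p (vw w) u) 0 = pd (Inl m) (\<lambda>w. ev (a' (T x)) k p (Dp x (vw w)) (Dp x u)) 0"
    using r x by (simp add: related_def)
  moreover have "\<dots> = (\<Sum>A\<in>UNIV. P x A m * evd (a' (T x)) (Inl A) k p (Dp x v) (Dp x u))"
  proof -
    have sD: "smooth_on UNIV (\<lambda>w. Dp x (vw w) A)"
      and pD: "pd (Inl m) (\<lambda>w. Dp x (vw w) A) 0 = pd (Inl m) (\<lambda>w. coord A (T w)) x" for A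
      unfolding D by (rule lin)+
    have "pd (Inl m) (\<lambda>w. ev (a' (T x)) k p (Dp x (vw w)) (Dp x u)) 0 =
      (\<Sum>A\<in>UNIV. pd (Inl m) (\<lambda>w. Dp x (vw w) A) 0 * evd (a' (T x)) A k p (Dp x (vw 0)) (Dp x u))"
      using pd_ev[of UNIV "0 :: complex^'n" "\<lambda>_. a' (T x)" "\<lambda>w. Dp x (vw w)" "\<lambda>_. Dp x u" "Inl m" k p]
      by (simp add: sD) (simp add: ev_def)
    also have "\<dots> = (\<Sum>A\<in>UNIV. pd (Inl m) (\<lambda>w. coord A (T w)) x * evd (a' (T x)) A k p (Dp x v) (Dp x u))"
      by (simp add: vw0 pD)
    finally show ?thesis by (simp add: sum_ix pd_cnj[OF d_T[OF x]] holo_T[OF x])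
  qed
  ultimately show ?thesis by simp
qed

text \<open>Differentiating the relation in the base point gives three terms. The one from
  \<open>u\<close> drops out: without dz only anti-holomorphic components of \<open>u\<close>
  matter, and their push-forward is antiholomorphic in the point. The one from \<open>v\<close>
  carries second derivatives of \<open>T\<close>.\<close>

lemma ev_pdw_related:
  assumes r: "related a a'" and x: "x \<in> V" and a: "ssec U a" and a': "ssec U' a'"
    and f: "\<And>y. y \<in> U' \<Longrightarrow> homog (\<lambda>_. 0) hol 0 (a' y)"
  shows "ev (pdw (Inl i) a x) k p v u = (\<Sum>c\<in>UNIV. P x c i * ev (pdw (Inl c) a' (T x)) k p (Dp x v) (Dp x u)) +
    (\<Sum>A\<in>UNIV. (\<Sum>j\<in>UNIV. pd (Inl i) (\<lambda>w. P w A j) x * v (Inl j)) * evd (a' (T x)) (Inl A) k p (Dp x v) (Dp x u))"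
proof -
  note d = smooth_on_differentiable[OF _ x]
  have aV: "ssec V a" using a VU by (auto simp: ssec_def intro: smooth_on_subset)
  have a'V: "ssec V (\<lambda>w. a' (T w))"
    unfolding ssec_def using smooth_on_comp[OF V c2.U smooth_T TV ssecD[OF a']] by auto
  have "ev (pdw (Inl i) a x) k p v u = pd (Inl i) (\<lambda>w. ev (a w) k p v u) x"
    using pd_ev[OF V x aV, of "\<lambda>_. v" "\<lambda>_. u" "Inl i" k p] by simp (simp add: ev_def)
  also have "\<dots> = pd (Inl i) (\<lambda>w. ev (a' (T w)) k p (Dp w v) (Dp w u)) x"
    by (rule pd_cong[OF V x]) (use r in \<open>simp add: related_def\<close>)
  also have "\<dots> = ev (pdw (Inl i) (\<lambda>w. a' (T w)) x) k p (Dp x v) (Dp x u) +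
     ev (a' (T x)) k p (Dp x v) (\<lambda>A. pd (Inl i) (\<lambda>x. Dp x u A) x) +
     (\<Sum>A\<in>UNIV. pd (Inl i) (\<lambda>x. Dp x v A) x * evd (a' (T x)) A k p (Dp x v) (Dp x u))"
    by (rule pd_ev[OF V x a'V smooth_Dp smooth_Dp])
  also have "pdw (Inl i) (\<lambda>w. a' (T w)) x = (\<Sum>c\<in>UNIV. scl (P x c i) (pdw (Inl c) a' (T x)))"
    unfolding pdw_def
    by (intro ext) (simp add: weyl_sum_apply pd_T_chain(1)[OF x ssecD[OF a']] mult.commute)
  also have "ev (a' (T x)) k p (Dp x v) (\<lambda>A. pd (Inl i) (\<lambda>x. Dp x u A) x) = 0"
  proof (rule ev_form_hol_zero[OF f[OF TV[OF x]]])
    fix l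
    have "pd (Inl i) (\<lambda>x. Dp x u (Inr l)) x = pd (Inl i) (\<lambda>x. \<Sum>j\<in>UNIV. cnj (P x l j) * u (Inr j)) x"
      by (rule pd_cong[OF V x]) (simp add: Dp_simps)
    also have "\<dots> = 0" by (simp add: pd_sum pd_mult d smooth_cP smooth_on_mult[OF V] pd_P[OF x])
    finally show "pd (Inl i) (\<lambda>x. Dp x u (Inr l)) x = 0" .
  qed
  also have "(\<Sum>A\<in>UNIV. pd (Inl i) (\<lambda>x. Dp x v A) x * evd (a' (T x)) A k p (Dp x v) (Dp x u)) =
     (\<Sum>A\<in>UNIV. (\<Sum>j\<in>UNIV. pd (Inl i) (\<lambda>w. P w A j) x * v (Inl j)) * evd (a' (T x)) (Inl A) k p (Dp x v) (Dp x u))"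
  proof -
    have "pd (Inl i) (\<lambda>x. Dp x v (Inr l)) x = pd (Inl i) (\<lambda>x. \<Sum>j\<in>UNIV. cnj (P x l j) * v (Inr j)) x" for l
      by (rule pd_cong[OF V x]) (simp add: Dp_simps)
    then have 1: "pd (Inl i) (\<lambda>x. Dp x v (Inr l)) x = 0" for l
      by (simp add: pd_sum pd_mult d smooth_cP smooth_on_mult[OF V] pd_P[OF x])
    have "pd (Inl i) (\<lambda>x. Dp x v (Inl l)) x = pd (Inl i) (\<lambda>x. \<Sum>j\<in>UNIV. P x l j * v (Inl j)) x" for l
      by (rule pd_cong[OF V x]) (simp add: Dp_simps)
    then have 2: "pd (Inl i) (\<lambda>x. Dp x v (Inl l)) x = (\<Sum>j\<in>UNIV. pd (Inl i) (\<lambda>w. P w l j) x * v (Inl j))" for l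
      by (simp add: pd_sum pd_mult d smooth_P smooth_on_mult[OF V])
    show ?thesis by (simp add: sum_ix 1 2)
  qed
  finally show ?thesis by (simp only: ev_sum ev_scl add_0_right)
qed

lemma bilinear_push:
  fixes g Q R :: "'n \<Rightarrow> 'n \<Rightarrow> complex" and v w :: "'n \<Rightarrow> complex"
  shows "(\<Sum>i\<in>UNIV. \<Sum>j\<in>UNIV. v i * w j * (\<Sum>c\<in>UNIV. \<Sum>e\<in>UNIV. g c e * Q c i * R e j)) =
    (\<Sum>c\<in>UNIV. \<Sum>e\<in>UNIV. g c e * (\<Sum>i\<in>UNIV. Q c i * v i) * (\<Sum>j\<in>UNIV. R e j * w j))"
proof -
  have t: "(\<Sum>i\<in>UNIV. \<Sum>j\<in>UNIV. g c e * (Q c i * v i) * (R e j * w j)) =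
      g c e * (\<Sum>i\<in>UNIV. Q c i * v i) * (\<Sum>j\<in>UNIV. R e j * w j)" for c e
    unfolding mult.assoc[of "g c e"] unfolding sum_product unfolding sum_distrib_left ..
  have "(\<Sum>i\<in>UNIV. \<Sum>j\<in>UNIV. v i * w j * (\<Sum>c\<in>UNIV. \<Sum>e\<in>UNIV. g c e * Q c i * R e j)) =
    (\<Sum>i\<in>UNIV. \<Sum>j\<in>UNIV. \<Sum>c\<in>UNIV. \<Sum>e\<in>UNIV. g c e * (Q c i * v i) * (R e j * w j))"
    by (simp add: sum_distrib_left mult_ac)
  also have "\<dots> = (\<Sum>c\<in>UNIV. \<Sum>e\<in>UNIV. \<Sum>i\<in>UNIV. \<Sum>j\<in>UNIV. g c e * (Q c i * v i) * (R e j * w j))"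
    by (rule sum4_swap)
  finally show ?thesis unfolding t .
qed

text \<open>\<open>iota \<circ> nabla10\<close> acts on the evaluations as the holomorphic geodesic spray
  \<open>v\<^sup>i \<partial>\<^sub>i - \<Gamma>\<^sup>m\<^sub>i\<^sub>j v\<^sup>i v\<^sup>j \<partial>/\<partial>v\<^sup>m\<close>, which does not depend on the chart.\<close>

lemma related_iota_nabla10:
  assumes r: "related a a'" and a: "ssec U a" and a': "ssec U' a'"
    and h: "\<And>y. y \<in> U \<Longrightarrow> homog (\<lambda>_. 0) hol 0 (a y)" and h': "\<And>y. y \<in> U' \<Longrightarrow> homog (\<lambda>_. 0) hol 0 (a' y)"
  shows "related (\<lambda>x. iota (nabla10 G a x)) (\<lambda>x. iota (nabla10 G' a' x))"
  unfolding related_def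
proof (intro ballI allI)
  fix x k p and v u :: "'n ix \<Rightarrow> complex"
  assume x: "x \<in> V"
  note xU = U_V[OF x] note xU' = TV[OF x]
  show "ev (iota (nabla10 G a x)) k p v u = ev (iota (nabla10 G' a' (T x))) k p (Dp x v) (Dp x u)"
  proof (cases p)
    case 0
    then show ?thesis
      by (simp add: c1.iota_nabla10[OF xU h] c2.iota_nabla10[OF xU' h'] ev_sum ev_ygen)
  next
    case (Suc q)
    define E where "E A = evd (a' (T x)) (Inl A) k q (Dp x v) (Dp x u)" for A
    define X where "X c = ev (pdw (Inl c) a' (T x)) k q (Dp x v) (Dp x u)" for c
    define w where "w i = v (Inl i)" for i
    have Dw: "Dp x v (Inl c) = (\<Sum>i\<in>UNIV. P x c i * w i)" for c
      by (simp add: Dp_simps[OF x] w_def)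
    let ?\<Gamma>' = "\<lambda>A c e. christoffel G' (T x) (Inl A) (Inl c) (Inl e)"
    define K where "K A i j = (\<Sum>c\<in>UNIV. \<Sum>e\<in>UNIV. ?\<Gamma>' A c e * P x c i * P x e j)" for A i j
    have i: "ev (cov_deriv G (Inl i) a x) k q v u = (\<Sum>c\<in>UNIV. P x c i * X c) -
       (\<Sum>A\<in>UNIV. \<Sum>j\<in>UNIV. w j * K A i j * E A)" for i
    proof -
      have "(\<Sum>m\<in>UNIV. \<Sum>j\<in>UNIV. christoffel G x (Inl m) (Inl i) (Inl j) * v (Inl j) * evd (a x) (Inl m) k q v u) =
         (\<Sum>m\<in>UNIV. \<Sum>j\<in>UNIV. \<Sum>A\<in>UNIV. w j * (P x A m * christoffel G x (Inl m) (Inl i) (Inl j)) * E A)"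
        by (simp add: evd_related[OF r x] E_def w_def sum_distrib_left mult_ac)
      also have "\<dots> = (\<Sum>A\<in>UNIV. \<Sum>j\<in>UNIV. w j * (\<Sum>m\<in>UNIV. P x A m * christoffel G x (Inl m) (Inl i) (Inl j)) * E A)"
        by (subst sum3_rev) (simp add: sum_distrib_left sum_distrib_right)
      \<comment> \<open>\<open>christoffel_T\<close> splits off the second derivatives of
        \<open>T\<close>; they cancel against those contributed by \<open>ev_pdw_related\<close>,
        and only the Christoffel term of the second chart remains.\<close>
      also have "\<dots> = (\<Sum>A\<in>UNIV. \<Sum>j\<in>UNIV. w j * pd (Inl i) (\<lambda>w. P w A j) x * E A) +
         (\<Sum>A\<in>UNIV. \<Sum>j\<in>UNIV. w j * K A i j * E A)"
        unfolding christoffel_T[OF x] K_def[symmetric] by (simp only: distrib_left distrib_right sum.distrib)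
      moreover have "(\<Sum>A\<in>UNIV. (\<Sum>j\<in>UNIV. pd (Inl i) (\<lambda>w. P w A j) x * v (Inl j)) * E A) =
         (\<Sum>A\<in>UNIV. \<Sum>j\<in>UNIV. w j * pd (Inl i) (\<lambda>w. P w A j) x * E A)"
        unfolding sum_distrib_right w_def by (simp add: mult_ac)
      ultimately show ?thesis
        by (simp add: c1.ev_cov_hol[OF xU] ev_pdw_related[OF r x a a' h'] E_def X_def)
    qed
    have "ev (iota (nabla10 G a x)) k p v u = (\<Sum>i\<in>UNIV. w i * ev (cov_deriv G (Inl i) a x) k q v u)"
      by (simp add: c1.iota_nabla10[OF xU h] ev_sum ev_ygen Suc w_def)
    also have "\<dots> = (\<Sum>i\<in>UNIV. w i * (\<Sum>c\<in>UNIV. P x c i * X c)) -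
       (\<Sum>i\<in>UNIV. \<Sum>A\<in>UNIV. \<Sum>j\<in>UNIV. (w i * w j * K A i j) * E A)"
      unfolding i by (simp only: right_diff_distrib sum_subtractf sum_distrib_left mult.assoc)
    also have "(\<Sum>i\<in>UNIV. \<Sum>A\<in>UNIV. \<Sum>j\<in>UNIV. (w i * w j * K A i j) * E A) =
       (\<Sum>A\<in>UNIV. (\<Sum>i\<in>UNIV. \<Sum>j\<in>UNIV. w i * w j * K A i j) * E A)"
      by (subst sum.swap) (simp only: sum_distrib_right)
    also have "\<dots> = (\<Sum>A\<in>UNIV. (\<Sum>c\<in>UNIV. \<Sum>e\<in>UNIV. ?\<Gamma>' A c e * Dp x v (Inl c) * Dp x v (Inl e)) * E A)"
      unfolding K_def bilinear_push Dw ..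
    also have "(\<Sum>i\<in>UNIV. w i * (\<Sum>c\<in>UNIV. P x c i * X c)) = (\<Sum>c\<in>UNIV. Dp x v (Inl c) * X c)"
      unfolding Dw sum_distrib_left sum_distrib_right by (subst sum.swap) (simp add: mult_ac)
    also have "(\<Sum>A\<in>UNIV. (\<Sum>c\<in>UNIV. \<Sum>e\<in>UNIV. ?\<Gamma>' A c e * Dp x v (Inl c) * Dp x v (Inl e)) * E A) =
       (\<Sum>c\<in>UNIV. Dp x v (Inl c) * (\<Sum>A\<in>UNIV. \<Sum>e\<in>UNIV. ?\<Gamma>' A c e * Dp x v (Inl e) * E A))"
      unfolding sum_distrib_left sum_distrib_right by (subst sum.swap) (simp add: mult_ac)
    also have "(\<Sum>c\<in>UNIV. Dp x v (Inl c) * X c) - \<dots> = (\<Sum>c\<in>UNIV. Dp x v (Inl c) * ev (cov_deriv G' (Inl c) a' (T x)) k q (Dp x v) (Dp x u))"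
      unfolding c2.ev_cov_hol[OF xU'] E_def[symmetric] X_def[symmetric]
      by (simp add: right_diff_distrib sum_subtractf)
    also have "\<dots> = ev (iota (nabla10 G' a' (T x))) k p (Dp x v) (Dp x u)"
      by (simp add: c2.iota_nabla10[OF xU' h'] ev_sum ev_ygen Suc)
    finally show ?thesis .
  qed
qed

lemma related_scl: "related a a' \<Longrightarrow> related (\<lambda>x. scl z (a x)) (\<lambda>x. scl z (a' x))"
  by (simp add: related_def ev_scl)

text \<open>The normalising factor depends on the degree alone, hence is the same in both charts,
  and each step otherwise applies the chart-independent spray.\<close>

lemma related_hs:
  assumes b: "hol_source U G \<beta> n0 r" and b': "hol_source U' G' \<beta>' n0 r"
    and 0: "related (hs G \<beta> 0) (hs G' \<beta>' 0)"
  shows "related (hs G \<beta> n) (hs G' \<beta>' n)"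
proof (induction n)
  case (Suc n)
  interpret b: hol_source U G \<beta> n0 r by (rule b)
  interpret b': hol_source U' G' \<beta>' n0 r by (rule b')
  let ?c = "1 / of_nat (Suc (Suc (n0 + n))) :: complex"
  have e: "hs G \<beta> (Suc n) x = scl ?c (iota (nabla10 G (hs G \<beta> n) x))" if "x \<in> U" for x
    unfolding hs.simps by (rule delta10_inv_iota[OF b.nabla10_hs[OF that]])
  have e': "hs G' \<beta>' (Suc n) x = scl ?c (iota (nabla10 G' (hs G' \<beta>' n) x))" if "x \<in> U'" for x
    unfolding hs.simps by (rule delta10_inv_iota[OF b'.nabla10_hs[OF that]])
  have "related (\<lambda>x. scl ?c (iota (nabla10 G (hs G \<beta> n) x))) (\<lambda>x. scl ?c (iota (nabla10 G' (hs G' \<beta>' n) x)))"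
    by (intro related_scl related_iota_nabla10 Suc.IH b.hs_props(1) b'.hs_props(1) b.hs_props(4) b'.hs_props(4))
  then show ?case
    unfolding related_def using e[OF U_V] e'[OF TV] by (simp del: hs.simps)
qed (rule 0)

end

context hol_source
begin

text \<open>At total degree p only terms of degree at most p in y are visible, so the relation for
  the infinite sum reduces to finitely many terms.\<close>

lemma ev_hs_tot:
  assumes x: "x \<in> U"
  shows "ev (hs_tot G \<beta> n0 x) k p v u = (\<Sum>n\<le>p. ev (hs_deg G \<beta> n0 n x) k p v u)"
proof -
  have "(\<Sum>n\<le>p. hs_deg G \<beta> n0 n x k M {A}) = hs_tot G \<beta> n0 x k M {A}" if M: "M \<in> mset_deg p" for M A
  proof -
    let ?n = "\<Sum>i\<in>UNIV. M (Inl i)"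
    have "?n \<le> p" using M by (simp add: mset_deg_def sum_ix)
    moreover have "hs_deg G \<beta> n0 n x k M {A} = 0" if "n \<noteq> ?n" for n
      using homogD[OF hs_deg_props(2)[OF x], of n k M "{A}"] that by (auto simp: wt_hol)
    ultimately have "(\<Sum>n\<le>p. hs_deg G \<beta> n0 n x k M {A}) = (\<Sum>n\<in>{?n}. hs_deg G \<beta> n0 n x k M {A})"
      by (intro sum.mono_neutral_right) auto
    then show ?thesis by (simp add: hs_tot_def)
  qed
  then have "ev (hs_tot G \<beta> n0 x) k p v u = ev (\<Sum>n\<le>p. hs_deg G \<beta> n0 n x) k p v u"
    unfolding ev_def by (simp add: weyl_sum_apply)
  then show ?thesis by (simp add: ev_sum)
qed

end

context chart_change
begin

lemma related_hs_tot:
  assumes b: "hol_source U G \<beta> n0 r" and b': "hol_source U' G' \<beta>' n0 r"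
    and 0: "related (hs G \<beta> 0) (hs G' \<beta>' 0)"
  shows "related (hs_tot G \<beta> n0) (hs_tot G' \<beta>' n0)"
proof -
  interpret b: hol_source U G \<beta> n0 r by (rule b)
  interpret b': hol_source U' G' \<beta>' n0 r by (rule b')
  have "ev (hs_deg G \<beta> n0 n x) k p v u = ev (hs_deg G' \<beta>' n0 n (T x)) k p (Dp x v) (Dp x u)" if "x \<in> V" for n x k p v u
    using related_hs[OF assms, of "n - Suc n0"] that by (simp add: hs_deg_def related_def del: hs.simps)
  then show ?thesis
    unfolding related_def by (simp add: b.ev_hs_tot[OF U_V] b'.ev_hs_tot[OF TV])
qed

end

text \<open>Base case for the curvature. It goes through the one-form \<open>I_n G 2\<close>, since
  \<open>ev\<close> does not apply to the two-form \<open>R_nabla\<close>; degree 3 counts two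
  factors y and one y-bar.\<close>

lemma ev_I_2:
  fixes x :: "complex^'n::finite"
  shows "ev (I_n G 2 x) k p v u = (if k = 0 \<and> p = 3 then (\<Sum>m\<in>UNIV. \<Sum>n\<in>UNIV. om_low G x m n * v (Inr n) *
     (\<Sum>i\<in>UNIV. \<Sum>l\<in>UNIV. \<Sum>j\<in>UNIV. curv G x m i l j * v (Inl i) * u (Inr l) * v (Inl j))) / 2 else 0)"
proof -
  have g: "ev (dxgen (Inr l) \<odot> ygen (Inl i) \<odot> ygen (Inl j) \<odot> ygen (Inr n)) k p v u =
    (if k = 0 \<and> p = 3 then v (Inr n) * v (Inl i) * u (Inr l) * v (Inl j) else 0)" for l i j n
  proof -
    have "dxgen (Inr l) \<odot> ygen (Inl i) \<odot> ygen (Inl j) \<odot> ygen (Inr n) =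
      ygen (Inr n) \<odot> (ygen (Inl j) \<odot> (ygen (Inl i) \<odot> dxgen (Inr l)))"
      by (simp add: ygen_comm)
    then show ?thesis by (simp add: ev_ygen ev_dxgen numeral_3_eq_3 mult_ac split: nat.split)
  qed
  have "ev (I_n G 2 x) k p v u = (\<Sum>m\<in>UNIV. \<Sum>n\<in>UNIV. om_low G x m n *
     (\<Sum>i\<in>UNIV. \<Sum>l\<in>UNIV. \<Sum>j\<in>UNIV. curv G x m i l j / 2 *
       (if k = 0 \<and> p = 3 then v (Inr n) * v (Inl i) * u (Inr l) * v (Inl j) else 0)))"
    unfolding I_n_def by (simp add: numeral_2_eq_2 wmul_sum_left wmul_scl_left ev_sum ev_scl g)
  then show ?thesis by (simp add: sum_distrib_left sum_divide_distrib mult_ac)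
qed

lemma wsign_hol_anti [simp]: "wsign {Inl i} {Inr j} = 1"
proof -
  have "{(s, t). s \<in> {Inl i} \<and> t \<in> {Inr j} \<and> prec t s} = {}" by auto
  then show ?thesis by (simp only: wsign_def card.empty power_0)
qed

lemma ev_contr_11:
  fixes a :: "'n::finite weyl"
  assumes h: "homog (\<lambda>_. 0) hol 1 a" and y: "\<And>k M S. a k M S \<noteq> 0 \<Longrightarrow> M = 0"
  shows "ev (contr (Inl i) a) k p v u = (if p = 0 then \<Sum>j\<in>UNIV. u (Inr j) * a k 0 {Inl i, Inr j} else 0)"
proof (cases "p = 0")
  case True
  have "mset_deg 0 = {0 :: 'n ix \<Rightarrow> nat}" using mset_deg_0 by auto
  moreover have "contr (Inl i) a k 0 {Inl j} = 0" for j
    using homogD[OF h, of k 0 "{Inl i, Inl j}"] by (auto simp: contr_def wt_def)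
  ultimately show ?thesis
    using True by (simp add: ev_def mon_def sum_ix) (simp add: contr_def)
next
  case False
  have "contr (Inl i) a k M {A} = 0" if "M \<in> mset_deg p" for M A
    using that False y[of k M "{Inl i, A}"] by (auto simp: contr_def mset_deg_def)
  then show ?thesis using False by (simp add: ev_def)
qed

lemma ev_iota_11:
  fixes a :: "'n::finite weyl"
  assumes "homog (\<lambda>_. 0) hol 1 a" and "\<And>k M S. a k M S \<noteq> 0 \<Longrightarrow> M = 0"
  shows "ev (iota a) k p v u = (if p = 1 then \<Sum>i\<in>UNIV. \<Sum>j\<in>UNIV. v (Inl i) * u (Inr j) * a k 0 {Inl i, Inr j} else 0)"
  unfolding iota_def ev_sum ev_ygen
  by (cases p) (simp_all add: ev_contr_11[OF assms] sum_distrib_left mult.assoc)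

lemma sum4_rot:
  fixes F :: "'i \<Rightarrow> 'j \<Rightarrow> 'k \<Rightarrow> 'l \<Rightarrow> 'b::comm_monoid_add"
  shows "(\<Sum>i\<in>I. \<Sum>j\<in>J. \<Sum>k\<in>K. \<Sum>l\<in>L. F i j k l) = (\<Sum>j\<in>J. \<Sum>k\<in>K. \<Sum>l\<in>L. \<Sum>i\<in>I. F i j k l)"
proof -
  have "(\<Sum>i\<in>I. \<Sum>j\<in>J. \<Sum>k\<in>K. \<Sum>l\<in>L. F i j k l) = (\<Sum>j\<in>J. \<Sum>i\<in>I. \<Sum>k\<in>K. \<Sum>l\<in>L. F i j k l)"
    by (rule sum.swap)
  also have "\<dots> = (\<Sum>j\<in>J. \<Sum>k\<in>K. \<Sum>i\<in>I. \<Sum>l\<in>L. F i j k l)" by (intro sum.cong refl sum.swap)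
  also have "\<dots> = (\<Sum>j\<in>J. \<Sum>k\<in>K. \<Sum>l\<in>L. \<Sum>i\<in>I. F i j k l)" by (intro sum.cong refl sum.swap)
  finally show ?thesis .
qed

context chart_change
begin

lemma related_add: "related a a' \<Longrightarrow> related b b' \<Longrightarrow> related (\<lambda>x. a x + b x) (\<lambda>x. a' x + b' x)"
  by (simp add: related_def ev_add)

lemma curv_push:
  assumes x: "x \<in> V"
  shows "(\<Sum>m\<in>UNIV. P x a m * (\<Sum>i\<in>UNIV. \<Sum>l\<in>UNIV. \<Sum>j\<in>UNIV. curv G x m i l j * v (Inl i) * u (Inr l) * v (Inl j))) =
    (\<Sum>c\<in>UNIV. \<Sum>d\<in>UNIV. \<Sum>e\<in>UNIV. curv G' (T x) a c d e * Dp x v (Inl c) * Dp x u (Inr d) * Dp x v (Inl e))"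
proof -
  define w where "w i = v (Inl i)" for i
  define r where "r l = u (Inr l)" for l
  let ?K = "\<lambda>c d e. curv G' (T x) a c d e"
  let ?w = "\<lambda>c. \<Sum>i\<in>UNIV. P x c i * w i"
  have "(\<Sum>m\<in>UNIV. P x a m * (\<Sum>i\<in>UNIV. \<Sum>l\<in>UNIV. \<Sum>j\<in>UNIV. curv G x m i l j * v (Inl i) * u (Inr l) * v (Inl j))) =
      (\<Sum>m\<in>UNIV. \<Sum>i\<in>UNIV. \<Sum>l\<in>UNIV. \<Sum>j\<in>UNIV. r l * (w i * w j * (P x a m * curv G x m i l j)))"
    unfolding w_def r_def sum_distrib_left by (simp add: mult_ac)
  also have "\<dots> = (\<Sum>i\<in>UNIV. \<Sum>l\<in>UNIV. \<Sum>j\<in>UNIV. \<Sum>m\<in>UNIV. r l * (w i * w j * (P x a m * curv G x m i l j)))"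
    by (rule sum4_rot)
  also have "\<dots> = (\<Sum>l\<in>UNIV. \<Sum>i\<in>UNIV. \<Sum>j\<in>UNIV. \<Sum>m\<in>UNIV. r l * (w i * w j * (P x a m * curv G x m i l j)))"
    by (rule sum.swap)
  also have "\<dots> = (\<Sum>l\<in>UNIV. r l * (\<Sum>i\<in>UNIV. \<Sum>j\<in>UNIV. w i * w j *
      (\<Sum>c\<in>UNIV. \<Sum>e\<in>UNIV. (\<Sum>d\<in>UNIV. ?K c d e * cnj (P x d l)) * P x c i * P x e j)))"
    unfolding sum_distrib_left[symmetric] curv_T[OF x] sum_distrib_right[symmetric] ..
  also have "\<dots> = (\<Sum>l\<in>UNIV. r l * (\<Sum>c\<in>UNIV. \<Sum>e\<in>UNIV. (\<Sum>d\<in>UNIV. ?K c d e * cnj (P x d l)) * ?w c * ?w e))"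
    unfolding bilinear_push ..
  also have "\<dots> = (\<Sum>l\<in>UNIV. \<Sum>c\<in>UNIV. \<Sum>e\<in>UNIV. \<Sum>d\<in>UNIV. r l * (?K c d e * cnj (P x d l) * ?w c * ?w e))"
    by (simp only: sum_distrib_left[of "r _"] sum_distrib_right[of "\<lambda>d. _ d * cnj (P x d _)"] sum_distrib_right[of "\<lambda>d. _ d * cnj (P x d _) * _"])
  also have "\<dots> = (\<Sum>c\<in>UNIV. \<Sum>e\<in>UNIV. \<Sum>d\<in>UNIV. \<Sum>l\<in>UNIV. r l * (?K c d e * cnj (P x d l) * ?w c * ?w e))"
    by (rule sum4_rot)
  also have "\<dots> = (\<Sum>c\<in>UNIV. \<Sum>e\<in>UNIV. \<Sum>d\<in>UNIV. ?K c d e * ?w c * (\<Sum>l\<in>UNIV. cnj (P x d l) * r l) * ?w e)"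
  proof (intro sum.cong refl)
    fix c e d
    have "r l * (?K c d e * cnj (P x d l) * ?w c * ?w e) = ?K c d e * ?w c * (cnj (P x d l) * r l) * ?w e" for l
      by (simp only: mult_ac)
    then show "(\<Sum>l\<in>UNIV. r l * (?K c d e * cnj (P x d l) * ?w c * ?w e)) = ?K c d e * ?w c * (\<Sum>l\<in>UNIV. cnj (P x d l) * r l) * ?w e"
      by (simp only: sum_distrib_left[symmetric] sum_distrib_right[symmetric])
  qed
  also have "\<dots> = (\<Sum>c\<in>UNIV. \<Sum>d\<in>UNIV. \<Sum>e\<in>UNIV. ?K c d e * ?w c * (\<Sum>l\<in>UNIV. cnj (P x d l) * r l) * ?w e)"
    by (intro sum.cong refl sum.swap)
  finally show ?thesis unfolding Dp_simps[OF x] w_def r_def .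
qed

lemma related_R: "related (hs G (R_nabla G) 0) (hs G' (R_nabla G') 0)"
  unfolding related_def
proof (intro ballI allI)
  fix x k p and v u :: "'n ix \<Rightarrow> complex" assume x: "x \<in> V"
  define C where "C m = (\<Sum>i\<in>UNIV. \<Sum>l\<in>UNIV. \<Sum>j\<in>UNIV. curv G x m i l j * v (Inl i) * u (Inr l) * v (Inl j))" for m
  have om: "om_low G x m n = (\<Sum>a\<in>UNIV. \<Sum>b\<in>UNIV. om_low G' (T x) a b * P x a m * cnj (P x b n))" for m n
    by (simp add: om_low_def metric_T[OF x] sum_distrib_left mult_ac)
  have "(\<Sum>m\<in>UNIV. \<Sum>n\<in>UNIV. om_low G x m n * v (Inr n) * C m) =
    (\<Sum>m\<in>UNIV. \<Sum>n\<in>UNIV. C m * v (Inr n) * (\<Sum>a\<in>UNIV. \<Sum>b\<in>UNIV. om_low G' (T x) a b * P x a m * cnj (P x b n)))"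
    unfolding om by (simp only: mult_ac)
  also have "\<dots> = (\<Sum>a\<in>UNIV. \<Sum>b\<in>UNIV. om_low G' (T x) a b * (\<Sum>m\<in>UNIV. P x a m * C m) * Dp x v (Inr b))"
    unfolding bilinear_push Dp_simps[OF x] ..
  also have "\<dots> = (\<Sum>a\<in>UNIV. \<Sum>b\<in>UNIV. om_low G' (T x) a b * Dp x v (Inr b) *
      (\<Sum>c\<in>UNIV. \<Sum>d\<in>UNIV. \<Sum>e\<in>UNIV. curv G' (T x) a c d e * Dp x v (Inl c) * Dp x u (Inr d) * Dp x v (Inl e)))"
    unfolding C_def curv_push[OF x] by (intro sum.cong refl) (simp only: mult_ac)
  finally show "ev (hs G (R_nabla G) 0 x) k p v u = ev (hs G' (R_nabla G') 0 (T x)) k p (Dp x v) (Dp x u)"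
    unfolding c1.I_n_hs[OF U_V[OF x], symmetric] c2.I_n_hs[OF TV[OF x], symmetric]
    by (simp only: numeral_2_eq_2[symmetric] ev_I_2 C_def)
qed

lemma related_11:
  assumes \<alpha>: "kaehler_chart_form U G \<alpha>" and \<alpha>': "kaehler_chart_form U' G' \<alpha>'"
    and law: "\<And>x k i j. x \<in> V \<Longrightarrow> \<alpha> x k 0 {Inl i, Inr j} =
      (\<Sum>a\<in>UNIV. \<Sum>b\<in>UNIV. P x a i * cnj (P x b j) * \<alpha>' (T x) k 0 {Inl a, Inr b})"
  shows "related (hs G (\<lambda>x. - \<alpha> x) 0) (hs G' (\<lambda>x. - \<alpha>' x) 0)"
  unfolding related_def
proof (intro ballI allI)
  fix x k p and v u :: "'n ix \<Rightarrow> complex" assume x: "x \<in> V"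
  interpret \<alpha>: kaehler_chart_form U G \<alpha> by (rule \<alpha>)
  interpret \<alpha>': kaehler_chart_form U' G' \<alpha>' by (rule \<alpha>')
  note xU = U_V[OF x] note xU' = TV[OF x]
  have y: "M = 0" if "(- \<alpha> x) k M S \<noteq> 0" for k M S using \<alpha>.\<alpha>_y[OF xU, of k M S] that by simp
  have y': "M = 0" if "(- \<alpha>' (T x)) k M S \<noteq> 0" for k M S using \<alpha>'.\<alpha>_y[OF xU', of k M S] that by simp
  have "(\<Sum>i\<in>UNIV. \<Sum>j\<in>UNIV. v (Inl i) * u (Inr j) * (\<Sum>a\<in>UNIV. \<Sum>b\<in>UNIV. (- \<alpha>' (T x) k 0 {Inl a, Inr b}) * P x a i * cnj (P x b j))) =
     (\<Sum>a\<in>UNIV. \<Sum>b\<in>UNIV. (- \<alpha>' (T x) k 0 {Inl a, Inr b}) * Dp x v (Inl a) * Dp x u (Inr b))"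
    unfolding bilinear_push Dp_simps[OF x] ..
  moreover have "- \<alpha> x k 0 {Inl i, Inr j} = (\<Sum>a\<in>UNIV. \<Sum>b\<in>UNIV. (- \<alpha>' (T x) k 0 {Inl a, Inr b}) * P x a i * cnj (P x b j))" for i j
    unfolding law[OF x] sum_negf[symmetric] by (simp add: mult_ac)
  ultimately have e: "(\<Sum>i\<in>UNIV. \<Sum>j\<in>UNIV. v (Inl i) * u (Inr j) * (- \<alpha> x) k 0 {Inl i, Inr j}) =
     (\<Sum>a\<in>UNIV. \<Sum>b\<in>UNIV. Dp x v (Inl a) * Dp x u (Inr b) * (- \<alpha>' (T x)) k 0 {Inl a, Inr b})"
    by (simp add: mult_ac)
  have "ev (iota (- \<alpha> x)) k p v u = (if p = 1 then \<Sum>i\<in>UNIV. \<Sum>j\<in>UNIV. v (Inl i) * u (Inr j) * (- \<alpha> x) k 0 {Inl i, Inr j} else 0)"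
    by (rule ev_iota_11[OF \<alpha>.J.form_hol_\<beta>[OF xU]]) (rule y)
  moreover have "ev (iota (- \<alpha>' (T x))) k p (Dp x v) (Dp x u) =
      (if p = 1 then \<Sum>i\<in>UNIV. \<Sum>j\<in>UNIV. Dp x v (Inl i) * Dp x u (Inr j) * (- \<alpha>' (T x)) k 0 {Inl i, Inr j} else 0)"
    by (rule ev_iota_11[OF \<alpha>'.J.form_hol_\<beta>[OF xU']]) (rule y')
  ultimately have "ev (iota (- \<alpha> x)) k p v u = ev (iota (- \<alpha>' (T x))) k p (Dp x v) (Dp x u)"
    unfolding e by (rule trans[OF _ sym])
  then show "ev (hs G (\<lambda>x. - \<alpha> x) 0 x) k p v u = ev (hs G' (\<lambda>x. - \<alpha>' x) 0 (T x)) k p (Dp x v) (Dp x u)"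
    unfolding hs.simps delta10_inv_iota[OF \<alpha>.J.form_hol_\<beta>[OF xU] \<alpha>.J.hol_\<beta>[OF xU]]
      delta10_inv_iota[OF \<alpha>'.J.form_hol_\<beta>[OF xU'] \<alpha>'.J.hol_\<beta>[OF xU']] ev_scl
    by simp
qed

end

section \<open>Tensor evaluation\<close>

lemma contr_vec_apply: "contr_vec u a k M S = (\<Sum>A\<in>UNIV. u A * contr A a k M S)"
  by (simp add: contr_vec_def weyl_sum_apply)

text \<open>Without a vector no scalar part is left to read off, and a second contraction finds no
  form index; so exactly one vector gives a possibly non-zero value.\<close>

lemma tensor_eval_one_form:
  fixes a :: "'n::finite weyl"
  assumes a: "homog (\<lambda>_. 0) (\<lambda>_. 1) 1 a"
  shows "tensor_eval a k p v us = (case us of [u] \<Rightarrow> ev a k p v u | _ \<Rightarrow> 0)"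
proof -
  have c: "card S = 1" if "a k M S \<noteq> 0" for k M S
    using homogD[OF a that] by (simp add: wt_def)
  consider "us = []" | u where "us = [u]" | u u' us' where "us = u # u' # us'"
    by (metis list.exhaust)
  then show ?thesis
  proof cases
    case 1
    have "a k M {} = 0" for M using c[of k M "{}"] by auto
    with 1 show ?thesis by (simp add: tensor_eval_def)
  next
    case 2
    then show ?thesis
      by (simp add: tensor_eval_def ev_def mset_deg_def mon_def contr_vec_apply contr_def)
  next
    case 3
    have 0: "contr A a k M S = 0" if "S \<noteq> {}" for A k M S
    proof (cases "A \<in> S")
      case False
      have "card (insert A S) \<noteq> 1" using that False card_insert_disjoint[of S A] finite[of S] by (simp add: card_eq_0_iff)
      then show ?thesis using c[of k M "insert A S"] by (auto simp: contr_def)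
    qed (simp add: contr_def)
    have "contr B (contr_vec u a) k M S = 0" for B k M S
      using 0[of "insert B S"] by (simp add: contr_def[of B] contr_vec_apply)
    then have "contr_vec u' (contr_vec u a) = 0"
      by (intro ext) (simp add: contr_vec_apply[of u'])
    moreover have "contr_vec w 0 = (0 :: 'n weyl)" for w
      unfolding contr_vec_def by simp
    then have "fold contr_vec us' 0 = (0 :: 'n weyl)"
      by (induction us') (simp_all only: fold_simps)
    ultimately show ?thesis by (simp add: 3 tensor_eval_def)
  qed
qed

text \<open>One vector of type (1,0) and one of type (0,1) isolate the mixed coefficients, with sign
  +1 because holomorphic indices come first.\<close>

lemma tensor_eval_two_form:
  assumes u: "\<And>j. u (Inr j) = 0" "\<And>i. u' (Inl i) = 0"
  shows "tensor_eval a k 0 v [u, u'] = (\<Sum>i\<in>UNIV. \<Sum>j\<in>UNIV. u (Inl i) * u' (Inr j) * a k 0 {Inl i, Inr j})"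
proof -
  have c: "contr (Inr j) (contr (Inl i) a) k 0 {} = a k 0 {Inl i, Inr j}" for i j
    by (simp add: contr_def)
  have "tensor_eval a k 0 v [u, u'] = contr_vec u' (contr_vec u a) k 0 {}"
  proof -
    have "{M. (\<Sum>A\<in>UNIV. M A) = 0} = {0 :: 'a ix \<Rightarrow> nat}" by (auto simp: fun_eq_iff)
    then show ?thesis unfolding tensor_eval_def by (simp only: sum.insert sum.empty finite.emptyI) simp
  qed
  also have "\<dots> = (\<Sum>j\<in>UNIV. \<Sum>i\<in>UNIV. u (Inl i) * u' (Inr j) * a k 0 {Inl i, Inr j})"
    by (simp add: contr_vec_apply sum_ix u contr_vec_def[of u] contr_sum contr_scl weyl_sum_apply c sum_distrib_left mult_ac)
  also have "\<dots> = (\<Sum>i\<in>UNIV. \<Sum>j\<in>UNIV. u (Inl i) * u' (Inr j) * a k 0 {Inl i, Inr j})"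
    by (rule sum.swap)
  finally show ?thesis .
qed

section \<open>From the Kaehler form to the metric in coordinates\<close>

lemma kaehler_form_coeff:
  "kaehler_form G x 0 0 {Inl i, Inr j} = \<i> * G x $ i $ j"
  "kaehler_form G x 0 0 {Inl i, Inl i'} = 0" "kaehler_form G x 0 0 {Inr j, Inr j'} = 0"
proof -
  have 1: "(dxgen (Inl i') \<odot> dxgen (Inr j')) 0 0 {Inl i, Inr j} = (if j' = j then if i' = i then 1 else 0 else 0)" for i' j'
    by (auto simp: dxgen_wmul) (auto simp: dxgen_def)
  show "kaehler_form G x 0 0 {Inl i, Inr j} = \<i> * G x $ i $ j"
    by (simp add: kaehler_form_def weyl_sum_apply 1 om_low_def if_distrib[of "\<lambda>z. _ * z"] sum.delta cong: if_cong)
  have 2: "(dxgen (Inl i'') \<odot> dxgen (Inr j'')) 0 0 {Inl i, Inl i'} = 0" "(dxgen (Inl i'') \<odot> dxgen (Inr j'')) 0 0 {Inr j, Inr j'} = 0" for i'' j''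
    by (auto simp: dxgen_wmul) (auto simp: dxgen_def split: if_splits dest: equalityD2)
  show "kaehler_form G x 0 0 {Inl i, Inl i'} = 0" "kaehler_form G x 0 0 {Inr j, Inr j'} = 0"
    by (simp_all add: kaehler_form_def weyl_sum_apply 2)
qed

lemma ext_d_coeff:
  assumes S: "A \<noteq> B" "A \<noteq> C" "B \<noteq> C"
  shows "ext_d a x 0 0 {A, B, C} = wsign {A} {B, C} * pd A (\<lambda>w. a w 0 0 {B, C}) x +
    wsign {B} {A, C} * pd B (\<lambda>w. a w 0 0 {A, C}) x + wsign {C} {A, B} * pd C (\<lambda>w. a w 0 0 {A, B}) x"
proof -
  have e: "{A, B, C} - {A} = {B, C}" "{A, B, C} - {B} = {A, C}" "{A, B, C} - {C} = {A, B}" using S by auto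
  have "ext_d a x 0 0 {A, B, C} = (\<Sum>D\<in>UNIV. if D \<in> {A, B, C} then wsign {D} ({A, B, C} - {D}) * pd D (\<lambda>w. a w 0 0 ({A, B, C} - {D})) x else 0)"
    by (simp only: ext_d_def weyl_sum_apply dxgen_wmul pdw_def)
  also have "\<dots> = (\<Sum>D\<in>{A, B, C}. wsign {D} ({A, B, C} - {D}) * pd D (\<lambda>w. a w 0 0 ({A, B, C} - {D})) x)"
    by (rule sum.mono_neutral_cong_right) auto
  also have "\<dots> = wsign {A} {B, C} * pd A (\<lambda>w. a w 0 0 {B, C}) x +
    wsign {B} {A, C} * pd B (\<lambda>w. a w 0 0 {A, C}) x + wsign {C} {A, B} * pd C (\<lambda>w. a w 0 0 {A, B}) x"
    using S by (subst sum.insert; simp only: e finite.intros; simp add: e)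
  finally show ?thesis .
qed

lemma wsign_pair: "B \<noteq> C \<Longrightarrow> wsign {A} {B, C} = wsign {A} {B} * wsign {A} {C}"
  using wsign_Un2[of "{B}" "{C}" "{A}"] by (simp add: insert_commute)

lemma wsign_flip: "A \<noteq> B \<Longrightarrow> wsign {A} {B} = - wsign {B} {A}"
  using wsign_swap[of "{A}" "{B}"] by simp

lemma wsign_nonzero: "wsign S T \<noteq> 0"
  by (simp add: wsign_def)

text \<open>A kernel vector would be a null vector of the positive definite form.\<close>

lemma invertible_posdef:
  fixes A :: "complex^'n::finite^'n"
  assumes pos: "\<And>v. v \<noteq> 0 \<Longrightarrow> 0 < Re (\<Sum>i\<in>UNIV. \<Sum>j\<in>UNIV. A $ i $ j * v $ i * cnj (v $ j))"
  shows "invertible A"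
proof -
  have "y = 0" if y: "A *v y = 0" for y
  proof (rule ccontr)
    \<comment> \<open>The form conjugates its second argument, so conjugating the kernel vector
      makes the sum over j equal to the vanishing entry of \<open>A *v y\<close>.\<close>
    define v where "v = (\<chi> i. cnj (y $ i))"
    assume "y \<noteq> 0"
    then have "v \<noteq> 0" by (simp add: v_def vec_eq_iff)
    have "(\<Sum>j\<in>UNIV. A $ i $ j * y $ j) = 0" for i
      using arg_cong[OF y, of "\<lambda>w. w $ i"] by (simp add: matrix_vector_mult_def)
    moreover have "(\<Sum>i\<in>UNIV. \<Sum>j\<in>UNIV. A $ i $ j * v $ i * cnj (v $ j)) = (\<Sum>i\<in>UNIV. v $ i * (\<Sum>j\<in>UNIV. A $ i $ j * y $ j))"
      by (simp add: v_def sum_distrib_left mult_ac)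
    ultimately show False using pos[OF \<open>v \<noteq> 0\<close>] by simp
  qed
  then show ?thesis
    by (simp add: invertible_left_inverse matrix_left_invertible_ker)
qed

section \<open>Passage to the manifold\<close>

lemma weyl_forms_ssec: "a \<in> weyl_forms At \<Longrightarrow> c \<in> At \<Longrightarrow> ssec (cdom c) (a c)"
  unfolding weyl_forms_def ssec_def by blast

lemma weyl_forms_tensor_eval:
  assumes "a \<in> weyl_forms At" "c \<in> At" "c' \<in> At" "p \<in> fst c \<inter> fst c'"
  shows "tensor_eval (a c (snd c p)) k d v us =
    tensor_eval (a c' (snd c' p)) k d (push c c' p v) (map (push c c' p) us)"
  using assms unfolding weyl_forms_def by blast

locale kaehler_atlas =
  fixes X :: "'a topology" and At :: "('a, 'n::finite) chart set" and g :: "('a, 'n) metric"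
  assumes kaehler: "kaehler_manifold X At g"
begin

lemma atlas: "complex_manifold X At"
  using kaehler by (simp add: kaehler_manifold_def)

lemma open_cdom: "c \<in> At \<Longrightarrow> open (cdom c)"
  using atlas by (simp add: complex_manifold_def)

lemma chart_homeo: "c \<in> At \<Longrightarrow> homeomorphic_map (subtopology X (fst c)) (top_of_set (cdom c)) (snd c)"
  and chart_openin: "c \<in> At \<Longrightarrow> openin X (fst c)"
  using atlas by (auto simp: complex_manifold_def)

lemma topspace_chart: "c \<in> At \<Longrightarrow> topspace (subtopology X (fst c)) = fst c"
  using openin_subset[OF chart_openin[of c]] by (simp add: topspace_subtopology Int_absorb1)

lemma trans_map: "c \<in> At \<Longrightarrow> p \<in> fst c \<Longrightarrow> trans_map c c' (snd c p) = snd c' p"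
  using homeomorphic_imp_injective_map[OF chart_homeo[of c]] topspace_chart[of c]
  by (simp add: trans_map_def)

lemma open_overlap:
  assumes "c \<in> At" "c' \<in> At"
  shows "open (snd c ` (fst c \<inter> fst c'))"
proof -
  have "openin (subtopology X (fst c)) (fst c \<inter> fst c')"
    using chart_openin[OF assms(2)] by (simp add: openin_subtopology_Int2)
  then have "openin (top_of_set (cdom c)) (snd c ` (fst c \<inter> fst c'))"
    using homeomorphic_map_openness_eq[OF chart_homeo[OF assms(1)]] by blast
  then show ?thesis using open_cdom[OF assms(1)] openin_open_trans by blast
qed

lemma trans_holo:
  assumes "c \<in> At" "c' \<in> At"
  shows "smooth_on (snd c ` (fst c \<inter> fst c')) (\<lambda>w. trans_map c c' w $ i)"
    "p \<in> fst c \<inter> fst c' \<Longrightarrow> pd (Inr j) (\<lambda>w. trans_map c c' w $ i) (snd c p) = 0"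
  using atlas assms by (auto simp: complex_manifold_def holo_map_on_def)

lemma push_simps:
  assumes c: "c \<in> At" "c' \<in> At" and p: "p \<in> fst c \<inter> fst c'"
  shows "push c c' p v (Inl a) = (\<Sum>i\<in>UNIV. pd (Inl i) (\<lambda>w. trans_map c c' w $ a) (snd c p) * v (Inl i))"
    "push c c' p v (Inr a) = (\<Sum>i\<in>UNIV. cnj (pd (Inl i) (\<lambda>w. trans_map c c' w $ a) (snd c p)) * v (Inr i))"
proof -
  have d: "(\<lambda>w. trans_map c c' w $ a) differentiable (at (snd c p))" for a
    by (rule smooth_on_differentiable[OF trans_holo(1)[OF c]]) (use p in auto)
  show "push c c' p v (Inl a) = (\<Sum>i\<in>UNIV. pd (Inl i) (\<lambda>w. trans_map c c' w $ a) (snd c p) * v (Inl i))"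
    "push c c' p v (Inr a) = (\<Sum>i\<in>UNIV. cnj (pd (Inl i) (\<lambda>w. trans_map c c' w $ a) (snd c p)) * v (Inr i))"
    by (simp_all add: push_def sum_ix trans_holo(2)[OF c p] pd_cnj[OF d])
qed

text \<open>The abstract invariance is tested on a holomorphic and an anti-holomorphic coordinate
  vector. The resulting coefficient law serves both the metric and \<alpha>.\<close>

lemma form_11_law:
  assumes a: "a \<in> weyl_forms At" and c: "c \<in> At" "c' \<in> At" and p: "p \<in> fst c \<inter> fst c'"
  shows "a c (snd c p) k 0 {Inl i, Inr j} = (\<Sum>b\<in>UNIV. \<Sum>d\<in>UNIV.
     pd (Inl i) (\<lambda>w. trans_map c c' w $ b) (snd c p) * cnj (pd (Inl j) (\<lambda>w. trans_map c c' w $ d) (snd c p)) *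
     a c' (trans_map c c' (snd c p)) k 0 {Inl b, Inr d})"
proof -
  define e :: "'n ix \<Rightarrow> 'n ix \<Rightarrow> complex" where "e A B = (if B = A then 1 else 0)" for A B
  have "tensor_eval (a c (snd c p)) k 0 0 [e (Inl i), e (Inr j)] =
     tensor_eval (a c' (snd c' p)) k 0 (push c c' p 0) [push c c' p (e (Inl i)), push c c' p (e (Inr j))]"
    using weyl_forms_tensor_eval[OF a c p, of k 0 0 "[e (Inl i), e (Inr j)]"] by simp
  moreover have "tensor_eval (a c (snd c p)) k 0 0 [e (Inl i), e (Inr j)] = a c (snd c p) k 0 {Inl i, Inr j}"
    by (subst tensor_eval_two_form) (simp_all add: e_def if_distrib[of "\<lambda>z. _ * z"] if_distrib[of "\<lambda>z. z * _"] sum.delta' sum.delta cong: if_cong)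
  moreover have "push c c' p (e (Inl i)) (Inl b) = pd (Inl i) (\<lambda>w. trans_map c c' w $ b) (snd c p)"
    "push c c' p (e (Inl i)) (Inr b) = 0" "push c c' p (e (Inr j)) (Inl b) = 0"
    "push c c' p (e (Inr j)) (Inr b) = cnj (pd (Inl j) (\<lambda>w. trans_map c c' w $ b) (snd c p))" for b
    by (simp_all add: push_simps[OF c p] e_def if_distrib[of "\<lambda>z. _ * z"] sum.delta cong: if_cong)
  moreover have "snd c' p = trans_map c c' (snd c p)"
    using trans_map[OF c(1)] p by simp
  ultimately show ?thesis by (simp add: tensor_eval_two_form)
qed

lemma chart:
  assumes c: "c \<in> At"
  shows "kaehler_chart (cdom c) (g c)"
proof
  show U: "open (cdom c)" by (rule open_cdom[OF c])
  have k: "(\<lambda>c. kaehler_form (g c)) \<in> weyl_forms At" and d: "\<And>x. x \<in> cdom c \<Longrightarrow> ext_d (kaehler_form (g c)) x = 0"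
    and pos: "\<And>x v. x \<in> cdom c \<Longrightarrow> v \<noteq> 0 \<Longrightarrow> 0 < Re (\<Sum>i\<in>UNIV. \<Sum>j\<in>UNIV. g c x $ i $ j * v $ i * cnj (v $ j))"
    using kaehler c unfolding kaehler_manifold_def by blast+
  have "smooth_on (cdom c) (\<lambda>x. kaehler_form (g c) x 0 0 {Inl i, Inr j})" for i j
    by (rule ssecD[OF weyl_forms_ssec[OF k c]])
  \<comment> \<open>The coefficient of the form is \<i> times the metric; the factor -\<i> undoes
    this.\<close>
  then have "smooth_on (cdom c) (\<lambda>x. - \<i> * (\<i> * g c x $ i $ j))" for i j
    unfolding kaehler_form_coeff by (rule smooth_on_cmul[OF U])
  then show s: "smooth_on (cdom c) (\<lambda>x. g c x $ i $ j)" for i j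
    by (simp flip: mult.assoc)
  fix x assume x: "x \<in> cdom c"
  show "invertible (g c x)" by (rule invertible_posdef) (rule pos[OF x])
  have pk: "pd B (\<lambda>w. \<i> * g c w $ i $ j) x = \<i> * pd B (\<lambda>w. g c w $ i $ j) x" for B i j
    by (rule pd_cmul[OF smooth_on_differentiable[OF s x]])
  have z: "ext_d (kaehler_form (g c)) x 0 0 S = 0" for S using d[OF x] by simp
  show "pd (Inl k) (\<lambda>w. g c w $ i $ j) x = pd (Inl i) (\<lambda>w. g c w $ k $ j) x" for i j k
  proof (cases "i = k")
    case False
    \<comment> \<open>The coefficient of dz^k, dz^i and the conjugate dz^j: the Kaehler form has no
      part of pure type, so of the three derivatives only the two being compared survive.\<close>
    have "ext_d (kaehler_form (g c)) x 0 0 {Inl k, Inl i, Inr j} = wsign {Inl k} {Inl i} * (\<i> * (pd (Inl k) (\<lambda>w. g c w $ i $ j) x - pd (Inl i) (\<lambda>w. g c w $ k $ j) x))"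
      using False by (subst ext_d_coeff) (simp_all add: kaehler_form_coeff pk wsign_pair wsign_flip[of "Inl i" "Inl k"] algebra_simps)
    then show ?thesis using z[of "{Inl k, Inl i, Inr j}"] by (simp add: wsign_nonzero)
  qed simp
  show "pd (Inr k) (\<lambda>w. g c w $ i $ j) x = pd (Inr j) (\<lambda>w. g c w $ i $ k) x" for i j k
  proof (cases "j = k")
    case False
    have "ext_d (kaehler_form (g c)) x 0 0 {Inl i, Inr j, Inr k} = wsign {Inr k} {Inl i} * (wsign {Inr k} {Inr j} * (\<i> * (pd (Inr k) (\<lambda>w. g c w $ i $ j) x - pd (Inr j) (\<lambda>w. g c w $ i $ k) x)))"
      using False by (subst ext_d_coeff)
        (simp_all add: kaehler_form_coeff pk wsign_pair wsign_flip[of "Inr _" "Inl _"] wsign_flip[of "Inr j" "Inr k"] algebra_simps)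
    then show ?thesis using z[of "{Inl i, Inr j, Inr k}"] by (simp add: wsign_nonzero)
  qed simp
qed

lemma change:
  assumes c: "c \<in> At" "c' \<in> At"
  shows "chart_change (cdom c) (g c) (cdom c') (g c') (snd c ` (fst c \<inter> fst c')) (trans_map c c')"
proof -
  have k: "(\<lambda>c. kaehler_form (g c)) \<in> weyl_forms At" using kaehler by (simp add: kaehler_manifold_def)
  show ?thesis
  proof (intro chart_change.intro chart chart_change_axioms.intro c open_overlap trans_holo)
    fix x assume "x \<in> snd c ` (fst c \<inter> fst c')"
    then obtain p where p: "p \<in> fst c \<inter> fst c'" and x: "x = snd c p" by auto
    show "trans_map c c' x \<in> cdom c'" using p trans_map[OF c(1)] by (simp add: x cdom_def)
    show "pd (Inr j) (\<lambda>w. trans_map c c' w $ i) x = 0" for i j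
      unfolding x by (rule trans_holo(2)[OF c p])
    have "\<i> * g c x $ i $ j = \<i> * (\<Sum>a\<in>UNIV. \<Sum>b\<in>UNIV. pd (Inl i) (\<lambda>w. trans_map c c' w $ a) x *
        cnj (pd (Inl j) (\<lambda>w. trans_map c c' w $ b) x) * g c' (trans_map c c' x) $ a $ b)" for i j
      using form_11_law[OF k c p, of 0 i j] unfolding kaehler_form_coeff x by (simp add: sum_distrib_left mult_ac)
    then show "g c x $ i $ j = (\<Sum>a\<in>UNIV. \<Sum>b\<in>UNIV. pd (Inl i) (\<lambda>w. trans_map c c' w $ a) x *
        cnj (pd (Inl j) (\<lambda>w. trans_map c c' w $ b) x) * g c' (trans_map c c' x) $ a $ b)" for i j
      unfolding mult_cancel_left by auto
  qed (auto simp: cdom_def)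
qed

text \<open>For one-forms the invariance under all lists of tangent vectors reduces to
  \<open>related\<close>, the only list of interest having length one.\<close>

lemma weyl_forms_type_01I:
  assumes s: "\<And>c. c \<in> At \<Longrightarrow> ssec (cdom c) (a c)"
    and h: "\<And>c x. c \<in> At \<Longrightarrow> x \<in> cdom c \<Longrightarrow> homog (\<lambda>_. 0) hol 0 (a c x)"
    and h': "\<And>c x. c \<in> At \<Longrightarrow> x \<in> cdom c \<Longrightarrow> homog (\<lambda>_. 0) anti 1 (a c x)"
    and r: "\<And>c c'. c \<in> At \<Longrightarrow> c' \<in> At \<Longrightarrow>
      chart_change.related (snd c ` (fst c \<inter> fst c')) (trans_map c c') (a c) (a c')"
  shows "a \<in> weyl_forms_type At 0 1"
proof -
  have "tensor_eval (a c (snd c p)) k d v us = tensor_eval (a c' (snd c' p)) k d (push c c' p v) (map (push c c' p) us)"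
    if c: "c \<in> At" "c' \<in> At" and p: "p \<in> fst c \<inter> fst c'" for c c' p k d v us
  proof -
    interpret chart_change "cdom c" "g c" "cdom c'" "g c'" "snd c ` (fst c \<inter> fst c')" "trans_map c c'"
      by (rule change[OF c])
    have P: "push c c' p w = Dp (snd c p) w" for w by (intro ext) (simp add: push_def Dp_def)
    have x: "snd c p \<in> cdom c" "snd c' p \<in> cdom c'" using p by (auto simp: cdom_def)
    have "ev (a c (snd c p)) k d v u = ev (a c' (snd c' p)) k d (push c c' p v) (push c c' p u)" for u
      using r[OF c] p trans_map[OF c(1), of p c'] by (auto simp: related_def P)
    moreover have "homog (\<lambda>_. 0) (\<lambda>_. 1) 1 (a c (snd c p))" "homog (\<lambda>_. 0) (\<lambda>_. 1) 1 (a c' (snd c' p))"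
      using homog_form[OF h h'] c x by simp_all
    ultimately show ?thesis by (simp add: tensor_eval_one_form split: list.split)
  qed
  moreover have "card (S \<inter> range Inl) = 0 \<and> card (S \<inter> range Inr) = 1" if "c \<in> At" "x \<in> cdom c" "a c x k M S \<noteq> 0" for c x k M S
    using homogD[OF h[OF that(1,2)] that(3)] homogD[OF h'[OF that(1,2)] that(3)] unfolding wt_form_hol wt_form_anti by simp
  ultimately show ?thesis
    using s unfolding weyl_forms_type_def weyl_forms_def ssec_def by blast
qed

lemma weyl_forms_type_deg: "a \<in> weyl_forms_type At p q \<Longrightarrow> a \<in> weyl_forms_deg At (p + q)"
proof -
  have "card S = card (S \<inter> range Inl) + card (S \<inter> range Inr)" for S :: "'n ix set"
    using wt_form_split[of 0 S] by (simp add: wt_form wt_form_hol wt_form_anti)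
  then have "card S = p + q" if "card (S \<inter> range Inl) = p" "card (S \<inter> range Inr) = q" for S :: "'n ix set"
    using that by metis
  then show "a \<in> weyl_forms_type At p q \<Longrightarrow> a \<in> weyl_forms_deg At (p + q)"
    unfolding weyl_forms_type_def weyl_forms_deg_def by blast
qed

lemma chart_form:
  assumes \<alpha>: "closed_formal_11 At \<alpha>" and c: "c \<in> At"
  shows "kaehler_chart_form (cdom c) (g c) (\<alpha> c)"
proof -
  have t: "card (S \<inter> range Inl) = 1" "card (S \<inter> range Inr) = 1" if "x \<in> cdom c" "\<alpha> c x k M S \<noteq> 0" for x k M S
    using \<alpha> c that by (auto simp: closed_formal_11_def weyl_forms_type_def)
  show ?thesis
  proof (intro kaehler_chart_form.intro kaehler_chart_form_axioms.intro chart c)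
    show "ssec (cdom c) (\<alpha> c)"
      using \<alpha> weyl_forms_ssec[OF _ c] by (simp add: closed_formal_11_def weyl_forms_type_def)
    fix x assume x: "x \<in> cdom c"
    show "homog (\<lambda>_. 0) hol 1 (\<alpha> c x)" "homog (\<lambda>_. 0) anti 1 (\<alpha> c x)"
      unfolding homog_def wt_form_hol wt_form_anti using t[OF x] by auto
    show "ext_d (\<alpha> c) x = 0" "\<alpha> c x k M S \<noteq> 0 \<Longrightarrow> M = 0" for k M S
      using \<alpha> c x unfolding closed_formal_11_def by blast+
  qed
qed

end

theorem theorem1p1:
  fixes X :: "'a topology" and At :: "('a, 'n::finite) chart set"
    and g :: "('a, 'n) metric" and \<alpha> :: "('a, 'n) sect"
  assumes "kaehler_manifold X At g"
    and "closed_formal_11 At \<alpha>"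
  shows "\<exists>J\<in>weyl_forms_type At 0 1. \<exists>I\<^sub>\<alpha>\<in>weyl_forms_type At 0 1.
     I\<^sub>\<alpha> = (\<lambda>c. I_sum (g c)) + J \<and>
     sec_eq At (\<lambda>c. fedosov_lhs (g c) (I\<^sub>\<alpha> c)) \<alpha> \<and>
     fedosov_abelian_connection At g (\<lambda>a c. D_F (g c) (I\<^sub>\<alpha> c) (a c)) \<and>
     (\<forall>a\<in>holo_weyl_forms At.
        sec_eq At (\<lambda>c. D_F (g c) (I\<^sub>\<alpha> c) (a c)) (\<lambda>c. D_K (g c) (a c)))"
proof -
  interpret kaehler_atlas X At g by unfold_locales (rule assms(1))
  note cf = chart_form[OF assms(2)]
  have a11: "\<alpha> \<in> weyl_forms At" using assms(2) by (simp add: closed_formal_11_def weyl_forms_type_def)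
  \<comment> \<open>Defined chart by chart without choices; agreement on overlaps is inherited from
    \<alpha> through \<open>related_hs_tot\<close>.\<close>
  define J where "J c = hs_tot (g c) (\<lambda>x. - \<alpha> c x) 0" for c
  define I where "I c x = I_sum (g c) x + J c x" for c x
  have IJ: "I = (\<lambda>c. I_sum (g c)) + J" by (intro ext) (simp add: I_def)
  have Ic: "I c = (\<lambda>x. I_sum (g c) x + hs_tot (g c) (\<lambda>x. - \<alpha> c x) 0 x)" for c
    by (rule ext) (simp only: I_def J_def)
  have rJ: "chart_change.related (snd c ` (fst c \<inter> fst c')) (trans_map c c') (J c) (J c')"
    and rI: "chart_change.related (snd c ` (fst c \<inter> fst c')) (trans_map c c') (I c) (I c')"
    if c: "c \<in> At" "c' \<in> At" for c c'
  proof -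
    interpret chart_change "cdom c" "g c" "cdom c'" "g c'" "snd c ` (fst c \<inter> fst c')" "trans_map c c'"
      by (rule change[OF c])
    interpret f: kaehler_chart_form "cdom c" "g c" "\<alpha> c" by (rule cf[OF c(1)])
    interpret f': kaehler_chart_form "cdom c'" "g c'" "\<alpha> c'" by (rule cf[OF c(2)])
    have l: "\<alpha> c x k 0 {Inl i, Inr j} = (\<Sum>a\<in>UNIV. \<Sum>b\<in>UNIV. P x a i * cnj (P x b j) * \<alpha> c' (trans_map c c' x) k 0 {Inl a, Inr b})"
      if "x \<in> snd c ` (fst c \<inter> fst c')" for x k i j
      using that form_11_law[OF a11 c] by blast
    show J: "related (J c) (J c')" unfolding J_def
      by (rule related_hs_tot[OF f.J.hol_source_axioms f'.J.hol_source_axioms related_11[OF cf[OF c(1)] cf[OF c(2)] l]])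
    \<comment> \<open>The infinite sum \<open>I_sum\<close> is related through its description as
      the iterated solution for the curvature.\<close>
    have "related (hs_tot (g c) (R_nabla (g c)) 1) (hs_tot (g c') (R_nabla (g c')) 1)"
      by (rule related_hs_tot[OF c1.R.hol_source_axioms c2.R.hol_source_axioms related_R])
    then have "related (I_sum (g c)) (I_sum (g c'))"
      unfolding related_def using c1.I_sum_hs_tot[OF U_V] c2.I_sum_hs_tot[OF TV] by simp
    from related_add[OF this J] show "related (I c) (I c')" unfolding I_def .
  qed
  have J: "J \<in> weyl_forms_type At 0 1"
  proof (rule weyl_forms_type_01I[OF _ _ _ rJ])
    fix c assume c: "c \<in> At"
    interpret f: kaehler_chart_form "cdom c" "g c" "\<alpha> c" by (rule cf[OF c])
    show "ssec (cdom c) (J c)" unfolding J_def by (rule f.J.ssec_hs_tot)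
    show "homog (\<lambda>_. 0) hol 0 (J c x)" "homog (\<lambda>_. 0) anti 1 (J c x)" if "x \<in> cdom c" for x
      unfolding J_def by (rule f.J.hs_tot_homog[OF that])+
  qed
  have I: "I \<in> weyl_forms_type At 0 1"
  proof (rule weyl_forms_type_01I[OF _ _ _ rI])
    fix c assume c: "c \<in> At"
    interpret f: kaehler_chart_form "cdom c" "g c" "\<alpha> c" by (rule cf[OF c])
    show "ssec (cdom c) (I c)" unfolding Ic by (rule f.F.ssec_I)
    show "homog (\<lambda>_. 0) hol 0 (I c x)" "homog (\<lambda>_. 0) anti 1 (I c x)" if "x \<in> cdom c" for x
      unfolding Ic by (rule f.F.I_hol[OF that] f.F.I_anti[OF that])+
  qed
  have "sec_eq At (\<lambda>c. fedosov_lhs (g c) (I c)) \<alpha>"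
    unfolding sec_eq_def Ic
  proof (intro ballI)
    fix c x assume c: "c \<in> At" and x: "x \<in> cdom c"
    interpret f: kaehler_chart_form "cdom c" "g c" "\<alpha> c" by (rule cf[OF c])
    show "fedosov_lhs (g c) (\<lambda>x. I_sum (g c) x + hs_tot (g c) (\<lambda>x. - \<alpha> c x) 0 x) x = \<alpha> c x"
      by (rule f.F.fedosov_equation[OF x])
  qed
  moreover have "fedosov_abelian_connection At g (\<lambda>a c. D_F (g c) (I c) (a c))"
    unfolding fedosov_abelian_connection_def
  proof (intro conjI ballI)
    show "\<exists>I'\<in>weyl_forms_deg At 1. (\<lambda>a c. D_F (g c) (I c) (a c)) = (\<lambda>a c. D_F (g c) (I' c) (a c))"
      using weyl_forms_type_deg[OF I] by auto
    fix a assume a: "a \<in> weyl_forms At"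
    show "sec_eq At (\<lambda>c. D_F (g c) (I c) (D_F (g c) (I c) (a c))) 0"
      unfolding sec_eq_def Ic
    proof (intro ballI)
      fix c x assume c: "c \<in> At" and x: "x \<in> cdom c"
      interpret f: kaehler_chart_form "cdom c" "g c" "\<alpha> c" by (rule cf[OF c])
      have "ssec (cdom c) (a c)" by (rule weyl_forms_ssec[OF a c])
      from f.F.D_F_square[OF x this]
      show "D_F (g c) (\<lambda>x. I_sum (g c) x + hs_tot (g c) (\<lambda>x. - \<alpha> c x) 0 x)
         (D_F (g c) (\<lambda>x. I_sum (g c) x + hs_tot (g c) (\<lambda>x. - \<alpha> c x) 0 x) (a c)) x = 0 c x"
        by simp
    qed
  qed
  moreover have "sec_eq At (\<lambda>c. D_F (g c) (I c) (a c)) (\<lambda>c. D_K (g c) (a c))" if a: "a \<in> holo_weyl_forms At" for a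
    unfolding sec_eq_def Ic
  proof (intro ballI)
    fix c x assume c: "c \<in> At" and x: "x \<in> cdom c"
    interpret f: kaehler_chart_form "cdom c" "g c" "\<alpha> c" by (rule cf[OF c])
    have "dy (Inr j) (a c x) = 0" for j
    proof (intro ext)
      fix k S and M :: "'n ix \<Rightarrow> nat"
      have "a c x k N S \<noteq> 0 \<Longrightarrow> N (Inr j) = 0" for N
        using a c x unfolding holo_weyl_forms_def by blast
      \<comment> \<open>\<open>dy\<close> at \<open>M\<close> reads the coefficient whose exponent
        of this y-bar is larger by one, hence positive, where a holomorphic section
        vanishes.\<close>
      from this[of "M(Inr j := M (Inr j) + 1)"]
      have "a c x k (M(Inr j := M (Inr j) + 1)) S = 0" by (cases "a c x k (M(Inr j := M (Inr j) + 1)) S = 0") auto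
      then show "dy (Inr j) (a c x) k M S = 0 k M S" by (simp add: dy_def)
    qed
    then show "D_F (g c) (\<lambda>x. I_sum (g c) x + hs_tot (g c) (\<lambda>x. - \<alpha> c x) 0 x) (a c) x = D_K (g c) (a c) x"
      by (rule f.D_F_holo[OF x])
  qed
  ultimately show ?thesis using I J IJ by blast
qed

end
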